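(* Let $n\geq 2$ be an integer and let $u\in W^{1,n}(\mathbb{H}^n)$. Let $u^*$ be the non-increasing rearrangement of $u$, and let $u_g^\sharp$ (a function on $\mathbb{B}^n$) and $u_e^\sharp$ (a function on $\mathbb{R}^n$) be given by $$ u_g^\sharp(x)=u^*\!\left(\mathrm{Vol}_g(B_g(0,\rho(x)))\right),\quad x\in\mathbb{B}^n,\qquad\qquad u_e^\sharp(x)=u^*(\sigma_n|x|^n),\quad x\in\mathbb{R}^n . $$ Then $$ \int_{\mathbb{B}^n}|\nabla_g u_g^\sharp|_g^n\,d\mathrm{Vol}_g-\left(\frac{n-1}{n}\right)^n\int_{\mathbb{B}^n}|u_g^\sharp|^n\,d\mathrm{Vol}_g\ \geq\ \int_{\mathbb{R}^n}|\nabla u_e^\sharp|^n\,dx . $$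
   Context: The hyperbolic space $\mathbb{H}^n$ is represented by the Poincaré ball model: the open unit ball $\mathbb{B}^n\subset\mathbb{R}^n$ with the metric $g(x)=\frac{4}{(1-|x|^2)^2}\sum_{i=1}^n dx_i^2$. Its volume element is $d\mathrm{Vol}_g=\frac{2^n}{(1-|x|^2)^n}\,dx$. The hyperbolic gradient is $\nabla_g u=\frac{(1-|x|^2)^2}{4}\nabla u$, where $\nabla$ is the Euclidean gradient, and its $g$-norm is $|\nabla_g u|_g=\frac{1-|x|^2}{2}|\nabla u|$; in particular $\int_{\mathbb{B}^n}|\nabla_g u|_g^n\,d\mathrm{Vol}_g=\int_{\mathbb{B}^n}|\nabla u|^n\,dx$. $W^{1,n}(\mathbb{H}^n)$ is the completion of $C_0^\infty(\mathbb{B}^n)$ (real-valued functions) with respect to the norm $\left(\int_{\mathbb{B}^n}|\nabla_g u|_g^n\,d\mathrm{Vol}_g\right)^{1/n}$; it is identified with the standard Sobolev space $W^{1,n}_0(\mathbb{B}^n)$ with norm $\left(\int_{\mathbb{B}^n}|\nabla u|^n\,dx\right)^{1/n}$. $\rho(x)=\ln\frac{1+|x|}{1-|x|}$ is the geodesic distance from $x\in\mathbb{B}^n$ to $0$; $B_g(0,r)$ is the open geodesic ball with center $0$ and radius $r$, so $\mathrm{Vol}_g(B_g(0,r))=n\sigma_n\int_0^r(\sinh t)^{n-1}\,dt$; $\sigma_n$ is the volume of the unit ball in $\mathbb{R}^n$. Rearrangement: for $u$ on $\mathbb{H}^n$ with $\mathrm{Vol}_g(\{|u|>t\})<\infty$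 for all $t>0$ (which holds for $u\in W^{1,n}(\mathbb{H}^n)$), the distribution function is $\mu_u(t)=\mathrm{Vol}_g(\{x\in\mathbb{H}^n: |u(x)|>t\})$, $t>0$, and the non-increasing rearrangement is $u^*(t)=\sup\{s>0:\mu_u(s)>t\}$, $t>0$ (with $\sup\emptyset=0$). *)

theory Defs
  imports "HOL-Analysis.Analysis"
begin

section \<open>Test functions and weak gradients on $\mathbb{R}^n$\<close>

definition grad :: "(real ^ 'n \<Rightarrow> real) \<Rightarrow> real ^ 'n \<Rightarrow> real ^ 'n" where
  "grad f x = (\<chi> i. frechet_derivative f (at x) (axis i 1))"

primrec Ck :: "nat \<Rightarrow> (real ^ 'n \<Rightarrow> real) \<Rightarrow> bool" where
  "Ck 0 = (\<lambda>f. continuous_on UNIV f)"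
| "Ck (Suc k) = (\<lambda>f. (\<forall>x. f differentiable (at x)) \<and> (\<forall>i. Ck k (\<lambda>x. grad f x $ i)))"

text \<open>Elements of $C_0^\infty(U)$ are represented by their extension by zero to the whole space.\<close>

definition test_functions :: "(real ^ 'n) set \<Rightarrow> (real ^ 'n \<Rightarrow> real) set" where
  "test_functions U =
     {\<phi>. (\<forall>k. Ck k \<phi>) \<and> compact (closure {x. \<phi> x \<noteq> 0}) \<and> closure {x. \<phi> x \<noteq> 0} \<subseteq> U}"

definition has_weak_gradient ::
    "(real ^ 'n) set \<Rightarrow> (real ^ 'n \<Rightarrow> real) \<Rightarrow> (real ^ 'n \<Rightarrow> real ^ 'n) \<Rightarrow> bool" where
  "has_weak_gradient U u G \<longleftrightarrow>
     (\<forall>K. compact K \<and> K \<subseteq> U \<longrightarrow> u absolutely_integrable_on K \<and> G absolutely_integrable_on K) \<and>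
     (\<forall>\<phi>\<in>test_functions U.
        (\<integral>x. u x *\<^sub>R grad \<phi> x \<partial>lebesgue_on U) = - (\<integral>x. \<phi> x *\<^sub>R G x \<partial>lebesgue_on U))"

definition weakly_differentiable_on ::
    "(real ^ 'n \<Rightarrow> real) \<Rightarrow> (real ^ 'n) set \<Rightarrow> bool" (infix "weakly'_differentiable'_on" 50) where
  "u weakly_differentiable_on U \<longleftrightarrow> (\<exists>G. has_weak_gradient U u G)"

text \<open>A weak gradient on an open set is unique up to a null set, so integrals over \<open>U\<close> do not depend
  on the choice made here. The value is meaningful only if \<open>u weakly_differentiable_on U\<close>.\<close>

definition weak_grad ::
    "(real ^ 'n) set \<Rightarrow> (real ^ 'n \<Rightarrow> real) \<Rightarrow> real ^ 'n \<Rightarrow> real ^ 'n" where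
  "weak_grad U u = (SOME G. has_weak_gradient U u G)"


section \<open>The Poincar\'e ball\<close>

definition hyp_metric :: "real ^ 'n \<Rightarrow> real ^ 'n \<Rightarrow> real ^ 'n \<Rightarrow> real" where
  "hyp_metric x v w = 4 / (1 - (norm x)\<^sup>2)\<^sup>2 * (v \<bullet> w)"

definition hyp_norm :: "real ^ 'n \<Rightarrow> real ^ 'n \<Rightarrow> real" where
  "hyp_norm x v = sqrt (hyp_metric x v v)"

definition hyp_vol :: "(real ^ 'n) measure" where
  "hyp_vol = density (lebesgue_on (ball 0 1))
     (\<lambda>x. ennreal (2 ^ CARD('n) / (1 - (norm x)\<^sup>2) ^ CARD('n)))"

text \<open>The hyperbolic gradient, obtained from a (classical or weak) Euclidean gradient field \<open>G\<close>.\<close>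

definition hyp_grad :: "(real ^ 'n \<Rightarrow> real ^ 'n) \<Rightarrow> real ^ 'n \<Rightarrow> real ^ 'n" where
  "hyp_grad G x = ((1 - (norm x)\<^sup>2)\<^sup>2 / 4) *\<^sub>R G x"

definition hyp_dist0 :: "real ^ 'n \<Rightarrow> real" where
  "hyp_dist0 x = ln ((1 + norm x) / (1 - norm x))"

definition hyp_ball0 :: "real \<Rightarrow> (real ^ 'n) set" where
  "hyp_ball0 r = {y \<in> ball 0 1. hyp_dist0 y < r}"


section \<open>The Sobolev space $W^{1,n}(\mathbb{H}^n)$\<close>

definition hyp_sobolev_norm :: "(real ^ 'n \<Rightarrow> real) \<Rightarrow> real" where
  "hyp_sobolev_norm \<phi> =
     root CARD('n) (\<integral>x. hyp_norm x (hyp_grad (grad \<phi>) x) ^ CARD('n) \<partial>hyp_vol)"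

text \<open>The completion of $C_0^\infty(\mathbb{B}^n)$ is realised as a space of functions: by the
  Poincar\'e inequality every Cauchy sequence for \<open>hyp_sobolev_norm\<close> converges in
  $L^n(\mathbb{B}^n, dx)$, and its limit there represents its class in the completion. This is the
  usual $W^{1,n}_0(\mathbb{B}^n)$. Only the values of the functions on the ball matter.\<close>

definition W1n_hyp :: "(real ^ 'n \<Rightarrow> real) set" where
  "W1n_hyp = {u. u \<in> borel_measurable (lebesgue_on (ball 0 1)) \<and>
     (\<exists>\<phi>. (\<forall>k::nat. \<phi> k \<in> test_functions (ball 0 1)) \<and>
        (\<forall>e>0. \<exists>N. \<forall>j\<ge>N. \<forall>k\<ge>N. hyp_sobolev_norm (\<lambda>x. \<phi> j x - \<phi> k x) < e) \<and>
        (\<lambda>k. \<integral>\<^sup>+x. ennreal (\<bar>\<phi> k x - u x\<bar> ^ CARD('n)) \<partial>lebesgue_on (ball 0 1))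
           \<longlonglongrightarrow> 0)}"


section \<open>Rearrangements\<close>

definition distribution_function :: "(real ^ 'n \<Rightarrow> real) \<Rightarrow> real \<Rightarrow> ennreal" where
  "distribution_function u t = emeasure hyp_vol {x \<in> ball 0 1. \<bar>u x\<bar> > t}"

text \<open>Inserting \<open>0\<close> implements the convention that the supremum of the empty set is \<open>0\<close>; it does not
  affect the supremum otherwise. For \<open>t > 0\<close> the set is bounded above as soon as
  \<open>distribution_function u\<close> is finite on the positive reals.\<close>

definition decreasing_rearrangement :: "(real ^ 'n \<Rightarrow> real) \<Rightarrow> real \<Rightarrow> real" where
  "decreasing_rearrangement u t =
     Sup (insert 0 {s. s > 0 \<and> distribution_function u s > ennreal t})"

definition sharp_g :: "(real ^ 'n \<Rightarrow> real) \<Rightarrow> real ^ 'n \<Rightarrow> real" where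
  "sharp_g u x =
     decreasing_rearrangement u (measure (hyp_vol :: (real ^ 'n) measure) (hyp_ball0 (hyp_dist0 x)))"

definition sharp_e :: "(real ^ 'n \<Rightarrow> real) \<Rightarrow> real ^ 'n \<Rightarrow> real" where
  "sharp_e u x =
     decreasing_rearrangement u
       (measure lebesgue (ball 0 1 :: (real ^ 'n) set) * norm x ^ CARD('n))"

end

theory Submission
  imports Defs "HOL-Computational_Algebra.Polynomial"
begin

text \<open>Put \<open>h (y) = u\<^sup>* (exp y)\<close>. A non-sharp hyperbolic isoperimetric inequality, applied to the level
  sets of test functions approximating \<open>u\<close>, shows that \<open>h y\<close> is the integral of a function \<open>\<gamma> \<ge> 0\<close>
  over \<open>{y<..}\<close>, where \<open>\<gamma>\<^sup>n (1 + exp y)\<close> is integrable. Both rearrangements are therefore weakly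
  differentiable, and in the variable \<open>y\<close>, the logarithm of the volume,
    \<open>\<integral>|\<nabla> u\<^sub>e|\<^sup>n = n\<^sup>n \<sigma> \<integral>\<gamma>\<^sup>n\<close>,
    \<open>\<integral>|\<nabla>\<^sub>g u\<^sub>g|\<^sup>n = \<integral>\<gamma>\<^sup>n k(V)\<^sup>n / V\<^sup>n\<^sup>-\<^sup>1\<close>,
    \<open>\<integral>|u\<^sub>g|\<^sup>n = \<integral>h\<^sup>n V\<close>,
  with \<open>V = exp y\<close> and \<open>k(V)\<close> the perimeter of the geodesic ball of volume \<open>V\<close>. The theorem follows
  from the profile inequality \<open>k(V)\<^sup>n \<ge> n\<^sup>n \<sigma> V\<^sup>n\<^sup>-\<^sup>1 + ((n - 1) V)\<^sup>n\<close> and from Hardy's inequality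
  \<open>\<integral>h\<^sup>n V \<le> n\<^sup>n \<integral>\<gamma>\<^sup>n V\<close>.\<close>

section \<open>Integration by parts\<close>

text \<open>Both rearrangements are built from the same one-dimensional function \<open>h\<close>,
  so \<open>u\<close> enters only qualitatively: \<open>h\<close> must be absolutely continuous and
  certain integrals of \<open>\<gamma> ^ n\<close> must be finite. This is why an isoperimetric
  inequality with an unspecified constant suffices. It must however have the right form at both
  ends, perimeter at least a multiple of V^((n-1)/n) + V: the first term, dominant for small
  volumes, controls the Euclidean energy, the second the integral of \<gamma>^n V. The obstacle is
  that \<open>u\<close> is only a limit of test functions, which says nothing directly about
  derivatives of its rearrangement. The inequality is therefore transferred at finitely many levels,
  with errors that are sent to 0 for a fixed partition, and only afterwards is the partition
  refined. The sharp constants come from the last two inequalities alone: Hardy's n^n turns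
  ((n-1)/n)^n into (n-1)^n, exactly the coefficient of V^n in the profile inequality.\<close>

lemma nn_integral_translate:
  fixes f :: "'a::euclidean_space \<Rightarrow> ennreal"
  assumes [measurable]: "f \<in> borel_measurable borel"
  shows "(\<integral>\<^sup>+x. f (x + c) \<partial>lborel) = (\<integral>\<^sup>+x. f x \<partial>lborel)"
proof -
  have "(\<integral>\<^sup>+x. f x \<partial>lborel) = (\<integral>\<^sup>+x. f x \<partial>distr lborel borel ((+) c))"
    by (simp add: lborel_distr_plus)
  also have "\<dots> = (\<integral>\<^sup>+x. f (c + x) \<partial>lborel)"
    by (subst nn_integral_distr) auto
  finally show ?thesis by (simp add: add.commute)
qed

lemma integrable_translate:
  fixes f :: "'a::euclidean_space \<Rightarrow> real"
  assumes "integrable lborel f"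
  shows "integrable lborel (\<lambda>x. f (x + c))"
    and "(\<integral>x. f (x + c) \<partial>lborel) = (\<integral>x. f x \<partial>lborel)"
proof -
  have [measurable]: "f \<in> borel_measurable borel"
    using assms by auto
  have "integrable (distr lborel borel ((+) c)) f"
    using assms by (simp add: lborel_distr_plus)
  then show "integrable lborel (\<lambda>x. f (x + c))"
    by (subst (asm) integrable_distr_eq) (auto simp: add.commute)
  have "(\<integral>x. f x \<partial>lborel) = (\<integral>x. f x \<partial>distr lborel borel ((+) c))"
    by (simp add: lborel_distr_plus)
  also have "\<dots> = (\<integral>x. f (c + x) \<partial>lborel)"
    by (subst integral_distr) auto
  finally show "(\<integral>x. f (x + c) \<partial>lborel) = (\<integral>x. f x \<partial>lborel)"
    by (simp add: add.commute)
qed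

lemma integrable_continuous_compact_support:
  fixes f :: "'a::euclidean_space \<Rightarrow> 'b::{banach, second_countable_topology}"
  assumes "continuous_on UNIV f" "compact K" "\<And>x. x \<notin> K \<Longrightarrow> f x = 0"
  shows "integrable lborel f"
proof -
  have "integrable lborel (\<lambda>x. indicator K x *\<^sub>R f x)"
    using assms by (intro borel_integrable_compact) (auto intro: continuous_on_subset)
  also have "(\<lambda>x. indicator K x *\<^sub>R f x) = f"
    using assms(3) by (auto simp: indicator_def fun_eq_iff)
  finally show ?thesis .
qed

lemma measurable_vec_component [measurable (raw)]:
  fixes f :: "'a \<Rightarrow> real ^ 'n"
  assumes "f \<in> borel_measurable M"
  shows "(\<lambda>x. f x $ i) \<in> borel_measurable M"
  by (rule measurable_compose[OF assms]) (auto intro!: borel_measurable_continuous_onI continuous_intros)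

lemma has_derivative_grad:
  fixes f :: "real ^ 'n \<Rightarrow> real"
  assumes "f differentiable at x"
  shows "(f has_derivative (\<lambda>h. grad f x \<bullet> h)) (at x)"
proof -
  let ?D = "frechet_derivative f (at x)"
  have D: "(f has_derivative ?D) (at x)"
    using assms frechet_derivative_works by blast
  then have lin: "linear ?D"
    by (rule has_derivative_linear)
  have "?D h = grad f x \<bullet> h" for h
  proof -
    have "?D h = ?D (\<Sum>i\<in>UNIV. h $ i *\<^sub>R axis i 1)"
      by (simp add: basis_expansion scalar_mult_eq_scaleR[symmetric])
    also have "\<dots> = (\<Sum>i\<in>UNIV. h $ i * ?D (axis i 1))"
      using lin by (simp add: linear_sum linear_cmul)
    also have "\<dots> = grad f x \<bullet> h"
      by (simp add: inner_vec_def grad_def mult.commute)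
    finally show ?thesis .
  qed
  then have "?D = (\<lambda>h. grad f x \<bullet> h)" by auto
  with D show ?thesis by simp
qed

lemma grad_eqI:
  fixes f :: "real ^ 'n \<Rightarrow> real"
  assumes "(f has_derivative (\<lambda>h. G \<bullet> h)) (at x)"
  shows "grad f x = G"
  using frechet_derivative_at[OF assms, symmetric]
  by (simp add: grad_def vec_eq_iff inner_axis)

text \<open>The truncations and powers that are composed with test functions below are only C^1 in
  general. This class is stable under such compositions, and the divergence theorem still holds in
  it.\<close>

definition C1_compact :: "(real ^ 'n) set \<Rightarrow> (real ^ 'n \<Rightarrow> real) \<Rightarrow> bool" where
  "C1_compact U v \<longleftrightarrow> (\<forall>x. v differentiable at x) \<and> continuous_on UNIV (grad v) \<and>
     compact (closure {x. v x \<noteq> 0}) \<and> closure {x. v x \<noteq> 0} \<subseteq> U"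

lemma C1_compactD:
  assumes "C1_compact U v"
  shows "v differentiable at x" "continuous_on S (grad v)" "continuous_on S v"
    "compact (closure {x. v x \<noteq> 0})" "closure {x. v x \<noteq> 0} \<subseteq> U"
    "(v has_derivative (\<lambda>h. grad v x \<bullet> h)) (at x)"
  using assms continuous_on_subset[of UNIV "grad v" S] has_derivative_grad[of v x]
  by (auto simp: C1_compact_def intro!: differentiable_imp_continuous_on differentiable_at_imp_differentiable_on)

lemma C1_compact_measurable [measurable_dest]:
  assumes "C1_compact U v"
  shows "v \<in> borel_measurable borel"
  using C1_compactD(3)[OF assms] by (rule borel_measurable_continuous_onI)

lemma C1_compact_measurable_grad [measurable_dest]:
  assumes "C1_compact U v"
  shows "grad v \<in> borel_measurable borel"
  using C1_compactD(2)[OF assms] by (rule borel_measurable_continuous_onI)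

lemma C1_compact_zero:
  assumes "C1_compact U v" "x \<notin> closure {x. v x \<noteq> 0}"
  shows "v x = 0" "grad v x = 0"
proof -
  show "v x = 0"
    using assms closure_subset[of "{x. v x \<noteq> 0}"] by blast
  have "((\<lambda>x. 0::real) has_derivative (\<lambda>h. 0 \<bullet> h)) (at x)"
    by simp
  then have "(v has_derivative (\<lambda>h. 0 \<bullet> h)) (at x)"
    by (rule has_derivative_transform_within_open[OF _ open_Compl[OF closed_closure[of "{x. v x \<noteq> 0}"]]])
       (use assms closure_subset[of "{x. v x \<noteq> 0}"] in auto)
  then show "grad v x = 0" by (rule grad_eqI)
qed

lemma C1_compact_zero':
  assumes "C1_compact U v" "x \<notin> U"
  shows "v x = 0" "grad v x = 0"
  using C1_compact_zero[OF assms(1), of x] assms(2) C1_compactD(5)[OF assms(1)] by auto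

lemma C1_compact_integrable:
  assumes "C1_compact U v"
  shows "integrable lborel v" "integrable lborel (grad v)"
  using integrable_continuous_compact_support[OF C1_compactD(3)[OF assms] C1_compactD(4)[OF assms] C1_compact_zero(1)[OF assms]]
    integrable_continuous_compact_support[OF C1_compactD(2)[OF assms] C1_compactD(4)[OF assms] C1_compact_zero(2)[OF assms]]
  by blast+

lemma C1_compact_subset: "C1_compact U v \<Longrightarrow> U \<subseteq> V \<Longrightarrow> C1_compact V v"
  by (auto simp: C1_compact_def)

lemma test_functions_C1_compact:
  assumes "\<phi> \<in> test_functions U"
  shows "C1_compact U \<phi>"
proof -
  have "Ck (Suc 0) \<phi>" using assms unfolding test_functions_def by blast
  then have "\<forall>x. \<phi> differentiable at x" "\<And>i. continuous_on UNIV (\<lambda>x. grad \<phi> x $ i)"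
    by auto
  moreover from this(2) have "continuous_on UNIV (\<lambda>x. \<chi> i. grad \<phi> x $ i)"
    by (rule continuous_on_vec_lambda)
  ultimately show ?thesis
    using assms by (auto simp: C1_compact_def test_functions_def)
qed

lemma C1_compact_bounded_grad:
  assumes "C1_compact U v"
  obtains M where "M > 0" "\<And>x. norm (grad v x) \<le> M"
proof -
  let ?K = "closure {x. v x \<noteq> 0}"
  have "compact (grad v ` ?K)"
    using C1_compactD(2,4)[OF assms] by (intro compact_continuous_image) auto
  then obtain M where M: "\<And>x. x \<in> ?K \<Longrightarrow> norm (grad v x) \<le> M"
    using compact_imp_bounded by (force simp: bounded_iff)
  have "norm (grad v x) \<le> max M 1" for x
    using M[of x] C1_compact_zero(2)[OF assms, of x] by (cases "x \<in> ?K") auto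
  then show ?thesis by (intro that[of "max M 1"]) auto
qed

text \<open>Translation invariance makes the integral of every difference quotient vanish.\<close>

lemma integral_grad_eq_0:
  fixes v :: "real ^ 'n \<Rightarrow> real"
  assumes v: "C1_compact U v"
  shows "(\<integral>x. grad v x $ i \<partial>lborel) = 0"
proof -
  let ?K = "closure {x. v x \<noteq> 0}" and ?e = "axis i 1 :: real ^ 'n"
  obtain M where M: "M > 0" "\<And>x. norm (grad v x) \<le> M"
    using C1_compact_bounded_grad[OF v] by blast
  obtain R where R: "R > 0" "?K \<subseteq> ball 0 R"
    using compact_imp_bounded[OF C1_compactD(4)[OF v]] bounded_subset_ballD by blast
  define t where "t k = 1 / real (Suc k)" for k
  have t: "0 < t k" "t k \<le> 1" for k by (auto simp: t_def)
  have tlim: "t \<longlonglongrightarrow> 0" unfolding t_def by (rule LIMSEQ_inverse_real_of_nat[unfolded inverse_eq_divide])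
  define s where "s k x = (v (x + t k *\<^sub>R ?e) - v x) / t k" for k x
  have [measurable]: "v \<in> borel_measurable borel" "grad v \<in> borel_measurable borel"
    using v by measurable
  have "(\<lambda>k. \<integral>x. s k x \<partial>lborel) \<longlonglongrightarrow> (\<integral>x. grad v x $ i \<partial>lborel)"
  \<comment> \<open>The shifts \<open>t k\<close> are at most 1, so all difference quotients vanish
    outside the ball of radius \<open>R + 1\<close>; on it \<open>M\<close> is the mean value
    bound.\<close>
  proof (rule integral_dominated_convergence[where w = "\<lambda>x. indicator (cball 0 (R + 1)) x *\<^sub>R M"])
    show "AE x in lborel. (\<lambda>k. s k x) \<longlonglongrightarrow> grad v x $ i"
    proof (rule AE_I2)
      fix x
      have "((\<lambda>r. v (x + r *\<^sub>R ?e)) has_derivative (\<lambda>r. grad v (x + 0 *\<^sub>R ?e) \<bullet> (r *\<^sub>R ?e))) (at 0)"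
        by (rule has_derivative_compose[where f = "\<lambda>r. x + r *\<^sub>R ?e", OF _ C1_compactD(6)[OF v]])
           (auto intro!: derivative_eq_intros)
      then have "((\<lambda>r. v (x + r *\<^sub>R ?e)) has_real_derivative grad v x $ i) (at 0)"
        by (simp add: has_field_derivative_def inner_axis mult_commute_abs)
      then have "((\<lambda>h. (v (x + h *\<^sub>R ?e) - v x) / h) \<longlongrightarrow> grad v x $ i) (at 0)"
        by (simp add: DERIV_def)
      moreover have "filterlim t (at 0) sequentially"
        using tlim t(1) by (auto simp: filterlim_at eventually_sequentially less_imp_neq[symmetric])
      ultimately show "(\<lambda>k. s k x) \<longlonglongrightarrow> grad v x $ i"
        unfolding s_def by (rule filterlim_compose)
    qed
    show "AE x in lborel. norm (s k x) \<le> indicator (cball 0 (R + 1)) x *\<^sub>R M" for k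
    proof (rule AE_I2)
      fix x
      have on: "onorm (\<lambda>h. grad v x \<bullet> h) \<le> M" for x
      proof (rule onorm_le)
        fix h
        show "norm (grad v x \<bullet> h) \<le> M * norm h"
          using Cauchy_Schwarz_ineq2[of "grad v x" h] mult_right_mono[OF M(2)[of x], of "norm h"] by simp
      qed
      have "norm (v (x + t k *\<^sub>R ?e) - v x) \<le> M * norm (x + t k *\<^sub>R ?e - x)"
        by (rule differentiable_bound[where S = UNIV and f' = "\<lambda>x h. grad v x \<bullet> h"])
           (use C1_compactD(6)[OF v] on in auto)
      then have le: "norm (s k x) \<le> M"
        using t[of k] by (simp add: s_def field_simps norm_axis_1)
      show "norm (s k x) \<le> indicator (cball 0 (R + 1)) x *\<^sub>R M"
      proof (cases "norm x \<le> R + 1")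
        case False
        then have "norm (x + t k *\<^sub>R ?e) > R"
          using norm_triangle_ineq2[of x "- (t k *\<^sub>R ?e)"] t[of k] by (simp add: norm_axis_1)
        then have "x \<notin> ?K" "x + t k *\<^sub>R ?e \<notin> ?K" using R(2) False by (auto simp: subset_iff)
        then have "v x = 0" "v (x + t k *\<^sub>R ?e) = 0" using C1_compact_zero(1)[OF v] by blast+
        then show ?thesis using M(1) by (simp add: s_def)
      qed (use le in simp)
    qed
    show "integrable lborel (\<lambda>x::real ^ 'n. indicator (cball 0 (R + 1)) x *\<^sub>R M)"
      by (intro borel_integrable_compact) auto
  qed (auto simp: s_def intro!: measurable_vec_component)
  moreover have "(\<integral>x. s k x \<partial>lborel) = 0" for k
    using integrable_translate[OF C1_compact_integrable(1)[OF v], of "t k *\<^sub>R ?e"] C1_compact_integrable(1)[OF v]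
    by (simp add: s_def)
  ultimately show ?thesis by (simp add: LIMSEQ_const_iff)
qed

text \<open>The factor \<open>w\<close> may be singular outside \<open>U\<close>: the product
  vanishes on the complement of the support of \<open>v\<close>, and this open set together with
  \<open>U\<close> covers the space.\<close>

lemma C1_compact_mult_local:
  fixes v w :: "real ^ 'n \<Rightarrow> real"
  assumes v: "C1_compact U v" and "open U"
    and w: "\<And>x. x \<in> U \<Longrightarrow> (w has_derivative (\<lambda>h. W x \<bullet> h)) (at x)" and W: "continuous_on U W"
  shows "C1_compact U (\<lambda>x. v x * w x)"
    and "x \<in> U \<Longrightarrow> grad (\<lambda>x. v x * w x) x = v x *\<^sub>R W x + w x *\<^sub>R grad v x"
proof -
  let ?f = "\<lambda>x. v x * w x"
  define K where "K = closure {x. v x \<noteq> 0}"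
  have z: "x \<notin> K \<Longrightarrow> v x = 0" for x unfolding K_def by (rule C1_compact_zero(1)[OF v])
  have K: "K \<subseteq> U" "compact K" using C1_compactD(4,5)[OF v] by (simp_all add: K_def)
  then have oK: "open (- K)" by (simp add: compact_imp_closed open_Compl)
  have d1: "(?f has_derivative (\<lambda>h. (v x *\<^sub>R W x + w x *\<^sub>R grad v x) \<bullet> h)) (at x)" if "x \<in> U" for x
    by (rule has_derivative_eq_rhs, rule has_derivative_mult[OF C1_compactD(6)[OF v] w[OF that]])
       (auto simp: inner_simps algebra_simps)
  then show g1: "x \<in> U \<Longrightarrow> grad ?f x = v x *\<^sub>R W x + w x *\<^sub>R grad v x" for x
    by (rule grad_eqI)
  have d2: "(?f has_derivative (\<lambda>h. 0 \<bullet> h)) (at x)" if "x \<notin> K" for x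
    by (rule has_derivative_transform_within_open[where f = "\<lambda>x. 0", OF _ oK])
       (use that z in auto)
  then have g2: "x \<notin> K \<Longrightarrow> grad ?f x = 0" for x by (rule grad_eqI)
  have "?f differentiable at x" for x
    using d1[of x] d2[of x] K by (auto simp: differentiable_def)
  moreover have "continuous_on (U \<union> - K) (grad ?f)"
  proof (rule continuous_on_open_Un)
    have "continuous_on U w"
      by (rule has_derivative_continuous_on) (use w has_derivative_at_withinI in blast)
    then have "continuous_on U (\<lambda>x. v x *\<^sub>R W x + w x *\<^sub>R grad v x)"
      using C1_compactD(2,3)[OF v] W by (intro continuous_intros) auto
    then show "continuous_on U (grad ?f)"
      using g1 by (simp cong: continuous_on_cong)
    show "continuous_on (- K) (grad ?f)"
      by (rule continuous_on_eq[OF continuous_on_const[of _ 0]]) (use g2 in auto)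
  qed (use \<open>open U\<close> oK in auto)
  moreover have "U \<union> - K = UNIV" using K by auto
  moreover have sub: "closure {x. ?f x \<noteq> 0} \<subseteq> K" unfolding K_def by (rule closure_mono) auto
  moreover have "compact (closure {x. ?f x \<noteq> 0})"
    using compact_Int_closed[OF K(2) closed_closure[of "{x. ?f x \<noteq> 0}"]] sub by (simp add: Int_absorb1)
  ultimately show "C1_compact U ?f" using K by (auto simp: C1_compact_def)
qed

lemma C1_compact_compose:
  fixes v :: "real ^ 'n \<Rightarrow> real"
  assumes v: "C1_compact U v" and \<theta>: "\<And>t. (\<theta> has_real_derivative \<theta>' t) (at t)"
    and "continuous_on UNIV \<theta>'" "\<theta> 0 = 0"
  shows "C1_compact U (\<lambda>x. \<theta> (v x))" "grad (\<lambda>x. \<theta> (v x)) x = \<theta>' (v x) *\<^sub>R grad v x"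
proof -
  have d: "((\<lambda>x. \<theta> (v x)) has_derivative (\<lambda>h. (\<theta>' (v x) *\<^sub>R grad v x) \<bullet> h)) (at x)" for x
    by (rule has_derivative_eq_rhs,
        rule has_derivative_compose[OF C1_compactD(6)[OF v] \<theta>[THEN has_field_derivative_imp_has_derivative]]) auto
  then show g: "grad (\<lambda>x. \<theta> (v x)) x = \<theta>' (v x) *\<^sub>R grad v x" for x by (rule grad_eqI)
  have "continuous_on UNIV (\<lambda>x. \<theta>' (v x) *\<^sub>R grad v x)"
    using C1_compactD(2,3)[OF v] assms(3)
    by (auto intro!: continuous_intros continuous_on_compose2[of UNIV \<theta>'])
  then have "continuous_on UNIV (grad (\<lambda>x. \<theta> (v x)))" by (simp add: g[abs_def])
  moreover have sub: "closure {x. \<theta> (v x) \<noteq> 0} \<subseteq> closure {x. v x \<noteq> 0}"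
    by (rule closure_mono) (use \<open>\<theta> 0 = 0\<close> in \<open>auto intro!: notI\<close>)
  moreover have "compact (closure {x. \<theta> (v x) \<noteq> 0})"
    using compact_Int_closed[OF C1_compactD(4)[OF v] closed_closure[of "{x. \<theta> (v x) \<noteq> 0}"]] sub
    by (simp add: Int_absorb1)
  ultimately show "C1_compact U (\<lambda>x. \<theta> (v x))"
    using d C1_compactD(5)[OF v] by (auto simp: C1_compact_def differentiable_def)
qed


section \<open>A hyperbolic isoperimetric inequality\<close>

text \<open>In terms of \<open>hdelta\<close>, the hyperbolic volume is \<open>dx / hdelta x ^ n\<close> and the hyperbolic norm of the
  hyperbolic gradient is \<open>hdelta x * norm (grad u x)\<close>.\<close>

definition hdelta :: "real ^ 'n \<Rightarrow> real" where
  "hdelta x = (1 - (norm x)\<^sup>2) / 2"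

lemma measurable_ball [measurable]: "ball a r \<in> sets borel"
  by simp

lemma hdelta_pos: "x \<in> ball 0 1 \<Longrightarrow> hdelta x > 0"
  by (auto simp: hdelta_def power_less_one_iff abs_square_less_1)

lemma continuous_on_hdelta [continuous_intros]:
  "continuous_on S f \<Longrightarrow> continuous_on S (\<lambda>x. hdelta (f x))"
  unfolding hdelta_def by (intro continuous_intros) auto

lemma borel_measurable_hdelta [measurable]: "hdelta \<in> borel_measurable borel"
  by (intro borel_measurable_continuous_onI continuous_intros)

lemma hdelta_lower_bound:
  assumes "compact K" "K \<subseteq> ball 0 1"
  obtains c where "c > 0" "\<And>x. x \<in> K \<Longrightarrow> c \<le> hdelta x"
proof (cases "K = {}")
  case False
  have "continuous_on K hdelta" by (intro continuous_intros)
  then obtain a where "a \<in> K" "\<And>x. x \<in> K \<Longrightarrow> hdelta a \<le> hdelta x"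
    using continuous_attains_inf[OF assms(1) False] by blast
  then show ?thesis using that[of "hdelta a"] hdelta_pos assms(2) by blast
qed (use that[of 1] in auto)

lemma has_derivative_inverse_power_hdelta:
  assumes "x \<in> ball 0 1"
  shows "((\<lambda>x. 1 / hdelta x ^ m) has_derivative (\<lambda>h. (real m / hdelta x ^ Suc m) * (x \<bullet> h))) (at x)"
proof -
  have "(hdelta has_derivative (\<lambda>h. - (x \<bullet> h))) (at x)"
    unfolding hdelta_def dot_square_norm[symmetric]
    by (auto intro!: derivative_eq_intros simp: inner_commute)
  moreover have "((\<lambda>t. 1 / t ^ m) has_real_derivative - (real m / hdelta x ^ Suc m)) (at (hdelta x))"
  proof (cases m)
    case (Suc k)
    let ?t = "hdelta x"
    have "((\<lambda>t. t ^ Suc k) has_real_derivative real (Suc k) * ?t ^ k) (at ?t)"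
      using DERIV_pow[of "Suc k" ?t] by simp
    from DERIV_inverse'[OF this] hdelta_pos[OF assms]
    have "((\<lambda>t. inverse (t ^ Suc k)) has_real_derivative
        - (inverse (?t ^ Suc k) * (real (Suc k) * ?t ^ k) * inverse (?t ^ Suc k))) (at ?t)" by simp
    moreover have "inverse (?t ^ Suc k) * (real (Suc k) * ?t ^ k) * inverse (?t ^ Suc k) = real m / ?t ^ Suc m"
      using hdelta_pos[OF assms] by (simp add: Suc field_simps)
    ultimately show ?thesis by (simp only: Suc inverse_eq_divide)
  qed simp
  ultimately show ?thesis
    by (rule has_derivative_eq_rhs[OF has_derivative_compose[OF _ has_field_derivative_imp_has_derivative]]) auto
qed

lemma integrable_over_hdelta:
  fixes v :: "real ^ 'n \<Rightarrow> 'b::{banach, second_countable_topology}"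
  assumes "continuous_on UNIV v" "compact K" "K \<subseteq> ball 0 1" "\<And>x. x \<notin> K \<Longrightarrow> v x = 0"
  shows "integrable lborel (\<lambda>x. norm (v x) / hdelta x ^ m)"
proof -
  obtain c where c: "c > 0" "\<And>x. x \<in> K \<Longrightarrow> c \<le> hdelta x"
    using hdelta_lower_bound assms(2,3) by blast
  have [measurable]: "v \<in> borel_measurable borel"
    using assms(1) by (rule borel_measurable_continuous_onI)
  have "integrable lborel (\<lambda>x. norm (v x) / c ^ m)"
    using integrable_continuous_compact_support[OF assms(1,2,4)] by auto
  then show ?thesis
  proof (rule Bochner_Integration.integrable_bound)
    have "norm (v x) / hdelta x ^ m \<le> norm (v x) / c ^ m" if "x \<in> K" for x
      using c that by (intro divide_left_mono power_mono mult_pos_pos zero_less_power) (auto intro: less_le_trans)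
    moreover have "hdelta x > 0" if "x \<in> K" for x using c that by force
    ultimately show "AE x in lborel. norm (norm (v x) / hdelta x ^ m) \<le> norm (norm (v x) / c ^ m)"
      using c(1) assms(4) by (intro AE_I2, rename_tac x, case_tac "x \<in> K") (auto simp: less_imp_le)
  qed measurable
qed

text \<open>The vector field \<open>x / hdelta x ^ (n - 1)\<close> has divergence at least \<open>1 / hdelta x ^ n\<close>:
  the linear isoperimetric inequality of hyperbolic space.\<close>

lemma hyperbolic_cheeger:
  fixes v :: "real ^ 'n \<Rightarrow> real"
  assumes v: "C1_compact (ball 0 1) v" and v0: "\<And>x. v x \<ge> 0" and n2: "CARD('n) \<ge> 2"
  shows "(\<integral>\<^sup>+x. ennreal (v x / hdelta x ^ CARD('n)) \<partial>lborel)
    \<le> (\<integral>\<^sup>+x. ennreal (norm (grad v x) / hdelta x ^ (CARD('n) - 1)) \<partial>lborel)"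
proof -
  define m where "m = CARD('n) - 1"
  have n: "CARD('n) = Suc m" "m \<ge> 1" using n2 by (auto simp: m_def)
  define w where "w i x = x $ i / hdelta x ^ m" for i and x :: "real ^ 'n"
  define W where "W i x = (1 / hdelta x ^ m) *\<^sub>R axis i 1 + (real m * x $ i / hdelta x ^ Suc m) *\<^sub>R x" for i and x :: "real ^ 'n"
  have wd: "(w i has_derivative (\<lambda>h. W i x \<bullet> h)) (at x)" if "x \<in> ball 0 1" for i x
  proof -
    have 1: "((\<lambda>x. x $ i) has_derivative (\<lambda>h. h $ i)) (at x)"
      by (rule bounded_linear_imp_has_derivative[OF bounded_linear_vec_nth])
    have "((\<lambda>x. x $ i * (1 / hdelta x ^ m)) has_derivative (\<lambda>h. W i x \<bullet> h)) (at x)"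
      by (rule has_derivative_eq_rhs, rule has_derivative_mult[OF 1 has_derivative_inverse_power_hdelta[OF that]])
         (auto simp: W_def inner_simps inner_axis' fun_eq_iff field_simps)
    then show ?thesis by (simp add: w_def[abs_def])
  qed
  have Wc: "continuous_on (ball 0 1) (W i)" for i
    unfolding W_def by (intro continuous_intros) (use hdelta_pos in \<open>fastforce\<close>)+
  define h where "h i x = v x * w i x" for i x
  have h: "C1_compact (ball 0 1) (h i)" for i
    unfolding h_def by (rule C1_compact_mult_local(1)[OF v _ wd Wc]) auto
  have gh: "grad (h i) x = v x *\<^sub>R W i x + w i x *\<^sub>R grad v x" if "x \<in> ball 0 1" for i x
    unfolding h_def by (rule C1_compact_mult_local(2)[OF v _ wd Wc]) (use that in auto)
  define S where "S x = (\<Sum>i\<in>UNIV. grad (h i) x $ i)" for x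
  have gi: "integrable lborel (\<lambda>x. grad (h i) x $ i)" for i
  proof (rule Bochner_Integration.integrable_bound[OF C1_compact_integrable(2)[OF h[of i]]])
    have [measurable]: "grad (h i) \<in> borel_measurable borel" using h[of i] by (rule C1_compact_measurable_grad)
    show "(\<lambda>x. grad (h i) x $ i) \<in> borel_measurable lborel" by (simp add: measurable_vec_component)
    show "AE x in lborel. norm (grad (h i) x $ i) \<le> norm (grad (h i) x)"
      by (simp add: component_le_norm_cart)
  qed
  have Si: "integrable lborel S" "(\<integral>x. S x \<partial>lborel) = 0"
    unfolding S_def using gi by (auto simp: integral_grad_eq_0[OF h])
  have vi: "integrable lborel (\<lambda>x. v x / hdelta x ^ Suc m)"
    using integrable_over_hdelta[OF C1_compactD(3)[OF v] C1_compactD(4,5)[OF v] C1_compact_zero(1)[OF v], of "Suc m"] v0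
    by simp
  have dvi: "integrable lborel (\<lambda>x. norm (grad v x) / hdelta x ^ m)"
    using integrable_over_hdelta[OF C1_compactD(2)[OF v] C1_compactD(4,5)[OF v] C1_compact_zero(2)[OF v], of m] by simp
  have pt: "v x / hdelta x ^ Suc m \<le> S x + norm (grad v x) / hdelta x ^ m" for x
  proof (cases "x \<in> ball 0 1")
    case True
    then have d: "hdelta x > 0" by (rule hdelta_pos)
    have "S x = (\<Sum>i\<in>UNIV. v x / hdelta x ^ m + v x * (real m / hdelta x ^ Suc m) * (x $ i * x $ i) + (x $ i * grad v x $ i) / hdelta x ^ m)"
      unfolding S_def by (intro sum.cong refl, subst gh[OF True])
        (simp add: W_def w_def algebra_simps add_divide_distrib)
    also have "\<dots> = real (Suc m) * (v x / hdelta x ^ m) + v x * (real m / hdelta x ^ Suc m) * (x \<bullet> x) + (x \<bullet> grad v x) / hdelta x ^ m"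
      by (simp only: sum.distrib sum_distrib_left[symmetric] sum_divide_distrib[symmetric] sum_constant)
         (simp add: inner_vec_def n)
    also have "\<dots> = v x * ((real (Suc m) * hdelta x + real m * (x \<bullet> x)) / hdelta x ^ Suc m) + (x \<bullet> grad v x) / hdelta x ^ m"
      using d by (simp add: field_simps)
    finally have S: "S x = \<dots>" .
    \<comment> \<open>This is the divergence of the field multiplied by
      \<open>hdelta x ^ Suc m\<close>. It equals (m + 1) / 2 + (m - 1) |x|^2 / 2, which is at least
      1 because m \<ge> 1, that is, n \<ge> 2.\<close>
    have "(1::real) \<le> real (Suc m) * hdelta x + real m * (x \<bullet> x)"
    proof -
      have "real (Suc m) * hdelta x + real m * (x \<bullet> x) = real (Suc m) / 2 + (real m - 1) / 2 * (x \<bullet> x)"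
        by (simp add: hdelta_def dot_square_norm field_simps)
      moreover have "(real m - 1) / 2 * (x \<bullet> x) \<ge> 0" "real (Suc m) / 2 \<ge> 1" using n by simp_all
      ultimately show ?thesis by linarith
    qed
    then have 1: "v x * (1 / hdelta x ^ Suc m) \<le> v x * ((real (Suc m) * hdelta x + real m * (x \<bullet> x)) / hdelta x ^ Suc m)"
      using d v0 by (intro mult_left_mono divide_right_mono) auto
    have "- (x \<bullet> grad v x) \<le> norm x * norm (grad v x)"
      using Cauchy_Schwarz_ineq2[of x "grad v x"] by linarith
    also have "\<dots> \<le> norm (grad v x)" using True by (intro mult_left_le_one_le) auto
    finally have "- (x \<bullet> grad v x) / hdelta x ^ m \<le> norm (grad v x) / hdelta x ^ m"
      using d by (intro divide_right_mono) auto
    with 1 S show ?thesis by simp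
  next
    case False
    have "S x = 0" unfolding S_def using C1_compact_zero'(2)[OF h False] by simp
    then show ?thesis using C1_compact_zero'[OF v False] by simp
  qed
  have "(\<integral>x. v x / hdelta x ^ Suc m \<partial>lborel) \<le> (\<integral>x. S x + norm (grad v x) / hdelta x ^ m \<partial>lborel)"
    using pt by (intro integral_mono vi Bochner_Integration.integrable_add Si dvi)
  also have "\<dots> = (\<integral>x. norm (grad v x) / hdelta x ^ m \<partial>lborel)"
    by (subst Bochner_Integration.integral_add[OF Si(1) dvi]) (simp add: Si)
  finally have le: "(\<integral>x. v x / hdelta x ^ Suc m \<partial>lborel) \<le> (\<integral>x. norm (grad v x) / hdelta x ^ m \<partial>lborel)" .
  have p: "v x / hdelta x ^ Suc m \<ge> 0" "norm (grad v x) / hdelta x ^ m \<ge> 0" for x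
    using v0[of x] C1_compact_zero'[OF v, of x] hdelta_pos[of x] by (cases "x \<in> ball 0 1"; simp)+
  show ?thesis
    using le unfolding n diff_Suc_1
    by (subst (1 2) nn_integral_eq_integral) (use vi dvi p in \<open>auto simp del: power_Suc\<close>)
qed

text \<open>On the ball \<open>hdelta\<close> is 1-Lipschitz and at most the Euclidean distance 1 -
  |x| to the sphere. A shift by less than an eighth of \<open>hdelta x\<close> thus stays in the
  ball and changes \<open>hdelta\<close> by at most an eighth of \<open>hdelta x\<close>, well
  within a factor 2.\<close>

lemma hdelta_shift:
  assumes "x \<in> ball 0 1" "\<tau> \<le> 1/8" "norm h < \<tau> * hdelta x" "s \<in> {0..1}"
  shows "x + s *\<^sub>R h \<in> ball 0 1" "hdelta (x + s *\<^sub>R h) \<le> 2 * hdelta x" "hdelta x \<le> 2 * hdelta (x + s *\<^sub>R h)"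
proof -
  let ?z = "x + s *\<^sub>R h"
  have d: "hdelta x > 0" using hdelta_pos assms by blast
  have h: "norm (s *\<^sub>R h) \<le> hdelta x / 8"
  proof -
    have "norm (s *\<^sub>R h) \<le> 1 * norm h" using assms(4) by (simp add: mult_left_le_one_le)
    also have "\<dots> \<le> \<tau> * hdelta x" using assms by simp
    also have "\<dots> \<le> 1/8 * hdelta x" using assms d by (intro mult_right_mono) auto
    finally show ?thesis by simp
  qed
  have x: "norm x < 1" using assms by simp
  have "hdelta x = (1 - norm x) * (1 + norm x) / 2" by (simp add: hdelta_def algebra_simps power2_eq_square)
  also have "\<dots> \<le> (1 - norm x) * 2 / 2" using x by (intro divide_right_mono mult_left_mono) auto
  finally have dx: "hdelta x \<le> 1 - norm x" by simp
  have zx: "\<bar>norm ?z - norm x\<bar> \<le> hdelta x / 8" using h norm_triangle_ineq3[of ?z x] by simp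
  then have z: "norm ?z < 1" using dx d by linarith
  then show "?z \<in> ball 0 1" by simp
  have "\<bar>hdelta ?z - hdelta x\<bar> = \<bar>norm ?z - norm x\<bar> * ((norm ?z + norm x) / 2)"
  proof -
    have "hdelta ?z - hdelta x = - ((norm ?z - norm x) * ((norm ?z + norm x) / 2))"
      by (simp add: hdelta_def power2_eq_square algebra_simps diff_divide_distrib)
    then have "\<bar>hdelta ?z - hdelta x\<bar> = \<bar>norm ?z - norm x\<bar> * \<bar>(norm ?z + norm x) / 2\<bar>"
      by (metis abs_minus_cancel abs_mult)
    also have "\<bar>(norm ?z + norm x) / 2\<bar> = (norm ?z + norm x) / 2" by simp
    finally show ?thesis .
  qed
  also have "\<dots> \<le> hdelta x / 8 * 1" using zx z x d by (intro mult_mono) auto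
  finally have "\<bar>hdelta ?z - hdelta x\<bar> \<le> hdelta x / 8" by simp
  then show "hdelta ?z \<le> 2 * hdelta x" "hdelta x \<le> 2 * hdelta ?z" using d by linarith+
qed

lemma increment_le_line_integral:
  fixes v :: "real ^ 'n \<Rightarrow> real"
  assumes v: "C1_compact U v"
  shows "ennreal \<bar>v (x + h) - v x\<bar>
    \<le> (\<integral>\<^sup>+s. indicator {0..1} s * ennreal (norm (grad v (x + s *\<^sub>R h)) * norm h) \<partial>lborel)"
proof -
  let ?g = "\<lambda>s. grad v (x + s *\<^sub>R h) \<bullet> h"
  have cg: "continuous_on UNIV (\<lambda>s. grad v (x + s *\<^sub>R h))"
    by (rule continuous_on_compose2[OF C1_compactD(2)[OF v, of UNIV]]) (auto intro!: continuous_intros)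
  then have c: "continuous_on UNIV ?g" by (intro continuous_intros)
  have [measurable]: "(\<lambda>s. grad v (x + s *\<^sub>R h)) \<in> borel_measurable borel"
    using cg by (rule borel_measurable_continuous_onI)
  have d: "((\<lambda>s. v (x + s *\<^sub>R h)) has_real_derivative ?g s) (at s)" for s
  proof -
    have "((\<lambda>s. v (x + s *\<^sub>R h)) has_derivative (\<lambda>r. grad v (x + s *\<^sub>R h) \<bullet> (r *\<^sub>R h))) (at s)"
      by (rule has_derivative_compose[where f = "\<lambda>r. x + r *\<^sub>R h", OF _ C1_compactD(6)[OF v]])
         (auto intro!: derivative_eq_intros)
    then show ?thesis by (simp add: has_field_derivative_def mult_commute_abs)
  qed
  have "integrable lborel (\<lambda>s. indicator {0..1} s *\<^sub>R ?g s)"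
    by (rule borel_integrable_compact) (auto intro: continuous_on_subset[OF c])
  then have i: "integrable lborel (\<lambda>s. ?g s * indicator {0..1} s)" by (simp add: mult.commute)
  have "(\<integral>s. ?g s * indicator {0..1} s \<partial>lborel) = v (x + 1 *\<^sub>R h) - v (x + 0 *\<^sub>R h)"
    by (rule integral_FTC_Icc_real) (use d c in \<open>auto simp: continuous_on_eq_continuous_at\<close>)
  then have "ennreal \<bar>v (x + h) - v x\<bar> = ennreal (norm (\<integral>s. ?g s * indicator {0..1} s \<partial>lborel))" by simp
  also have "\<dots> \<le> (\<integral>\<^sup>+s. ennreal (norm (?g s * indicator {0..1} s)) \<partial>lborel)"
    by (rule integral_norm_bound_ennreal[OF i])
  also have "\<dots> \<le> (\<integral>\<^sup>+s. indicator {0..1} s * ennreal (norm (grad v (x + s *\<^sub>R h)) * norm h) \<partial>lborel)"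
    by (intro nn_integral_mono) (auto simp: indicator_def intro!: ennreal_leI Cauchy_Schwarz_ineq2)
  finally show ?thesis .
qed


lemma emeasure_lborel_ball:
  "r \<ge> 0 \<Longrightarrow> emeasure lborel (ball (c :: real ^ 'n) r) = ennreal (unit_ball_vol (real CARD('n)) * r ^ CARD('n))"
  by (simp add: emeasure_ball)

text \<open>Compare \<open>v x\<close> with its mean over the Euclidean ball of radius \<open>\<tau> * hdelta x\<close>, which is comparable
  to a hyperbolic ball.\<close>

lemma local_isoperimetric:
  fixes v :: "real ^ 'n \<Rightarrow> real"
  defines "n \<equiv> CARD('n)" and "\<sigma> \<equiv> unit_ball_vol (real CARD('n))"
  assumes v: "C1_compact (ball 0 1) v" and v01: "\<And>x. 0 \<le> v x" "\<And>x. v x \<le> 1"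
    and \<tau>: "0 < \<tau>" "\<tau> \<le> 1/8"
    and N: "2 ^ (n + 1) * (\<integral>\<^sup>+x. ennreal (v x / hdelta x ^ n) \<partial>lborel) \<le> ennreal (\<sigma> * \<tau> ^ n)"
  shows "(\<integral>\<^sup>+x. indicator {x \<in> ball 0 1. v x = 1} x * ennreal (1 / hdelta x ^ n) \<partial>lborel)
    \<le> ennreal (2 ^ (3 * n + 2) * \<tau>) * (\<integral>\<^sup>+x. ennreal (norm (grad v x) / hdelta x ^ (n - 1)) \<partial>lborel)"
proof -
  have \<sigma>: "\<sigma> > 0" by (simp add: \<sigma>_def)
  have n: "n \<ge> 1" by (simp add: n_def Suc_leI)
  have [measurable]: "v \<in> borel_measurable borel" "grad v \<in> borel_measurable borel"
    using v by measurable
  let ?A = "{x \<in> ball 0 1. v x = 1}" and ?B = "ball 0 1 :: (real ^ 'n) set"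
  define N where "N = (\<integral>\<^sup>+x. ennreal (v x / hdelta x ^ n) \<partial>lborel)"
  define E where "E x = (\<integral>\<^sup>+h. indicator {h. norm h < \<tau> * hdelta x} h * ennreal \<bar>v (x + h) - v x\<bar> \<partial>lborel)" for x
  \<comment> \<open>Normalisation: \<open>c x\<close> times the lower bound \<open>E_lower\<close>
    is \<open>\<sigma> / 2\<close> times the density \<open>1 / hdelta x ^ n\<close> of the
    hyperbolic volume.\<close>
  define c where "c x = 1 / (hdelta x ^ (2 * n) * \<tau> ^ n)" for x :: "real ^ 'n"
  \<comment> \<open>The integrand after the change of variables
    \<open>z = x + s *\<^sub>R h\<close>. Since \<open>hdelta x\<close> and \<open>hdelta z\<close>
    agree up to a factor 2, the weight \<open>c x\<close> costs a factor 2^(2 n) and the radius of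
    the shifts doubles; bounding |h| by \<open>2 * \<tau> * hdelta z\<close> then lowers the power
    of \<open>hdelta z\<close> by one.\<close>
  define J where "J z h = indicator {(z, h). norm z < 1 \<and> norm h < 2 * \<tau> * hdelta z} (z, h) *
      ennreal (2 ^ (2 * n + 1) * \<tau> / \<tau> ^ n * norm (grad v z) / hdelta z ^ (2 * n - 1))" for z h :: "real ^ 'n"
  have [measurable]: "(\<lambda>(z, h). J z h) \<in> borel_measurable (borel \<Otimes>\<^sub>M borel)"
    unfolding J_def by measurable
  \<comment> \<open>The ball of radius \<open>\<tau> * hdelta x\<close> has volume
    \<open>\<sigma> * (\<tau> * hdelta x) ^ n\<close>. By comparability of \<open>hdelta\<close>,
    the integral of \<open>v\<close> over it is at most \<open>(2 * hdelta x) ^ n * N\<close>, which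
    the smallness of \<open>N\<close> makes at most half of that volume. The other half must come
    from the increments 1 - v.\<close>
  have E_lower: "ennreal (\<sigma> * (\<tau> * hdelta x) ^ n / 2) \<le> E x" if x: "x \<in> ?A" for x
  proof -
    let ?r = "\<tau> * hdelta x"
    have d: "hdelta x > 0" and vx: "v x = 1" using x hdelta_pos by auto
    have "ennreal (\<sigma> * ?r ^ n) = (\<integral>\<^sup>+h. indicator (ball 0 ?r :: (real ^ 'n) set) h \<partial>lborel)"
      using d \<tau> by (simp add: emeasure_lborel_ball \<sigma>_def n_def)
    also have "\<dots> \<le> (\<integral>\<^sup>+h. indicator {h. norm h < ?r} h * ennreal \<bar>v (x + h) - v x\<bar>
        + ennreal ((2 * hdelta x) ^ n) * ennreal (v (h + x) / hdelta (h + x) ^ n) \<partial>lborel)"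
    proof (rule nn_integral_mono)
      fix h :: "real ^ 'n"
      show "indicator (ball 0 ?r) h \<le> indicator {h. norm h < ?r} h * ennreal \<bar>v (x + h) - v x\<bar>
        + ennreal ((2 * hdelta x) ^ n) * ennreal (v (h + x) / hdelta (h + x) ^ n)"
      proof (cases "norm h < ?r")
        case True
        have z: "x + h \<in> ?B" "hdelta (x + h) \<le> 2 * hdelta x"
          using hdelta_shift[of x \<tau> h 1] x \<tau> True by auto
        then have dz: "hdelta (x + h) > 0" by (simp add: hdelta_pos)
        have "v (x + h) * 1 \<le> v (x + h) * ((2 * hdelta x) ^ n / hdelta (x + h) ^ n)"
          using power_mono[OF z(2), of n] dz v01[of "x + h"] by (intro mult_left_mono) (simp_all add: le_divide_eq)
        then have "1 \<le> \<bar>v (x + h) - v x\<bar> + (2 * hdelta x) ^ n * (v (x + h) / hdelta (x + h) ^ n)"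
          using vx by (simp add: mult.commute)
        then have "ennreal 1 \<le> ennreal (\<bar>v (x + h) - v x\<bar> + (2 * hdelta x) ^ n * (v (x + h) / hdelta (x + h) ^ n))"
          by (rule ennreal_leI)
        also have "\<dots> = ennreal \<bar>v (x + h) - v x\<bar> + ennreal ((2 * hdelta x) ^ n) * ennreal (v (x + h) / hdelta (x + h) ^ n)"
          using d dz v01[of "x + h"] by (subst ennreal_plus) (auto simp: ennreal_mult' simp flip: times_divide_eq_right)
        finally show ?thesis using True by (simp add: add.commute)
      qed auto
    qed
    also have "\<dots> = E x + ennreal ((2 * hdelta x) ^ n) * N"
      unfolding E_def N_def
      by (subst nn_integral_add, measurable)
         (simp add: nn_integral_cmult nn_integral_translate[of "\<lambda>y. ennreal (v y / hdelta y ^ n)" x])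
    also have "ennreal ((2 * hdelta x) ^ n) * N = ennreal (hdelta x ^ n / 2) * (2 ^ (n + 1) * N)"
    proof -
      have "ennreal ((2 * hdelta x) ^ n) = ennreal (hdelta x ^ n / 2) * ennreal (2 ^ (n + 1))"
        using d by (subst ennreal_mult[symmetric]) (auto simp: power_mult_distrib field_simps)
      also have "ennreal (2 ^ (n + 1)) = 2 ^ (n + 1)" by (simp flip: ennreal_power ennreal_numeral add: ennreal_mult)
      finally show ?thesis by (simp add: mult.assoc)
    qed
    also have "\<dots> \<le> ennreal (hdelta x ^ n / 2) * ennreal (\<sigma> * \<tau> ^ n)"
      using N unfolding N_def by (rule mult_left_mono) simp
    also have "\<dots> = ennreal (\<sigma> * ?r ^ n / 2)"
      using d \<sigma> \<tau> by (subst ennreal_mult[symmetric]) (auto simp: power_mult_distrib field_simps)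
    finally have "ennreal (\<sigma> * ?r ^ n) \<le> E x + ennreal (\<sigma> * ?r ^ n / 2)"
      by (simp add: add_left_mono)
    moreover have "ennreal (\<sigma> * ?r ^ n) = ennreal (\<sigma> * ?r ^ n / 2) + ennreal (\<sigma> * ?r ^ n / 2)"
      using d \<sigma> \<tau> by (subst ennreal_plus[symmetric]) auto
    ultimately have "ennreal (\<sigma> * ?r ^ n / 2) + ennreal (\<sigma> * ?r ^ n / 2) \<le> ennreal (\<sigma> * ?r ^ n / 2) + E x"
      by (simp add: add.commute)
    then show ?thesis unfolding ennreal_add_left_cancel_le by simp
  qed
  have 2: "ennreal (\<sigma> / 2) * (indicator ?A x * ennreal (1 / hdelta x ^ n)) \<le> indicator ?B x * (ennreal (c x) * E x)" for x
  proof (cases "x \<in> ?A")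
    case True
    then have d: "hdelta x > 0" using hdelta_pos by auto
    have "ennreal (\<sigma> / 2) * ennreal (1 / hdelta x ^ n) = ennreal (c x) * ennreal (\<sigma> * (\<tau> * hdelta x) ^ n / 2)"
    proof -
      have "\<sigma> / 2 * (1 / hdelta x ^ n) = c x * (\<sigma> * (\<tau> * hdelta x) ^ n / 2)"
        using d \<tau> unfolding c_def mult_2 power_add by (simp add: power_mult_distrib)
      then show ?thesis
        using d \<sigma> \<tau> by (subst (1 2) ennreal_mult[symmetric]) (auto simp: c_def)
    qed
    also have "\<dots> \<le> ennreal (c x) * E x"
      using E_lower[OF True] by (rule mult_left_mono) simp
    finally show ?thesis using True by simp
  qed simp
  have pt: "indicator {0..1} s * (ennreal (c x) * ennreal (norm (grad v (x + s *\<^sub>R h)) * norm h)) \<le> indicator {0..1} s * J (x + s *\<^sub>R h) h"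
    if x: "x \<in> ?B" "norm h < \<tau> * hdelta x" for x h and s :: real
  proof (cases "s \<in> {0..1}")
    case True
    let ?z = "x + s *\<^sub>R h"
    note sh = hdelta_shift[OF x(1) \<tau>(2) x(2) True]
    have d: "hdelta x > 0" "hdelta ?z > 0" using x sh(1) by (auto intro: hdelta_pos)
    have "norm h < \<tau> * hdelta x" using x by simp
    also have "\<dots> \<le> \<tau> * (2 * hdelta ?z)" using sh \<tau> by (intro mult_left_mono) auto
    finally have h: "norm h < 2 * \<tau> * hdelta ?z" by simp
    have "c x \<le> 2 ^ (2 * n) / (hdelta ?z ^ (2 * n) * \<tau> ^ n)"
    proof -
      have "hdelta ?z ^ (2 * n) \<le> (2 * hdelta x) ^ (2 * n)" using sh d by (intro power_mono) auto
      then show ?thesis using d \<tau> by (simp add: c_def field_simps power_mult_distrib)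
    qed
    then have "c x * (norm (grad v ?z) * norm h) \<le> (2 ^ (2 * n) / (hdelta ?z ^ (2 * n) * \<tau> ^ n)) * (norm (grad v ?z) * (2 * \<tau> * hdelta ?z))"
      using h d \<tau> by (intro mult_mono mult_left_mono) (auto simp: c_def)
    also have "\<dots> = 2 ^ (2 * n + 1) * \<tau> / \<tau> ^ n * norm (grad v ?z) / hdelta ?z ^ (2 * n - 1)"
    proof -
      have "hdelta ?z ^ (2 * n) = hdelta ?z * hdelta ?z ^ (2 * n - 1)"
        using n by (subst power_Suc[symmetric]) (rule arg_cong[where f = "power (hdelta ?z)"], simp)
      then show ?thesis using d by (simp add: field_simps)
    qed
    finally have "ennreal (c x) * ennreal (norm (grad v ?z) * norm h) \<le> J ?z h"
      using sh(1) h d \<tau> by (simp add: J_def c_def ennreal_mult'[symmetric] ennreal_leI)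
    then show ?thesis by (rule mult_left_mono) simp
  qed simp
  have 3: "indicator ?B x * (ennreal (c x) * E x) \<le> (\<integral>\<^sup>+h. \<integral>\<^sup>+s. indicator {0..1::real} s * J (x + s *\<^sub>R h) h \<partial>lborel \<partial>lborel)" for x
  proof (cases "x \<in> ?B")
    case True
    have "ennreal (c x) * E x = (\<integral>\<^sup>+h. ennreal (c x) * (indicator {h. norm h < \<tau> * hdelta x} h * ennreal \<bar>v (x + h) - v x\<bar>) \<partial>lborel)"
      unfolding E_def by (rule nn_integral_cmult[symmetric]) measurable
    also have "\<dots> \<le> (\<integral>\<^sup>+h. \<integral>\<^sup>+s. indicator {0..1::real} s * J (x + s *\<^sub>R h) h \<partial>lborel \<partial>lborel)"
    proof (rule nn_integral_mono)
      fix h :: "real ^ 'n"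
      show "ennreal (c x) * (indicator {h. norm h < \<tau> * hdelta x} h * ennreal \<bar>v (x + h) - v x\<bar>)
        \<le> (\<integral>\<^sup>+s. indicator {0..1::real} s * J (x + s *\<^sub>R h) h \<partial>lborel)"
      proof (cases "norm h < \<tau> * hdelta x")
        case h: True
        have "ennreal (c x) * ennreal \<bar>v (x + h) - v x\<bar>
          \<le> ennreal (c x) * (\<integral>\<^sup>+s. indicator {0..1} s * ennreal (norm (grad v (x + s *\<^sub>R h)) * norm h) \<partial>lborel)"
          by (rule mult_left_mono[OF increment_le_line_integral[OF v]]) simp
        also have "\<dots> = (\<integral>\<^sup>+s. indicator {0..1} s * (ennreal (c x) * ennreal (norm (grad v (x + s *\<^sub>R h)) * norm h)) \<partial>lborel)"
          by (subst nn_integral_cmult[symmetric]) (measurable, simp add: ac_simps)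
        also have "\<dots> \<le> (\<integral>\<^sup>+s. indicator {0..1::real} s * J (x + s *\<^sub>R h) h \<partial>lborel)"
          by (rule nn_integral_mono) (rule pt[OF True h])
        finally show ?thesis using h by simp
      qed simp
    qed
    finally show ?thesis using True by simp
  qed simp
  \<comment> \<open>For fixed \<open>s\<close> and \<open>h\<close> the map from \<open>x\<close> to
    \<open>x + s *\<^sub>R h\<close> is a translation, so the dependence on \<open>s\<close>
    disappears and the unit interval contributes the factor 1.\<close>
  have swap: "(\<integral>\<^sup>+x. \<integral>\<^sup>+h. \<integral>\<^sup>+s. indicator {0..1::real} s * J (x + s *\<^sub>R h) h \<partial>lborel \<partial>lborel \<partial>lborel)
    = (\<integral>\<^sup>+z. \<integral>\<^sup>+h. J z h \<partial>lborel \<partial>lborel)"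
  proof -
    have "(\<integral>\<^sup>+x. \<integral>\<^sup>+h. \<integral>\<^sup>+s. indicator {0..1::real} s * J (x + s *\<^sub>R h) h \<partial>lborel \<partial>lborel \<partial>lborel)
      = (\<integral>\<^sup>+h. \<integral>\<^sup>+x. \<integral>\<^sup>+s. indicator {0..1::real} s * J (x + s *\<^sub>R h) h \<partial>lborel \<partial>lborel \<partial>lborel)"
      by (rule lborel_pair.Fubini') measurable
    also have "\<dots> = (\<integral>\<^sup>+h. \<integral>\<^sup>+s. \<integral>\<^sup>+x. indicator {0..1::real} s * J (x + s *\<^sub>R h) h \<partial>lborel \<partial>lborel \<partial>lborel)"
      by (intro nn_integral_cong lborel_pair.Fubini') measurable
    also have "\<dots> = (\<integral>\<^sup>+h. \<integral>\<^sup>+s. indicator {0..1::real} s * (\<integral>\<^sup>+z. J z h \<partial>lborel) \<partial>lborel \<partial>lborel)"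
    proof (intro nn_integral_cong)
      fix h :: "real ^ 'n" and s :: real
      have "(\<integral>\<^sup>+x. indicator {0..1::real} s * J (x + s *\<^sub>R h) h \<partial>lborel) = indicator {0..1::real} s * (\<integral>\<^sup>+x. J (x + s *\<^sub>R h) h \<partial>lborel)"
        by (rule nn_integral_cmult) measurable
      also have "(\<integral>\<^sup>+x. J (x + s *\<^sub>R h) h \<partial>lborel) = (\<integral>\<^sup>+z. J z h \<partial>lborel)"
        by (rule nn_integral_translate[where f = "\<lambda>z. J z h"]) measurable
      finally show "(\<integral>\<^sup>+x. indicator {0..1::real} s * J (x + s *\<^sub>R h) h \<partial>lborel) = indicator {0..1::real} s * (\<integral>\<^sup>+z. J z h \<partial>lborel)" .
    qed
    also have "\<dots> = (\<integral>\<^sup>+h. \<integral>\<^sup>+z. J z h \<partial>lborel \<partial>lborel)"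
      by (intro nn_integral_cong) (simp add: nn_integral_multc)
    also have "\<dots> = (\<integral>\<^sup>+z. \<integral>\<^sup>+h. J z h \<partial>lborel \<partial>lborel)"
      by (rule lborel_pair.Fubini') measurable
    finally show ?thesis .
  qed
  have 5: "(\<integral>\<^sup>+h. J z h \<partial>lborel) = ennreal (2 ^ (3 * n + 1) * \<sigma> * \<tau>) * ennreal (norm (grad v z) / hdelta z ^ (n - 1))" for z
  proof (cases "z \<in> ?B")
    case True
    then have d: "hdelta z > 0" by (rule hdelta_pos)
    let ?k = "2 ^ (2 * n + 1) * \<tau> / \<tau> ^ n * norm (grad v z) / hdelta z ^ (2 * n - 1)"
    have "(\<integral>\<^sup>+h. J z h \<partial>lborel) = (\<integral>\<^sup>+h. indicator (ball (0 :: real ^ 'n) (2 * \<tau> * hdelta z)) h * ennreal ?k \<partial>lborel)"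
      using True by (intro nn_integral_cong) (auto simp: J_def indicator_def)
    also have "\<dots> = ennreal (\<sigma> * (2 * \<tau> * hdelta z) ^ n) * ennreal ?k"
      using d \<tau> by (subst nn_integral_multc) (auto simp: emeasure_lborel_ball \<sigma>_def n_def intro!: borel_measurable_indicator)
    also have "\<dots> = ennreal ((2 ^ (3 * n + 1) * \<sigma> * \<tau>) * (norm (grad v z) / hdelta z ^ (n - 1)))"
    proof -
      have dn: "hdelta z ^ (2 * n - 1) = hdelta z ^ n * hdelta z ^ (n - 1)"
        using n by (subst power_add[symmetric]) (rule arg_cong[where f = "power (hdelta z)"], simp)
      define a b :: real where "a = 2 ^ (2 * n + 1)" and "b = 2 ^ n"
      have ab: "(2::real) ^ (3 * n + 1) = a * b"
        unfolding a_def b_def by (subst power_add[symmetric]) (rule arg_cong[where f = "power 2"], simp)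
      have "\<sigma> * (2 * \<tau> * hdelta z) ^ n * ?k = (2 ^ (3 * n + 1) * \<sigma> * \<tau>) * (norm (grad v z) / hdelta z ^ (n - 1))"
        unfolding ab power_mult_distrib dn a_def[symmetric] b_def[symmetric] using d \<tau> by simp
      then show ?thesis using d \<tau> \<sigma> by (subst ennreal_mult[symmetric]) auto
    qed
    finally show ?thesis using d \<tau> \<sigma> by (subst ennreal_mult[symmetric]) simp_all
  next
    case False
    then have "grad v z = 0" by (rule C1_compact_zero'(2)[OF v])
    then show ?thesis by (simp add: J_def)
  qed
  have "ennreal (\<sigma> / 2) * (\<integral>\<^sup>+x. indicator ?A x * ennreal (1 / hdelta x ^ n) \<partial>lborel)
    = (\<integral>\<^sup>+x. ennreal (\<sigma> / 2) * (indicator ?A x * ennreal (1 / hdelta x ^ n)) \<partial>lborel)"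
    by (rule nn_integral_cmult[symmetric]) measurable
  also have "\<dots> \<le> (\<integral>\<^sup>+x. \<integral>\<^sup>+h. \<integral>\<^sup>+s. indicator {0..1::real} s * J (x + s *\<^sub>R h) h \<partial>lborel \<partial>lborel \<partial>lborel)"
    by (rule nn_integral_mono) (rule order_trans[OF 2 3])
  also have "\<dots> = ennreal (2 ^ (3 * n + 1) * \<sigma> * \<tau>) * (\<integral>\<^sup>+x. ennreal (norm (grad v x) / hdelta x ^ (n - 1)) \<partial>lborel)"
    unfolding swap 5 by (rule nn_integral_cmult) measurable
  finally have "ennreal (2 / \<sigma>) * (ennreal (\<sigma> / 2) * (\<integral>\<^sup>+x. indicator ?A x * ennreal (1 / hdelta x ^ n) \<partial>lborel))
    \<le> ennreal (2 / \<sigma>) * (ennreal (2 ^ (3 * n + 1) * \<sigma> * \<tau>) * (\<integral>\<^sup>+x. ennreal (norm (grad v x) / hdelta x ^ (n - 1)) \<partial>lborel))"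
    by (rule mult_left_mono) simp
  then show ?thesis
    using \<sigma> \<tau> by (simp add: mult.assoc[symmetric] ennreal_mult[symmetric])
qed

section \<open>Hyperbolic volume as a density with respect to Lebesgue measure\<close>

lemma borel_measurable_lebesgue_onI:
  "f \<in> borel_measurable borel \<Longrightarrow> f \<in> borel_measurable (lebesgue_on S)"
  by (simp add: measurable_completion measurable_restrict_space1)

text \<open>Later computations take place in \<open>lborel\<close>. For integrands that are only
  Lebesgue measurable this is legitimate because \<open>nn_integral\<close> does not change under
  completion.\<close>

lemma nn_integral_hyp_vol:
  fixes f :: "real ^ 'n \<Rightarrow> ennreal"
  assumes "f \<in> borel_measurable (lebesgue_on (ball 0 1))"
  shows "(\<integral>\<^sup>+x. f x \<partial>hyp_vol)
    = (\<integral>\<^sup>+x. indicator (ball 0 1) x * (ennreal (1 / hdelta x ^ CARD('n)) * f x) \<partial>lborel)"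
proof -
  have e: "2 ^ CARD('n) / (1 - (norm x)\<^sup>2) ^ CARD('n) = 1 / hdelta x ^ CARD('n)" for x :: "real ^ 'n"
    by (simp add: hdelta_def power_divide)
  have "(\<integral>\<^sup>+x. f x \<partial>hyp_vol) = (\<integral>\<^sup>+x. ennreal (1 / hdelta x ^ CARD('n)) * f x \<partial>lebesgue_on (ball 0 1))"
    unfolding hyp_vol_def e
    by (subst nn_integral_density) (auto intro!: borel_measurable_lebesgue_onI assms)
  also have "\<dots> = (\<integral>\<^sup>+x. (ennreal (1 / hdelta x ^ CARD('n)) * f x) * indicator (ball 0 1) x \<partial>lebesgue)"
    by (rule nn_integral_restrict_space) auto
  also have "\<dots> = (\<integral>\<^sup>+x. indicator (ball 0 1) x * (ennreal (1 / hdelta x ^ CARD('n)) * f x) \<partial>lborel)"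
    by (simp add: nn_integral_completion mult.commute)
  finally show ?thesis .
qed

lemma space_hyp_vol [simp]: "space (hyp_vol :: (real ^ 'n) measure) = ball 0 1"
  by (simp add: hyp_vol_def)

lemma sets_hyp_vol [simp]: "sets (hyp_vol :: (real ^ 'n) measure) = sets (lebesgue_on (ball 0 1))"
  by (simp add: hyp_vol_def)

lemma emeasure_hyp_vol:
  assumes "A \<in> sets (lebesgue_on (ball 0 1))"
  shows "emeasure hyp_vol (A :: (real ^ 'n) set)
    = (\<integral>\<^sup>+x. indicator A x * ennreal (1 / hdelta x ^ CARD('n)) \<partial>lborel)"
proof -
  have "A \<subseteq> ball 0 1" using assms sets.sets_into_space by fastforce
  moreover have "emeasure hyp_vol A = (\<integral>\<^sup>+x. indicator A x \<partial>hyp_vol)" using assms by simp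
  ultimately show ?thesis
    using assms by (subst (asm) nn_integral_hyp_vol)
      (auto intro!: nn_integral_cong simp: indicator_def)
qed

text \<open>Two scales. If T is small, \<open>local_isoperimetric\<close> with \<tau> proportional
  to T^(1/n) gives the Euclidean factor T^(-1/n). If T is not small, T^(-1/n) is bounded and
  \<open>hyperbolic_cheeger\<close> alone suffices. The function \<open>v\<close> plays the part of
  a smoothed indicator, and the integral on the right that of the perimeter.\<close>

lemma hyperbolic_isoperimetric:
  assumes n2: "CARD('n) \<ge> 2"
  obtains C where "C > 0"
    "\<And>(v :: real ^ 'n \<Rightarrow> real) T. \<lbrakk>C1_compact (ball 0 1) v; \<And>x. 0 \<le> v x; \<And>x. v x \<le> 1; T > 0;
        emeasure hyp_vol {x \<in> ball 0 1. v x > 0} \<le> ennreal T\<rbrakk> \<Longrightarrow>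
      emeasure hyp_vol {x \<in> ball 0 1. v x = 1} * ennreal (1 + T powr (- 1 / CARD('n)))
        \<le> ennreal C * (\<integral>\<^sup>+x. ennreal (norm (grad v x) / hdelta x ^ (CARD('n) - 1)) \<partial>lborel)"
proof -
  define n where "n = CARD('n)"
  have n: "n \<ge> 2" using n2 by (simp add: n_def)
  define \<sigma> where "\<sigma> = unit_ball_vol (real CARD('n))"
  have \<sigma>: "\<sigma> > 0" by (simp add: \<sigma>_def)
  \<comment> \<open>Chosen so that \<tau> = a T^(1/n) satisfies
    \<open>\<sigma> * \<tau> ^ n = 2 ^ (n + 1) * T\<close>; the smallness hypothesis of
    \<open>local_isoperimetric\<close> then follows from \<open>?N \<le> T\<close>.\<close>
  define a where "a = (2 ^ (n + 1) / \<sigma>) powr (1 / n)"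
  have a: "a > 0" using \<sigma> by (simp add: a_def)
  have an: "a ^ n = 2 ^ (n + 1) / \<sigma>"
    using \<sigma> n by (simp add: a_def powr_power)
  define C where "C = 1 + (2 ^ (3 * n + 2) * a + 8 * a)"
  show ?thesis
  proof (rule that[of C])
    show "C > 0" using a by (auto simp: C_def intro!: add_pos_pos mult_pos_pos)
    fix v :: "real ^ 'n \<Rightarrow> real" and T :: real
    assume v: "C1_compact (ball 0 1) v" and v01: "\<And>x. 0 \<le> v x" "\<And>x. v x \<le> 1" and T: "T > 0"
      and le: "emeasure hyp_vol {x \<in> ball 0 1. v x > 0} \<le> ennreal T"
    have [measurable]: "v \<in> borel_measurable borel" "grad v \<in> borel_measurable borel"
      using v by measurable
    let ?A = "{x \<in> ball 0 1. v x = 1}" and ?P = "{x \<in> ball 0 1. v x > 0}"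
    let ?D = "\<integral>\<^sup>+x. ennreal (norm (grad v x) / hdelta x ^ (n - 1)) \<partial>lborel"
    let ?N = "\<integral>\<^sup>+x. ennreal (v x / hdelta x ^ n) \<partial>lborel"
    have s: "{x \<in> ball 0 1. Q (v x)} \<in> sets (lebesgue_on (ball 0 1))" if "Measurable.pred borel Q" for Q
    proof -
      have [measurable]: "Measurable.pred borel Q" by fact
      have "{x \<in> ball 0 1. Q (v x)} \<in> sets borel" by measurable
      then show ?thesis by (subst sets_restrict_space_iff) auto
    qed
    have mA: "emeasure hyp_vol ?A = (\<integral>\<^sup>+x. indicator ?A x * ennreal (1 / hdelta x ^ n) \<partial>lborel)"
      unfolding n_def by (rule emeasure_hyp_vol) (rule s, measurable)
    have mP: "emeasure hyp_vol ?P = (\<integral>\<^sup>+x. indicator ?P x * ennreal (1 / hdelta x ^ n) \<partial>lborel)"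
      unfolding n_def by (rule emeasure_hyp_vol) (rule s, measurable)
    have AN: "emeasure hyp_vol ?A \<le> ?N"
      unfolding mA by (intro nn_integral_mono) (auto simp: indicator_def)
    have "?N \<le> emeasure hyp_vol ?P"
      unfolding mP
    proof (intro nn_integral_mono)
      fix x
      show "ennreal (v x / hdelta x ^ n) \<le> indicator ?P x * ennreal (1 / hdelta x ^ n)"
        using v01[of x] C1_compact_zero'(1)[OF v, of x] hdelta_pos[of x]
        by (cases "x \<in> ball 0 1"; cases "v x = 0") (auto simp: indicator_def intro!: ennreal_leI divide_right_mono)
    qed
    with le have NT: "?N \<le> ennreal T" by simp
    have ND: "?N \<le> ?D" unfolding n_def using hyperbolic_cheeger[OF v v01(1) n2] .
    have AD: "emeasure hyp_vol ?A \<le> ?D" using AN ND by (rule order_trans)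
    define b where "b = T powr (1 / n)"
    have b: "b > 0" "b ^ n = T" "T powr (- 1 / n) = 1 / b"
      using T n by (auto simp: b_def powr_power powr_minus_divide)
    have main: "emeasure hyp_vol ?A * ennreal (1 / b) \<le> ennreal (2 ^ (3 * n + 2) * a + 8 * a) * ?D"
    proof (cases "a * b \<le> 1 / 8")
      case True
      have "2 ^ (n + 1) * ?N \<le> 2 ^ (n + 1) * ennreal T"
        using NT by (rule mult_left_mono) simp
      also have "\<dots> = ennreal (\<sigma> * (a * b) ^ n)"
      proof -
        have "\<sigma> * (a * b) ^ n = 2 ^ (n + 1) * T" using \<sigma> by (simp add: power_mult_distrib an b)
        moreover have "ennreal (2 ^ (n + 1) * T) = 2 ^ (n + 1) * ennreal T"
          using T by (simp flip: ennreal_power ennreal_numeral add: ennreal_mult)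
        ultimately show ?thesis by simp
      qed
      finally have "emeasure hyp_vol ?A \<le> ennreal (2 ^ (3 * n + 2) * (a * b)) * ?D"
        unfolding mA n_def \<sigma>_def
        by (intro local_isoperimetric[OF v v01]) (use a b True in auto)
      then have "emeasure hyp_vol ?A * ennreal (1 / b) \<le> (ennreal (2 ^ (3 * n + 2) * (a * b)) * ?D) * ennreal (1 / b)"
        by (rule mult_right_mono) simp
      also have "\<dots> = (ennreal (2 ^ (3 * n + 2) * (a * b)) * ennreal (1 / b)) * ?D"
        by (simp add: ac_simps)
      also have "ennreal (2 ^ (3 * n + 2) * (a * b)) * ennreal (1 / b) = ennreal (2 ^ (3 * n + 2) * a)"
        using a b by (subst ennreal_mult[symmetric]) auto
      also have "\<dots> * ?D \<le> ennreal (2 ^ (3 * n + 2) * a + 8 * a) * ?D"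
        using a by (intro mult_right_mono ennreal_leI) auto
      finally show ?thesis .
    next
      case False
      then have "1 / b \<le> 8 * a" using a b by (simp add: field_simps)
      then have "emeasure hyp_vol ?A * ennreal (1 / b) \<le> ?D * ennreal (8 * a)"
        using AD by (intro mult_mono ennreal_leI) auto
      also have "\<dots> \<le> ennreal (2 ^ (3 * n + 2) * a + 8 * a) * ?D"
        using a by (subst mult.commute) (intro mult_right_mono ennreal_leI, auto)
      finally show ?thesis .
    qed
    have "emeasure hyp_vol ?A * ennreal (1 + T powr (- 1 / n)) = emeasure hyp_vol ?A + emeasure hyp_vol ?A * ennreal (1 / b)"
      using b by (simp add: ennreal_plus distrib_left)
    also have "\<dots> \<le> ?D + ennreal (2 ^ (3 * n + 2) * a + 8 * a) * ?D"
      using AD main by (rule add_mono)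
    also have "\<dots> = ennreal C * ?D"
      unfolding C_def using a by (subst ennreal_plus[of 1]) (auto simp: distrib_right)
    finally show "emeasure hyp_vol ?A * ennreal (1 + T powr (- 1 / CARD('n)))
        \<le> ennreal C * (\<integral>\<^sup>+x. ennreal (norm (grad v x) / hdelta x ^ (CARD('n) - 1)) \<partial>lborel)"
      by (simp only: n_def)
  qed
qed


section \<open>C^1 truncations and the layers between two levels\<close>

lemma DERIV_max_0_power:
  fixes p :: real
  assumes "n \<ge> 2"
  shows "((\<lambda>p. (max 0 p) ^ n) has_real_derivative real n * (max 0 p) ^ (n - 1)) (at p)"
proof -
  consider "p > 0" | "p < 0" | "p = 0" by linarith
  then show ?thesis
  proof cases
    case 1
    have "((\<lambda>p. p ^ n) has_real_derivative real n * p ^ (n - 1)) (at p)"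
      by (auto intro!: derivative_eq_intros)
    then show ?thesis
      unfolding max_absorb2[OF less_imp_le[OF 1]]
      by (rule has_field_derivative_transform_within_open[where S = "{0<..}"]) (use 1 in auto)
  next
    case 2
    have "((\<lambda>p. 0::real) has_real_derivative real n * (max 0 p) ^ (n - 1)) (at p)"
      using 2 assms by (simp add: zero_power)
    then show ?thesis
      by (rule has_field_derivative_transform_within_open[where S = "{..<0}"]) (use 2 assms in \<open>auto simp: zero_power\<close>)
  next
    case 3
    have "((\<lambda>h. (max 0 h) ^ n / h) \<longlongrightarrow> 0) (at (0::real))"
    proof (rule Lim_null_comparison[where g = "\<lambda>h. \<bar>h\<bar> ^ (n - 1)"])
      have "norm ((max 0 h) ^ n / h) \<le> \<bar>h\<bar> ^ (n - 1)" for h :: real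
        using assms by (cases "h > 0"; cases n) (auto simp: max_def zero_power power_0_left)
      then show "\<forall>\<^sub>F h in at (0::real). norm ((max 0 h) ^ n / h) \<le> \<bar>h\<bar> ^ (n - 1)" by simp
      show "((\<lambda>h. \<bar>h\<bar> ^ (n - 1)) \<longlongrightarrow> 0) (at (0::real))"
        by (rule tendsto_eq_intros | simp)+ (use assms in \<open>auto simp: zero_power\<close>)
    qed
    then show ?thesis using 3 assms by (simp add: DERIV_def zero_power)
  qed
qed

text \<open>A quadratic spline from 0 to 1: its derivative is the tent on [0, 1] with peak 2 at
  1/2.\<close>

definition smoothstep :: "real \<Rightarrow> real" where
  "smoothstep p = 2 * (max 0 p)\<^sup>2 - 4 * (max 0 (p - 1/2))\<^sup>2 + 2 * (max 0 (p - 1))\<^sup>2"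

definition smoothstep' :: "real \<Rightarrow> real" where
  "smoothstep' p = 4 * max 0 p - 8 * max 0 (p - 1/2) + 4 * max 0 (p - 1)"

lemma DERIV_smoothstep: "(smoothstep has_real_derivative smoothstep' p) (at p)"
proof -
  have *: "((\<lambda>p. (max 0 (p - c))\<^sup>2) has_real_derivative 2 * max 0 (p - c)) (at p)" for c
  proof -
    have i: "((\<lambda>p. p - c) has_real_derivative 1) (at p)" by (auto intro!: derivative_eq_intros)
    show ?thesis
      using DERIV_chain2[where f = "\<lambda>p. (max 0 p)\<^sup>2" and g = "\<lambda>p. p - c", OF DERIV_max_0_power[of 2] i] by simp
  qed
  show ?thesis
    unfolding smoothstep_def[abs_def] smoothstep'_def
    by (rule DERIV_cong[OF DERIV_add[OF DERIV_diff[OF DERIV_cmult DERIV_cmult] DERIV_cmult],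
          OF *[of 0, simplified] *[of "1/2"] *[of 1]]) simp
qed

lemma smoothstep_simps [simp]:
  "p \<le> 0 \<Longrightarrow> smoothstep p = 0" "p \<ge> 1 \<Longrightarrow> smoothstep p = 1"
  "p \<le> 0 \<Longrightarrow> smoothstep' p = 0" "p \<ge> 1 \<Longrightarrow> smoothstep' p = 0"
  by (simp_all add: smoothstep_def smoothstep'_def max_def power2_eq_square algebra_simps)

lemma smoothstep_bounds: "0 \<le> smoothstep p" "smoothstep p \<le> 1" "0 \<le> smoothstep' p" "smoothstep' p \<le> 2"
proof -
  show d: "0 \<le> smoothstep' p" "smoothstep' p \<le> 2" for p
    by (auto simp: smoothstep'_def max_def)
  have mono: "smoothstep a \<le> smoothstep b" if "a \<le> b" for a b
    using DERIV_nonneg_imp_nondecreasing[OF that, of smoothstep] DERIV_smoothstep d by blast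
  show "0 \<le> smoothstep p" using mono[of "min 0 p" p] by simp
  show "smoothstep p \<le> 1" using mono[of p "max 1 p"] by simp
qed

lemma continuous_on_smoothstep': "continuous_on UNIV smoothstep'"
  unfolding smoothstep'_def by (intro continuous_intros)

text \<open>Young's inequality with a free parameter and non-optimal constants: the first term on
  the right dominates if X \<le> d Y, the second otherwise.\<close>

lemma mult_power_le_sum_powers:
  fixes X Y d :: real
  assumes "X \<ge> 0" "Y \<ge> 0" "d > 0" "n \<ge> 1"
  shows "X * Y ^ (n - 1) \<le> d * Y ^ n + X ^ n / d ^ (n - 1)"
proof (cases "X \<le> d * Y")
  case True
  have n: "n = Suc (n - 1)" using assms by simp
  have "X * Y ^ (n - 1) \<le> (d * Y) * Y ^ (n - 1)" using True assms by (intro mult_right_mono) auto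
  also have "\<dots> = d * Y ^ n" by (subst (2) n) simp
  finally show ?thesis using assms by (simp add: add_increasing2)
next
  case False
  have n: "n = Suc (n - 1)" using assms by simp
  have "X * Y ^ (n - 1) \<le> X * (X / d) ^ (n - 1)"
    using False assms by (intro mult_left_mono power_mono) (auto simp: field_simps)
  also have "\<dots> = X ^ n / d ^ (n - 1)" by (subst (2) n) (simp add: power_divide)
  finally show ?thesis using assms by (simp add: add_increasing)
qed

lemma sets_lebesgue_on_ballI:
  fixes S :: "(real ^ 'n) set"
  shows "S \<in> sets borel \<Longrightarrow> S \<subseteq> ball 0 1 \<Longrightarrow> S \<in> sets (lebesgue_on (ball 0 1))"
  by (subst sets_restrict_space_iff) auto

text \<open>The isoperimetric inequality is applied to a truncation of |\<phi>| that is 0 up to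
  level \<open>a\<close> and 1 from level \<open>b\<close> on, so its gradient lives in the layer in
  between. Young's inequality splits the L^1 norm of this gradient into the volume and the n-energy
  of the layer; the parameter \<open>d\<close> stays free so that it can be chosen layer by
  layer.\<close>

lemma level_set_inequality:
  assumes n2: "CARD('n) \<ge> 2"
  obtains C where "C > 0"
    "\<And>(\<phi> :: real ^ 'n \<Rightarrow> real) a b d T. \<lbrakk>C1_compact (ball 0 1) \<phi>; 0 < a; a < b; d > 0; T > 0;
        emeasure hyp_vol {x \<in> ball 0 1. \<bar>\<phi> x\<bar> > a} \<le> ennreal T\<rbrakk> \<Longrightarrow>
      ennreal ((b - a) * (1 + T powr (- 1 / CARD('n)))) * emeasure hyp_vol {x \<in> ball 0 1. \<bar>\<phi> x\<bar> \<ge> b}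
        \<le> ennreal C * (ennreal d * emeasure hyp_vol {x \<in> ball 0 1. a < \<bar>\<phi> x\<bar> \<and> \<bar>\<phi> x\<bar> < b}
          + ennreal (1 / d ^ (CARD('n) - 1)) *
            (\<integral>\<^sup>+x. indicator {x. a < \<bar>\<phi> x\<bar> \<and> \<bar>\<phi> x\<bar> < b} x * ennreal (norm (grad \<phi> x) ^ CARD('n)) \<partial>lborel))"
proof -
  obtain C where C: "C > 0"
    "\<And>(v :: real ^ 'n \<Rightarrow> real) T. \<lbrakk>C1_compact (ball 0 1) v; \<And>x. 0 \<le> v x; \<And>x. v x \<le> 1; T > 0;
        emeasure hyp_vol {x \<in> ball 0 1. v x > 0} \<le> ennreal T\<rbrakk> \<Longrightarrow>
      emeasure hyp_vol {x \<in> ball 0 1. v x = 1} * ennreal (1 + T powr (- 1 / CARD('n)))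
        \<le> ennreal C * (\<integral>\<^sup>+x. ennreal (norm (grad v x) / hdelta x ^ (CARD('n) - 1)) \<partial>lborel)"
    using hyperbolic_isoperimetric[OF n2] by blast
  define n where "n = CARD('n)"
  have n: "n \<ge> 2" using n2 by (simp add: n_def)
  show ?thesis
  proof (rule that[of "2 * C"])
    show "2 * C > 0" using C by simp
    fix \<phi> :: "real ^ 'n \<Rightarrow> real" and a b d T :: real
    assume \<phi>: "C1_compact (ball 0 1) \<phi>" and ab: "0 < a" "a < b" and d: "d > 0" and T: "T > 0"
      and le: "emeasure hyp_vol {x \<in> ball 0 1. \<bar>\<phi> x\<bar> > a} \<le> ennreal T"
    have [measurable]: "\<phi> \<in> borel_measurable borel" "grad \<phi> \<in> borel_measurable borel"
      using \<phi> by measurable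
    \<comment> \<open>A C^1 function of |t|, written without the absolute value: since a > 0, at
      most one of the two summands is nonzero, according to the sign of t.\<close>
    define \<theta> where "\<theta> t = smoothstep ((t - a) / (b - a)) + smoothstep ((- t - a) / (b - a))" for t
    define \<theta>' where "\<theta>' t = (smoothstep' ((t - a) / (b - a)) - smoothstep' ((- t - a) / (b - a))) / (b - a)" for t
    have \<theta>d: "(\<theta> has_real_derivative \<theta>' t) (at t)" for t
      unfolding \<theta>_def[abs_def] \<theta>'_def
    proof -
      have "((\<lambda>t. smoothstep ((t - a) / (b - a))) has_real_derivative smoothstep' ((t - a) / (b - a)) * (1 / (b - a))) (at t)"
        by (rule DERIV_chain2[OF DERIV_smoothstep]) (use ab in \<open>auto intro!: derivative_eq_intros\<close>)
      moreover have "((\<lambda>t. smoothstep ((- t - a) / (b - a))) has_real_derivative smoothstep' ((- t - a) / (b - a)) * (- 1 / (b - a))) (at t)"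
        by (rule DERIV_chain2[OF DERIV_smoothstep], rule DERIV_cdivide) (auto intro!: derivative_eq_intros)
      ultimately show "((\<lambda>t. smoothstep ((t - a) / (b - a)) + smoothstep ((- t - a) / (b - a))) has_real_derivative
          (smoothstep' ((t - a) / (b - a)) - smoothstep' ((- t - a) / (b - a))) / (b - a)) (at t)"
        by (rule DERIV_cong[OF DERIV_add]) (simp add: diff_divide_distrib)
    qed
    have \<theta>'c: "continuous_on UNIV \<theta>'"
      unfolding \<theta>'_def using ab
      by (intro continuous_intros continuous_on_compose2[OF continuous_on_smoothstep']) auto
    have \<theta>1: "\<theta> t = 1" if "\<bar>t\<bar> \<ge> b" for t
    proof (cases "t \<ge> 0")
      case True
      then have "(t - a) / (b - a) \<ge> 1" "(- t - a) / (b - a) \<le> 0" using that ab by (auto simp: field_simps)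
      then show ?thesis by (simp add: \<theta>_def)
    next
      case False
      then have "(- t - a) / (b - a) \<ge> 1" "(t - a) / (b - a) \<le> 0" using that ab by (auto simp: field_simps)
      then show ?thesis by (simp add: \<theta>_def)
    qed
    have \<theta>0: "\<theta> t = 0" if "\<bar>t\<bar> \<le> a" for t
    proof -
      have "(t - a) / (b - a) \<le> 0" "(- t - a) / (b - a) \<le> 0" using that ab by (auto simp: divide_le_0_iff)
      then show ?thesis by (simp add: \<theta>_def)
    qed
    have \<theta>b: "0 \<le> \<theta> t" "\<theta> t \<le> 1" for t
    proof -
      have "(t - a) / (b - a) \<le> 0 \<or> (- t - a) / (b - a) \<le> 0" using ab by (auto simp: divide_le_0_iff)
      then show "0 \<le> \<theta> t" "\<theta> t \<le> 1" using smoothstep_bounds by (auto simp: \<theta>_def)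
    qed
    have \<theta>'0: "\<theta>' t = 0" if "\<not> (a < \<bar>t\<bar> \<and> \<bar>t\<bar> < b)" for t
    proof -
      have "(t - a) / (b - a) \<le> 0 \<or> (t - a) / (b - a) \<ge> 1" "(- t - a) / (b - a) \<le> 0 \<or> (- t - a) / (b - a) \<ge> 1"
        using that ab by (auto simp: divide_le_0_iff le_divide_eq)
      then show ?thesis by (auto simp: \<theta>'_def)
    qed
    have \<theta>'b: "\<bar>\<theta>' t\<bar> \<le> 2 / (b - a)" for t
    proof -
      have "\<bar>smoothstep' ((t - a) / (b - a)) - smoothstep' ((- t - a) / (b - a))\<bar> \<le> 2"
        using smoothstep_bounds(3,4)[of "(t - a) / (b - a)"] smoothstep_bounds(3,4)[of "(- t - a) / (b - a)"] by linarith
      then show ?thesis using ab by (auto simp: \<theta>'_def abs_divide intro!: divide_right_mono)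
    qed
    define v where "v x = \<theta> (\<phi> x)" for x
    have v: "C1_compact (ball 0 1) v" "grad v x = \<theta>' (\<phi> x) *\<^sub>R grad \<phi> x" for x
      unfolding v_def using C1_compact_compose[OF \<phi> \<theta>d \<theta>'c] \<theta>0[of 0] ab by auto
    let ?G = "{x. a < \<bar>\<phi> x\<bar> \<and> \<bar>\<phi> x\<bar> < b}"
    let ?e = "\<lambda>x. norm (grad \<phi> x) ^ n"
    have G: "{x \<in> ball 0 1. a < \<bar>\<phi> x\<bar> \<and> \<bar>\<phi> x\<bar> < b} = ?G"
      using C1_compact_zero'(1)[OF \<phi>] ab by force
    have D: "(\<integral>\<^sup>+x. ennreal (norm (grad v x) / hdelta x ^ (n - 1)) \<partial>lborel)
      \<le> ennreal (2 / (b - a)) * (ennreal d * emeasure hyp_vol ?G + ennreal (1 / d ^ (n - 1)) * (\<integral>\<^sup>+x. indicator ?G x * ennreal (?e x) \<partial>lborel))"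
    proof -
      have pt: "ennreal (norm (grad v x) / hdelta x ^ (n - 1))
        \<le> ennreal (2 / (b - a)) * (ennreal d * (indicator ?G x * ennreal (1 / hdelta x ^ n)) + ennreal (1 / d ^ (n - 1)) * (indicator ?G x * ennreal (?e x)))" for x
      proof (cases "x \<in> ?G")
        case True
        then have "x \<in> ball 0 1" using G by blast
        then have dx: "hdelta x > 0" by (rule hdelta_pos)
        \<comment> \<open>Young's inequality is used with Y = 1 / \<open>hdelta x\<close>: then Y^n
          is the density of the hyperbolic volume, and X^n is the n-energy density.\<close>
        have "norm (grad v x) / hdelta x ^ (n - 1) = \<bar>\<theta>' (\<phi> x)\<bar> * (norm (grad \<phi> x) * (1 / hdelta x) ^ (n - 1))"
          by (simp add: v(2) power_divide)
        also have "\<dots> \<le> 2 / (b - a) * (norm (grad \<phi> x) * (1 / hdelta x) ^ (n - 1))"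
          using dx by (intro mult_right_mono \<theta>'b) auto
        also have "\<dots> \<le> 2 / (b - a) * (d * (1 / hdelta x) ^ n + ?e x / d ^ (n - 1))"
          using dx ab d n by (intro mult_left_mono mult_power_le_sum_powers) auto
        finally have "ennreal (norm (grad v x) / hdelta x ^ (n - 1)) \<le> ennreal (2 / (b - a) * (d * (1 / hdelta x ^ n) + 1 / d ^ (n - 1) * ?e x))"
          unfolding power_one_over by (intro ennreal_leI) simp
        also have "\<dots> = ennreal (2 / (b - a)) * (ennreal d * ennreal (1 / hdelta x ^ n) + ennreal (1 / d ^ (n - 1)) * ennreal (?e x))"
        proof -
          have "2 / (b - a) \<ge> 0" "d \<ge> 0" "1 / hdelta x ^ n \<ge> 0" "1 / d ^ (n - 1) \<ge> 0" "?e x \<ge> 0"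
            using ab d dx by auto
          then show ?thesis by (simp only: ennreal_mult ennreal_plus mult_nonneg_nonneg add_nonneg_nonneg)
        qed
        finally show ?thesis using True by simp
      next
        case False
        then have "grad v x = 0" using v(2)[of x] \<theta>'0 by auto
        then show ?thesis by simp
      qed
      have m: "emeasure hyp_vol ?G = (\<integral>\<^sup>+x. indicator ?G x * ennreal (1 / hdelta x ^ n) \<partial>lborel)"
        unfolding n_def
      proof (rule emeasure_hyp_vol, rule sets_lebesgue_on_ballI)
        show "?G \<subseteq> ball 0 1" using G by blast
      qed measurable
      show ?thesis
        unfolding m
        by (rule order_trans[OF nn_integral_mono[OF pt]])
           (simp add: nn_integral_add nn_integral_cmult)
    qed
    have sup: "emeasure hyp_vol {x \<in> ball 0 1. v x > 0} \<le> ennreal T"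
    proof (rule order_trans[OF emeasure_mono le])
      show "{x \<in> ball 0 1. v x > 0} \<subseteq> {x \<in> ball 0 1. \<bar>\<phi> x\<bar> > a}"
        using \<theta>0 unfolding v_def by (smt (verit) Collect_mono)
      show "{x \<in> ball 0 1. \<bar>\<phi> x\<bar> > a} \<in> sets hyp_vol"
        unfolding sets_hyp_vol by (rule sets_lebesgue_on_ballI) (measurable, auto)
    qed
    have vm [measurable]: "v \<in> borel_measurable borel" using v(1) by measurable
    have sub: "emeasure hyp_vol {x \<in> ball 0 1. \<bar>\<phi> x\<bar> \<ge> b} \<le> emeasure hyp_vol {x \<in> ball 0 1. v x = 1}"
    proof (rule emeasure_mono)
      show "{x \<in> ball 0 1. v x = 1} \<in> sets hyp_vol"
        unfolding sets_hyp_vol by (rule sets_lebesgue_on_ballI) (measurable, auto)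
    qed (auto simp: v_def \<theta>1)
    let ?P = "1 + T powr (- 1 / n)"
    let ?R = "ennreal d * emeasure hyp_vol ?G + ennreal (1 / d ^ (n - 1)) * (\<integral>\<^sup>+x. indicator ?G x * ennreal (?e x) \<partial>lborel)"
    have "ennreal ((b - a) * ?P) * emeasure hyp_vol {x \<in> ball 0 1. \<bar>\<phi> x\<bar> \<ge> b}
      \<le> ennreal ((b - a) * ?P) * emeasure hyp_vol {x \<in> ball 0 1. v x = 1}"
      using sub by (rule mult_left_mono) simp
    also have "\<dots> = ennreal (b - a) * (emeasure hyp_vol {x \<in> ball 0 1. v x = 1} * ennreal ?P)"
      using ab by (simp add: ennreal_mult ac_simps)
    also have "\<dots> \<le> ennreal (b - a) * (ennreal C * (\<integral>\<^sup>+x. ennreal (norm (grad v x) / hdelta x ^ (n - 1)) \<partial>lborel))"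
      unfolding n_def by (intro mult_left_mono C(2)[OF v(1) _ _ T sup]) (auto simp: v_def \<theta>b)
    also have "\<dots> \<le> ennreal (b - a) * (ennreal C * (ennreal (2 / (b - a)) * ?R))"
      by (intro mult_left_mono D) auto
    also have "\<dots> = (ennreal (b - a) * ennreal C * ennreal (2 / (b - a))) * ?R"
      by (simp only: mult.assoc)
    also have "ennreal (b - a) * ennreal C * ennreal (2 / (b - a)) = ennreal (2 * C)"
      using ab C by (subst ennreal_mult[symmetric] | simp)+
    finally show "ennreal ((b - a) * (1 + T powr (- 1 / CARD('n)))) * emeasure hyp_vol {x \<in> ball 0 1. \<bar>\<phi> x\<bar> \<ge> b}
        \<le> ennreal (2 * C) * (ennreal d * emeasure hyp_vol {x \<in> ball 0 1. a < \<bar>\<phi> x\<bar> \<and> \<bar>\<phi> x\<bar> < b}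
          + ennreal (1 / d ^ (CARD('n) - 1)) *
            (\<integral>\<^sup>+x. indicator {x. a < \<bar>\<phi> x\<bar> \<and> \<bar>\<phi> x\<bar> < b} x * ennreal (norm (grad \<phi> x) ^ CARD('n)) \<partial>lborel))"
      unfolding G by (simp only: n_def)
  qed
qed

section \<open>A Poincare inequality\<close>

lemma DERIV_abs_power:
  fixes t :: real
  assumes "n \<ge> 2"
  shows "((\<lambda>t. \<bar>t\<bar> ^ n) has_real_derivative real n * ((max 0 t) ^ (n - 1) - (max 0 (- t)) ^ (n - 1))) (at t)"
proof -
  have eq: "\<bar>t\<bar> ^ n = (max 0 t) ^ n + (max 0 (- t)) ^ n" for t :: real
    using assms by (cases "t \<ge> 0") (auto simp: zero_power)
  have "((\<lambda>t. (max 0 (- t)) ^ n) has_real_derivative (real n * (max 0 (- t)) ^ (n - 1)) * (- 1)) (at t)"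
    by (rule DERIV_chain2[OF DERIV_max_0_power[OF assms]]) (auto intro!: derivative_eq_intros)
  from DERIV_add[OF DERIV_max_0_power[OF assms, of t] this] show ?thesis
    unfolding eq by (simp add: algebra_simps)
qed

text \<open>The linear isoperimetric inequality for \<open>\<bar>\<phi>\<bar> ^ n\<close>, with Young's inequality absorbing one factor.\<close>

lemma hyperbolic_poincare:
  fixes \<phi> :: "real ^ 'n \<Rightarrow> real"
  assumes n2: "CARD('n) \<ge> 2" and \<phi>: "C1_compact (ball 0 1) \<phi>"
  shows "(\<integral>\<^sup>+x. ennreal (\<bar>\<phi> x\<bar> ^ CARD('n)) \<partial>hyp_vol)
    \<le> ennreal ((2 * real CARD('n)) ^ CARD('n)) * (\<integral>\<^sup>+x. ennreal (norm (grad \<phi> x) ^ CARD('n)) \<partial>lborel)"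
proof -
  define n where "n = CARD('n)"
  have n: "n \<ge> 2" using n2 by (simp add: n_def)
  have [measurable]: "\<phi> \<in> borel_measurable borel" "grad \<phi> \<in> borel_measurable borel"
    using \<phi> by measurable
  define \<theta>' where "\<theta>' t = real n * ((max 0 t) ^ (n - 1) - (max 0 (- t)) ^ (n - 1))" for t :: real
  have \<theta>'c: "continuous_on UNIV \<theta>'" unfolding \<theta>'_def by (intro continuous_intros)
  have \<theta>'a: "\<bar>\<theta>' t\<bar> = real n * \<bar>t\<bar> ^ (n - 1)" for t
    using n by (cases "t \<ge> 0") (auto simp: \<theta>'_def abs_mult zero_power power_abs)
  define v where "v x = \<bar>\<phi> x\<bar> ^ n" for x
  have v: "C1_compact (ball 0 1) v" "grad v x = \<theta>' (\<phi> x) *\<^sub>R grad \<phi> x" for x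
    unfolding v_def using C1_compact_compose[OF \<phi> DERIV_abs_power[OF n, folded \<theta>'_def] \<theta>'c] n
    by (auto simp: zero_power)
  let ?N = "\<integral>\<^sup>+x. ennreal (v x / hdelta x ^ n) \<partial>lborel" and ?E = "\<integral>\<^sup>+x. ennreal (norm (grad \<phi> x) ^ n) \<partial>lborel"
  have "(\<lambda>x. ennreal (v x)) \<in> borel_measurable (lebesgue_on (ball 0 1))"
    unfolding v_def by (intro borel_measurable_lebesgue_onI) measurable
  then have "(\<integral>\<^sup>+x. ennreal (v x) \<partial>hyp_vol) = (\<integral>\<^sup>+x. indicator (ball 0 1) x * (ennreal (1 / hdelta x ^ n) * ennreal (v x)) \<partial>lborel)"
    unfolding n_def by (rule nn_integral_hyp_vol)
  also have "\<dots> = ?N"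
  proof (intro nn_integral_cong)
    fix x
    show "indicator (ball 0 1) x * (ennreal (1 / hdelta x ^ n) * ennreal (v x)) = ennreal (v x / hdelta x ^ n)"
      using C1_compact_zero'(1)[OF v(1), of x] hdelta_pos[of x]
      by (cases "x \<in> ball 0 1") (auto simp: ennreal_mult'[symmetric] v_def zero_power)
  qed
  finally have eq: "(\<integral>\<^sup>+x. ennreal (v x) \<partial>hyp_vol) = ?N" .
  have "?N \<le> (\<integral>\<^sup>+x. ennreal (norm (grad v x) / hdelta x ^ (n - 1)) \<partial>lborel)"
    unfolding n_def by (rule hyperbolic_cheeger[OF v(1) _ n2]) (simp add: v_def)
  also have "\<dots> \<le> (\<integral>\<^sup>+x. ennreal (1/2) * ennreal (v x / hdelta x ^ n) + ennreal (real n * (2 * real n) ^ (n - 1)) * ennreal (norm (grad \<phi> x) ^ n) \<partial>lborel)"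
  proof (intro nn_integral_mono)
    fix x
    show "ennreal (norm (grad v x) / hdelta x ^ (n - 1))
      \<le> ennreal (1/2) * ennreal (v x / hdelta x ^ n) + ennreal (real n * (2 * real n) ^ (n - 1)) * ennreal (norm (grad \<phi> x) ^ n)"
    proof (cases "x \<in> ball 0 1")
      case True
      then have d: "hdelta x > 0" by (rule hdelta_pos)
      have "norm (grad v x) / hdelta x ^ (n - 1) = real n * (norm (grad \<phi> x) * (\<bar>\<phi> x\<bar> / hdelta x) ^ (n - 1))"
        by (simp add: v(2) \<theta>'a power_divide)
      \<comment> \<open>The parameter 1 / (2 n) makes the coefficient of the zero-order term 1/2, so
        that half of the left side absorbs it.\<close>
      also have "\<dots> \<le> real n * (1 / (2 * real n) * (\<bar>\<phi> x\<bar> / hdelta x) ^ n + norm (grad \<phi> x) ^ n / (1 / (2 * real n)) ^ (n - 1))"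
        using d n by (intro mult_left_mono mult_power_le_sum_powers) auto
      also have "\<dots> = 1/2 * (v x / hdelta x ^ n) + real n * (2 * real n) ^ (n - 1) * norm (grad \<phi> x) ^ n"
        using n by (simp add: v_def power_divide field_simps)
      finally have "ennreal (norm (grad v x) / hdelta x ^ (n - 1)) \<le> ennreal (1/2 * (v x / hdelta x ^ n) + real n * (2 * real n) ^ (n - 1) * norm (grad \<phi> x) ^ n)"
        by (rule ennreal_leI)
      also have "\<dots> = ennreal (1/2) * ennreal (v x / hdelta x ^ n) + ennreal (real n * (2 * real n) ^ (n - 1)) * ennreal (norm (grad \<phi> x) ^ n)"
      proof -
        have "(1/2::real) \<ge> 0" "v x / hdelta x ^ n \<ge> 0" "real n * (2 * real n) ^ (n - 1) \<ge> 0" "norm (grad \<phi> x) ^ n \<ge> 0"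
          using d by (auto simp: v_def)
        then show ?thesis by (simp only: ennreal_mult ennreal_plus mult_nonneg_nonneg)
      qed
      finally show ?thesis .
    qed (use C1_compact_zero'(2)[OF v(1), of x] in simp)
  qed
  also have "\<dots> = ennreal (1/2) * ?N + ennreal (real n * (2 * real n) ^ (n - 1)) * ?E"
    unfolding v_def by (subst nn_integral_add) (measurable, simp add: nn_integral_cmult)
  finally have le: "?N \<le> ennreal (1/2) * ?N + ennreal (real n * (2 * real n) ^ (n - 1)) * ?E" .
  \<comment> \<open>Cancelling \<open>?N / 2\<close> on both sides requires finiteness, which
    compact support in the open ball provides.\<close>
  have fin: "?N < \<infinity>"
  proof -
    have "integrable lborel (\<lambda>x. norm (v x) / hdelta x ^ n)"
      by (rule integrable_over_hdelta[OF C1_compactD(3)[OF v(1)] C1_compactD(4,5)[OF v(1)] C1_compact_zero(1)[OF v(1)]])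
    then have "integrable lborel (\<lambda>x. v x / hdelta x ^ n)" by (simp add: v_def)
    moreover have "v x / hdelta x ^ n \<ge> 0" for x
      using C1_compact_zero'(1)[OF v(1), of x] hdelta_pos[of x]
      by (cases "x \<in> ball 0 1") (auto simp: v_def zero_power)
    ultimately show ?thesis by (simp add: nn_integral_eq_integral)
  qed
  then obtain N where N: "?N = ennreal N" "N \<ge> 0" by (cases ?N) auto
  have "?N = ennreal (1/2) * ?N + ennreal (1/2) * ?N"
  proof -
    have "ennreal (1/2) * ennreal N = ennreal (1/2 * N)" using N(2) by (intro ennreal_mult[symmetric]) auto
    then show ?thesis unfolding N using N(2) by (simp only:) (subst ennreal_plus[symmetric], auto)
  qed
  with le have "ennreal (1/2) * ?N + ennreal (1/2) * ?N \<le> ennreal (1/2) * ?N + ennreal (real n * (2 * real n) ^ (n - 1)) * ?E"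
    by simp
  then have "ennreal (1/2) * ?N \<le> ennreal (real n * (2 * real n) ^ (n - 1)) * ?E"
    unfolding ennreal_add_left_cancel_le using fin by (auto simp: ennreal_mult_eq_top_iff)
  then have "ennreal 2 * (ennreal (1/2) * ?N) \<le> ennreal 2 * (ennreal (real n * (2 * real n) ^ (n - 1)) * ?E)"
    by (rule mult_left_mono) simp
  moreover have "ennreal 2 * ennreal (1/2) = 1" by (subst ennreal_mult[symmetric]) auto
  moreover have "ennreal 2 * ennreal (real n * (2 * real n) ^ (n - 1)) = ennreal ((2 * real n) ^ n)"
  proof -
    have "2 * (real n * (2 * real n) ^ (n - 1)) = (2 * real n) ^ n"
      using n by (cases n) auto
    then show ?thesis by (subst ennreal_mult[symmetric]) auto
  qed
  ultimately have "?N \<le> ennreal ((2 * real n) ^ n) * ?E" by (simp add: mult.assoc[symmetric] del: ennreal_numeral)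
  then show ?thesis using eq unfolding v_def n_def by simp
qed


section \<open>Approximation and rearrangement\<close>

lemma hyp_norm_hyp_grad:
  assumes "x \<in> ball 0 1"
  shows "hyp_norm x (hyp_grad G x) = hdelta x * norm (G x)"
proof -
  have d: "hdelta x > 0" using assms by (rule hdelta_pos)
  have "4 / (1 - (norm x)\<^sup>2)\<^sup>2 = 1 / (hdelta x)\<^sup>2" "(1 - (norm x)\<^sup>2)\<^sup>2 / 4 = (hdelta x)\<^sup>2"
    by (simp_all add: hdelta_def power_divide)
  then have "hyp_metric x (hyp_grad G x) (hyp_grad G x) = 1 / (hdelta x)\<^sup>2 * (((hdelta x)\<^sup>2 *\<^sub>R G x) \<bullet> ((hdelta x)\<^sup>2 *\<^sub>R G x))"
    by (simp only: hyp_metric_def hyp_grad_def)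
  also have "\<dots> = (hdelta x * norm (G x))\<^sup>2"
    using d by (simp add: dot_square_norm power2_eq_square)
  finally show ?thesis using d by (simp add: hyp_norm_def)
qed

text \<open>Conformal invariance of the n-energy: the power \<open>hdelta x ^ n\<close> from the
  norm of the gradient cancels the density of the volume.\<close>

lemma nn_integral_hyp_grad:
  fixes G :: "real ^ 'n \<Rightarrow> real ^ 'n"
  assumes "G \<in> borel_measurable (lebesgue_on (ball 0 1))"
  shows "(\<lambda>x. hyp_norm x (hyp_grad G x) ^ CARD('n)) \<in> borel_measurable hyp_vol"
    and "(\<integral>\<^sup>+x. ennreal (hyp_norm x (hyp_grad G x) ^ CARD('n)) \<partial>hyp_vol)
    = (\<integral>\<^sup>+x. indicator (ball 0 1) x * ennreal (norm (G x) ^ CARD('n)) \<partial>lborel)"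
proof -
  let ?f = "\<lambda>x. hyp_norm x (hyp_grad G x) ^ CARD('n)"
  have [measurable]: "hdelta \<in> borel_measurable (lebesgue_on (ball 0 1))"
    by (intro borel_measurable_lebesgue_onI) measurable
  note [measurable] = assms
  have "(\<lambda>x. (hdelta x * norm (G x)) ^ CARD('n)) \<in> borel_measurable (lebesgue_on (ball 0 1))"
    by measurable
  then have m: "?f \<in> borel_measurable (lebesgue_on (ball 0 1))"
    by (subst measurable_cong[where g = "\<lambda>x. (hdelta x * norm (G x)) ^ CARD('n)"]) (auto simp: hyp_norm_hyp_grad)
  then show "?f \<in> borel_measurable hyp_vol"
    by (simp add: hyp_vol_def cong: measurable_cong_sets)
  show "(\<integral>\<^sup>+x. ennreal (?f x) \<partial>hyp_vol) = (\<integral>\<^sup>+x. indicator (ball 0 1) x * ennreal (norm (G x) ^ CARD('n)) \<partial>lborel)"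
  proof (subst nn_integral_hyp_vol)
    show "(\<lambda>x. ennreal (?f x)) \<in> borel_measurable (lebesgue_on (ball 0 1))" using m by measurable
    show "(\<integral>\<^sup>+x. indicator (ball 0 1) x * (ennreal (1 / hdelta x ^ CARD('n)) * ennreal (?f x)) \<partial>lborel)
      = (\<integral>\<^sup>+x. indicator (ball 0 1) x * ennreal (norm (G x) ^ CARD('n)) \<partial>lborel)"
    proof (intro nn_integral_cong)
      fix x
      show "indicator (ball 0 1) x * (ennreal (1 / hdelta x ^ CARD('n)) * ennreal (?f x))
        = indicator (ball 0 1) x * ennreal (norm (G x) ^ CARD('n))"
      proof (cases "x \<in> ball 0 1")
        case True
        then show ?thesis
          using hdelta_pos[OF True] by (simp add: hyp_norm_hyp_grad power_mult_distrib ennreal_mult'[symmetric])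
      qed simp
    qed
  qed
qed

text \<open>\<open>hyp_sobolev_norm\<close> is built on a Bochner integral, whose value would be 0
  without integrability. Compact support gives integrability, and from here on the norm can be
  handled as a nonnegative integral.\<close>

lemma hyp_sobolev_norm_C1_compact:
  fixes \<phi> :: "real ^ 'n \<Rightarrow> real"
  assumes \<phi>: "C1_compact (ball 0 1) \<phi>"
  shows "(\<integral>\<^sup>+x. ennreal (norm (grad \<phi> x) ^ CARD('n)) \<partial>lborel) = ennreal (hyp_sobolev_norm \<phi> ^ CARD('n))"
    and "hyp_sobolev_norm \<phi> \<ge> 0"
proof -
  have [measurable]: "grad \<phi> \<in> borel_measurable borel" using \<phi> by measurable
  have m: "grad \<phi> \<in> borel_measurable (lebesgue_on (ball 0 1))"
    by (intro borel_measurable_lebesgue_onI) measurable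
  let ?I = "\<integral>x. hyp_norm x (hyp_grad (grad \<phi>) x) ^ CARD('n) \<partial>hyp_vol"
  have p: "hyp_norm x (hyp_grad (grad \<phi>) x) ^ CARD('n) \<ge> 0" for x
    by (simp add: hyp_norm_def hyp_metric_def)
  have eq: "(\<integral>\<^sup>+x. ennreal (norm (grad \<phi> x) ^ CARD('n)) \<partial>lborel) = (\<integral>\<^sup>+x. ennreal (hyp_norm x (hyp_grad (grad \<phi>) x) ^ CARD('n)) \<partial>hyp_vol)"
    unfolding nn_integral_hyp_grad(2)[OF m]
    by (intro nn_integral_cong) (use C1_compact_zero'(2)[OF \<phi>] in \<open>auto simp: indicator_def\<close>)
  have "integrable lborel (\<lambda>x. norm (grad \<phi> x) ^ CARD('n))"
    by (rule integrable_continuous_compact_support[OF _ C1_compactD(4)[OF \<phi>]])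
       (use C1_compact_zero(2)[OF \<phi>] in \<open>auto intro!: continuous_intros C1_compactD(2)[OF \<phi>]\<close>)
  then have fin: "(\<integral>\<^sup>+x. ennreal (norm (grad \<phi> x) ^ CARD('n)) \<partial>lborel) < \<infinity>"
    by (simp add: nn_integral_eq_integral)
  have "integrable hyp_vol (\<lambda>x. hyp_norm x (hyp_grad (grad \<phi>) x) ^ CARD('n))"
    by (rule integrableI_nonneg) (use nn_integral_hyp_grad(1)[OF m] p fin eq in auto)
  then have I: "(\<integral>\<^sup>+x. ennreal (norm (grad \<phi> x) ^ CARD('n)) \<partial>lborel) = ennreal ?I" "?I \<ge> 0"
    using p unfolding eq by (auto simp: nn_integral_eq_integral)
  then show "(\<integral>\<^sup>+x. ennreal (norm (grad \<phi> x) ^ CARD('n)) \<partial>lborel) = ennreal (hyp_sobolev_norm \<phi> ^ CARD('n))"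
    "hyp_sobolev_norm \<phi> \<ge> 0"
    unfolding hyp_sobolev_norm_def by (auto simp: real_root_pow_pos2)
qed

lemma C1_compact_diff:
  fixes v w :: "real ^ 'n \<Rightarrow> real"
  assumes v: "C1_compact U v" and w: "C1_compact U w"
  shows "C1_compact U (\<lambda>x. v x - w x)" "grad (\<lambda>x. v x - w x) x = grad v x - grad w x"
proof -
  have d: "((\<lambda>x. v x - w x) has_derivative (\<lambda>h. (grad v x - grad w x) \<bullet> h)) (at x)" for x
    by (rule has_derivative_eq_rhs, rule has_derivative_diff[OF C1_compactD(6)[OF v] C1_compactD(6)[OF w]])
       (auto simp: inner_diff_left)
  then show g: "grad (\<lambda>x. v x - w x) x = grad v x - grad w x" for x by (rule grad_eqI)
  let ?S = "closure {x. v x \<noteq> 0} \<union> closure {x. w x \<noteq> 0}"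
  have S: "compact ?S" "?S \<subseteq> U" using C1_compactD(4,5)[OF v] C1_compactD(4,5)[OF w] by auto
  have sub: "closure {x. v x - w x \<noteq> 0} \<subseteq> ?S"
    unfolding closure_Un[symmetric] by (rule closure_mono) auto
  have "continuous_on UNIV (\<lambda>x. grad v x - grad w x)"
    by (intro continuous_intros C1_compactD(2)[OF v] C1_compactD(2)[OF w])
  then have "continuous_on UNIV (grad (\<lambda>x. v x - w x))" by (simp add: g[abs_def])
  moreover have "compact (closure {x. v x - w x \<noteq> 0})"
    using compact_Int_closed[OF S(1) closed_closure[of "{x. v x - w x \<noteq> 0}"]] sub by (simp only: Int_absorb1)
  ultimately show "C1_compact U (\<lambda>x. v x - w x)"
    unfolding C1_compact_def using d sub S(2) by (blast intro: differentiableI)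
qed

lemma power_add_le_double:
  fixes a b :: real
  assumes "a \<ge> 0" "b \<ge> 0"
  shows "(a + b) ^ n \<le> 2 ^ n * (a ^ n + b ^ n)"
proof -
  have "(a + b) ^ n \<le> (2 * max a b) ^ n" using assms by (intro power_mono) auto
  also have "\<dots> = 2 ^ n * (max a b) ^ n" by (rule power_mult_distrib)
  also have "\<dots> \<le> 2 ^ n * (a ^ n + b ^ n)"
    using assms by (intro mult_left_mono) (auto simp: max_def)
  finally show ?thesis .
qed

lemma nn_integral_le_exhaustion:
  assumes [measurable]: "f \<in> borel_measurable M" "\<And>i. A i \<in> sets M"
    and "incseq A" "(\<Union>i. A i) = space M"
    and "\<And>i::nat. (\<integral>\<^sup>+x. indicator (A i) x * f x \<partial>M) \<le> B"
  shows "(\<integral>\<^sup>+x. f x \<partial>M) \<le> B"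
proof -
  have "(\<integral>\<^sup>+x. f x \<partial>M) = (\<integral>\<^sup>+x. (SUP i. indicator (A i) x * f x) \<partial>M)"
  proof (rule nn_integral_cong)
    fix x assume "x \<in> space M"
    then obtain i where "x \<in> A i" using assms(4) by blast
    then have "f x \<le> (SUP i. indicator (A i) x * f x)"
      by (intro SUP_upper2[of i]) auto
    moreover have "(SUP i. indicator (A i) x * f x) \<le> f x"
      by (rule SUP_least) (auto simp: indicator_def)
    ultimately show "f x = (SUP i. indicator (A i) x * f x)" by (rule antisym)
  qed
  also have "\<dots> = (SUP i. \<integral>\<^sup>+x. indicator (A i) x * f x \<partial>M)"
    by (intro nn_integral_monotone_convergence_SUP)
       (use \<open>incseq A\<close> in \<open>auto simp: incseq_def le_fun_def indicator_def\<close>)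
  also have "\<dots> \<le> B" using assms(5) by (rule SUP_least)
  finally show ?thesis .
qed

text \<open>Away from the sphere the two volumes are comparable. The constant blows up as r tends to
  1, so this serves only to identify limits on a fixed smaller ball.\<close>

lemma hyp_vol_nn_integral_le_lebesgue:
  assumes r: "r < 1"
  obtains c where "c \<ge> 0" "\<And>f :: real ^ 'n \<Rightarrow> ennreal. f \<in> borel_measurable (lebesgue_on (ball 0 1)) \<Longrightarrow>
    (\<integral>\<^sup>+x. indicator (cball 0 r) x * f x \<partial>hyp_vol) \<le> ennreal c * (\<integral>\<^sup>+x. f x \<partial>lebesgue_on (ball 0 1))"
proof -
  have "cball 0 r \<subseteq> ball (0 :: real ^ 'n) 1" using r by auto
  then obtain c where c: "c > 0" "\<And>x :: real ^ 'n. x \<in> cball 0 r \<Longrightarrow> c \<le> hdelta x"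
    using hdelta_lower_bound[OF compact_cball] by blast
  show ?thesis
  proof (rule that[of "1 / c ^ CARD('n)"])
    fix f :: "real ^ 'n \<Rightarrow> ennreal" assume f [measurable]: "f \<in> borel_measurable (lebesgue_on (ball 0 1))"
    have [measurable]: "(\<lambda>x. indicator (cball 0 r) x :: ennreal) \<in> borel_measurable (lebesgue_on (ball (0 :: real ^ 'n) 1))"
      by (intro borel_measurable_lebesgue_onI borel_measurable_indicator) simp
    have "(\<integral>\<^sup>+x. indicator (cball 0 r) x * f x \<partial>hyp_vol)
      = (\<integral>\<^sup>+x. indicator (ball 0 1) x * (ennreal (1 / hdelta x ^ CARD('n)) * (indicator (cball 0 r) x * f x)) \<partial>lborel)"
      by (rule nn_integral_hyp_vol) measurable
    also have "\<dots> = (\<integral>\<^sup>+x. (ennreal (1 / hdelta x ^ CARD('n)) * (indicator (cball 0 r) x * f x)) * indicator (ball 0 1) x \<partial>lebesgue)"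
      by (simp add: nn_integral_completion mult.commute)
    also have "\<dots> = (\<integral>\<^sup>+x. ennreal (1 / hdelta x ^ CARD('n)) * (indicator (cball 0 r) x * f x) \<partial>lebesgue_on (ball 0 1))"
      by (rule nn_integral_restrict_space[symmetric]) auto
    also have "\<dots> \<le> (\<integral>\<^sup>+x. ennreal (1 / c ^ CARD('n)) * f x \<partial>lebesgue_on (ball 0 1))"
    proof (rule nn_integral_mono)
      fix x :: "real ^ 'n"
      show "ennreal (1 / hdelta x ^ CARD('n)) * (indicator (cball 0 r) x * f x) \<le> ennreal (1 / c ^ CARD('n)) * f x"
      proof (cases "x \<in> cball 0 r")
        case True
        then have "1 / hdelta x ^ CARD('n) \<le> 1 / c ^ CARD('n)"
          using c by (intro divide_left_mono power_mono mult_pos_pos zero_less_power) (auto intro: less_le_trans)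
        then show ?thesis using True by (auto intro!: mult_right_mono ennreal_leI)
      qed auto
    qed
    also have "\<dots> = ennreal (1 / c ^ CARD('n)) * (\<integral>\<^sup>+x. f x \<partial>lebesgue_on (ball 0 1))"
      by (rule nn_integral_cmult) measurable
    finally show "(\<integral>\<^sup>+x. indicator (cball 0 r) x * f x \<partial>hyp_vol) \<le> ennreal (1 / c ^ CARD('n)) * (\<integral>\<^sup>+x. f x \<partial>lebesgue_on (ball 0 1))" .
  qed (use c in simp)
qed

text \<open>Membership in \<open>W1n_hyp\<close> gives convergence to \<open>u\<close> only in
  Lebesgue L^n, which is too weak near the sphere. By \<open>hyperbolic_poincare\<close> the
  sequence is Cauchy in hyperbolic L^n as well; the limit is recognised as \<open>u\<close> on balls
  of radius less than 1, and these exhaust the unit ball.\<close>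

lemma W1n_hyp_approx:
  fixes u :: "real ^ 'n \<Rightarrow> real"
  assumes n2: "CARD('n) \<ge> 2" and u: "u \<in> W1n_hyp"
  obtains \<phi> M where "\<And>k::nat. C1_compact (ball 0 1) (\<phi> k)" "M \<ge> 0"
    "\<And>k. (\<integral>\<^sup>+x. ennreal (norm (grad (\<phi> k) x) ^ CARD('n)) \<partial>lborel) \<le> ennreal M"
    "\<And>e. e > 0 \<Longrightarrow> \<exists>k. (\<integral>\<^sup>+x. ennreal (\<bar>\<phi> k x - u x\<bar> ^ CARD('n)) \<partial>hyp_vol) \<le> ennreal e"
proof -
  define n where "n = CARD('n)"
  have n: "n \<ge> 2" using n2 by (simp add: n_def)
  from u obtain \<psi> where um [measurable]: "u \<in> borel_measurable (lebesgue_on (ball 0 1))"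
    and t: "\<And>k::nat. \<psi> k \<in> test_functions (ball 0 1)"
    and cauchy: "\<And>e. e > 0 \<Longrightarrow> \<exists>N. \<forall>j\<ge>N. \<forall>k\<ge>N. hyp_sobolev_norm (\<lambda>x. \<psi> j x - \<psi> k x) < e"
    and lim: "(\<lambda>k. \<integral>\<^sup>+x. ennreal (\<bar>\<psi> k x - u x\<bar> ^ n) \<partial>lebesgue_on (ball 0 1)) \<longlonglongrightarrow> 0"
    unfolding W1n_hyp_def n_def by blast
  have \<psi>: "C1_compact (ball 0 1) (\<psi> k)" for k using t by (rule test_functions_C1_compact)
  have [measurable]: "\<psi> k \<in> borel_measurable borel" "grad (\<psi> k) \<in> borel_measurable borel" for k
    using \<psi>[of k] by measurable
  have \<psi>m [measurable]: "\<psi> k \<in> borel_measurable (lebesgue_on (ball 0 1))" for k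
    by (intro borel_measurable_lebesgue_onI) measurable
  define E where "E v = (\<integral>\<^sup>+x. ennreal (norm (grad v x) ^ n) \<partial>lborel)" for v :: "real ^ 'n \<Rightarrow> real"
  have cauchyE: "\<exists>N. \<forall>j\<ge>N. \<forall>k\<ge>N. E (\<lambda>x. \<psi> j x - \<psi> k x) \<le> ennreal e" if "e > 0" for e
  proof -
    have "root n e > 0" using that n by simp
    then obtain N where N: "\<And>j k. j \<ge> N \<Longrightarrow> k \<ge> N \<Longrightarrow> hyp_sobolev_norm (\<lambda>x. \<psi> j x - \<psi> k x) < root n e"
      using cauchy by blast
    have "E (\<lambda>x. \<psi> j x - \<psi> k x) \<le> ennreal e" if jk: "j \<ge> N" "k \<ge> N" for j k
    proof -
      have "hyp_sobolev_norm (\<lambda>x. \<psi> j x - \<psi> k x) ^ n \<le> root n e ^ n"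
        using N[OF jk] hyp_sobolev_norm_C1_compact(2)[OF C1_compact_diff(1)[OF \<psi> \<psi>]] by (intro power_mono) auto
      then show ?thesis
        unfolding E_def n_def hyp_sobolev_norm_C1_compact(1)[OF C1_compact_diff(1)[OF \<psi> \<psi>]]
        using \<open>e > 0\<close> n by (auto simp: n_def intro!: ennreal_leI)
    qed
    then show ?thesis by blast
  qed
  obtain N0 where N0: "\<And>j k. j \<ge> N0 \<Longrightarrow> k \<ge> N0 \<Longrightarrow> E (\<lambda>x. \<psi> j x - \<psi> k x) \<le> ennreal 1"
    using cauchyE[of 1] by auto
  \<comment> \<open>From index \<open>N0\<close> on, each gradient is within 1, in the n-th power of
    the norm, of that of \<open>\<psi> N0\<close>. The sequence is finally shifted by
    \<open>N0\<close> so that the bound holds for every index.\<close>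
  define M where "M = 2 ^ n * (hyp_sobolev_norm (\<psi> N0) ^ n + 1)"
  have M: "M \<ge> 0" using hyp_sobolev_norm_C1_compact(2)[OF \<psi>] by (simp add: M_def)
  have EM: "E (\<psi> k) \<le> ennreal M" if "k \<ge> N0" for k
  proof -
    have "E (\<psi> k) \<le> (\<integral>\<^sup>+x. ennreal (2 ^ n) * (ennreal (norm (grad (\<psi> N0) x) ^ n) + ennreal (norm (grad (\<lambda>x. \<psi> k x - \<psi> N0 x) x) ^ n)) \<partial>lborel)"
      unfolding E_def
    proof (rule nn_integral_mono)
      fix x
      have "norm (grad (\<psi> k) x) \<le> norm (grad (\<psi> N0) x) + norm (grad (\<lambda>x. \<psi> k x - \<psi> N0 x) x)"
        unfolding C1_compact_diff(2)[OF \<psi> \<psi>] by (metis norm_triangle_sub)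
      then have "norm (grad (\<psi> k) x) ^ n \<le> (norm (grad (\<psi> N0) x) + norm (grad (\<lambda>x. \<psi> k x - \<psi> N0 x) x)) ^ n"
        by (intro power_mono) auto
      also have "\<dots> \<le> 2 ^ n * (norm (grad (\<psi> N0) x) ^ n + norm (grad (\<lambda>x. \<psi> k x - \<psi> N0 x) x) ^ n)"
        by (rule power_add_le_double) auto
      finally show "ennreal (norm (grad (\<psi> k) x) ^ n) \<le> ennreal (2 ^ n) * (ennreal (norm (grad (\<psi> N0) x) ^ n) + ennreal (norm (grad (\<lambda>x. \<psi> k x - \<psi> N0 x) x) ^ n))"
        by (subst ennreal_plus[symmetric], simp, simp, subst ennreal_mult[symmetric]) (auto intro!: ennreal_leI)
    qed
    also have "\<dots> = ennreal (2 ^ n) * (E (\<psi> N0) + E (\<lambda>x. \<psi> k x - \<psi> N0 x))"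
    proof -
      have [measurable]: "grad (\<lambda>x. \<psi> k x - \<psi> N0 x) \<in> borel_measurable borel"
        using C1_compact_diff(1)[OF \<psi> \<psi>] by (rule C1_compact_measurable_grad)
      show ?thesis unfolding E_def by (subst nn_integral_cmult, measurable) (subst nn_integral_add, auto)
    qed
    also have "\<dots> \<le> ennreal (2 ^ n) * (ennreal (hyp_sobolev_norm (\<psi> N0) ^ n) + ennreal 1)"
      using N0[OF that order_refl] hyp_sobolev_norm_C1_compact(1)[OF \<psi>[of N0]]
      by (intro mult_left_mono add_mono) (auto simp: E_def n_def)
    also have "\<dots> = ennreal M"
      unfolding M_def using hyp_sobolev_norm_C1_compact(2)[OF \<psi>[of N0]]
      by (subst ennreal_plus[symmetric], simp, simp, subst ennreal_mult[symmetric]) auto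
    finally show ?thesis .
  qed
  define P where "P = (2 * real n) ^ n"
  have P: "P > 0" using n by (simp add: P_def)
  have conv: "\<exists>k. (\<integral>\<^sup>+x. ennreal (\<bar>\<psi> (k + N0) x - u x\<bar> ^ n) \<partial>hyp_vol) \<le> ennreal e" if e: "e > 0" for e
  proof -
    define e' where "e' = e / (2 ^ n * P)"
    have e': "e' > 0" using e P by (simp add: e'_def)
    obtain N where N: "\<And>j k. j \<ge> N \<Longrightarrow> k \<ge> N \<Longrightarrow> E (\<lambda>x. \<psi> j x - \<psi> k x) \<le> ennreal e'"
      using cauchyE[OF e'] by blast
    define j where "j = N + N0"
    have jN: "j \<ge> N" by (simp add: j_def)
    have "(\<integral>\<^sup>+x. ennreal (\<bar>\<psi> j x - u x\<bar> ^ n) \<partial>hyp_vol) \<le> ennreal e"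
    proof (rule nn_integral_le_exhaustion[where A = "\<lambda>i. cball 0 (1 - 1 / real (Suc i))"])
      show "(\<lambda>x. ennreal (\<bar>\<psi> j x - u x\<bar> ^ n)) \<in> borel_measurable hyp_vol"
        by (simp add: hyp_vol_def cong: measurable_cong_sets) measurable
      show "cball 0 (1 - 1 / real (Suc i)) \<in> sets (hyp_vol :: (real ^ 'n) measure)" for i
      proof -
        have "1 - 1 / real (Suc i) < 1" by simp
        then show ?thesis unfolding sets_hyp_vol by (intro sets_lebesgue_on_ballI) (auto simp del: of_nat_Suc intro: le_less_trans[OF _ \<open>1 - 1 / real (Suc i) < 1\<close>])
      qed
      show "incseq (\<lambda>i. cball (0 :: real ^ 'n) (1 - 1 / real (Suc i)))"
        by (intro incseq_SucI subset_cball) (simp add: field_simps)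
      show "(\<Union>i. cball (0 :: real ^ 'n) (1 - 1 / real (Suc i))) = space hyp_vol"
      proof (intro set_eqI iffI)
        fix x :: "real ^ 'n" assume "x \<in> space hyp_vol"
        then have "norm x < 1" by simp
        then obtain i where "inverse (real (Suc i)) < 1 - norm x" using reals_Archimedean[of "1 - norm x"] by auto
        then show "x \<in> (\<Union>i. cball 0 (1 - 1 / real (Suc i)))" by (intro UN_I[of i]) (simp_all add: inverse_eq_divide)
      next
        fix x :: "real ^ 'n" assume "x \<in> (\<Union>i. cball 0 (1 - 1 / real (Suc i)))"
        then obtain i where "norm x \<le> 1 - 1 / real (Suc i)" by auto
        also have "\<dots> < 1" by simp
        finally show "x \<in> space hyp_vol" by simp
      qed
      fix i
      let ?K = "cball (0 :: real ^ 'n) (1 - 1 / real (Suc i))"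
      obtain c where c: "c \<ge> 0" "\<And>f :: real ^ 'n \<Rightarrow> ennreal. f \<in> borel_measurable (lebesgue_on (ball 0 1)) \<Longrightarrow>
          (\<integral>\<^sup>+x. indicator ?K x * f x \<partial>hyp_vol) \<le> ennreal c * (\<integral>\<^sup>+x. f x \<partial>lebesgue_on (ball 0 1))"
        using hyp_vol_nn_integral_le_lebesgue[of "1 - 1 / real (Suc i)"] by auto
      let ?L = "\<lambda>k. \<integral>\<^sup>+x. ennreal (\<bar>\<psi> k x - u x\<bar> ^ n) \<partial>lebesgue_on (ball 0 1)"
      \<comment> \<open>The Cauchy estimate between \<open>\<psi> j\<close> and
        \<open>\<psi> k\<close> holds on the whole ball and supplies \<open>e\<close>; only the
        comparison of \<open>\<psi> k\<close> with \<open>u\<close> is confined to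
        \<open>?K\<close>.\<close>
      have bound: "(\<integral>\<^sup>+x. indicator ?K x * ennreal (\<bar>\<psi> j x - u x\<bar> ^ n) \<partial>hyp_vol)
        \<le> ennreal e + ennreal (2 ^ n * c) * ?L k" if k: "k \<ge> N" for k
      proof -
        have hm: "f \<in> borel_measurable hyp_vol" if "f \<in> borel_measurable (lebesgue_on (ball 0 1))" for f :: "real ^ 'n \<Rightarrow> ennreal"
          using that by (simp add: hyp_vol_def cong: measurable_cong_sets)
        have [measurable]: "(\<lambda>x. indicator ?K x :: ennreal) \<in> borel_measurable (lebesgue_on (ball (0 :: real ^ 'n) 1))"
          by (intro borel_measurable_lebesgue_onI borel_measurable_indicator) simp
        have "(\<integral>\<^sup>+x. indicator ?K x * ennreal (\<bar>\<psi> j x - u x\<bar> ^ n) \<partial>hyp_vol)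
          \<le> (\<integral>\<^sup>+x. ennreal (2 ^ n) * (ennreal (\<bar>\<psi> j x - \<psi> k x\<bar> ^ n) + indicator ?K x * ennreal (\<bar>\<psi> k x - u x\<bar> ^ n)) \<partial>hyp_vol)"
        proof (rule nn_integral_mono)
          fix x
          have "\<bar>\<psi> j x - u x\<bar> ^ n \<le> (\<bar>\<psi> j x - \<psi> k x\<bar> + \<bar>\<psi> k x - u x\<bar>) ^ n" by (intro power_mono) auto
          also have "\<dots> \<le> 2 ^ n * (\<bar>\<psi> j x - \<psi> k x\<bar> ^ n + \<bar>\<psi> k x - u x\<bar> ^ n)" by (rule power_add_le_double) auto
          finally have "ennreal (\<bar>\<psi> j x - u x\<bar> ^ n) \<le> ennreal (2 ^ n) * (ennreal (\<bar>\<psi> j x - \<psi> k x\<bar> ^ n) + ennreal (\<bar>\<psi> k x - u x\<bar> ^ n))"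
            by (subst ennreal_plus[symmetric], simp, simp, subst ennreal_mult[symmetric]) (auto intro!: ennreal_leI)
          then show "indicator ?K x * ennreal (\<bar>\<psi> j x - u x\<bar> ^ n)
            \<le> ennreal (2 ^ n) * (ennreal (\<bar>\<psi> j x - \<psi> k x\<bar> ^ n) + indicator ?K x * ennreal (\<bar>\<psi> k x - u x\<bar> ^ n))"
            by (auto simp: indicator_def)
        qed
        also have "\<dots> = ennreal (2 ^ n) * ((\<integral>\<^sup>+x. ennreal (\<bar>\<psi> j x - \<psi> k x\<bar> ^ n) \<partial>hyp_vol) + (\<integral>\<^sup>+x. indicator ?K x * ennreal (\<bar>\<psi> k x - u x\<bar> ^ n) \<partial>hyp_vol))"
        proof -
          have a: "(\<lambda>x. ennreal (\<bar>\<psi> j x - \<psi> k x\<bar> ^ n)) \<in> borel_measurable hyp_vol"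
            by (rule hm) measurable
          have b: "(\<lambda>x. indicator ?K x * ennreal (\<bar>\<psi> k x - u x\<bar> ^ n)) \<in> borel_measurable hyp_vol"
            by (rule hm) measurable
          show ?thesis using a b by (simp add: nn_integral_cmult nn_integral_add)
        qed
        also have "\<dots> \<le> ennreal (2 ^ n) * (ennreal P * ennreal e' + ennreal c * ?L k)"
        proof (intro mult_left_mono add_mono)
          have "(\<integral>\<^sup>+x. ennreal (\<bar>\<psi> j x - \<psi> k x\<bar> ^ n) \<partial>hyp_vol) \<le> ennreal P * E (\<lambda>x. \<psi> j x - \<psi> k x)"
            unfolding P_def E_def n_def by (rule hyperbolic_poincare[OF n2 C1_compact_diff(1)[OF \<psi> \<psi>]])
          also have "\<dots> \<le> ennreal P * ennreal e'" using N[OF jN k] by (rule mult_left_mono) simp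
          finally show "(\<integral>\<^sup>+x. ennreal (\<bar>\<psi> j x - \<psi> k x\<bar> ^ n) \<partial>hyp_vol) \<le> ennreal P * ennreal e'" .
          show "(\<integral>\<^sup>+x. indicator ?K x * ennreal (\<bar>\<psi> k x - u x\<bar> ^ n) \<partial>hyp_vol) \<le> ennreal c * ?L k"
            by (rule c(2)) measurable
        qed auto
        also have "\<dots> = ennreal e + ennreal (2 ^ n * c) * ?L k"
        proof -
          have "2 ^ n * (P * e') = e" using P by (simp add: e'_def)
          moreover have "ennreal (2 ^ n) * (ennreal P * ennreal e') = ennreal (2 ^ n * (P * e'))"
            using P e' by (simp add: ennreal_mult)
          ultimately show ?thesis using c(1) by (simp add: distrib_left ennreal_mult mult.assoc)
        qed
        finally show ?thesis .
      qed
      \<comment> \<open>With the ball \<open>?K\<close> fixed, letting k tend to infinity removes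
        the term with the constant \<open>c\<close>, so the bound \<open>e\<close> is the same for
        all balls.\<close>
      have "(\<lambda>k. ennreal e + ennreal (2 ^ n * c) * ?L k) \<longlonglongrightarrow> ennreal e + ennreal (2 ^ n * c) * 0"
        by (intro tendsto_intros ennreal_tendsto_cmult lim) simp
      then have "(\<lambda>k. ennreal e + ennreal (2 ^ n * c) * ?L k) \<longlonglongrightarrow> ennreal e" by simp
      then show "(\<integral>\<^sup>+x. indicator ?K x * ennreal (\<bar>\<psi> j x - u x\<bar> ^ n) \<partial>hyp_vol) \<le> ennreal e"
        by (rule LIMSEQ_le_const) (use bound in blast)
    qed
    then show ?thesis unfolding j_def by blast
  qed
  show ?thesis
    by (rule that[of "\<lambda>k. \<psi> (k + N0)" M]) (use \<psi> M EM conv in \<open>auto simp: E_def n_def\<close>)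
qed


section \<open>The rearrangement of a function in hyperbolic L^n\<close>

lemma borel_measurable_hyp_volI:
  "f \<in> borel_measurable (lebesgue_on (ball (0 :: real ^ 'n) 1)) \<Longrightarrow> f \<in> borel_measurable hyp_vol"
  by (simp add: hyp_vol_def cong: measurable_cong_sets)

lemma hyp_vol_markov:
  fixes g :: "real ^ 'n \<Rightarrow> real"
  assumes g [measurable]: "g \<in> borel_measurable (lebesgue_on (ball 0 1))"
    and "(\<integral>\<^sup>+x. ennreal (\<bar>g x\<bar> ^ n) \<partial>hyp_vol) \<le> ennreal e" "s > 0" "e \<ge> 0"
  shows "emeasure hyp_vol {x \<in> ball 0 1. \<bar>g x\<bar> > s} \<le> ennreal (e / s ^ n)"
proof -
  have [measurable]: "g \<in> borel_measurable hyp_vol" using g by (rule borel_measurable_hyp_volI)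
  have S: "{x \<in> ball 0 1. \<bar>g x\<bar> > s} \<in> sets (hyp_vol :: (real ^ 'n) measure)"
  proof -
    have "{x \<in> space hyp_vol. \<bar>g x\<bar> > s} \<in> sets hyp_vol" by measurable
    then show ?thesis by simp
  qed
  have "emeasure hyp_vol {x \<in> ball 0 1. \<bar>g x\<bar> > s} = (\<integral>\<^sup>+x. indicator {x \<in> ball 0 1. \<bar>g x\<bar> > s} x \<partial>hyp_vol)"
    using S by simp
  also have "\<dots> \<le> (\<integral>\<^sup>+x. ennreal (1 / s ^ n) * ennreal (\<bar>g x\<bar> ^ n) \<partial>hyp_vol)"
  proof (rule nn_integral_mono)
    fix x
    show "indicator {x \<in> ball 0 1. \<bar>g x\<bar> > s} x \<le> ennreal (1 / s ^ n) * ennreal (\<bar>g x\<bar> ^ n)"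
    proof (cases "\<bar>g x\<bar> > s")
      case True
      then have "s ^ n \<le> \<bar>g x\<bar> ^ n" using \<open>s > 0\<close> by (intro power_mono) auto
      then have "1 \<le> 1 / s ^ n * \<bar>g x\<bar> ^ n" using \<open>s > 0\<close> by simp
      then have "ennreal 1 \<le> ennreal (1 / s ^ n * \<bar>g x\<bar> ^ n)" by (rule ennreal_leI)
      also have "\<dots> = ennreal (1 / s ^ n) * ennreal (\<bar>g x\<bar> ^ n)"
        using \<open>s > 0\<close> by (intro ennreal_mult) auto
      finally show ?thesis by (simp add: indicator_def)
    qed simp
  qed
  also have "\<dots> = ennreal (1 / s ^ n) * (\<integral>\<^sup>+x. ennreal (\<bar>g x\<bar> ^ n) \<partial>hyp_vol)"
    by (rule nn_integral_cmult) measurable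
  also have "\<dots> \<le> ennreal (1 / s ^ n) * ennreal e" using assms(2) by (rule mult_left_mono) simp
  also have "\<dots> = ennreal (e / s ^ n)" using \<open>s > 0\<close> \<open>e \<ge> 0\<close> by (subst ennreal_mult[symmetric]) auto
  finally show ?thesis .
qed

lemma distribution_function_antimono:
  fixes u :: "real ^ 'n \<Rightarrow> real"
  assumes [measurable]: "u \<in> borel_measurable (lebesgue_on (ball 0 1))" and "s \<le> s'"
  shows "distribution_function u s' \<le> distribution_function u s"
  unfolding distribution_function_def
proof (rule emeasure_mono)
  have "{x \<in> space (lebesgue_on (ball 0 1)). s < \<bar>u x\<bar>} \<in> sets (lebesgue_on (ball 0 1))" by measurable
  then show "{x \<in> ball 0 1. s < \<bar>u x\<bar>} \<in> sets hyp_vol" by simp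
qed (use assms in auto)

text \<open>By Markov's inequality the L^n bound makes the distribution function finite and lets it
  tend to 0. The suprema that define \<open>f\<close> at positive volumes are then taken over
  bounded sets, as they must be for \<open>Sup\<close> on the reals to have its meaning.\<close>

locale rearrangement =
  fixes u :: "real ^ 'n \<Rightarrow> real" and I :: real
  assumes um [measurable]: "u \<in> borel_measurable (lebesgue_on (ball 0 1))"
    and I0: "I \<ge> 0" and I: "(\<integral>\<^sup>+x. ennreal (\<bar>u x\<bar> ^ CARD('n)) \<partial>hyp_vol) \<le> ennreal I"
begin

abbreviation "f \<equiv> decreasing_rearrangement u"

lemma distribution_le: "s > 0 \<Longrightarrow> distribution_function u s \<le> ennreal (I / s ^ CARD('n))"
  unfolding distribution_function_def by (rule hyp_vol_markov[OF um I _ I0])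

lemma bdd: "t > 0 \<Longrightarrow> bdd_above (insert 0 {s. s > 0 \<and> distribution_function u s > ennreal t})"
proof (rule bdd_aboveI)
  fix s assume t: "t > 0" and s: "s \<in> insert 0 {s. s > 0 \<and> distribution_function u s > ennreal t}"
  show "s \<le> max 1 (I / t)"
  proof (cases "s \<le> 1")
    case False
    then have "distribution_function u s > ennreal t" using s by auto
    also have "distribution_function u s \<le> ennreal (I / s ^ CARD('n))" using False by (intro distribution_le) auto
    finally have "t < I / s ^ CARD('n)" using t by (simp add: ennreal_less_iff)
    then have "s ^ CARD('n) < I / t" using t False by (simp add: field_simps)
    moreover have "s \<le> s ^ CARD('n)" using False by (intro self_le_power) auto
    ultimately show ?thesis by simp
  qed simp
qed

lemma f_nonneg: "t > 0 \<Longrightarrow> f t \<ge> 0"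
  unfolding decreasing_rearrangement_def by (rule cSup_upper[OF _ bdd]) auto

lemma f_ge: "t > 0 \<Longrightarrow> s > 0 \<Longrightarrow> distribution_function u s > ennreal t \<Longrightarrow> s \<le> f t"
  unfolding decreasing_rearrangement_def by (rule cSup_upper[OF _ bdd]) auto

lemma distribution_le_of_gt: "t > 0 \<Longrightarrow> s > f t \<Longrightarrow> distribution_function u s \<le> ennreal t"
  using f_ge[of t s] f_nonneg[of t] by (metis le_less_trans not_le)

lemma distribution_gt_of_less: 
  assumes "t > 0" "s > 0" "s < f t"
  shows "distribution_function u s > ennreal t"
proof -
  obtain s' where "s' \<in> insert 0 {s. s > 0 \<and> distribution_function u s > ennreal t}" "s < s'"
    using assms(3) unfolding decreasing_rearrangement_def
    by (subst (asm) less_cSup_iff[OF _ bdd[OF assms(1)]]) auto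
  then show ?thesis
    using assms distribution_function_antimono[OF um, of s s'] by auto
qed

lemma f_antimono: "0 < t \<Longrightarrow> t \<le> t' \<Longrightarrow> f t' \<le> f t"
  unfolding decreasing_rearrangement_def
  by (rule cSup_subset_mono[OF _ bdd]) (auto intro: le_less_trans[OF ennreal_leI])

text \<open>A level s below \<open>f t\<close> has distribution strictly greater than t; the strict
  inequality leaves room for slightly larger arguments, so s stays a lower bound for
  \<open>f\<close> just to the right of t.\<close>

lemma f_right_continuous:
  assumes t: "t > 0"
  shows "continuous (at_right t) f"
  unfolding continuous_within
proof (rule tendstoI)
  fix e :: real assume e: "e > 0"
  show "\<forall>\<^sub>F t' in at_right t. dist (f t') (f t) < e"
  proof (cases "f t < e")
    case True
    have "dist (f t') (f t) < e" if "t' > t" for t'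
      using f_antimono[OF t, of t'] f_nonneg[of t'] that t True by (auto simp: dist_real_def)
    then show ?thesis by (auto simp: eventually_at_filter)
  next
    case False
    define s where "s = f t - e / 2"
    have s: "s > 0" "s < f t" using False e by (auto simp: s_def)
    then obtain r where r: "ennreal t < r" "r < distribution_function u s"
      using distribution_gt_of_less[OF t] dense by blast
    then obtain t1 where t1: "r = ennreal t1" "t1 > t"
      using t by (cases r) (auto simp: ennreal_less_iff)
    have "dist (f t') (f t) < e" if "t' > t" "t' < t1" for t'
    proof -
      have "distribution_function u s > ennreal t'"
      proof (rule less_trans)
        show "ennreal t' < ennreal t1" using that t by (subst ennreal_less_iff) auto
        show "ennreal t1 < distribution_function u s" using r(2) t1(1) by simp
      qed
      then have "s \<le> f t'" using s that t by (intro f_ge) auto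
      then show ?thesis using f_antimono[OF t, of t'] that e by (auto simp: dist_real_def s_def)
    qed
    then show ?thesis using eventually_at_right_real[OF t1(2)] by (auto elim: eventually_mono)
  qed
qed

lemma f_tendsto_0: "(f \<longlongrightarrow> 0) at_top"
proof (rule tendstoI)
  fix e :: real assume e: "e > 0"
  have "dist (f t) 0 < e" if "t > max 1 (I / (e / 2) ^ CARD('n))" for t
  proof -
    have "\<not> (e / 2 < f t)"
    proof
      assume "e / 2 < f t"
      then have "ennreal t < distribution_function u (e / 2)"
        using that e by (intro distribution_gt_of_less) auto
      also have "\<dots> \<le> ennreal (I / (e / 2) ^ CARD('n))" using e by (intro distribution_le) auto
      finally show False using that by (simp add: ennreal_less_iff)
    qed
    then show ?thesis using f_nonneg[of t] that e by auto
  qed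
  then show "\<forall>\<^sub>F t in at_top. dist (f t) 0 < e"
    using eventually_gt_at_top[of "max 1 (I / (e / 2) ^ CARD('n))"] by (auto elim: eventually_mono)
qed

end


lemma W1n_hyp_approx_ex:
  fixes u :: "real ^ 'n \<Rightarrow> real"
  assumes n2: "CARD('n) \<ge> 2" and u: "u \<in> W1n_hyp"
  shows "\<exists>\<phi> M. (\<forall>k::nat. C1_compact (ball 0 1) (\<phi> k)) \<and> M \<ge> 0 \<and>
    (\<forall>k. (\<integral>\<^sup>+x. ennreal (norm (grad (\<phi> k) x) ^ CARD('n)) \<partial>lborel) \<le> ennreal M) \<and>
    (\<forall>e>0. \<exists>k. (\<integral>\<^sup>+x. ennreal (\<bar>\<phi> k x - u x\<bar> ^ CARD('n)) \<partial>hyp_vol) \<le> ennreal e)"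
  by (rule W1n_hyp_approx[OF n2 u]) blast

text \<open>One approximating test function within distance 1 of \<open>u\<close>, together with
  \<open>hyperbolic_poincare\<close> for it, places \<open>u\<close> in hyperbolic L^n.\<close>

lemma W1n_hyp_rearrangement:
  fixes u :: "real ^ 'n \<Rightarrow> real"
  assumes n2: "CARD('n) \<ge> 2" and u: "u \<in> W1n_hyp"
  obtains I where "rearrangement u I"
proof -
  define n where "n = CARD('n)"
  have um [measurable]: "u \<in> borel_measurable (lebesgue_on (ball 0 1))"
    using u by (simp add: W1n_hyp_def)
  obtain \<phi> M where \<phi>: "\<And>k::nat. C1_compact (ball 0 1) (\<phi> k)" and M: "M \<ge> 0"
    "\<And>k. (\<integral>\<^sup>+x. ennreal (norm (grad (\<phi> k) x) ^ n) \<partial>lborel) \<le> ennreal M"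
    and approx: "\<And>e. e > 0 \<Longrightarrow> \<exists>k. (\<integral>\<^sup>+x. ennreal (\<bar>\<phi> k x - u x\<bar> ^ n) \<partial>hyp_vol) \<le> ennreal e"
    using W1n_hyp_approx_ex[OF n2 u, folded n_def] by blast
  obtain k where k: "(\<integral>\<^sup>+x. ennreal (\<bar>\<phi> k x - u x\<bar> ^ n) \<partial>hyp_vol) \<le> ennreal 1"
    using approx[of 1] by auto
  have [measurable]: "\<phi> k \<in> borel_measurable borel" using \<phi>[of k] by measurable
  have \<phi>m [measurable]: "\<phi> k \<in> borel_measurable (lebesgue_on (ball 0 1))"
    by (intro borel_measurable_lebesgue_onI) measurable
  have [measurable]: "\<phi> k \<in> borel_measurable hyp_vol" "u \<in> borel_measurable hyp_vol"
    by (simp_all add: borel_measurable_hyp_volI um \<phi>m)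
  define P where "P = (2 * real n) ^ n"
  have P: "P \<ge> 0" by (simp add: P_def)
  have "(\<integral>\<^sup>+x. ennreal (\<bar>u x\<bar> ^ n) \<partial>hyp_vol)
    \<le> (\<integral>\<^sup>+x. ennreal (2 ^ n) * (ennreal (\<bar>\<phi> k x\<bar> ^ n) + ennreal (\<bar>\<phi> k x - u x\<bar> ^ n)) \<partial>hyp_vol)"
  proof (rule nn_integral_mono)
    fix x
    have "\<bar>u x\<bar> ^ n \<le> (\<bar>\<phi> k x\<bar> + \<bar>\<phi> k x - u x\<bar>) ^ n" by (intro power_mono) auto
    also have "\<dots> \<le> 2 ^ n * (\<bar>\<phi> k x\<bar> ^ n + \<bar>\<phi> k x - u x\<bar> ^ n)" by (rule power_add_le_double) auto
    finally show "ennreal (\<bar>u x\<bar> ^ n) \<le> ennreal (2 ^ n) * (ennreal (\<bar>\<phi> k x\<bar> ^ n) + ennreal (\<bar>\<phi> k x - u x\<bar> ^ n))"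
      by (subst ennreal_plus[symmetric], simp, simp, subst ennreal_mult[symmetric]) (auto intro!: ennreal_leI)
  qed
  also have "\<dots> = ennreal (2 ^ n) * ((\<integral>\<^sup>+x. ennreal (\<bar>\<phi> k x\<bar> ^ n) \<partial>hyp_vol) + (\<integral>\<^sup>+x. ennreal (\<bar>\<phi> k x - u x\<bar> ^ n) \<partial>hyp_vol))"
    by (simp add: nn_integral_cmult nn_integral_add)
  also have "\<dots> \<le> ennreal (2 ^ n) * (ennreal P * ennreal M + ennreal 1)"
  proof (intro mult_left_mono add_mono k)
    have "(\<integral>\<^sup>+x. ennreal (\<bar>\<phi> k x\<bar> ^ n) \<partial>hyp_vol) \<le> ennreal P * (\<integral>\<^sup>+x. ennreal (norm (grad (\<phi> k) x) ^ n) \<partial>lborel)"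
      unfolding P_def n_def by (rule hyperbolic_poincare[OF n2 \<phi>])
    also have "\<dots> \<le> ennreal P * ennreal M" by (rule mult_left_mono[OF M(2)]) simp
    finally show "(\<integral>\<^sup>+x. ennreal (\<bar>\<phi> k x\<bar> ^ n) \<partial>hyp_vol) \<le> ennreal P * ennreal M" .
  qed simp
  also have "\<dots> = ennreal (2 ^ n * (P * M + 1))"
    using P M(1) by (simp add: ennreal_mult ennreal_plus)
  finally have "rearrangement u (2 ^ n * (P * M + 1))"
    using P M(1) by unfold_locales (auto simp: n_def um)
  then show ?thesis by (rule that)
qed

section \<open>Increments of the rearrangement along a partition of the logarithmic volume\<close>

lemma exp_diff_le_double:
  fixes x y :: real
  assumes "x \<le> y" "y - x \<le> ln 2"
  shows "exp y - exp x \<le> 2 * exp x * (y - x)"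
proof -
  have "1 - (y - x) \<le> exp (- (y - x))" using exp_ge_add_one_self[of "- (y - x)"] by linarith
  then have "exp (y - x) * (1 - (y - x)) \<le> exp (y - x) * exp (- (y - x))" by (intro mult_left_mono) auto
  moreover have "exp (y - x) * exp (- (y - x)) = 1" by (simp flip: exp_add)
  ultimately have "exp (y - x) - 1 \<le> (y - x) * exp (y - x)" by (simp only:) (simp add: algebra_simps)
  also have "\<dots> \<le> (y - x) * 2" using assms by (intro mult_left_mono) (auto simp: ln_ge_iff)
  finally have "exp x * (exp (y - x) - 1) \<le> exp x * ((y - x) * 2)" by (intro mult_left_mono) auto
  moreover have "exp x * (exp (y - x) - 1) = exp y - exp x" by (simp add: algebra_simps flip: exp_add)
  ultimately show ?thesis by (simp add: algebra_simps)
qed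

text \<open>Origin of the weight \<beta>: for V = \<open>exp x\<close>, it is V times the n-th power
  of the isoperimetric factor 1 + V^(-1/n). It is comparable to 1 + V.\<close>

lemma exp_mult_power_one_plus:
  fixes x :: real
  assumes "n \<ge> 1"
  shows "exp x * (1 + exp x powr (- 1 / n)) ^ n = (1 + exp (x / real n)) ^ n"
proof -
  have "exp x = exp (x / real n) ^ n" using assms by (simp flip: exp_of_nat_mult)
  moreover have "exp x powr (- 1 / n) = exp (- (x / real n))" by (simp add: powr_def)
  ultimately have "exp x * (1 + exp x powr (- 1 / n)) ^ n = (exp (x / real n) * (1 + exp (- (x / real n)))) ^ n"
    by (metis power_mult_distrib)
  also have "exp (x / real n) * (1 + exp (- (x / real n))) = 1 + exp (x / real n)"
    by (simp add: exp_minus field_simps)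
  finally show ?thesis .
qed

text \<open>The isoperimetric factor will be evaluated at four times the relevant volume; since
  4^(-1/n) \<ge> 1/2 for n \<ge> 2, this costs at most a factor 2.\<close>

lemma powr_quadruple_ge:
  fixes t :: real
  assumes "t > 0" "n \<ge> 2"
  shows "1 + (4 * t) powr (- 1 / real n) \<ge> (1 + t powr (- 1 / real n)) / 2"
proof -
  have "(1::real) / 2 = 4 powr (- 1 / 2)" by (simp add: powr_minus_divide powr_half_sqrt)
  also have "\<dots> \<le> 4 powr (- 1 / real n)" using assms(2) by (intro powr_mono) (auto simp: field_simps)
  finally have "(1/2) * t powr (- 1 / real n) \<le> 4 powr (- 1 / real n) * t powr (- 1 / real n)"
    by (intro mult_right_mono) auto
  also have "\<dots> = (4 * t) powr (- 1 / real n)" using assms by (simp add: powr_mult)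
  finally show ?thesis by simp
qed

lemma sum_disjoint_nn_integral_le:
  fixes g :: "'a \<Rightarrow> ennreal"
  assumes "finite J" "disjoint_family_on A J" and [measurable]: "g \<in> borel_measurable M" "\<And>i. i \<in> J \<Longrightarrow> A i \<in> sets M"
  shows "(\<Sum>i\<in>J. \<integral>\<^sup>+x. indicator (A i) x * g x \<partial>M) \<le> (\<integral>\<^sup>+x. g x \<partial>M)"
proof -
  have "(\<Sum>i\<in>J. \<integral>\<^sup>+x. indicator (A i) x * g x \<partial>M) = (\<integral>\<^sup>+x. (\<Sum>i\<in>J. indicator (A i) x * g x) \<partial>M)"
    by (rule nn_integral_sum[symmetric]) measurable
  also have "\<dots> = (\<integral>\<^sup>+x. indicator (\<Union>i\<in>J. A i) x * g x \<partial>M)"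
    using assms(1,2) by (simp add: indicator_UN_disjoint sum_distrib_right)
  also have "\<dots> \<le> (\<integral>\<^sup>+x. g x \<partial>M)"
    by (intro nn_integral_mono) (auto simp: indicator_def)
  finally show ?thesis .
qed

text \<open>The isoperimetric inequality between consecutive values of the rearrangement. The levels
  \<open>f (exp (x i))\<close> of \<open>u\<close> are compared with those of a test function \<open>\<phi>\<close> that is within \<open>\<epsilon>\<close> of \<open>u\<close>
  outside a set of measure \<open>\<epsilon>\<close>.\<close>

lemma rearrangement_step_inequality:
  fixes u :: "real ^ 'n \<Rightarrow> real"
  assumes n2: "CARD('n) \<ge> 2" and u: "u \<in> W1n_hyp"
  defines "f \<equiv> decreasing_rearrangement u" and "\<beta> \<equiv> \<lambda>x::real. (1 + exp (x / real CARD('n))) ^ CARD('n)"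
  obtains B where "B > 0"
    "\<And>N x w. \<lbrakk>\<And>i. i < N \<Longrightarrow> x i < x (Suc i); \<And>i. i < N \<Longrightarrow> x (Suc i) - x i \<le> ln 2; \<And>i. w i \<ge> 0\<rbrakk> \<Longrightarrow>
      (\<Sum>i<N. w i ^ (CARD('n) - 1) * \<beta> (x i) * (f (exp (x i)) - f (exp (x (Suc i)))))
        \<le> B * ((\<Sum>i<N. w i ^ CARD('n) * \<beta> (x i) * (x (Suc i) - x i)) + 1)"
proof -
  define n where "n = CARD('n)"
  have n: "n \<ge> 2" using n2 by (simp add: n_def)
  obtain I where "rearrangement u I" using W1n_hyp_rearrangement[OF n2 u] by blast
  then interpret rearrangement u I .
  obtain C where C: "C > 0"
    "\<And>(\<phi> :: real ^ 'n \<Rightarrow> real) a b d T. \<lbrakk>C1_compact (ball 0 1) \<phi>; 0 < a; a < b; d > 0; T > 0;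
        emeasure hyp_vol {x \<in> ball 0 1. \<bar>\<phi> x\<bar> > a} \<le> ennreal T\<rbrakk> \<Longrightarrow>
      ennreal ((b - a) * (1 + T powr (- 1 / n))) * emeasure hyp_vol {x \<in> ball 0 1. \<bar>\<phi> x\<bar> \<ge> b}
        \<le> ennreal C * (ennreal d * emeasure hyp_vol {x \<in> ball 0 1. a < \<bar>\<phi> x\<bar> \<and> \<bar>\<phi> x\<bar> < b}
          + ennreal (1 / d ^ (n - 1)) *
            (\<integral>\<^sup>+x. indicator {x. a < \<bar>\<phi> x\<bar> \<and> \<bar>\<phi> x\<bar> < b} x * ennreal (norm (grad \<phi> x) ^ n) \<partial>lborel))"
    using level_set_inequality[OF n2] unfolding n_def by blast
  obtain \<phi> M where \<phi>: "\<And>k::nat. C1_compact (ball 0 1) (\<phi> k)" and M: "M \<ge> 0"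
    "\<And>k. (\<integral>\<^sup>+x. ennreal (norm (grad (\<phi> k) x) ^ n) \<partial>lborel) \<le> ennreal M"
    and approx: "\<And>e. e > 0 \<Longrightarrow> \<exists>k. (\<integral>\<^sup>+x. ennreal (\<bar>\<phi> k x - u x\<bar> ^ n) \<partial>hyp_vol) \<le> ennreal e"
    using W1n_hyp_approx_ex[OF n2 u, folded n_def] by blast
  define p where "p x = 1 + exp x powr (- 1 / n)" for x :: real
  have p: "p x > 0" for x by (simp add: p_def add_pos_pos)
  have \<beta>: "\<beta> x = exp x * p x ^ n" for x
    unfolding \<beta>_def p_def n_def[symmetric] using n by (subst exp_mult_power_one_plus) auto
  \<comment> \<open>One approximant serves all levels of the partition. It depends on \<epsilon>,
    but the bound \<open>M\<close> for its energy does not, so \<epsilon> can tend to 0 afterwards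
    while the partition is fixed.\<close>
  have key: "(\<Sum>i<N. w i ^ (n - 1) * \<beta> (x i) * (f (exp (x i)) - f (exp (x (Suc i))) - 4 * \<epsilon>))
      \<le> 4 * C * ((\<Sum>i<N. w i ^ n * p (x i) ^ n * (exp (x (Suc i)) - exp (x i) + 2 * \<epsilon>)) + M)"
    if x: "\<And>i. i < N \<Longrightarrow> x i < x (Suc i)" "\<And>i. i < N \<Longrightarrow> x (Suc i) - x i \<le> ln 2" and w: "\<And>i. w i \<ge> 0"
      and \<epsilon>: "\<epsilon> > 0" "\<epsilon> \<le> exp (x 0) / 2" for N x w \<epsilon>
  proof -
    have xmono: "x i \<le> x j" if "i \<le> j" "j \<le> N" for i j
      using that by (induction rule: dec_induct) (use x(1) in \<open>auto intro: order_trans less_imp_le Suc_le_lessD\<close>)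
    \<comment> \<open>The power n + 1 lets Markov's inequality at height \<epsilon> bound the
      measure of the exceptional set by \<epsilon>.\<close>
    obtain k where k: "(\<integral>\<^sup>+x. ennreal (\<bar>\<phi> k x - u x\<bar> ^ n) \<partial>hyp_vol) \<le> ennreal (\<epsilon> ^ Suc n)"
      using approx[of "\<epsilon> ^ Suc n"] \<epsilon> by auto
    define \<psi> where "\<psi> = \<phi> k"
    have \<psi>: "C1_compact (ball 0 1) \<psi>" using \<phi> by (simp add: \<psi>_def)
    have [measurable]: "\<psi> \<in> borel_measurable borel" "grad \<psi> \<in> borel_measurable borel" using \<psi> by measurable
    have \<psi>m [measurable]: "\<psi> \<in> borel_measurable (lebesgue_on (ball 0 1))"
      by (intro borel_measurable_lebesgue_onI) measurable
    have meas: "{x \<in> ball 0 1. Q (\<psi> x) (u x)} \<in> sets hyp_vol"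
      if "Measurable.pred (lebesgue_on (ball 0 1)) (\<lambda>x. Q (\<psi> x) (u x))" for Q
    proof -
      have "{x \<in> space (lebesgue_on (ball 0 1)). Q (\<psi> x) (u x)} \<in> sets (lebesgue_on (ball 0 1))"
        using that by measurable
      then show ?thesis by simp
    qed
    let ?D = "{x \<in> ball 0 1. \<bar>\<psi> x - u x\<bar> > \<epsilon>}"
    have Ds: "?D \<in> sets hyp_vol" by (rule meas) measurable
    have "emeasure hyp_vol ?D \<le> ennreal (\<epsilon> ^ Suc n / \<epsilon> ^ n)"
      by (rule hyp_vol_markov[where g = "\<lambda>x. \<psi> x - u x"]) (use k \<epsilon> in \<open>auto simp: \<psi>_def[symmetric]\<close>)
    then have D: "emeasure hyp_vol ?D \<le> ennreal \<epsilon>" using \<epsilon> by simp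
    \<comment> \<open>Of the margin 2 \<epsilon>, one \<epsilon> pays for the error of the
      approximant off the exceptional set, the other moves strictly past the value of
      \<open>f\<close>, where the distribution function is controlled.\<close>
    define a where "a i = f (exp (x (Suc i))) + 2 * \<epsilon>" for i
    define b where "b i = f (exp (x i)) - 2 * \<epsilon>" for i
    define A where "A i = {x. a i < \<bar>\<psi> x\<bar> \<and> \<bar>\<psi> x\<bar> < b i}" for i
    have As [measurable]: "A i \<in> sets borel" for i unfolding A_def by measurable
    define E where "E i = (\<integral>\<^sup>+x. indicator (A i) x * ennreal (norm (grad \<psi> x) ^ n) \<partial>lborel)" for i
    have EM: "(\<Sum>i<N. E i) \<le> ennreal M"
    proof -
      have "disjoint_family_on A {..<N}"
      proof (unfold disjoint_family_on_def, intro ballI impI)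
        \<comment> \<open>Layers of different steps do not overlap because \<open>f\<close> is
          decreasing; their energies therefore add up to at most \<open>M\<close>, whatever the
          partition.\<close>
        have *: "A i \<inter> A j = {}" if "i < j" "j < N" for i j
        proof -
          have "b j \<le> a i"
            using f_antimono[of "exp (x (Suc i))" "exp (x j)"] xmono[of "Suc i" j] that \<epsilon>
            by (simp add: a_def b_def f_def)
          then show ?thesis by (auto simp: A_def)
        qed
        fix i j assume "i \<in> {..<N}" "j \<in> {..<N}" "i \<noteq> j"
        then show "A i \<inter> A j = {}" using *[of i j] *[of j i] by (cases "i < j") auto
      qed
      then have "(\<Sum>i<N. E i) \<le> (\<integral>\<^sup>+x. ennreal (norm (grad \<psi> x) ^ n) \<partial>lborel)"
        unfolding E_def by (intro sum_disjoint_nn_integral_le) auto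
      then show ?thesis using M(2)[of k] by (simp add: \<psi>_def)
    qed
    have Efin: "E i = ennreal (enn2real (E i))" if "i < N" for i
    proof -
      have "E i \<le> (\<Sum>i<N. E i)" using that by (intro member_le_sum) auto
      also note EM
      finally have "E i < \<infinity>" by (simp add: le_less_trans)
      then show ?thesis by (cases "E i") auto
    qed
    have EM': "(\<Sum>i<N. enn2real (E i)) \<le> M"
    proof -
      have "ennreal (\<Sum>i<N. enn2real (E i)) = (\<Sum>i<N. E i)"
        using Efin by (subst sum_ennreal[symmetric]) (auto intro!: sum.cong)
      then show ?thesis using EM ennreal_le_iff[OF M(1)] by metis
    qed
    have term_le: "w i ^ (n - 1) * \<beta> (x i) * (f (exp (x i)) - f (exp (x (Suc i))) - 4 * \<epsilon>)
      \<le> 4 * C * (w i ^ n * p (x i) ^ n * (exp (x (Suc i)) - exp (x i) + 2 * \<epsilon>) + enn2real (E i))" if i: "i < N" for i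
    proof -
      let ?t = "exp (x i)" and ?t' = "exp (x (Suc i))"
      have tt: "?t < ?t'" "?t' \<le> 2 * ?t" "\<epsilon> \<le> ?t / 2"
      proof -
        show "?t < ?t'" using x(1)[OF i] by simp
        have "?t' \<le> exp (ln 2 + x i)" using x(2)[OF i] by simp
        also have "\<dots> = 2 * ?t" by (simp add: exp_add)
        finally show "?t' \<le> 2 * ?t" .
        show "\<epsilon> \<le> ?t / 2" using \<epsilon>(2) xmono[of 0 i] i by (simp add: order_trans)
      qed
      have R0: "0 \<le> 4 * C * (w i ^ n * p (x i) ^ n * (?t' - ?t + 2 * \<epsilon>) + enn2real (E i))"
        using C(1) w p[of "x i"] tt \<epsilon> by (intro mult_nonneg_nonneg add_nonneg_nonneg) auto
      show ?thesis
      proof (cases "a i < b i \<and> w i > 0")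
        case False
        have "w i ^ (n - 1) * \<beta> (x i) * (f ?t - f ?t' - 4 * \<epsilon>) \<le> 0"
        proof (cases "w i = 0")
          case True
          then show ?thesis using n by (simp add: zero_power)
        next
          case wi: False
          then have "f ?t - f ?t' - 4 * \<epsilon> \<le> 0" using False w[of i] by (auto simp: a_def b_def)
          then show ?thesis using w[of i] p[of "x i"] by (intro mult_nonneg_nonpos) (auto simp: \<beta>)
        qed
        with R0 show ?thesis by linarith
      next
        case True
        then have ab: "a i < b i" and wi: "w i > 0" by auto
        have f0: "f ?t' \<ge> 0" using f_nonneg[of ?t'] by (simp add: f_def)
        then have a0: "a i > 0" using \<epsilon> by (simp add: a_def)
        let ?G = "{x \<in> ball 0 1. \<bar>\<psi> x\<bar> \<ge> b i}" and ?S = "{x \<in> ball 0 1. \<bar>\<psi> x\<bar> > a i}"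
        let ?A = "{x \<in> ball 0 1. a i < \<bar>\<psi> x\<bar> \<and> \<bar>\<psi> x\<bar> < b i}"
        have Gs: "?G \<in> sets hyp_vol" by (rule meas) measurable
        have Ss: "?S \<in> sets hyp_vol" by (rule meas) measurable
        have Us: "{x \<in> ball 0 1. \<bar>u x\<bar> > s} \<in> sets hyp_vol" for s by (rule meas) measurable
        have G: "ennreal ?t \<le> emeasure hyp_vol ?G + ennreal \<epsilon>"
        proof -
          have "ennreal ?t \<le> distribution_function u (f ?t - \<epsilon>)"
            using distribution_gt_of_less[of ?t "f ?t - \<epsilon>"] ab a0 \<epsilon> unfolding f_def
            by (intro less_imp_le) (auto simp: b_def f_def)
          also have "\<dots> \<le> emeasure hyp_vol (?G \<union> ?D)"
            unfolding distribution_function_def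
          proof (rule emeasure_mono)
            show "{x \<in> ball 0 1. f ?t - \<epsilon> < \<bar>u x\<bar>} \<subseteq> ?G \<union> ?D"
              using \<epsilon> by (auto simp: b_def)
          qed (use Gs Ds in auto)
          also have "\<dots> \<le> emeasure hyp_vol ?G + emeasure hyp_vol ?D"
            using Gs Ds by (rule emeasure_subadditive)
          also have "\<dots> \<le> emeasure hyp_vol ?G + ennreal \<epsilon>" using D by (rule add_left_mono)
          finally show ?thesis .
        qed
        have S: "emeasure hyp_vol ?S \<le> ennreal (?t' + \<epsilon>)"
        proof -
          have "emeasure hyp_vol ?S \<le> emeasure hyp_vol ({x \<in> ball 0 1. f ?t' + \<epsilon> < \<bar>u x\<bar>} \<union> ?D)"
          proof (rule emeasure_mono)
            show "?S \<subseteq> {x \<in> ball 0 1. f ?t' + \<epsilon> < \<bar>u x\<bar>} \<union> ?D"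
              using \<epsilon> by (auto simp: a_def)
          qed (use Us Ds in auto)
          also have "\<dots> \<le> distribution_function u (f ?t' + \<epsilon>) + emeasure hyp_vol ?D"
            unfolding distribution_function_def using Us Ds by (intro emeasure_subadditive)
          also have "\<dots> \<le> ennreal ?t' + ennreal \<epsilon>"
            using D distribution_le_of_gt[of ?t' "f ?t' + \<epsilon>"] \<epsilon> unfolding f_def by (intro add_mono) auto
          finally show ?thesis using \<epsilon> by (simp add: ennreal_plus)
        qed
        have Sfin: "emeasure hyp_vol ?S < \<infinity>" using S by (simp add: le_less_trans)
        have GS: "?G \<subseteq> ?S" using ab by auto
        have Gfin: "emeasure hyp_vol ?G < \<infinity>" using emeasure_mono[OF GS Ss] Sfin by (rule le_less_trans)
        have AE: "?A = ?S - ?G" by auto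
        have As': "?A \<in> sets hyp_vol" unfolding AE using Ss Gs by (rule sets.Diff)
        have Afin: "emeasure hyp_vol ?A < \<infinity>"
          using emeasure_mono[of ?A ?S hyp_vol] Ss Sfin by (auto intro: le_less_trans)
        have mG: "measure hyp_vol ?G \<ge> ?t - \<epsilon>"
        proof -
          have "ennreal ?t \<le> ennreal (measure hyp_vol ?G + \<epsilon>)"
            using G Gfin \<epsilon> by (simp add: emeasure_eq_ennreal_measure ennreal_plus)
          then show ?thesis using \<epsilon> by (subst (asm) ennreal_le_iff) auto
        qed
        have mS: "measure hyp_vol ?S \<le> ?t' + \<epsilon>"
        proof -
          have "emeasure hyp_vol ?S = ennreal (measure hyp_vol ?S)" using Sfin by (intro emeasure_eq_ennreal_measure) auto
          with S have "ennreal (measure hyp_vol ?S) \<le> ennreal (?t' + \<epsilon>)" by (simp only:)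
          then show ?thesis using \<epsilon> by (subst (asm) ennreal_le_iff) auto
        qed
        have mA: "measure hyp_vol ?A \<le> ?t' - ?t + 2 * \<epsilon>"
        proof -
          have "measure hyp_vol ?A = measure hyp_vol ?S - measure hyp_vol ?G"
            unfolding AE using Ss Gs Sfin GS by (intro measure_Diff) auto
          then show ?thesis using mG mS by linarith
        qed
        \<comment> \<open>The Young parameter is the free weight \<open>w i\<close> times the
          isoperimetric factor \<open>p (x i)\<close>. After multiplication by
          \<open>d ^ (n - 1)\<close> both the increment and the volume term then carry
          \<open>p (x i) ^ n\<close>, which is what turns \<open>exp (x i)\<close> into
          \<beta>.\<close>
        define d where "d = w i * p (x i)"
        have d: "d > 0" using wi p by (simp add: d_def)
        \<comment> \<open>A volume bound for \<open>?S\<close>: steps of length at most ln 2 give t'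
          \<le> 2 t, and \<epsilon> \<le> t / 2.\<close>
        define T where "T = 4 * ?t"
        have T: "T > 0" by (simp add: T_def)
        have ST: "emeasure hyp_vol ?S \<le> ennreal T"
        proof (intro order_trans[OF S] ennreal_leI)
          show "?t' + \<epsilon> \<le> T" unfolding T_def using tt exp_gt_zero[of "x i"] by linarith
        qed
        have "ennreal ((b i - a i) * (1 + T powr (- 1 / n))) * emeasure hyp_vol ?G
          \<le> ennreal C * (ennreal d * emeasure hyp_vol ?A + ennreal (1 / d ^ (n - 1)) * E i)"
          unfolding E_def A_def by (rule C(2)[OF \<psi> a0 ab d T ST])
        then have "ennreal ((b i - a i) * (1 + T powr (- 1 / n))) * ennreal (measure hyp_vol ?G)
          \<le> ennreal C * (ennreal d * ennreal (measure hyp_vol ?A) + ennreal (1 / d ^ (n - 1)) * ennreal (enn2real (E i)))"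
          using Gfin Afin Efin[OF i] by (simp add: emeasure_eq_ennreal_measure)
        also have "\<dots> = ennreal (C * (d * measure hyp_vol ?A + 1 / d ^ (n - 1) * enn2real (E i)))"
        proof -
          have "0 \<le> d" "0 \<le> C" "0 \<le> 1 / d ^ (n - 1)" using d C(1) by auto
          then show ?thesis
            by (simp only: ennreal_mult ennreal_plus mult_nonneg_nonneg add_nonneg_nonneg measure_nonneg enn2real_nonneg)
        qed
        also have "ennreal ((b i - a i) * (1 + T powr (- 1 / n))) * ennreal (measure hyp_vol ?G)
          = ennreal ((b i - a i) * (1 + T powr (- 1 / n)) * measure hyp_vol ?G)"
          using ab by (intro ennreal_mult[symmetric]) auto
        finally have main: "(b i - a i) * (1 + T powr (- 1 / n)) * measure hyp_vol ?G
          \<le> C * (d * measure hyp_vol ?A + 1 / d ^ (n - 1) * enn2real (E i))"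
          using d C(1) by (subst (asm) ennreal_le_iff) (auto intro!: mult_nonneg_nonneg add_nonneg_nonneg)
        have "(b i - a i) * (p (x i) / 2) * (?t / 2) \<le> (b i - a i) * (1 + T powr (- 1 / n)) * measure hyp_vol ?G"
        proof (intro mult_mono)
          show "p (x i) / 2 \<le> 1 + T powr (- 1 / n)"
            unfolding T_def p_def by (rule powr_quadruple_ge) (use n in auto)
          show "?t / 2 \<le> measure hyp_vol ?G" using mG tt by linarith
        qed (use ab p[of "x i"] in \<open>auto intro!: mult_nonneg_nonneg\<close>)
        also have "\<dots> \<le> C * (d * (?t' - ?t + 2 * \<epsilon>) + 1 / d ^ (n - 1) * enn2real (E i))"
          using main C(1) mA d by (elim order_trans) (intro mult_left_mono add_mono, auto)
        \<comment> \<open>Clearing the coefficient of the energy is decisive: the energies then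
          enter with the same coefficient in every layer, independent of the weights, and can be
          summed.\<close>
        finally have "d ^ (n - 1) * ((b i - a i) * (p (x i) / 2) * (?t / 2))
          \<le> d ^ (n - 1) * (C * (d * (?t' - ?t + 2 * \<epsilon>) + 1 / d ^ (n - 1) * enn2real (E i)))"
          using d by (intro mult_left_mono) auto
        also have "\<dots> = C * (d ^ n * (?t' - ?t + 2 * \<epsilon>) + enn2real (E i))"
        proof -
          have "d ^ n = d ^ (n - 1) * d" using power_minus_mult[of n d] n by simp
          then show ?thesis using d by (simp add: field_simps)
        qed
        also have "d ^ n = w i ^ n * p (x i) ^ n" by (simp add: d_def power_mult_distrib)
        also have "d ^ (n - 1) * ((b i - a i) * (p (x i) / 2) * (?t / 2)) = w i ^ (n - 1) * \<beta> (x i) * (f ?t - f ?t' - 4 * \<epsilon>) / 4"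
        proof -
          have "p (x i) ^ n = p (x i) ^ (n - 1) * p (x i)" using power_minus_mult[of n "p (x i)"] n by simp
          then have bb: "\<beta> (x i) = ?t * (p (x i) ^ (n - 1) * p (x i))" by (simp add: \<beta>)
          have "b i - a i = f ?t - f ?t' - 4 * \<epsilon>" by (simp add: a_def b_def)
          then show ?thesis unfolding bb d_def power_mult_distrib by simp
        qed
        finally show ?thesis by simp
      qed
    qed
    have "(\<Sum>i<N. w i ^ (n - 1) * \<beta> (x i) * (f (exp (x i)) - f (exp (x (Suc i))) - 4 * \<epsilon>))
      \<le> (\<Sum>i<N. 4 * C * (w i ^ n * p (x i) ^ n * (exp (x (Suc i)) - exp (x i) + 2 * \<epsilon>) + enn2real (E i)))"
      by (intro sum_mono term_le) auto
    also have "\<dots> = 4 * C * ((\<Sum>i<N. w i ^ n * p (x i) ^ n * (exp (x (Suc i)) - exp (x i) + 2 * \<epsilon>)) + (\<Sum>i<N. enn2real (E i)))"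
      by (simp only: sum_distrib_left[symmetric] sum.distrib)
    also have "\<dots> \<le> 4 * C * ((\<Sum>i<N. w i ^ n * p (x i) ^ n * (exp (x (Suc i)) - exp (x i) + 2 * \<epsilon>)) + M)"
      using EM' C(1) by (intro mult_left_mono add_left_mono) auto
    finally show ?thesis .
  qed
  \<comment> \<open>A single constant that dominates \<open>4 * C * (2 * S + M)\<close> by
    \<open>B * (S + 1)\<close> for every S \<ge> 0.\<close>
  define B where "B = 8 * C + 4 * C * M"
  show ?thesis
  proof (rule that[of B])
    show "B > 0" using C(1) M(1) by (auto simp: B_def intro!: add_pos_nonneg)
    fix N and x w :: "nat \<Rightarrow> real"
    assume x: "\<And>i. i < N \<Longrightarrow> x i < x (Suc i)" "\<And>i. i < N \<Longrightarrow> x (Suc i) - x i \<le> ln 2" and w: "\<And>i. w i \<ge> 0"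
    let ?L = "\<lambda>\<epsilon>. \<Sum>i<N. w i ^ (n - 1) * \<beta> (x i) * (f (exp (x i)) - f (exp (x (Suc i))) - 4 * \<epsilon>)"
    let ?R = "\<lambda>\<epsilon>. 4 * C * ((\<Sum>i<N. w i ^ n * p (x i) ^ n * (exp (x (Suc i)) - exp (x i) + 2 * \<epsilon>)) + M)"
    have "\<forall>\<^sub>F \<epsilon> in at_right 0. ?L \<epsilon> \<le> ?R \<epsilon>"
      using eventually_at_right_real[of 0 "exp (x 0) / 2"] key[of N x w, OF x w] by (auto elim!: eventually_mono)
    moreover have "continuous (at_right 0) ?L" "continuous (at_right 0) ?R"
      by (intro continuous_intros)+
    then have "(?L \<longlongrightarrow> ?L 0) (at_right 0)" "(?R \<longlongrightarrow> ?R 0) (at_right 0)"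
      by (simp_all only: continuous_within)
    ultimately have "?L 0 \<le> ?R 0"
      by (intro tendsto_le[OF trivial_limit_at_right_real])
    also have "?R 0 \<le> B * ((\<Sum>i<N. w i ^ n * \<beta> (x i) * (x (Suc i) - x i)) + 1)"
    proof -
      let ?S = "\<Sum>i<N. w i ^ n * \<beta> (x i) * (x (Suc i) - x i)"
      have "(\<Sum>i<N. w i ^ n * p (x i) ^ n * (exp (x (Suc i)) - exp (x i) + 2 * 0)) \<le> (\<Sum>i<N. w i ^ n * p (x i) ^ n * (2 * exp (x i) * (x (Suc i) - x i)))"
        using x w p by (intro sum_mono mult_left_mono) (simp_all add: exp_diff_le_double less_imp_le)
      also have "\<dots> = 2 * ?S" by (simp add: \<beta> sum_distrib_left ac_simps)
      finally have "?R 0 \<le> 4 * C * (2 * ?S + M)" using C(1) by (intro mult_left_mono add_right_mono) auto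
      moreover have "?S \<ge> 0" using w p x by (intro sum_nonneg mult_nonneg_nonneg) (auto simp: \<beta> less_imp_le)
      moreover have "B * (?S + 1) = 4 * C * (2 * ?S + M) + 4 * C * M * ?S + 8 * C" by (simp add: B_def algebra_simps)
      moreover have "4 * C * M * ?S \<ge> 0" using C(1) M(1) \<open>?S \<ge> 0\<close> by auto
      ultimately show ?thesis using C(1) by linarith
    qed
    finally show "(\<Sum>i<N. w i ^ (CARD('n) - 1) * \<beta> (x i) * (f (exp (x i)) - f (exp (x (Suc i)))))
        \<le> B * ((\<Sum>i<N. w i ^ CARD('n) * \<beta> (x i) * (x (Suc i) - x i)) + 1)"
      by (simp add: n_def)
  qed
qed


section \<open>Absolute continuity of the rearrangement\<close>

text \<open>Clamping to [0, L] and multiplying by a tent function keep bounds and supports uniform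
  along an almost everywhere convergent sequence of continuous functions. This allows dominated
  convergence when an identity or inequality is extended from continuous to bounded Borel
  functions.\<close>

lemma continuous_approx_borel:
  fixes f :: "real \<Rightarrow> real"
  assumes [measurable]: "f \<in> borel_measurable borel"
    and b: "\<And>x. 0 \<le> f x" "\<And>x. f x \<le> L" and supp: "\<And>x. x \<notin> {a..b} \<Longrightarrow> f x = 0" and e: "e > 0"
  obtains c where "\<And>j::nat. continuous_on UNIV (c j)" "\<And>j x. 0 \<le> c j x" "\<And>j x. c j x \<le> L"
    "\<And>j x. x \<notin> {a - e..b + e} \<Longrightarrow> c j x = 0" "AE x in lborel. (\<lambda>j. c j x) \<longlonglongrightarrow> f x"
proof -
  have L: "L \<ge> 0" using b order_trans by blast
  have "f measurable_on UNIV"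
    by (rule lebesgue_measurable_imp_measurable_on_nnreal_UNIV) (use b in \<open>simp_all add: measurable_completion\<close>)
  then obtain N g where N: "negligible N" and gc: "\<And>j. continuous_on UNIV (g j)"
    and gl: "\<And>x. x \<notin> N \<Longrightarrow> (\<lambda>j. g j x) \<longlonglongrightarrow> f x"
    unfolding measurable_on_def by auto
  define tent where "tent x = max 0 (min 1 (min (1 + (x - a) / e) (1 + (b - x) / e)))" for x
  have tc: "continuous_on UNIV tent" unfolding tent_def by (intro continuous_intros) (use e in auto)
  have t01: "0 \<le> tent x" "tent x \<le> 1" for x by (auto simp: tent_def)
  have t1: "tent x = 1" if "x \<in> {a..b}" for x using that e by (auto simp: tent_def min_def max_def)
  have t0: "tent x = 0" if "x \<notin> {a - e..b + e}" for x
  proof -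
    have "1 + (x - a) / e \<le> 0 \<or> 1 + (b - x) / e \<le> 0" using that e by (auto simp: field_simps)
    then show ?thesis by (auto simp: tent_def)
  qed
  define c where "c j x = max 0 (min L (g j x)) * tent x" for j x
  show ?thesis
  proof (rule that[of c])
    show "continuous_on UNIV (c j)" for j
      unfolding c_def by (intro continuous_intros gc tc)
    show "0 \<le> c j x" for j x unfolding c_def using t01 by simp
    show "c j x \<le> L" for j x
    proof -
      have "c j x \<le> max 0 (min L (g j x)) * 1" unfolding c_def using t01 by (intro mult_left_mono) auto
      then show ?thesis using L by auto
    qed
    show "x \<notin> {a - e..b + e} \<Longrightarrow> c j x = 0" for j x unfolding c_def using t0 by simp
    have "(\<lambda>j. c j x) \<longlonglongrightarrow> f x" if "x \<notin> N" for x
    proof -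
      have "(\<lambda>j. c j x) \<longlonglongrightarrow> max 0 (min L (f x)) * tent x"
        unfolding c_def by (intro tendsto_intros gl that)
      moreover have "max 0 (min L (f x)) * tent x = f x"
        using b[of x] t1[of x] supp[of x] by (cases "x \<in> {a..b}") auto
      ultimately show ?thesis by simp
    qed
    moreover have "AE x in lebesgue. x \<notin> N"
      using N by (auto simp: negligible_iff_null_sets intro: AE_not_in)
    ultimately have "AE x in lebesgue. (\<lambda>j. c j x) \<longlonglongrightarrow> f x" by auto
    then show "AE x in lborel. (\<lambda>j. c j x) \<longlonglongrightarrow> f x" by (simp add: AE_completion_iff)
  qed
qed

text \<open>In the limit of fine partitions, \<open>step\<close> bounds \<open>\<integral>c\<^sup>n\<^sup>-\<^sup>1 \<beta> d\<nu>\<close> by \<open>B (\<integral>c\<^sup>n \<beta> dx + 1)\<close> for \<open>\<nu> = - dh\<close>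
  and continuous \<open>c \<ge> 0\<close>. Large \<open>c\<close> near a null set show that \<open>\<nu>\<close> is absolutely continuous, and
  for \<open>c\<close> close to its density \<open>\<gamma>\<close> the bound makes \<open>\<integral>\<gamma>\<^sup>n \<beta> dx\<close> finite.\<close>

locale step_controlled =
  fixes h \<beta> :: "real \<Rightarrow> real" and n :: nat and B :: real
  assumes n: "n \<ge> 2" and B: "B > 0" and \<beta>c: "continuous_on UNIV \<beta>" and \<beta>1: "\<And>x. \<beta> x \<ge> 1"
    and h_antimono: "\<And>x y. x \<le> y \<Longrightarrow> h y \<le> h x"
    and h_right: "\<And>x. continuous (at_right x) h" and h_lim: "(h \<longlongrightarrow> 0) at_top"
    and step: "\<And>N x w. \<lbrakk>\<And>i. i < N \<Longrightarrow> x i < x (Suc i); \<And>i. i < N \<Longrightarrow> x (Suc i) - x i \<le> ln 2; \<And>i. w i \<ge> 0\<rbrakk> \<Longrightarrow>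
      (\<Sum>i<N. w i ^ (n - 1) * \<beta> (x i) * (h (x i) - h (x (Suc i))))
        \<le> B * ((\<Sum>i<N. w i ^ n * \<beta> (x i) * (x (Suc i) - x i)) + 1)"
begin

definition \<nu> where "\<nu> = interval_measure (\<lambda>x. - h x)"

lemma sets_\<nu> [simp, measurable_cong]: "sets \<nu> = sets borel"
  by (simp add: \<nu>_def)

lemma emeasure_\<nu>: "a \<le> b \<Longrightarrow> emeasure \<nu> {a<..b} = ennreal (h a - h b)"
  unfolding \<nu>_def
  by (subst emeasure_interval_measure_Ioc) (auto intro!: h_antimono continuous_minus h_right)

lemma \<beta>_measurable [measurable]: "\<beta> \<in> borel_measurable borel"
  using \<beta>c by (rule borel_measurable_continuous_onI)

lemma \<beta>_pos: "\<beta> x > 0" using \<beta>1[of x] by linarith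

section \<open>Riemann sums\<close>

definition grid :: "nat \<Rightarrow> nat \<Rightarrow> nat \<Rightarrow> real" where
  "grid R m i = - real R + real i / real m"

text \<open>The grid intervals are open on the left, matching the intervals whose \<nu>-measure is
  known; hence the ceiling minus one rather than the floor.\<close>

definition cell :: "nat \<Rightarrow> nat \<Rightarrow> real \<Rightarrow> nat" where
  "cell R m x = nat (\<lceil>(x + real R) * real m\<rceil> - 1)"

lemma grid_cell:
  assumes m: "m > 0" and x: "x \<in> {- real R<..real R}"
  shows "x \<in> {grid R m i<..grid R m (Suc i)} \<longleftrightarrow> i = cell R m x" "cell R m x < 2 * R * m"
    "\<bar>grid R m (cell R m x) - x\<bar> \<le> 1 / real m"
proof -
  let ?y = "(x + real R) * real m"
  have y: "?y > 0" "?y \<le> 2 * real R * real m"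
  proof -
    show "?y > 0" using m x by (intro mult_pos_pos) auto
    have "x + real R \<le> 2 * real R" using x by auto
    then show "?y \<le> 2 * real R * real m" by (intro mult_right_mono) auto
  qed
  have c: "\<lceil>?y\<rceil> \<ge> 1" using y by linarith
  have *: "x \<in> {grid R m i<..grid R m (Suc i)} \<longleftrightarrow> real i < ?y \<and> ?y \<le> real i + 1" for i
    using m by (auto simp: grid_def field_simps)
  show 1: "x \<in> {grid R m i<..grid R m (Suc i)} \<longleftrightarrow> i = cell R m x" for i
  proof -
    have "real i < ?y \<and> ?y \<le> real i + 1 \<longleftrightarrow> \<lceil>?y\<rceil> = int i + 1"
      by (simp add: ceiling_eq_iff)
    also have "\<dots> \<longleftrightarrow> i = cell R m x" using c by (auto simp: cell_def)
    finally show ?thesis unfolding * .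
  qed
  have "\<lceil>?y\<rceil> \<le> int (2 * R * m)" using y(2) by (intro ceiling_le) simp
  then show "cell R m x < 2 * R * m" using c unfolding cell_def by linarith
  have "x \<in> {grid R m (cell R m x)<..grid R m (Suc (cell R m x))}" using 1 by blast
  then show "\<bar>grid R m (cell R m x) - x\<bar> \<le> 1 / real m"
    by (auto simp: grid_def add_divide_distrib)
qed

text \<open>Sampled at left endpoints, because \<open>step\<close> evaluates the weights and \<beta>
  there.\<close>

definition riemann :: "nat \<Rightarrow> nat \<Rightarrow> (real \<Rightarrow> real) \<Rightarrow> real \<Rightarrow> ennreal" where
  "riemann R m g x = (\<Sum>i<2 * R * m. indicator {grid R m i<..grid R m (Suc i)} x * ennreal (g (grid R m i)))"

lemma riemann_eq:
  assumes m: "m > 0"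
  shows "riemann R m g x = (if x \<in> {- real R<..real R} then ennreal (g (grid R m (cell R m x))) else 0)"
proof (cases "x \<in> {- real R<..real R}")
  case True
  have "riemann R m g x = (\<Sum>i<2 * R * m. if i = cell R m x then ennreal (g (grid R m i)) else 0)"
    unfolding riemann_def using grid_cell(1)[OF m True] by (intro sum.cong refl) (simp add: indicator_def)
  then show ?thesis using True grid_cell(2)[OF m True] by simp
next
  case False
  have "x \<notin> {grid R m i<..grid R m (Suc i)}" if "i < 2 * R * m" for i
  proof -
    have "grid R m i \<ge> - real R" by (simp add: grid_def)
    moreover have "grid R m (Suc i) \<le> real R"
    proof -
      have "Suc i \<le> 2 * R * m" using that by simp
      then have "real (Suc i) \<le> 2 * real R * real m" by (metis of_nat_le_iff of_nat_mult of_nat_numeral)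
      then have "real (Suc i) / real m \<le> 2 * real R" using m by (simp add: field_simps)
      then show ?thesis by (simp add: grid_def)
    qed
    ultimately show ?thesis using False by auto
  qed
  then show ?thesis using False by (auto simp: riemann_def intro!: sum.neutral)
qed

text \<open>Stated for a general measure so that it applies to \<nu> on one side of
  \<open>step\<close> and to Lebesgue measure on the other. The shift by 2 keeps the mesh at most
  1/2, hence below ln 2.\<close>

lemma riemann_tendsto:
  assumes g: "continuous_on UNIV g" and g0: "\<And>x. g x \<ge> 0" and supp: "\<And>x. x \<notin> {- real R<..real R} \<Longrightarrow> g x = 0"
    and s: "sets M = sets borel" and fin: "emeasure M {- real R<..real R} < \<infinity>"
  shows "(\<lambda>m. \<integral>\<^sup>+x. riemann R (m + 2) g x \<partial>M) \<longlonglongrightarrow> (\<integral>\<^sup>+x. ennreal (g x) \<partial>M)"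
proof -
  have "compact (g ` {- real R..real R})" by (intro compact_continuous_image continuous_on_subset[OF g]) auto
  then obtain L where L: "\<And>x. x \<in> {- real R..real R} \<Longrightarrow> g x \<le> L"
    using compact_imp_bounded bounded_iff by (metis (no_types, lifting) abs_le_D1 image_eqI real_norm_def)
  have sp: "{- real R<..real R} \<in> sets M" using s by simp
  have gm [measurable]: "g \<in> borel_measurable borel" using g by (rule borel_measurable_continuous_onI)
  show ?thesis
  proof (rule nn_integral_dominated_convergence[where w = "\<lambda>x. ennreal (max L 0) * indicator {- real R<..real R} x"])
    show "riemann R (m + 2) g \<in> borel_measurable M" for m
      unfolding measurable_cong_sets[OF s refl] riemann_def by measurable
    show "(\<lambda>x. ennreal (g x)) \<in> borel_measurable M" "(\<lambda>x. ennreal (max L 0) * indicator {- real R<..real R} x) \<in> borel_measurable M"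
      unfolding measurable_cong_sets[OF s refl] by measurable
    have "riemann R (m + 2) g x \<le> ennreal (max L 0) * indicator {- real R<..real R} x" for m x
    proof (cases "x \<in> {- real R<..real R}")
      case True
      have "grid R (m + 2) (cell R (m + 2) x) \<in> {- real R..real R}"
      proof -
        have "x \<in> {grid R (m + 2) (cell R (m + 2) x)<..grid R (m + 2) (Suc (cell R (m + 2) x))}"
          using grid_cell(1)[OF _ True, of "m + 2"] by auto
        then show ?thesis using True by (auto simp: grid_def)
      qed
      then show ?thesis using True L by (auto simp: riemann_eq intro!: ennreal_leI max.coboundedI1)
    qed (auto simp: riemann_eq)
    then show "\<And>m. AE x in M. riemann R (m + 2) g x \<le> ennreal (max L 0) * indicator {- real R<..real R} x" by simp
    show "(\<integral>\<^sup>+x. ennreal (max L 0) * indicator {- real R<..real R} x \<partial>M) < \<infinity>"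
      using fin sp by (simp add: nn_integral_cmult_indicator ennreal_mult_less_top)
    have "(\<lambda>m. riemann R (m + 2) g x) \<longlonglongrightarrow> ennreal (g x)" for x
    proof (cases "x \<in> {- real R<..real R}")
      case True
      have "(\<lambda>m. grid R (m + 2) (cell R (m + 2) x)) \<longlonglongrightarrow> x"
      proof (rule Lim_transform2[OF tendsto_const], rule Lim_null_comparison)
        show "\<forall>\<^sub>F m in sequentially. norm (x - grid R (m + 2) (cell R (m + 2) x)) \<le> 1 / real (m + 2)"
        proof (intro always_eventually allI)
          fix m
          show "norm (x - grid R (m + 2) (cell R (m + 2) x)) \<le> 1 / real (m + 2)"
            using grid_cell(3)[OF _ True, of "m + 2"] by (simp only: real_norm_def abs_minus_commute[of x])
        qed
        show "(\<lambda>m. 1 / real (m + 2)) \<longlonglongrightarrow> 0"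
          by (rule LIMSEQ_ignore_initial_segment[OF lim_1_over_n])
      qed
      then have "(\<lambda>m. g (grid R (m + 2) (cell R (m + 2) x))) \<longlonglongrightarrow> g x"
        using g by (intro continuous_on_tendsto_compose[of UNIV g]) auto
      then show ?thesis using True by (simp add: riemann_eq)
    next
      case False
      then have "riemann R (m + 2) g x = 0" for m by (simp only: riemann_eq if_False)
      then show ?thesis using supp[OF False] by simp
    qed
    then show "AE x in M. (\<lambda>m. riemann R (m + 2) g x) \<longlonglongrightarrow> ennreal (g x)" by simp
  qed
qed

lemma nn_integral_riemann:
  assumes "sets M = sets borel"
  shows "(\<integral>\<^sup>+x. riemann R m g x \<partial>M) = (\<Sum>i<2 * R * m. emeasure M {grid R m i<..grid R m (Suc i)} * ennreal (g (grid R m i)))"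
  unfolding riemann_def using assms
  by (subst nn_integral_sum) (auto simp: nn_integral_multc cong: measurable_cong_sets)

lemma continuous_inequality:
  assumes c: "continuous_on UNIV c" "\<And>x. c x \<ge> 0" and supp: "\<And>x. x \<notin> {- real R<..real R} \<Longrightarrow> c x = 0"
  shows "(\<integral>\<^sup>+x. ennreal (c x ^ (n - 1) * \<beta> x) \<partial>\<nu>) \<le> ennreal B * ((\<integral>\<^sup>+x. ennreal (c x ^ n * \<beta> x) \<partial>lborel) + 1)"
proof -
  let ?g = "\<lambda>k x. c x ^ k * \<beta> x"
  have g: "continuous_on UNIV (?g k)" "\<And>x. ?g k x \<ge> 0" for k
    using c \<beta>_pos by (auto intro!: continuous_intros \<beta>c simp: less_imp_le)
  have gs: "k > 0 \<Longrightarrow> x \<notin> {- real R<..real R} \<Longrightarrow> ?g k x = 0" for k x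
    using supp[of x] by (simp add: zero_power)
  have le: "(\<integral>\<^sup>+x. riemann R (m + 2) (?g (n - 1)) x \<partial>\<nu>) \<le> ennreal B * ((\<integral>\<^sup>+x. riemann R (m + 2) (?g n) x \<partial>lborel) + 1)" for m
  proof -
    let ?x = "grid R (m + 2)" and ?N = "2 * R * (m + 2)"
    have x: "?x i < ?x (Suc i)" "?x (Suc i) - ?x i = 1 / real (m + 2)" for i
      by (simp_all add: grid_def divide_strict_right_mono diff_divide_distrib[symmetric])
    have "1 / real (m + 2) \<le> 1 / 2" by (simp add: field_simps)
    also have "1 / 2 \<le> ln (2::real)" by (subst ln_ge_iff) (simp_all only: exp_half_le2 zero_less_numeral)
    finally have x2: "?x (Suc i) - ?x i \<le> ln 2" for i by (simp only: x(2))
    have "(\<integral>\<^sup>+x. riemann R (m + 2) (?g (n - 1)) x \<partial>\<nu>) = (\<Sum>i<?N. ennreal (h (?x i) - h (?x (Suc i))) * ennreal (?g (n - 1) (?x i)))"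
      by (subst nn_integral_riemann) (simp_all only: sets_\<nu> emeasure_\<nu>[OF less_imp_le[OF x(1)]])
    also have "\<dots> = ennreal (\<Sum>i<?N. c (?x i) ^ (n - 1) * \<beta> (?x i) * (h (?x i) - h (?x (Suc i))))"
      using g h_antimono[OF less_imp_le[OF x(1)]]
      by (subst sum_ennreal[symmetric]) (auto intro!: sum.cong mult_nonneg_nonneg simp: ennreal_mult mult.commute)
    also have "\<dots> \<le> ennreal (B * ((\<Sum>i<?N. c (?x i) ^ n * \<beta> (?x i) * (?x (Suc i) - ?x i)) + 1))"
      by (intro ennreal_leI step x(1) x2 c(2))
    also have "\<dots> = ennreal B * (ennreal (\<Sum>i<?N. c (?x i) ^ n * \<beta> (?x i) * (?x (Suc i) - ?x i)) + 1)"
    proof -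
      have "(\<Sum>i<?N. c (?x i) ^ n * \<beta> (?x i) * (?x (Suc i) - ?x i)) \<ge> 0"
        using g(2) x(1) by (intro sum_nonneg mult_nonneg_nonneg[OF g(2)]) (simp add: less_imp_le)
      then show ?thesis using B by (simp add: ennreal_mult ennreal_plus)
    qed
    also have "ennreal (\<Sum>i<?N. c (?x i) ^ n * \<beta> (?x i) * (?x (Suc i) - ?x i)) = (\<integral>\<^sup>+x. riemann R (m + 2) (?g n) x \<partial>lborel)"
      using g x(1)
      by (subst sum_ennreal[symmetric], intro mult_nonneg_nonneg[OF g(2)], simp add: less_imp_le, subst nn_integral_riemann)
         (auto intro!: sum.cong simp: ennreal_mult less_imp_le mult.commute)
    finally show ?thesis .
  qed
  have 1: "(\<lambda>m. \<integral>\<^sup>+x. riemann R (m + 2) (?g (n - 1)) x \<partial>\<nu>) \<longlonglongrightarrow> (\<integral>\<^sup>+x. ennreal (?g (n - 1) x) \<partial>\<nu>)"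
    using n by (intro riemann_tendsto g gs) (auto simp: emeasure_\<nu>)
  have "(\<lambda>m. \<integral>\<^sup>+x. riemann R (m + 2) (?g n) x \<partial>lborel) \<longlonglongrightarrow> (\<integral>\<^sup>+x. ennreal (?g n x) \<partial>lborel)"
    using n by (intro riemann_tendsto g gs) auto
  then have 2: "(\<lambda>m. ennreal B * ((\<integral>\<^sup>+x. riemann R (m + 2) (?g n) x \<partial>lborel) + 1)) \<longlonglongrightarrow> ennreal B * ((\<integral>\<^sup>+x. ennreal (?g n x) \<partial>lborel) + 1)"
    by (intro ennreal_tendsto_cmult tendsto_add tendsto_const) auto
  show ?thesis by (rule LIMSEQ_le[OF 1 2]) (use le in blast)
qed

lemma \<nu>_finite: "emeasure \<nu> {a<..b} < \<infinity>"
  by (cases "a \<le> b") (auto simp: emeasure_\<nu>)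

lemma \<beta>_bound: obtains b where "b > 0" "\<And>x. x \<in> {- real R..real R} \<Longrightarrow> \<beta> x \<le> b"
proof -
  have "compact (\<beta> ` {- real R..real R})" by (intro compact_continuous_image continuous_on_subset[OF \<beta>c]) auto
  then obtain L where L: "\<And>x. x \<in> {- real R..real R} \<Longrightarrow> \<beta> x \<le> L"
    using compact_imp_bounded bounded_iff by (metis (no_types, lifting) abs_le_D1 image_eqI real_norm_def)
  show ?thesis by (rule that[of "max 1 L"]) (use L in force)+
qed

text \<open>The test function is L on V, reached from below through the distance to the complement,
  with Fatou's lemma on the left. The unequal powers of L are the point: if V has Lebesgue measure
  at most 1 / (L^n b), the right side stays bounded while the factor on the left grows with
  L.\<close>

lemma open_set_bound:
  assumes V: "open V" "V \<subseteq> {- real R<..<real R}" and L: "L > 0"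
    and b: "b > 0" "\<And>x. x \<in> {- real R..real R} \<Longrightarrow> \<beta> x \<le> b"
  shows "ennreal (L ^ (n - 1)) * emeasure \<nu> V \<le> ennreal B * (ennreal (L ^ n * b) * emeasure lborel V + 1)"
proof -
  have [measurable]: "V \<in> sets borel" using V by simp
  \<comment> \<open>By convention \<open>infdist\<close> to the empty set is 0, which would make
    every \<open>c j\<close> vanish.\<close>
  have ne: "- V \<noteq> {}" using V by (metis Compl_eq_Diff_UNIV Diff_eq_empty_iff UNIV_I greaterThanLessThan_iff less_irrefl subsetD)
  define c where "c j x = L * min 1 (real j * infdist x (- V))" for j x
  have cc: "continuous_on UNIV (c j)" for j unfolding c_def by (intro continuous_intros)
  have c0: "0 \<le> c j x" "c j x \<le> L" for j x using L by (auto simp: c_def infdist_nonneg)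
  have out: "x \<notin> V \<Longrightarrow> c j x = 0" for j x by (simp add: c_def)
  have lim: "(\<lambda>j. c j x) \<longlonglongrightarrow> L * indicator V x" for x
  proof (cases "x \<in> V")
    case True
    then have d: "infdist x (- V) > 0"
      using V ne in_closed_iff_infdist_zero[of "- V" x] by (metis ComplD closed_Compl infdist_nonneg order_le_less)
    obtain j0 where j0: "real j0 > 1 / infdist x (- V)" using reals_Archimedean2 by blast
    have "\<forall>\<^sub>F j in sequentially. c j x = L"
    proof (rule eventually_sequentiallyI[of j0])
      fix j assume "j0 \<le> j"
      then have "1 / infdist x (- V) < real j" using j0 by linarith
      then have "1 \<le> real j * infdist x (- V)" using d by (simp add: field_simps)
      then show "c j x = L" by (simp add: c_def)
    qed
    then show ?thesis using True by (simp add: tendsto_eventually)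
  qed (simp add: out)
  have bound: "(\<integral>\<^sup>+x. ennreal (c j x ^ (n - 1) * \<beta> x) \<partial>\<nu>) \<le> ennreal B * (ennreal (L ^ n * b) * emeasure lborel V + 1)" for j
  proof -
    have "(\<integral>\<^sup>+x. ennreal (c j x ^ (n - 1) * \<beta> x) \<partial>\<nu>) \<le> ennreal B * ((\<integral>\<^sup>+x. ennreal (c j x ^ n * \<beta> x) \<partial>lborel) + 1)"
      using V by (intro continuous_inequality[of _ R] cc c0) (auto intro!: out)
    also have "\<dots> \<le> ennreal B * ((\<integral>\<^sup>+x. ennreal (L ^ n * b) * indicator V x \<partial>lborel) + 1)"
    proof (intro mult_left_mono add_right_mono nn_integral_mono)
      fix x
      show "ennreal (c j x ^ n * \<beta> x) \<le> ennreal (L ^ n * b) * indicator V x"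
      proof (cases "x \<in> V")
        case True
        then have "x \<in> {- real R..real R}" using V(2) by force
        then have "c j x ^ n * \<beta> x \<le> L ^ n * b"
          using c0[where x = x and j = j] b L \<beta>_pos[of x] by (intro mult_mono power_mono) (auto simp: less_imp_le)
        then show ?thesis using True by (simp add: ennreal_leI)
      qed (use out n in \<open>simp add: zero_power\<close>)
    qed auto
    also have "\<dots> = ennreal B * (ennreal (L ^ n * b) * emeasure lborel V + 1)"
      by (simp add: nn_integral_cmult_indicator)
    finally show ?thesis .
  qed
  have "ennreal (L ^ (n - 1)) * emeasure \<nu> V = (\<integral>\<^sup>+x. ennreal (L ^ (n - 1)) * indicator V x \<partial>\<nu>)"
    by (simp add: nn_integral_cmult_indicator)
  also have "\<dots> \<le> (\<integral>\<^sup>+x. liminf (\<lambda>j. ennreal (c j x ^ (n - 1) * \<beta> x)) \<partial>\<nu>)"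
  proof (rule nn_integral_mono)
    fix x
    have "(\<lambda>j. ennreal (c j x ^ (n - 1) * \<beta> x)) \<longlonglongrightarrow> ennreal ((L * indicator V x) ^ (n - 1) * \<beta> x)"
      by (intro tendsto_intros lim tendsto_ennrealI)
    then have "liminf (\<lambda>j. ennreal (c j x ^ (n - 1) * \<beta> x)) = ennreal ((L * indicator V x) ^ (n - 1) * \<beta> x)"
      by (intro lim_imp_Liminf) auto
    moreover have "ennreal (L ^ (n - 1)) * indicator V x \<le> ennreal ((L * indicator V x) ^ (n - 1) * \<beta> x)"
    proof (cases "x \<in> V")
      case True
      have "L ^ (n - 1) * 1 \<le> L ^ (n - 1) * \<beta> x" using L \<beta>1[of x] by (intro mult_left_mono) auto
      then show ?thesis using True by (simp add: ennreal_leI)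
    qed simp
    ultimately show "ennreal (L ^ (n - 1)) * indicator V x \<le> liminf (\<lambda>j. ennreal (c j x ^ (n - 1) * \<beta> x))" by simp
  qed
  also have "\<dots> \<le> liminf (\<lambda>j. \<integral>\<^sup>+x. ennreal (c j x ^ (n - 1) * \<beta> x) \<partial>\<nu>)"
  proof (rule nn_integral_liminf)
    fix j
    have [measurable]: "c j \<in> borel_measurable borel" using cc by (rule borel_measurable_continuous_onI)
    show "(\<lambda>x. ennreal (c j x ^ (n - 1) * \<beta> x)) \<in> borel_measurable \<nu>" by measurable
  qed
  also have "\<dots> \<le> liminf (\<lambda>j::nat. ennreal B * (ennreal (L ^ n * b) * emeasure lborel V + 1))"
    by (rule Liminf_mono) (use bound in auto)
  finally show ?thesis by (simp add: Liminf_const)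
qed

text \<open>A bounded null set lies in open sets of arbitrarily small Lebesgue measure. Choosing
  that measure as 1 / (L^n b) in \<open>open_set_bound\<close> bounds L times the \<nu>-measure of
  the null set by 2 B for every L \<ge> 1.\<close>

lemma \<nu>_absolutely_continuous: "absolutely_continuous lborel \<nu>"
  unfolding absolutely_continuous_def
proof
  fix E assume E: "E \<in> null_sets (lborel :: real measure)"
  then have Eb [measurable]: "E \<in> sets borel" by auto
  have bounded: "emeasure \<nu> (E \<inter> {- real R<..<real R}) = 0" for R
  proof -
    let ?m = "emeasure \<nu> (E \<inter> {- real R<..<real R})"
    obtain b where b: "b > 0" "\<And>x. x \<in> {- real R..real R} \<Longrightarrow> \<beta> x \<le> b" using \<beta>_bound by blast
    have le: "ennreal L * ?m \<le> ennreal (2 * B)" if L: "L \<ge> 1" for L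
    proof -
      have pos: "1 / (L ^ n * b) > 0" using L b by simp
      have "E \<in> sets lebesgue" by simp
      then obtain T where T: "open T" "E \<subseteq> T" "emeasure lebesgue (T - E) < ennreal (1 / (L ^ n * b))"
        using sets_lebesgue_outer_open[OF _ pos] by metis
      define V where "V = T \<inter> {- real R<..<real R}"
      have V: "open V" "V \<subseteq> {- real R<..<real R}" using T by (auto simp: V_def)
      have "emeasure lborel V \<le> emeasure lborel ((T - E) \<union> E)"
        using T by (intro emeasure_mono) (auto simp: V_def)
      also have "\<dots> \<le> emeasure lborel (T - E) + emeasure lborel E"
        using T by (intro emeasure_subadditive) auto
      also have "\<dots> = emeasure lborel (T - E)" using E by (simp add: null_sets_def)
      also have "\<dots> \<le> ennreal (1 / (L ^ n * b))" using T by simp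
      finally have Vm: "emeasure lborel V \<le> ennreal (1 / (L ^ n * b))" .
      have "ennreal L * ?m \<le> ennreal (L ^ (n - 1)) * emeasure \<nu> V"
      proof (rule mult_mono)
        show "ennreal L \<le> ennreal (L ^ (n - 1))" using L n by (intro ennreal_leI self_le_power) auto
        show "?m \<le> emeasure \<nu> V" using T by (intro emeasure_mono) (auto simp: V_def)
      qed auto
      also have "\<dots> \<le> ennreal B * (ennreal (L ^ n * b) * emeasure lborel V + 1)"
        using L by (intro open_set_bound[OF V _ b]) auto
      also have "\<dots> \<le> ennreal B * (ennreal (L ^ n * b) * ennreal (1 / (L ^ n * b)) + 1)"
        by (intro mult_left_mono add_right_mono Vm) auto
      also have "ennreal (L ^ n * b) * ennreal (1 / (L ^ n * b)) = 1"
        using L b by (subst ennreal_mult[symmetric]) auto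
      also have "ennreal B * (1 + 1) = ennreal (2 * B)" using B by (simp add: ennreal_mult mult.commute)
      finally show ?thesis .
    qed
    have "?m \<le> emeasure \<nu> {- real R<..real R}" by (intro emeasure_mono) auto
    then have "?m < \<infinity>" using \<nu>_finite by (rule le_less_trans)
    then obtain r where r: "?m = ennreal r" "r \<ge> 0" by (cases ?m) auto
    have "r \<le> 0"
    proof (rule ccontr)
      assume "\<not> r \<le> 0"
      define L where "L = max 1 (2 * B / r + 1)"
      have "ennreal (L * r) \<le> ennreal (2 * B)" using le[of L] r \<open>\<not> r \<le> 0\<close> by (simp add: ennreal_mult L_def)
      then have "L * r \<le> 2 * B" using B by (simp add: ennreal_le_iff)
      moreover have "(2 * B / r + 1) * r \<le> L * r" using \<open>\<not> r \<le> 0\<close> by (intro mult_right_mono) (auto simp: L_def)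
      moreover have "(2 * B / r + 1) * r = 2 * B + r" using \<open>\<not> r \<le> 0\<close> by (simp add: field_simps)
      ultimately show False using \<open>\<not> r \<le> 0\<close> by simp
    qed
    then show ?thesis using r by simp
  qed
  have "E = (\<Union>R. E \<inter> {- real R<..<real R})"
  proof -
    have "\<exists>R. x \<in> {- real R<..<real R}" for x :: real
    proof -
      obtain R where "\<bar>x\<bar> < real R" using reals_Archimedean2 by blast
      then show ?thesis by (intro exI[of _ R]) auto
    qed
    then show ?thesis by blast
  qed
  moreover have "(\<Union>R. E \<inter> {- real R<..<real R}) \<in> null_sets \<nu>"
    using bounded by (intro null_sets_UN null_setsI) auto
  ultimately show "E \<in> null_sets \<nu>" by simp
qed


text \<open>The continuous approximants converge off a Lebesgue null set. The density representation
  makes it a null set of \<nu> too, so dominated convergence applies on both sides.\<close>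

lemma borel_inequality:
  assumes G [measurable]: "G \<in> borel_measurable borel" and \<nu>G: "\<nu> = density lborel G"
    and [measurable]: "c \<in> borel_measurable borel" and c: "\<And>x. 0 \<le> c x" "\<And>x. c x \<le> L"
    and supp: "\<And>x. x \<notin> {- real R..real R} \<Longrightarrow> c x = 0"
  shows "(\<integral>\<^sup>+x. ennreal (c x ^ (n - 1) * \<beta> x) \<partial>\<nu>) \<le> ennreal B * ((\<integral>\<^sup>+x. ennreal (c x ^ n * \<beta> x) \<partial>lborel) + 1)"
proof -
  have L: "L \<ge> 0" using c order_trans by blast
  obtain d where d: "\<And>j::nat. continuous_on UNIV (d j)" "\<And>j x. 0 \<le> d j x" "\<And>j x. d j x \<le> L"
    "\<And>j x. x \<notin> {- real R - 1..real R + 1} \<Longrightarrow> d j x = 0" "AE x in lborel. (\<lambda>j. d j x) \<longlonglongrightarrow> c x"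
    using continuous_approx_borel[of c L "- real R" "real R" 1] c supp by auto
  have [measurable]: "d j \<in> borel_measurable borel" for j using d(1) by (rule borel_measurable_continuous_onI)
  define S where "S = R + 2"
  have ds: "d j x = 0" if "x \<notin> {- real S<..real S}" for j x
    using that by (intro d(4)) (auto simp: S_def)
  have le: "(\<integral>\<^sup>+x. ennreal (d j x ^ (n - 1) * \<beta> x) \<partial>\<nu>) \<le> ennreal B * ((\<integral>\<^sup>+x. ennreal (d j x ^ n * \<beta> x) \<partial>lborel) + 1)" for j
    by (rule continuous_inequality[of _ S]) (use d ds in auto)
  obtain b where b: "b > 0" "\<And>x. x \<in> {- real S..real S} \<Longrightarrow> \<beta> x \<le> b" using \<beta>_bound by blast
  have AE\<nu>: "AE x in \<nu>. (\<lambda>j. d j x) \<longlonglongrightarrow> c x"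
    unfolding \<nu>G using d(5) by (subst AE_density) (auto elim: eventually_mono)
  have conv: "(\<lambda>j. \<integral>\<^sup>+x. ennreal (d j x ^ k * \<beta> x) \<partial>M) \<longlonglongrightarrow> (\<integral>\<^sup>+x. ennreal (c x ^ k * \<beta> x) \<partial>M)"
    if s: "sets M = sets borel" and fin: "emeasure M {- real S<..real S} < \<infinity>" and k: "k > 0"
      and ae: "AE x in M. (\<lambda>j. d j x) \<longlonglongrightarrow> c x" for M k
  proof (rule nn_integral_dominated_convergence[where w = "\<lambda>x. ennreal (L ^ k * b) * indicator {- real S<..real S} x"])
    show "(\<lambda>x. ennreal (d j x ^ k * \<beta> x)) \<in> borel_measurable M" for j
      unfolding measurable_cong_sets[OF s refl] by measurable
    show "(\<lambda>x. ennreal (c x ^ k * \<beta> x)) \<in> borel_measurable M" "(\<lambda>x. ennreal (L ^ k * b) * indicator {- real S<..real S} x) \<in> borel_measurable M"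
      unfolding measurable_cong_sets[OF s refl] by measurable
    show "(\<integral>\<^sup>+x. ennreal (L ^ k * b) * indicator {- real S<..real S} x \<partial>M) < \<infinity>"
      using fin s by (simp add: nn_integral_cmult_indicator ennreal_mult_less_top)
    show "AE x in M. (\<lambda>j. ennreal (d j x ^ k * \<beta> x)) \<longlonglongrightarrow> ennreal (c x ^ k * \<beta> x)"
      using ae by eventually_elim (intro tendsto_intros tendsto_ennrealI)
    have "ennreal (d j x ^ k * \<beta> x) \<le> ennreal (L ^ k * b) * indicator {- real S<..real S} x" for j x
    proof (cases "x \<in> {- real S<..real S}")
      case True
      then have "d j x ^ k * \<beta> x \<le> L ^ k * b"
        using d(2,3)[of j x] b L \<beta>_pos[of x] by (intro mult_mono power_mono) (auto simp: less_imp_le)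
      then show ?thesis using True by (simp add: ennreal_leI)
    qed (use ds k in \<open>simp add: zero_power\<close>)
    then show "\<And>j. AE x in M. ennreal (d j x ^ k * \<beta> x) \<le> ennreal (L ^ k * b) * indicator {- real S<..real S} x" by simp
  qed
  have 1: "(\<lambda>j. \<integral>\<^sup>+x. ennreal (d j x ^ (n - 1) * \<beta> x) \<partial>\<nu>) \<longlonglongrightarrow> (\<integral>\<^sup>+x. ennreal (c x ^ (n - 1) * \<beta> x) \<partial>\<nu>)"
    using n by (intro conv AE\<nu> \<nu>_finite) auto
  have "(\<lambda>j. \<integral>\<^sup>+x. ennreal (d j x ^ n * \<beta> x) \<partial>lborel) \<longlonglongrightarrow> (\<integral>\<^sup>+x. ennreal (c x ^ n * \<beta> x) \<partial>lborel)"
    using n by (intro conv d(5)) auto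
  then have 2: "(\<lambda>j. ennreal B * ((\<integral>\<^sup>+x. ennreal (d j x ^ n * \<beta> x) \<partial>lborel) + 1)) \<longlonglongrightarrow> ennreal B * ((\<integral>\<^sup>+x. ennreal (c x ^ n * \<beta> x) \<partial>lborel) + 1)"
    by (intro ennreal_tendsto_cmult tendsto_add tendsto_const) auto
  show ?thesis by (rule LIMSEQ_le[OF 1 2]) (use le in blast)
qed

text \<open>Testing with \<theta> w, where w is a truncation of \<gamma>, puts at least
  \<theta>^(n-1) times the integral I of w^n \<beta> on the left and B (\<theta>^n I + 1) on the
  right. The choice \<theta> = 1 / (2 B) lets the left side absorb half of itself. Truncation makes
  I finite for this step, and the resulting bound does not depend on it.\<close>

lemma density_bound:
  assumes [measurable]: "\<gamma> \<in> borel_measurable borel" and \<gamma>0: "\<And>x. \<gamma> x \<ge> 0" and \<nu>\<gamma>: "\<nu> = density lborel (\<lambda>x. ennreal (\<gamma> x))"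
  shows "(\<integral>\<^sup>+x. ennreal (\<gamma> x ^ n * \<beta> x) \<partial>lborel) \<le> ennreal ((2 * B) ^ n)"
proof -
  define w where "w i x = min (\<gamma> x) (real i) * indicator {- real i..real i} x" for i :: nat and x
  have [measurable]: "w i \<in> borel_measurable borel" for i unfolding w_def by measurable
  have w0: "0 \<le> w i x" "w i x \<le> \<gamma> x" "w i x \<le> real i" for i x
    using \<gamma>0[of x] by (auto simp: w_def indicator_def)
  define \<theta> where "\<theta> = 1 / (2 * B)"
  have \<theta>: "\<theta> > 0" using B by (simp add: \<theta>_def)
  have bound: "(\<integral>\<^sup>+x. ennreal (w i x ^ n * \<beta> x) \<partial>lborel) \<le> ennreal ((2 * B) ^ n)" for i
  proof -
    let ?I = "\<integral>\<^sup>+x. ennreal (w i x ^ n * \<beta> x) \<partial>lborel"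
    have "?I < \<infinity>"
    proof -
      obtain b where b: "b > 0" "\<And>x. x \<in> {- real i..real i} \<Longrightarrow> \<beta> x \<le> b" using \<beta>_bound by blast
      have "?I \<le> (\<integral>\<^sup>+x. ennreal (real i ^ n * b) * indicator {- real i..real i} x \<partial>lborel)"
      proof (rule nn_integral_mono)
        fix x
        show "ennreal (w i x ^ n * \<beta> x) \<le> ennreal (real i ^ n * b) * indicator {- real i..real i} x"
        proof (cases "x \<in> {- real i..real i}")
          case True
          then have "w i x ^ n * \<beta> x \<le> real i ^ n * b"
            using w0[of i x] b \<beta>_pos[of x] by (intro mult_mono power_mono) (auto simp: less_imp_le)
          then show ?thesis using True by (simp add: ennreal_leI)
        qed (use n in \<open>simp add: w_def zero_power\<close>)
      qed
      also have "\<dots> < \<infinity>" by (simp add: nn_integral_cmult_indicator ennreal_mult_less_top)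
      finally show ?thesis .
    qed
    then obtain I where I: "?I = ennreal I" "I \<ge> 0" by (cases ?I) auto
    have "ennreal (\<theta> ^ (n - 1)) * ?I = (\<integral>\<^sup>+x. ennreal (\<theta> ^ (n - 1)) * ennreal (w i x ^ n * \<beta> x) \<partial>lborel)"
      by (rule nn_integral_cmult[symmetric]) measurable
    also have "\<dots> \<le> (\<integral>\<^sup>+x. ennreal (\<gamma> x) * ennreal ((\<theta> * w i x) ^ (n - 1) * \<beta> x) \<partial>lborel)"
    proof (rule nn_integral_mono)
      fix x
      have "w i x ^ n = w i x ^ (n - 1) * w i x" using power_minus_mult[of n "w i x"] n by simp
      then have "\<theta> ^ (n - 1) * (w i x ^ n * \<beta> x) = w i x * ((\<theta> * w i x) ^ (n - 1) * \<beta> x)"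
        by (simp add: power_mult_distrib)
      also have "\<dots> \<le> \<gamma> x * ((\<theta> * w i x) ^ (n - 1) * \<beta> x)"
        using w0[of i x] \<theta> \<beta>_pos[of x] by (intro mult_right_mono) auto
      finally have "ennreal (\<theta> ^ (n - 1) * (w i x ^ n * \<beta> x)) \<le> ennreal (\<gamma> x * ((\<theta> * w i x) ^ (n - 1) * \<beta> x))"
        by (rule ennreal_leI)
      then show "ennreal (\<theta> ^ (n - 1)) * ennreal (w i x ^ n * \<beta> x) \<le> ennreal (\<gamma> x) * ennreal ((\<theta> * w i x) ^ (n - 1) * \<beta> x)"
        using \<theta> \<gamma>0[of x] by (simp add: ennreal_mult'[symmetric] less_imp_le)
    qed
    also have "\<dots> = (\<integral>\<^sup>+x. ennreal ((\<theta> * w i x) ^ (n - 1) * \<beta> x) \<partial>\<nu>)"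
      unfolding \<nu>\<gamma> by (subst nn_integral_density) auto
    also have "\<dots> \<le> ennreal B * ((\<integral>\<^sup>+x. ennreal ((\<theta> * w i x) ^ n * \<beta> x) \<partial>lborel) + 1)"
    proof (rule borel_inequality[OF _ \<nu>\<gamma>, where L = "\<theta> * real i" and R = i])
      show "\<theta> * w i x \<le> \<theta> * real i" for x using w0(3)[of i x] \<theta> by (intro mult_left_mono) auto
    qed (use w0(1) \<theta> in \<open>auto simp: w_def\<close>)
    also have "(\<integral>\<^sup>+x. ennreal ((\<theta> * w i x) ^ n * \<beta> x) \<partial>lborel) = ennreal (\<theta> ^ n) * ?I"
      using \<theta> by (subst nn_integral_cmult[symmetric]) (auto simp: power_mult_distrib ennreal_mult'[symmetric] mult.assoc)
    finally have "ennreal (\<theta> ^ (n - 1)) * ennreal I \<le> ennreal B * (ennreal (\<theta> ^ n) * ennreal I + 1)"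
      unfolding I .
    also have "\<dots> = ennreal (B * (\<theta> ^ n * I + 1))"
      using B I(2) \<theta> by (simp add: ennreal_mult ennreal_plus)
    also have "ennreal (\<theta> ^ (n - 1)) * ennreal I = ennreal (\<theta> ^ (n - 1) * I)"
      using I(2) \<theta> by (simp add: ennreal_mult)
    finally have r: "\<theta> ^ (n - 1) * I \<le> B * (\<theta> ^ n * I + 1)"
      using B I(2) \<theta> by (subst (asm) ennreal_le_iff) auto
    have "\<theta> ^ n = \<theta> ^ (n - 1) * \<theta>" using power_minus_mult[of n \<theta>] n by simp
    then have "B * (\<theta> ^ n * I) = \<theta> ^ (n - 1) * I / 2" using B by (simp add: \<theta>_def)
    with r have "\<theta> ^ (n - 1) * I \<le> 2 * B" by (simp add: distrib_left)
    then have "I \<le> 2 * B / \<theta> ^ (n - 1)" using \<theta> by (simp add: field_simps)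
    also have "\<dots> = (2 * B) * (2 * B) ^ (n - 1)" by (simp add: \<theta>_def power_divide)
    also have "\<dots> = (2 * B) ^ n" using power_minus_mult[of n "2 * B"] n by (simp add: mult.commute)
    finally show ?thesis using I by (simp add: ennreal_leI)
  qed
  have "(\<integral>\<^sup>+x. ennreal (\<gamma> x ^ n * \<beta> x) \<partial>lborel) = (\<integral>\<^sup>+x. liminf (\<lambda>i. ennreal (w i x ^ n * \<beta> x)) \<partial>lborel)"
  proof (rule nn_integral_cong)
    fix x
    obtain i0 where i0: "real i0 > max \<bar>x\<bar> (\<gamma> x)" using reals_Archimedean2 by blast
    have "\<forall>\<^sub>F i in sequentially. ennreal (w i x ^ n * \<beta> x) = ennreal (\<gamma> x ^ n * \<beta> x)"
    proof (rule eventually_sequentiallyI[of i0])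
      fix i assume "i0 \<le> i"
      then have "real i > max \<bar>x\<bar> (\<gamma> x)" using i0 by linarith
      then have "w i x = \<gamma> x" by (auto simp: w_def indicator_def)
      then show "ennreal (w i x ^ n * \<beta> x) = ennreal (\<gamma> x ^ n * \<beta> x)" by simp
    qed
    then have "(\<lambda>i. ennreal (w i x ^ n * \<beta> x)) \<longlonglongrightarrow> ennreal (\<gamma> x ^ n * \<beta> x)" by (rule tendsto_eventually)
    then show "ennreal (\<gamma> x ^ n * \<beta> x) = liminf (\<lambda>i. ennreal (w i x ^ n * \<beta> x))"
      by (intro lim_imp_Liminf[symmetric]) auto
  qed
  also have "\<dots> \<le> liminf (\<lambda>i. \<integral>\<^sup>+x. ennreal (w i x ^ n * \<beta> x) \<partial>lborel)"
    by (rule nn_integral_liminf) measurable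
  also have "\<dots> \<le> liminf (\<lambda>i::nat. ennreal ((2 * B) ^ n))"
    by (rule Liminf_mono) (use bound in auto)
  finally show ?thesis by (simp add: Liminf_const)
qed

lemma emeasure_\<nu>_greaterThan: "emeasure \<nu> {x<..} = ennreal (h x)"
proof -
  have "(\<lambda>i. emeasure \<nu> {x<..x + real i}) \<longlonglongrightarrow> emeasure \<nu> (\<Union>i. {x<..x + real i})"
    by (rule Lim_emeasure_incseq) (auto simp: incseq_def)
  moreover have "(\<Union>i. {x<..x + real i}) = {x<..}"
  proof -
    have "\<exists>i. y \<le> x + real i" for y using real_arch_simple[of "y - x"] by (auto simp: algebra_simps)
    then show ?thesis by auto
  qed
  moreover have "(\<lambda>i. emeasure \<nu> {x<..x + real i}) \<longlonglongrightarrow> ennreal (h x - 0)"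
  proof -
    have "filterlim (\<lambda>i. x + real i) at_top sequentially"
      by (rule filterlim_tendsto_add_at_top[OF tendsto_const filterlim_real_sequentially])
    then have "(\<lambda>i. h (x + real i)) \<longlonglongrightarrow> 0" by (rule filterlim_compose[OF h_lim])
    then have "(\<lambda>i. ennreal (h x - h (x + real i))) \<longlonglongrightarrow> ennreal (h x - 0)"
      by (intro tendsto_ennrealI tendsto_diff tendsto_const)
    then show ?thesis by (simp add: emeasure_\<nu>)
  qed
  ultimately show ?thesis using LIMSEQ_unique by force
qed

theorem density_exists:
  obtains \<gamma> where "\<gamma> \<in> borel_measurable borel" "\<And>x. \<gamma> x \<ge> 0"
    "\<And>x. (\<integral>\<^sup>+y. indicator {x<..} y * ennreal (\<gamma> y) \<partial>lborel) = ennreal (h x)"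
    "(\<integral>\<^sup>+x. ennreal (\<gamma> x ^ n * \<beta> x) \<partial>lborel) < \<infinity>"
proof -
  obtain G where G [measurable]: "G \<in> borel_measurable lborel" and \<nu>G: "density lborel G = \<nu>"
    using sigma_finite_measure.Radon_Nikodym[OF lborel.sigma_finite_measure_axioms \<nu>_absolutely_continuous] by auto
  \<comment> \<open>The Radon-Nikodym density takes extended values; it is finite almost everywhere
    because \<nu> is finite on bounded intervals.\<close>
  have fin: "AE x in lborel. G x \<noteq> \<infinity>"
  proof -
    have "AE x in lborel. G x * indicator {- real R<..real R} x \<noteq> \<infinity>" for R :: nat
    proof (rule nn_integral_PInf_AE)
      have "(\<integral>\<^sup>+x. G x * indicator {- real R<..real R} x \<partial>lborel) = emeasure \<nu> {- real R<..real R}"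
        unfolding \<nu>G[symmetric] by (subst emeasure_density) auto
      then show "(\<integral>\<^sup>+x. G x * indicator {- real R<..real R} x \<partial>lborel) \<noteq> \<infinity>"
        using \<nu>_finite[of "- real R" "real R"] by auto
    qed measurable
    then have "AE x in lborel. \<forall>R::nat. G x * indicator {- real R<..real R} x \<noteq> \<infinity>"
      by (simp add: AE_all_countable)
    then show ?thesis
    proof eventually_elim
      fix x assume *: "\<forall>R::nat. G x * indicator {- real R<..real R} x \<noteq> \<infinity>"
      obtain R where "real R > \<bar>x\<bar>" using reals_Archimedean2 by blast
      then have "x \<in> {- real R<..real R}" by auto
      then show "G x \<noteq> \<infinity>" using *[rule_format, of R] by simp
    qed
  qed
  define \<gamma> where "\<gamma> x = enn2real (G x)" for x
  have \<gamma>m [measurable]: "\<gamma> \<in> borel_measurable borel" unfolding \<gamma>_def using G by simp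
  have \<gamma>0: "\<gamma> x \<ge> 0" for x by (simp add: \<gamma>_def)
  have \<nu>\<gamma>: "\<nu> = density lborel (\<lambda>x. ennreal (\<gamma> x))"
    unfolding \<nu>G[symmetric]
  proof (rule density_cong)
    show "AE x in lborel. G x = ennreal (\<gamma> x)"
      using fin by eventually_elim (auto simp: \<gamma>_def less_top)
  qed auto
  show ?thesis
  proof (rule that[of \<gamma>])
    show "\<gamma> \<in> borel_measurable borel" by (rule \<gamma>m)
    show "\<gamma> x \<ge> 0" for x by (rule \<gamma>0)
    show "(\<integral>\<^sup>+y. indicator {x<..} y * ennreal (\<gamma> y) \<partial>lborel) = ennreal (h x)" for x
    proof -
      have "emeasure \<nu> {x<..} = (\<integral>\<^sup>+y. ennreal (\<gamma> y) * indicator {x<..} y \<partial>lborel)"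
        unfolding \<nu>\<gamma> by (subst emeasure_density) auto
      then show ?thesis by (simp add: emeasure_\<nu>_greaterThan mult.commute)
    qed
    show "(\<integral>\<^sup>+x. ennreal (\<gamma> x ^ n * \<beta> x) \<partial>lborel) < \<infinity>"
      using density_bound[OF \<gamma>m \<gamma>0 \<nu>\<gamma>] by (simp add: le_less_trans)
  qed
qed

end


section \<open>Hardy's inequality and the isoperimetric profile\<close>

text \<open>The graph of t^n lies above its tangent at \<open>a\<close>; after division by a^n this
  is Bernoulli's inequality for g / a - 1 \<ge> -1.\<close>

lemma power_tangent_le:
  fixes a g :: real
  assumes "a \<ge> 0" "g \<ge> 0" "n \<ge> 2"
  shows "real n * a ^ (n - 1) * g \<le> g ^ n + (real n - 1) * a ^ n"
proof (cases "a = 0")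
  case True
  then show ?thesis using assms by (simp add: zero_power)
next
  case False
  then have a: "a > 0" using assms by simp
  have an: "a ^ n = a ^ (n - 1) * a" using power_minus_mult[of n a] assms by simp
  have "1 + real n * (g / a - 1) \<le> (1 + (g / a - 1)) ^ n"
    using a assms by (intro Bernoulli_inequality) simp
  then have "(1 + real n * (g / a - 1)) * a ^ n \<le> (g / a) ^ n * a ^ n"
    using a by (intro mult_right_mono) auto
  also have "(g / a) ^ n * a ^ n = g ^ n" using a by (simp add: power_divide)
  also have "(1 + real n * (g / a - 1)) * a ^ n = real n * a ^ (n - 1) * g - (real n - 1) * a ^ n"
    using a by (simp add: an field_simps)
  finally show ?thesis by simp
qed

text \<open>The tangent inequality at the mean is integrated against the probability density. If the
  mean is infinite, the tangent at 1 already forces the right side to be infinite.\<close>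

lemma nn_integral_jensen_power:
  fixes g p :: "real \<Rightarrow> real"
  assumes [measurable]: "g \<in> borel_measurable M" "p \<in> borel_measurable M"
    and g: "\<And>x. g x \<ge> 0" and p: "\<And>x. p x \<ge> 0" and p1: "(\<integral>\<^sup>+x. ennreal (p x) \<partial>M) = 1" and n: "n \<ge> 2"
  shows "(\<integral>\<^sup>+x. ennreal (g x * p x) \<partial>M) ^ n \<le> (\<integral>\<^sup>+x. ennreal (g x ^ n * p x) \<partial>M)"
proof -
  let ?A = "\<integral>\<^sup>+x. ennreal (g x * p x) \<partial>M" and ?R = "\<integral>\<^sup>+x. ennreal (g x ^ n * p x) \<partial>M"
  have t: "ennreal (real n * a ^ (n - 1)) * ?A \<le> ?R + ennreal ((real n - 1) * a ^ n)" if a: "a \<ge> 0" for a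
  proof -
    have "ennreal (real n * a ^ (n - 1)) * ?A = (\<integral>\<^sup>+x. ennreal (real n * a ^ (n - 1) * (g x * p x)) \<partial>M)"
      using a by (subst nn_integral_cmult[symmetric]) (auto simp: ennreal_mult' intro!: nn_integral_cong)
    also have "\<dots> \<le> (\<integral>\<^sup>+x. ennreal (g x ^ n * p x) + ennreal ((real n - 1) * a ^ n) * ennreal (p x) \<partial>M)"
    proof (rule nn_integral_mono)
      fix x
      have "real n * a ^ (n - 1) * g x * p x \<le> (g x ^ n + (real n - 1) * a ^ n) * p x"
        using power_tangent_le[OF a g n] p by (rule mult_right_mono)
      then have "real n * a ^ (n - 1) * (g x * p x) \<le> g x ^ n * p x + (real n - 1) * a ^ n * p x"
        by (simp add: algebra_simps)
      then have "ennreal (real n * a ^ (n - 1) * (g x * p x)) \<le> ennreal (g x ^ n * p x + (real n - 1) * a ^ n * p x)"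
        by (rule ennreal_leI)
      also have "\<dots> = ennreal (g x ^ n * p x) + ennreal ((real n - 1) * a ^ n) * ennreal (p x)"
        using g p a n by (subst ennreal_plus) (auto simp: ennreal_mult)
      finally show "ennreal (real n * a ^ (n - 1) * (g x * p x)) \<le> ennreal (g x ^ n * p x) + ennreal ((real n - 1) * a ^ n) * ennreal (p x)" .
    qed
    also have "\<dots> = ?R + ennreal ((real n - 1) * a ^ n)"
      by (subst nn_integral_add) (auto simp: nn_integral_cmult p1)
    finally show ?thesis .
  qed
  show ?thesis
  proof (cases "?A = \<infinity>")
    case True
    then have "\<infinity> \<le> ?R + ennreal (real n - 1)"
      using t[of 1] n by (simp add: ennreal_mult_top)
    then have "?R = \<infinity>" by (simp add: top_unique)
    then show ?thesis by simp
  next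
    case False
    then obtain A where A: "?A = ennreal A" "A \<ge> 0" by (cases ?A) auto
    have An: "A ^ n = A ^ (n - 1) * A" using power_minus_mult[of n A] n by simp
    have "ennreal (real n * A ^ (n - 1)) * ennreal A = ennreal (A ^ n) + ennreal ((real n - 1) * A ^ n)"
    proof -
      have "real n * A ^ (n - 1) * A = A ^ n + (real n - 1) * A ^ n" by (simp add: An algebra_simps)
      moreover have "ennreal (real n * A ^ (n - 1)) * ennreal A = ennreal (real n * A ^ (n - 1) * A)"
        using A(2) by (intro ennreal_mult[symmetric]) auto
      moreover have "ennreal (A ^ n + (real n - 1) * A ^ n) = ennreal (A ^ n) + ennreal ((real n - 1) * A ^ n)"
        using A(2) n by (intro ennreal_plus) auto
      ultimately show ?thesis by simp
    qed
    with t[OF A(2)] have "ennreal ((real n - 1) * A ^ n) + ennreal (A ^ n) \<le> ennreal ((real n - 1) * A ^ n) + ?R"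
      unfolding A(1) by (simp add: add.commute)
    then have "ennreal (A ^ n) \<le> ?R" unfolding ennreal_add_left_cancel_le by simp
    then show ?thesis using A by (simp add: ennreal_power)
  qed
qed

text \<open>Hardy's inequality in logarithmic variables: Jensen's inequality with respect to the
  probability density \<open>exp (- s / n) / n\<close> on the half line.\<close>

lemma hardy_exponential:
  fixes \<gamma> :: "real \<Rightarrow> real"
  assumes [measurable]: "\<gamma> \<in> borel_measurable borel" and \<gamma>: "\<And>x. \<gamma> x \<ge> 0" and n: "n \<ge> 2"
  shows "(\<integral>\<^sup>+x. (\<integral>\<^sup>+y. indicator {x<..} y * ennreal (\<gamma> y) \<partial>lborel) ^ n * ennreal (exp x) \<partial>lborel)
    \<le> ennreal (real n ^ n) * (\<integral>\<^sup>+y. ennreal (\<gamma> y ^ n * exp y) \<partial>lborel)"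
proof -
  define p where "p s = exp (- s / n) / n * indicator {0..} s" for s :: real
  have p0: "p s \<ge> 0" for s by (simp add: p_def)
  have [measurable]: "p \<in> borel_measurable borel" unfolding p_def by measurable
  have p1: "(\<integral>\<^sup>+s. ennreal (p s) \<partial>lborel) = 1"
  proof -
    have "(\<integral>\<^sup>+s. ennreal (p s) \<partial>lborel) = (\<integral>\<^sup>+s. ennreal (exp (- s / n) / n) * indicator {0..} s \<partial>lborel)"
      by (intro nn_integral_cong) (auto simp: p_def indicator_def)
    also have "\<dots> = ennreal (0 - (- exp (- 0 / real n)))"
    proof (rule nn_integral_FTC_atLeast)
      show "((\<lambda>s. - exp (- s / real n)) has_real_derivative exp (- x / real n) / real n) (at x)" for x
        using n by (auto intro!: derivative_eq_intros)
      have "filterlim (\<lambda>s. - s / real n) at_bot at_top"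
        using n by real_asymp
      then have "((\<lambda>s. exp (- s / real n)) \<longlongrightarrow> 0) at_top" by (rule filterlim_compose[OF exp_at_bot])
      then show "((\<lambda>s. - exp (- s / real n)) \<longlongrightarrow> 0) at_top" using tendsto_minus by fastforce
    qed auto
    finally show ?thesis by simp
  qed
  \<comment> \<open>Chosen so that g times p is \<open>\<gamma> (x + s)\<close> on the half line. In
    the n-th power the factor exp (s / n) becomes exp s, which together with \<open>exp x\<close>
    gives the translated weight \<open>exp (x + s)\<close>; only the constant n^n remains.\<close>
  define g where "g x s = real n * \<gamma> (x + s) * exp (s / n)" for x s
  have g0: "g x s \<ge> 0" for x s using \<gamma> by (simp add: g_def)
  have [measurable]: "(\<lambda>(x, s). g x s) \<in> borel_measurable (borel \<Otimes>\<^sub>M borel)" unfolding g_def by measurable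
  have "(\<integral>\<^sup>+y. indicator {x<..} y * ennreal (\<gamma> y) \<partial>lborel) ^ n \<le> (\<integral>\<^sup>+s. ennreal (g x s ^ n * p s) \<partial>lborel)" for x
  proof -
    have "(\<integral>\<^sup>+y. indicator {x<..} y * ennreal (\<gamma> y) \<partial>lborel) = (\<integral>\<^sup>+s. indicator {x<..} (s + x) * ennreal (\<gamma> (s + x)) \<partial>lborel)"
      by (rule nn_integral_translate[symmetric]) measurable
    also have "\<dots> \<le> (\<integral>\<^sup>+s. ennreal (g x s * p s) \<partial>lborel)"
    proof (rule nn_integral_mono)
      fix s
      have "exp (s / n) * exp (- s / n) = 1" by (simp flip: exp_add)
      then have "g x s * p s = \<gamma> (x + s) * indicator {0..} s"
        using n unfolding g_def p_def by (simp add: field_simps)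
      then show "indicator {x<..} (s + x) * ennreal (\<gamma> (s + x)) \<le> ennreal (g x s * p s)"
        by (auto simp: indicator_def add.commute)
    qed
    finally have "(\<integral>\<^sup>+y. indicator {x<..} y * ennreal (\<gamma> y) \<partial>lborel) ^ n \<le> (\<integral>\<^sup>+s. ennreal (g x s * p s) \<partial>lborel) ^ n"
      by (rule power_mono) simp
    also have "\<dots> \<le> (\<integral>\<^sup>+s. ennreal (g x s ^ n * p s) \<partial>lborel)"
      by (rule nn_integral_jensen_power[OF _ _ g0 p0 p1 n]) measurable
    finally show ?thesis .
  qed
  then have "(\<integral>\<^sup>+x. (\<integral>\<^sup>+y. indicator {x<..} y * ennreal (\<gamma> y) \<partial>lborel) ^ n * ennreal (exp x) \<partial>lborel)
    \<le> (\<integral>\<^sup>+x. (\<integral>\<^sup>+s. ennreal (g x s ^ n * p s) \<partial>lborel) * ennreal (exp x) \<partial>lborel)"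
    by (intro nn_integral_mono mult_right_mono) auto
  also have "\<dots> = (\<integral>\<^sup>+x. \<integral>\<^sup>+s. ennreal (g x s ^ n * p s * exp x) \<partial>lborel \<partial>lborel)"
    using g0 p0 by (intro nn_integral_cong, subst nn_integral_multc[symmetric]) (auto simp: ennreal_mult' intro!: nn_integral_cong)
  also have "\<dots> = (\<integral>\<^sup>+s. \<integral>\<^sup>+x. ennreal (g x s ^ n * p s * exp x) \<partial>lborel \<partial>lborel)"
    by (rule lborel_pair.Fubini') measurable
  also have "\<dots> = (\<integral>\<^sup>+s. ennreal (p s) * (ennreal (real n ^ n) * (\<integral>\<^sup>+y. ennreal (\<gamma> y ^ n * exp y) \<partial>lborel)) \<partial>lborel)"
  proof (rule nn_integral_cong)
    fix s
    have eq: "g x s ^ n * p s * exp x = p s * (real n ^ n * (\<gamma> (x + s) ^ n * exp (x + s)))" for x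
    proof -
      have "exp (s / n) ^ n = exp s" using n by (simp flip: exp_of_nat_mult)
      then show ?thesis by (simp add: g_def power_mult_distrib exp_add)
    qed
    have "(\<integral>\<^sup>+x. ennreal (g x s ^ n * p s * exp x) \<partial>lborel)
      = (\<integral>\<^sup>+x. ennreal (p s) * (ennreal (real n ^ n) * ennreal (\<gamma> (x + s) ^ n * exp (x + s))) \<partial>lborel)"
      unfolding eq using p0 \<gamma> by (intro nn_integral_cong) (simp add: ennreal_mult')
    also have "\<dots> = ennreal (p s) * (ennreal (real n ^ n) * (\<integral>\<^sup>+x. ennreal (\<gamma> (x + s) ^ n * exp (x + s)) \<partial>lborel))"
      by (simp add: nn_integral_cmult)
    also have "(\<integral>\<^sup>+x. ennreal (\<gamma> (x + s) ^ n * exp (x + s)) \<partial>lborel) = (\<integral>\<^sup>+y. ennreal (\<gamma> y ^ n * exp y) \<partial>lborel)"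
      by (rule nn_integral_translate[where f = "\<lambda>y. ennreal (\<gamma> y ^ n * exp y)"]) measurable
    finally show "(\<integral>\<^sup>+x. ennreal (g x s ^ n * p s * exp x) \<partial>lborel) = ennreal (p s) * (ennreal (real n ^ n) * (\<integral>\<^sup>+y. ennreal (\<gamma> y ^ n * exp y) \<partial>lborel))" .
  qed
  also have "\<dots> = ennreal (real n ^ n) * (\<integral>\<^sup>+y. ennreal (\<gamma> y ^ n * exp y) \<partial>lborel)"
    by (simp add: nn_integral_multc p1)
  finally show ?thesis .
qed

text \<open>\<open>unit_ball_vol n * radial_volume n (sinh r)\<close> is the volume of a hyperbolic ball of radius \<open>r\<close>.\<close>

definition radial_volume :: "nat \<Rightarrow> real \<Rightarrow> real" where
  "radial_volume n X = integral {0..X} (\<lambda>t. real n * t ^ (n - 1) / sqrt (1 + t\<^sup>2))"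

lemma sqrt_1_plus_square_pos: "sqrt (1 + t\<^sup>2) > 0"
  by (simp add: add_pos_nonneg)

lemma radial_volume_0 [simp]: "radial_volume n 0 = 0"
  by (simp add: radial_volume_def)

lemma DERIV_radial_volume:
  assumes "X > 0"
  shows "(radial_volume n has_real_derivative real n * X ^ (n - 1) / sqrt (1 + X\<^sup>2)) (at X)"
proof -
  have "continuous_on {0..X + 1} (\<lambda>t::real. real n * t ^ (n - 1) / sqrt (1 + t\<^sup>2))"
    using sqrt_1_plus_square_pos by (intro continuous_intros) (metis less_irrefl)
  then have "(radial_volume n has_real_derivative real n * X ^ (n - 1) / sqrt (1 + X\<^sup>2)) (at X within {0..X + 1})"
    unfolding radial_volume_def using assms by (intro integral_has_real_derivative) auto
  moreover have "at X within {0..X + 1} = at X" using assms by (intro at_within_interior) auto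
  ultimately show ?thesis by simp
qed

lemma continuous_on_radial_volume: "continuous_on {0..} (radial_volume n)"
  unfolding continuous_on_eq_continuous_within
proof
  fix X :: real assume X: "X \<in> {0..}"
  have "continuous_on {0..X + 1} (\<lambda>t::real. real n * t ^ (n - 1) / sqrt (1 + t\<^sup>2))"
    using sqrt_1_plus_square_pos by (intro continuous_intros) (metis less_irrefl)
  then have "continuous_on {0..X + 1} (radial_volume n)"
    unfolding radial_volume_def by (intro indefinite_integral_continuous_1 integrable_continuous_interval)
  then have "continuous (at X within {0..X + 1}) (radial_volume n)"
    using X by (simp add: continuous_on_eq_continuous_within)
  moreover have "at X within {0..X + 1} = at X within {0..}"
    by (rule at_within_nhd[of X "{..<X + 1}"]) auto
  ultimately show "continuous (at X within {0..}) (radial_volume n)" by simp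
qed

lemma radial_volume_strict_mono:
  assumes "0 \<le> a" "a < b" "n \<ge> 1"
  shows "radial_volume n a < radial_volume n b"
proof (rule DERIV_pos_imp_increasing_open[OF assms(2)])
  fix x assume x: "a < x" "x < b"
  then have "x > 0" using assms by simp
  then have "real n * x ^ (n - 1) / sqrt (1 + x\<^sup>2) > 0"
    using assms sqrt_1_plus_square_pos[of x] by simp
  then show "\<exists>y. (radial_volume n has_real_derivative y) (at x) \<and> 0 < y"
    using DERIV_radial_volume[OF \<open>x > 0\<close>] by blast
qed (use assms in \<open>auto intro: continuous_on_subset[OF continuous_on_radial_volume]\<close>)

lemma radial_volume_pos: "X > 0 \<Longrightarrow> n \<ge> 1 \<Longrightarrow> radial_volume n X > 0"
  using radial_volume_strict_mono[of 0 X n] by simp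

text \<open>A crude lower bound for the volume, from sqrt (1 + x^2) \<le> 1 + x under the integral.
  It yields the finiteness of the hyperbolic energy and the divergence of the volume at the
  boundary.\<close>

lemma power_le_radial_volume:
  assumes X: "X > 0" and n: "n \<ge> 2"
  shows "X ^ n \<le> radial_volume n X * (1 + X)"
proof -
  let ?D = "\<lambda>x. radial_volume n x - x ^ n / (1 + x)"
  have "?D 0 \<le> ?D X"
  proof (rule DERIV_nonneg_imp_increasing_open[of 0 X])
    fix x assume x: "0 < x" "x < X"
    let ?y = "real n * x ^ (n - 1) / sqrt (1 + x\<^sup>2) - (real n * x ^ (n - 1) * (1 + x) - x ^ n) / (1 + x)\<^sup>2"
    have "((\<lambda>x. x ^ n / (1 + x)) has_real_derivative (real n * x ^ (n - 1) * (1 + x) - x ^ n) / (1 + x)\<^sup>2) (at x)"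
      using x by (auto intro!: derivative_eq_intros simp: power2_eq_square)
    then have d: "(?D has_real_derivative ?y) (at x)"
      by (intro DERIV_diff DERIV_radial_volume x)
    have "(real n * x ^ (n - 1) * (1 + x) - x ^ n) / (1 + x)\<^sup>2 \<le> (real n * x ^ (n - 1) * (1 + x)) / (1 + x)\<^sup>2"
      using x by (intro divide_right_mono) auto
    also have "\<dots> = real n * x ^ (n - 1) / (1 + x)" using x by (simp add: power2_eq_square)
    also have "\<dots> \<le> real n * x ^ (n - 1) / sqrt (1 + x\<^sup>2)"
    proof (intro divide_left_mono mult_pos_pos sqrt_1_plus_square_pos)
      have "1 + x\<^sup>2 \<le> (1 + x)\<^sup>2" using x by (simp add: power2_eq_square algebra_simps)
      then show "sqrt (1 + x\<^sup>2) \<le> 1 + x" using x by (simp add: real_le_lsqrt)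
    qed (use x in auto)
    finally show "\<exists>y. (?D has_real_derivative y) (at x) \<and> 0 \<le> y" using d by (intro exI[of _ ?y]) simp
  next
    show "continuous_on {0..X} ?D"
      by (intro continuous_intros continuous_on_subset[OF continuous_on_radial_volume]) auto
  qed (use X in simp)
  then have "X ^ n / (1 + X) \<le> radial_volume n X" using n by (simp add: zero_power)
  then show ?thesis using X by (simp add: field_simps)
qed

text \<open>Equality holds for n = 2. For n \<ge> 3 both exponents are at most 1, so on (0, 1) the
  powers may be replaced by their smaller arguments; what is left reduces to w^2 \<le> w.\<close>

lemma profile_polynomial_inequality:
  fixes w :: real
  assumes w: "0 < w" "w < 1" and n: "n \<ge> 2"
  shows "(real n - 1 + w)\<^sup>2 \<le> (real n - 1)\<^sup>2 * (1 - w) powr (2 / (real n - 1)) + (real n)\<^sup>2 * w powr (2 / real n)"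
proof -
  have le: "t \<le> t powr a" if "0 < t" "t < 1" "a \<le> 1" for t a :: real
    using powr_mono'[of a 1 t] that by simp
  show ?thesis
  proof (cases "n = 2")
    case True
    then show ?thesis using w by (simp add: power2_eq_square algebra_simps)
  next
    case False
    then have n3: "real n \<ge> 3" using n by simp
    have "(real n - 1 + w)\<^sup>2 = (real n - 1)\<^sup>2 + 2 * (real n - 1) * w + w * w" by (simp add: power2_eq_square algebra_simps)
    also have "\<dots> \<le> (real n - 1)\<^sup>2 + 2 * (real n - 1) * w + w" using w by (simp add: mult_left_le_one_le)
    also have "\<dots> = (real n - 1)\<^sup>2 * (1 - w) + (real n)\<^sup>2 * w" by (simp add: power2_eq_square algebra_simps)
    also have "\<dots> \<le> (real n - 1)\<^sup>2 * (1 - w) powr (2 / (real n - 1)) + (real n)\<^sup>2 * w powr (2 / real n)"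
      using w n3 by (intro add_mono mult_left_mono le) (auto simp: field_simps)
    finally show ?thesis .
  qed
qed

text \<open>With \<open>q = (n - 1) / n\<close> this says that \<open>R v \<le> X\<close> for \<open>v = radial_volume n X\<close>, where
  \<open>R v = (v * (1 + q ^ n * v) powr (1 / (n - 1))) powr (1 / n)\<close>. It follows from
  \<open>radial_volume n (R v) \<le> v\<close>, which is proved by differentiation in \<open>v\<close>.\<close>

lemma radial_volume_isoperimetric:
  assumes X: "X > 0" and n: "n \<ge> 2"
  defines "v \<equiv> radial_volume n X"
  shows "v ^ (n - 1) * (1 + ((real n - 1) / real n) ^ n * v) \<le> X ^ (n * (n - 1))"
proof -
  \<comment> \<open>For large X the value v is asymptotic to X^(n-1) / q, so q^n is the largest
    coefficient that the inequality to be proved can have.\<close>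
  define q where "q = (real n - 1) / real n"
  define c where "c = q ^ n"
  have q: "q > 0" using n by (simp add: q_def)
  then have c: "c > 0" by (simp add: c_def)
  define a b where "a = 1 / real n" and "b = 1 / (real n * (real n - 1))"
  have ab: "a > 0" "b > 0" using n by (auto simp: a_def b_def)
  define R where "R v = v powr a * (1 + c * v) powr b" for v
  have Rpos: "R v > 0" if "v > 0" for v using that c by (simp add: R_def add_pos_pos less_imp_neq[symmetric])
  have R0: "R 0 = 0" using ab by (simp add: R_def)
  have Rn: "R v ^ n = v * (1 + c * v) powr (1 / (real n - 1))" if "v > 0" for v
  proof -
    have z: "1 + c * v > 0" using c that by (simp add: add_pos_pos)
    have "(v powr a) ^ n = v" using that n by (simp add: powr_power a_def)
    moreover have "((1 + c * v) powr b) ^ n = (1 + c * v) powr (1 / (real n - 1))"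
      using z n by (simp add: powr_power b_def)
    ultimately show ?thesis by (simp add: R_def power_mult_distrib)
  qed
  have Rd: "(R has_real_derivative R v * (a / v + b * c / (1 + c * v))) (at v)" if "v > 0" for v
  proof -
    have z: "1 + c * v > 0" using c that by (simp add: add_pos_pos)
    have "((\<lambda>v. v powr a) has_real_derivative v powr a * (a / v)) (at v)"
      using DERIV_powr[OF DERIV_ident that DERIV_const[of a]] that by simp
    moreover have "((\<lambda>v. (1 + c * v) powr b) has_real_derivative (1 + c * v) powr b * (b * c / (1 + c * v))) (at v)"
    proof -
      have "((\<lambda>v. 1 + c * v) has_real_derivative c) (at v)" by (auto intro!: derivative_eq_intros)
      from DERIV_powr[OF this z DERIV_const[of b]] show ?thesis
        by (rule DERIV_cong) (simp add: ac_simps)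
    qed
    ultimately have "((\<lambda>v. v powr a * (1 + c * v) powr b) has_real_derivative
        v powr a * (a / v) * (1 + c * v) powr b + (1 + c * v) powr b * (b * c / (1 + c * v)) * v powr a) (at v)"
      by (rule DERIV_mult)
    then show ?thesis unfolding R_def by (rule DERIV_cong) (simp add: algebra_simps)
  qed
  \<comment> \<open>Divided by the square root on the right, the left side is the derivative of
    \<open>radial_volume n (R v)\<close>, so this says that the derivative is at most 1.\<close>
  have key: "real n * R v ^ (n - 1) * (R v * (a / v + b * c / (1 + c * v))) \<le> sqrt (1 + (R v)\<^sup>2)" if v: "v > 0" for v
  proof -
    define z where "z = 1 + c * v"
    \<comment> \<open>In this variable 1 - w = 1 / z, and after squaring both sides a common power
      of z drops out; what remains is \<open>profile_polynomial_inequality\<close>.\<close>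
    define w where "w = c * v / z"
    have z: "z > 0" using c v by (simp add: z_def add_pos_pos)
    have w: "0 < w" "w < 1" using c v z by (auto simp: w_def z_def)
    have w1: "1 - w = 1 / z" using z by (simp add: w_def z_def field_simps)
    let ?m = "real n - 1"
    have m: "?m > 0" using n by simp
    have "real n * R v ^ (n - 1) * (R v * (a / v + b * c / z)) = R v ^ n * (real n * (a / v + b * c / z))"
      using power_minus_mult[of n "R v"] n by (simp add: ac_simps)
    also have "real n * (a / v + b * c / z) = 1 / v + c / (?m * z)"
    proof -
      have "real n * a = 1" "real n * b = 1 / ?m" using n by (simp_all add: a_def b_def)
      moreover have "real n * (a / v + b * c / z) = (real n * a) / v + (real n * b) * c / z"
        by (simp add: distrib_left)
      ultimately show ?thesis by simp
    qed
    also have "R v ^ n * \<dots> = z powr (1 / ?m) * ((?m + w) / ?m)"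
      unfolding Rn[OF v] z_def[symmetric] using v m z by (simp add: w_def field_simps)
    finally have L: "real n * R v ^ (n - 1) * (R v * (a / v + b * c / z)) = z powr (1 / ?m) * ((?m + w) / ?m)" .
    have R2: "(R v)\<^sup>2 = z powr (2 / ?m) * (w powr (2 / real n) * (real n / ?m)\<^sup>2)"
    proof -
      have v': "v = w * z / c" using c z by (simp add: w_def)
      have cn: "c powr (2 * a) = q\<^sup>2"
      proof -
        have "c = q powr real n" using q by (simp add: c_def powr_realpow)
        then have "c powr (2 * a) = q powr (real n * (2 * a))" by (simp add: powr_powr)
        also have "real n * (2 * a) = 2" using n by (simp add: a_def)
        finally show ?thesis using q by simp
      qed
      have "(R v)\<^sup>2 = v powr (2 * a) * z powr (2 * b)"
        using v z by (simp add: R_def power_mult_distrib powr_power z_def[symmetric] mult.commute)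
      also have "v powr (2 * a) = w powr (2 * a) * z powr (2 * a) / c powr (2 * a)"
        unfolding v' using w z c by (simp add: powr_divide powr_mult)
      also have "w powr (2 * a) * z powr (2 * a) / c powr (2 * a) * z powr (2 * b) = w powr (2 * a) * (z powr (2 * a) * z powr (2 * b)) / q\<^sup>2"
        unfolding cn by simp
      also have "z powr (2 * a) * z powr (2 * b) = z powr (2 / ?m)"
      proof -
        have "2 * a + 2 * b = 2 / ?m" using m n by (simp add: a_def b_def field_simps)
        then show ?thesis by (simp flip: powr_add)
      qed
      finally show ?thesis using m n by (simp add: a_def q_def power_divide field_simps)
    qed
    have "(z powr (1 / ?m) * ((?m + w) / ?m))\<^sup>2 = z powr (2 / ?m) * ((?m + w)\<^sup>2 / ?m\<^sup>2)"
      using z by (simp add: power_mult_distrib powr_power power_divide)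
    also have "\<dots> \<le> z powr (2 / ?m) * ((?m\<^sup>2 * (1 - w) powr (2 / ?m) + (real n)\<^sup>2 * w powr (2 / real n)) / ?m\<^sup>2)"
      by (intro mult_left_mono divide_right_mono profile_polynomial_inequality w n) auto
    also have "\<dots> = z powr (2 / ?m) * (1 - w) powr (2 / ?m) + (R v)\<^sup>2"
      unfolding R2 using m by (simp add: field_simps power_divide)
    also have "z powr (2 / ?m) * (1 - w) powr (2 / ?m) = 1"
      unfolding w1 using z by (simp flip: powr_mult)
    finally have "(z powr (1 / ?m) * ((?m + w) / ?m))\<^sup>2 \<le> 1 + (R v)\<^sup>2" .
    then have "z powr (1 / ?m) * ((?m + w) / ?m) \<le> sqrt (1 + (R v)\<^sup>2)" by (rule real_le_rsqrt)
    then show ?thesis using L by (simp add: z_def)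
  qed
  have v: "v > 0" unfolding v_def using radial_volume_pos X n by simp
  have RR: "radial_volume n (R v) \<le> v"
  proof -
    let ?D = "\<lambda>v. v - radial_volume n (R v)"
    have "?D 0 \<le> ?D v"
    proof (rule DERIV_nonneg_imp_increasing_open[of 0 v])
      fix x assume x: "0 < x" "x < v"
      let ?R' = "R x * (a / x + b * c / (1 + c * x))"
      let ?y = "1 - real n * R x ^ (n - 1) / sqrt (1 + (R x)\<^sup>2) * ?R'"
      have "(?D has_real_derivative ?y) (at x)"
        by (intro DERIV_diff DERIV_ident DERIV_chain2[OF DERIV_radial_volume[OF Rpos[OF x(1)]] Rd[OF x(1)]])
      moreover have "?y \<ge> 0" using key[OF x(1)] sqrt_1_plus_square_pos[of "R x"] by (simp add: field_simps)
      ultimately show "\<exists>y. (?D has_real_derivative y) (at x) \<and> 0 \<le> y" by blast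
    next
      have Rc: "continuous_on {0..v} R"
        unfolding R_def using ab c by (intro continuous_intros continuous_on_powr') (auto intro: add_nonneg_nonneg)
      have Rp: "R x \<ge> 0" for x by (simp add: R_def)
      show "continuous_on {0..v} ?D"
        by (intro continuous_intros continuous_on_compose2[OF continuous_on_radial_volume Rc]) (use Rp in auto)
    qed (use v in simp)
    then show ?thesis by (simp add: R0)
  qed
  have "R v \<le> X"
  proof (rule ccontr)
    assume "\<not> R v \<le> X"
    then have "radial_volume n X < radial_volume n (R v)" using X n by (intro radial_volume_strict_mono) auto
    then show False using RR by (simp add: v_def)
  qed
  then have "R v ^ (n * (n - 1)) \<le> X ^ (n * (n - 1))" using Rpos[OF v] by (intro power_mono) auto
  moreover have "R v ^ (n * (n - 1)) = v ^ (n - 1) * (1 + c * v)"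
  proof -
    have z: "1 + c * v > 0" using c v by (simp add: add_pos_pos)
    have "((1 + c * v) powr (1 / (real n - 1))) ^ (n - 1) = 1 + c * v"
      using z n by (simp add: powr_power of_nat_diff)
    then show ?thesis by (simp add: power_mult Rn[OF v] power_mult_distrib)
  qed
  ultimately show ?thesis by (simp add: c_def q_def)
qed


section \<open>Weak gradients of radial functions\<close>

text \<open>Polar coordinates, by comparing two distributions on the line. The sign of the norm is
  reversed because the half lines that determine a measure must have finite mass: with the sign they
  correspond to balls, without it to their complements.\<close>

lemma nn_integral_radial:
  fixes h :: "real \<Rightarrow> ennreal"
  assumes [measurable]: "h \<in> borel_measurable borel"
  shows "(\<integral>\<^sup>+x. h (norm (x :: real ^ 'n)) \<partial>lborel)
    = (\<integral>\<^sup>+s. indicator {0<..} s * (ennreal (real CARD('n) * unit_ball_vol (real CARD('n)) * s ^ (CARD('n) - 1)) * h s) \<partial>lborel)"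
proof -
  define n where "n = CARD('n)"
  have n: "n \<ge> 1" by (simp add: n_def Suc_leI)
  define \<sigma> where "\<sigma> = unit_ball_vol (real n)"
  have \<sigma>: "\<sigma> > 0" by (simp add: \<sigma>_def)
  define k where "k s = real n * \<sigma> * s ^ (n - 1)" for s
  have [measurable]: "k \<in> borel_measurable borel" unfolding k_def by measurable
  define M1 where "M1 = distr (lborel :: (real ^ 'n) measure) borel (\<lambda>x. - norm x)"
  define M2 where "M2 = distr (density lborel (\<lambda>s. indicator {0<..} s * ennreal (k s))) borel (uminus :: real \<Rightarrow> real)"
  have e: "emeasure M1 {a<..} = ennreal (\<sigma> * (max 0 (- a)) ^ n)" "emeasure M2 {a<..} = ennreal (\<sigma> * (max 0 (- a)) ^ n)" for a
  proof -
    have "emeasure M1 {a<..} = emeasure lborel ((\<lambda>x::real ^ 'n. - norm x) -` {a<..} \<inter> space lborel)"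
      unfolding M1_def by (rule emeasure_distr) auto
    also have "(\<lambda>x::real ^ 'n. - norm x) -` {a<..} \<inter> space lborel = ball 0 (max 0 (- a))"
      using norm_ge_zero by (auto simp: max_def) (smt (verit) norm_ge_zero)
    also have "emeasure lborel (ball (0 :: real ^ 'n) (max 0 (- a))) = ennreal (\<sigma> * (max 0 (- a)) ^ n)"
      by (subst emeasure_lborel_ball) (auto simp: \<sigma>_def n_def)
    finally show "emeasure M1 {a<..} = ennreal (\<sigma> * (max 0 (- a)) ^ n)" .
    have "emeasure M2 {a<..} = emeasure (density lborel (\<lambda>s. indicator {0<..} s * ennreal (k s))) {..< - a}"
      unfolding M2_def by (subst emeasure_distr) (auto intro!: arg_cong[where f = "emeasure _"])
    also have "\<dots> = (\<integral>\<^sup>+s. indicator {0<..} s * ennreal (k s) * indicator {..< - a} s \<partial>lborel)"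
      by (rule emeasure_density) auto
    also have "\<dots> = (\<integral>\<^sup>+s. ennreal (k s) * indicator {0..max 0 (- a)} s \<partial>lborel)"
    proof (rule nn_integral_cong_AE)
      have "AE s in lborel. s \<noteq> (0::real)" "AE s in lborel. s \<noteq> - a" by (rule AE_lborel_singleton)+
      then show "AE s in lborel. indicator {0<..} s * ennreal (k s) * indicator {..< - a} s = ennreal (k s) * indicator {0..max 0 (- a)} s"
        by eventually_elim (auto simp: indicator_def max_def)
    qed
    also have "\<dots> = ennreal (\<sigma> * (max 0 (- a)) ^ n - \<sigma> * 0 ^ n)"
    proof (rule nn_integral_FTC_Icc[where F = "\<lambda>s. \<sigma> * s ^ n"])
      show "((\<lambda>s. \<sigma> * s ^ n) has_real_derivative k x) (at x)" for x
        by (auto intro!: derivative_eq_intros simp: k_def)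
      show "0 \<le> k x" if "x \<in> {0..max 0 (- a)}" for x using that \<sigma> by (simp add: k_def)
    qed auto
    finally show "emeasure M2 {a<..} = ennreal (\<sigma> * (max 0 (- a)) ^ n)"
      using n by (simp add: zero_power)
  qed
  have "M1 = M2"
    by (rule measure_eqI_lessThan) (auto simp: e, simp_all add: M1_def M2_def)
  then have "(\<integral>\<^sup>+s. h (- s) \<partial>M1) = (\<integral>\<^sup>+s. h (- s) \<partial>M2)" by simp
  then have "(\<integral>\<^sup>+x. h (norm (x :: real ^ 'n)) \<partial>lborel) = (\<integral>\<^sup>+s. h s \<partial>density lborel (\<lambda>s. indicator {0<..} s * ennreal (k s)))"
    unfolding M1_def M2_def by (simp add: nn_integral_distr)
  also have "\<dots> = (\<integral>\<^sup>+s. indicator {0<..} s * (ennreal (k s) * h s) \<partial>lborel)"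
    by (subst nn_integral_density) (auto simp: mult.assoc)
  finally show ?thesis by (simp add: k_def \<sigma>_def n_def)
qed

lemma AE_norm:
  assumes "AE s in lborel. P s"
  shows "AE x in (lborel :: (real ^ 'n) measure). P (norm x)"
proof -
  obtain N where N: "{s. \<not> P s} \<subseteq> N" "N \<in> sets borel" "emeasure lborel N = 0"
    using assms by (auto simp: eventually_ae_filter null_sets_def)
  have [measurable]: "N \<in> sets borel" by fact
  have "(\<integral>\<^sup>+x. indicator N (norm (x :: real ^ 'n)) \<partial>lborel) =
    (\<integral>\<^sup>+s. indicator {0<..} s * (ennreal (real CARD('n) * unit_ball_vol (real CARD('n)) * s ^ (CARD('n) - 1)) * indicator N s) \<partial>lborel)"
    by (rule nn_integral_radial) measurable
  also have "\<dots> = (\<integral>\<^sup>+s. 0 \<partial>(lborel :: real measure))"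
  proof (rule nn_integral_cong_AE)
    have "AE s in lborel. s \<notin> N" using N by (intro AE_not_in null_setsI) auto
    then show "AE s in lborel. indicator {0<..} s * (ennreal (real CARD('n) * unit_ball_vol (real CARD('n)) * s ^ (CARD('n) - 1)) * indicator N s) = 0"
      by eventually_elim auto
  qed
  finally have "(\<integral>\<^sup>+x. indicator N (norm (x :: real ^ 'n)) \<partial>lborel) = 0" by simp
  then have "AE x in (lborel :: (real ^ 'n) measure). indicator N (norm x) = (0 :: ennreal)"
    by (subst (asm) nn_integral_0_iff_AE) auto
  then show ?thesis by eventually_elim (use N(1) in \<open>auto simp: indicator_def split: if_splits\<close>)
qed

definition tail_integral :: "(real \<Rightarrow> real) \<Rightarrow> real \<Rightarrow> real" where
  "tail_integral q r = (\<integral>s. indicator {r<..} s * q s \<partial>lborel)"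

lemma tail_integral_measurable [measurable]:
  assumes [measurable]: "q \<in> borel_measurable borel"
  shows "tail_integral q \<in> borel_measurable borel"
proof -
  have "tail_integral q = (\<lambda>r. \<integral>s. (if r < s then q s else 0) \<partial>lborel)"
    by (auto simp: fun_eq_iff tail_integral_def indicator_def intro!: Bochner_Integration.integral_cong)
  then show ?thesis by simp
qed

text \<open>Since \<open>q\<close> vanishes near 0, the radial function with profile
  \<open>tail_integral q\<close> is constant near the origin and hence C^1 everywhere. The claim is
  the vanishing of the integral of the gradient of its product with \<phi>.\<close>

lemma radial_ibp_continuous:
  fixes \<phi> :: "real ^ 'n \<Rightarrow> real"
  assumes \<phi>: "C1_compact UNIV \<phi>" and q: "continuous_on UNIV q" and a: "0 < a" and supp: "\<And>s. s \<notin> {a..b} \<Longrightarrow> q s = 0"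
  shows "(\<integral>x. tail_integral q (norm x) * grad \<phi> x $ i \<partial>lborel) = (\<integral>x. \<phi> x * (q (norm x) / norm x * x $ i) \<partial>lborel)"
proof -
  define K where "K = (\<integral>s. q s \<partial>lborel)"
  define f where "f r = K - integral {0..r} q" for r
  have qi: "integrable lborel q"
    by (rule integrable_continuous_compact_support[OF q compact_Icc supp])
  have tf: "tail_integral q r = f r" if "r \<ge> 0" for r
  proof -
    have si: "set_integrable lborel {0..r} q"
      unfolding set_integrable_def by (rule borel_integrable_compact) (auto intro: continuous_on_subset[OF q])
    have "tail_integral q r = (\<integral>s. q s - indicator {0..r} s *\<^sub>R q s \<partial>lborel)"
      unfolding tail_integral_def
    proof (rule Bochner_Integration.integral_cong)
      fix s
      have "q s = 0" if "s < 0" using supp[of s] a that by auto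
      then show "indicator {r<..} s * q s = q s - indicator {0..r} s *\<^sub>R q s"
        using \<open>r \<ge> 0\<close> by (cases "s < 0") (auto simp: indicator_def)
    qed simp
    also have "\<dots> = K - (LINT s:{0..r}|lborel. q s)"
      unfolding K_def set_lebesgue_integral_def
      using qi si by (subst Bochner_Integration.integral_diff) (auto simp: set_integrable_def)
    also have "(LINT s:{0..r}|lborel. q s) = integral {0..r} q"
      by (rule set_borel_integral_eq_integral(2)[OF si])
    finally show ?thesis by (simp add: f_def)
  qed
  have fd: "(f has_real_derivative - q r) (at r)" if r: "r > 0" for r
  proof -
    have "((\<lambda>r. integral {0..r} q) has_real_derivative q r) (at r within {0..r + 1})"
      using r by (intro integral_has_real_derivative continuous_on_subset[OF q]) auto
    moreover have "at r within {0..r + 1} = at r" using r by (intro at_within_interior) auto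
    ultimately show ?thesis unfolding f_def by (auto intro!: derivative_eq_intros)
  qed
  have f0: "f r = K" if "r < a" for r
  proof -
    have "integral {0..r} q = integral {0..r} (\<lambda>_. 0)"
      using that supp by (intro integral_cong) auto
    then show ?thesis by (simp add: f_def)
  qed
  define w where "w x = f (norm x)" for x :: "real ^ 'n"
  define gw where "gw x = - (q (norm x) / norm x) *\<^sub>R x" for x :: "real ^ 'n"
  have wd: "(w has_derivative (\<lambda>h. gw x \<bullet> h)) (at x)" for x
  proof (cases "norm x < a")
    case True
    have "((\<lambda>_. K) has_derivative (\<lambda>h. gw x \<bullet> h)) (at x)"
      using True supp[of "norm x"] by (simp add: gw_def)
    then show ?thesis
      by (rule has_derivative_transform_within_open[OF _ open_ball[of 0 a]]) (use True in \<open>auto simp: w_def f0\<close>)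
  next
    case False
    then have x: "norm x > 0" "x \<noteq> 0" using a by auto
    have "(w has_derivative (\<lambda>h. - q (norm x) * (h \<bullet> sgn x))) (at x)"
      unfolding w_def
      by (rule has_derivative_eq_rhs, rule has_derivative_compose[OF has_derivative_norm[OF x(2)] fd[OF x(1), THEN has_field_derivative_imp_has_derivative]]) simp
    then show ?thesis
      by (rule has_derivative_eq_rhs) (auto simp: gw_def sgn_div_norm inner_commute divide_inverse)
  qed
  have gwc: "continuous_on UNIV gw"
  proof -
    have "continuous_on (- {0} \<union> ball 0 a) gw"
    proof (rule continuous_on_open_Un)
      have qn: "continuous_on (- {0}) (\<lambda>x :: real ^ 'n. q (norm x))"
        by (rule continuous_on_compose2[OF q]) (auto intro!: continuous_intros)
      show "continuous_on (- {0}) gw"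
        unfolding gw_def by (intro continuous_intros qn) auto
      have "gw x = 0" if "x \<in> ball 0 a" for x using that supp[of "norm x"] by (auto simp: gw_def)
      then show "continuous_on (ball 0 a) gw"
        by (intro continuous_on_eq[OF continuous_on_const[of _ 0]]) auto
    qed (auto simp: open_Compl)
    moreover have "- {0} \<union> ball (0 :: real ^ 'n) a = UNIV" using a by auto
    ultimately show ?thesis by simp
  qed
  have wc: "continuous_on UNIV w"
    by (rule has_derivative_continuous_on) (use wd has_derivative_at_withinI in blast)
  have C: "C1_compact UNIV (\<lambda>x. \<phi> x * w x)" "grad (\<lambda>x. \<phi> x * w x) x = \<phi> x *\<^sub>R gw x + w x *\<^sub>R grad \<phi> x" for x
    using C1_compact_mult_local[OF \<phi> open_UNIV wd gwc] by auto
  define S where "S = closure {x. \<phi> x \<noteq> 0}"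
  have S: "compact S" "\<And>x. x \<notin> S \<Longrightarrow> \<phi> x = 0" "\<And>x. x \<notin> S \<Longrightarrow> grad \<phi> x = 0"
    unfolding S_def using C1_compactD(4)[OF \<phi>] C1_compact_zero[OF \<phi>] by blast+
  have i1: "integrable lborel (\<lambda>x. \<phi> x * gw x $ i)"
    by (rule integrable_continuous_compact_support[OF _ S(1)])
       (use S(2) in \<open>auto intro!: continuous_intros C1_compactD(3)[OF \<phi>] gwc\<close>)
  have i2: "integrable lborel (\<lambda>x. w x * grad \<phi> x $ i)"
    by (rule integrable_continuous_compact_support[OF _ S(1)])
       (use S(3) in \<open>auto intro!: continuous_intros C1_compactD(2)[OF \<phi>] wc\<close>)
  have "0 = (\<integral>x. \<phi> x * gw x $ i + w x * grad \<phi> x $ i \<partial>lborel)"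
    using integral_grad_eq_0[OF C(1), of i] by (simp add: C(2))
  also have "\<dots> = (\<integral>x. \<phi> x * gw x $ i \<partial>lborel) + (\<integral>x. w x * grad \<phi> x $ i \<partial>lborel)"
    by (rule Bochner_Integration.integral_add[OF i1 i2])
  also have "(\<integral>x. \<phi> x * gw x $ i \<partial>lborel) = - (\<integral>x. \<phi> x * (q (norm x) / norm x * x $ i) \<partial>lborel)"
    by (simp add: gw_def)
  also have "(\<integral>x. w x * grad \<phi> x $ i \<partial>lborel) = (\<integral>x. tail_integral q (norm x) * grad \<phi> x $ i \<partial>lborel)"
    by (simp add: w_def tf)
  finally show ?thesis by simp
qed

lemma integrable_mult_indicator_compact:
  fixes h g :: "'a :: euclidean_space \<Rightarrow> real"
  assumes [measurable]: "h \<in> borel_measurable borel" "g \<in> borel_measurable borel"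
    and h: "\<And>x. h x \<ge> 0" and R: "(\<integral>\<^sup>+x. indicator (cball 0 R) x * ennreal (h x) \<partial>lborel) < \<infinity>"
    and g: "\<And>x. \<bar>g x\<bar> \<le> M" "\<And>x. x \<notin> cball 0 R \<Longrightarrow> g x = 0"
  shows "integrable lborel (\<lambda>x. indicator (cball 0 R) x * h x)" "integrable lborel (\<lambda>x. h x * g x)"
proof -
  have [measurable]: "cball (0 :: 'a) R \<in> sets borel" by simp
  show i: "integrable lborel (\<lambda>x. indicator (cball 0 R) x * h x)"
  proof (rule integrableI_nonneg)
    have "(\<integral>\<^sup>+x. ennreal (indicator (cball 0 R) x * h x) \<partial>lborel) = (\<integral>\<^sup>+x. indicator (cball 0 R) x * ennreal (h x) \<partial>lborel)"
      by (intro nn_integral_cong) (auto simp: indicator_def)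
    then show "(\<integral>\<^sup>+x. ennreal (indicator (cball 0 R) x * h x) \<partial>lborel) < \<infinity>" using R by simp
  qed (use h in auto)
  show "integrable lborel (\<lambda>x. h x * g x)"
  proof (rule Bochner_Integration.integrable_bound)
    show "integrable lborel (\<lambda>x. M * (indicator (cball 0 R) x * h x))" using i by simp
    have "norm (h x * g x) \<le> norm (M * (indicator (cball 0 R) x * h x))" for x
    proof (cases "x \<in> cball 0 R")
      case True
      have "\<bar>h x * g x\<bar> \<le> h x * M" using h[of x] g(1)[of x] by (simp add: abs_mult mult_left_mono)
      then show ?thesis using True by (simp add: mult.commute)
    qed (use g(2) in simp)
    then show "AE x in lborel. norm (h x * g x) \<le> norm (M * (indicator (cball 0 R) x * h x))" by simp
  qed measurable
qed

text \<open>Dominated convergence from the continuous case. Enlarging the support by a / 2 keeps the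
  approximants away from the origin.\<close>

lemma radial_ibp_bounded:
  fixes \<phi> :: "real ^ 'n \<Rightarrow> real"
  assumes \<phi>: "C1_compact UNIV \<phi>" and qm [measurable]: "q \<in> borel_measurable borel"
    and q: "\<And>s. 0 \<le> q s" "\<And>s. q s \<le> L" and a: "0 < a" and supp: "\<And>s. s \<notin> {a..b} \<Longrightarrow> q s = 0"
  shows "(\<integral>x. tail_integral q (norm x) * grad \<phi> x $ i \<partial>lborel) = (\<integral>x. \<phi> x * (q (norm x) / norm x * x $ i) \<partial>lborel)"
proof -
  have L: "L \<ge> 0" using q order_trans by blast
  obtain c where c: "\<And>j::nat. continuous_on UNIV (c j)" "\<And>j x. 0 \<le> c j x" "\<And>j x. c j x \<le> L"
    "\<And>j x. x \<notin> {a - a/2..b + a/2} \<Longrightarrow> c j x = 0" "AE x in lborel. (\<lambda>j. c j x) \<longlonglongrightarrow> q x"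
    using continuous_approx_borel[of q L a b "a/2"] q supp a by auto
  have [measurable]: "c j \<in> borel_measurable borel" for j using c(1) by (rule borel_measurable_continuous_onI)
  have eq: "(\<integral>x. tail_integral (c j) (norm x) * grad \<phi> x $ i \<partial>lborel) = (\<integral>x. \<phi> x * (c j (norm x) / norm x * x $ i) \<partial>lborel)" for j
    by (rule radial_ibp_continuous[OF \<phi> c(1), where a = "a - a/2" and b = "b + a/2"]) (use a c(4) in auto)
  define J where "J = {a - a/2..b + a/2}"
  have ij: "integrable lborel (\<lambda>s. indicator J s * L)"
    using borel_integrable_compact[of J "\<lambda>_. L"] by (simp add: J_def)
  have cb: "\<bar>indicator {r<..} s * c j s\<bar> \<le> indicator J s * L" for r j s
    using c(2,3)[of j s] c(4)[where x = s and j = j] L by (cases "s \<in> J") (auto simp: indicator_def J_def)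
  have tl: "(\<lambda>j. tail_integral (c j) r) \<longlonglongrightarrow> tail_integral q r" for r
    unfolding tail_integral_def
  proof (rule integral_dominated_convergence[OF _ _ ij])
    show "AE s in lborel. (\<lambda>j. indicator {r<..} s * c j s) \<longlonglongrightarrow> indicator {r<..} s * q s"
      using c(5) by eventually_elim (intro tendsto_intros)
    show "AE s in lborel. norm (indicator {r<..} s * c j s) \<le> indicator J s * L" for j using cb by simp
  qed measurable
  define T where "T = (\<integral>s. indicator J s * L \<partial>lborel)"
  have tb: "\<bar>tail_integral (c j) r\<bar> \<le> T" for j r
  proof -
    have i: "integrable lborel (\<lambda>s. indicator {r<..} s * c j s)"
      by (rule Bochner_Integration.integrable_bound[OF ij]) (use cb in \<open>auto intro!: AE_I2 order_trans[OF cb]\<close>)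
    have "\<bar>tail_integral (c j) r\<bar> \<le> (\<integral>s. \<bar>indicator {r<..} s * c j s\<bar> \<partial>lborel)"
      unfolding tail_integral_def by (rule integral_abs_bound)
    also have "\<dots> \<le> T" unfolding T_def using cb by (intro integral_mono ij integrable_abs i) auto
    finally show ?thesis .
  qed
  have [measurable]: "grad \<phi> \<in> borel_measurable borel" "\<phi> \<in> borel_measurable borel" using \<phi> by measurable
  have "(\<lambda>j. \<integral>x. tail_integral (c j) (norm x) * grad \<phi> x $ i \<partial>lborel) \<longlonglongrightarrow> (\<integral>x. tail_integral q (norm x) * grad \<phi> x $ i \<partial>lborel)"
  proof (rule integral_dominated_convergence)
    show "integrable lborel (\<lambda>x. T * norm (grad \<phi> x))" using C1_compact_integrable(2)[OF \<phi>] by auto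
    show "AE x in lborel. (\<lambda>j. tail_integral (c j) (norm x) * grad \<phi> x $ i) \<longlonglongrightarrow> tail_integral q (norm x) * grad \<phi> x $ i"
      by (intro AE_I2 tendsto_intros tl)
    have "\<bar>tail_integral (c j) (norm x)\<bar> * \<bar>grad \<phi> x $ i\<bar> \<le> T * norm (grad \<phi> x)" for j x
      using tb[of j "norm x"] by (intro mult_mono component_le_norm_cart) (auto intro: order_trans[OF abs_ge_zero])
    then show "AE x in lborel. norm (tail_integral (c j) (norm x) * grad \<phi> x $ i) \<le> T * norm (grad \<phi> x)" for j
      by (simp add: abs_mult)
  qed measurable
  moreover have "(\<lambda>j. \<integral>x. \<phi> x * (c j (norm x) / norm x * x $ i) \<partial>lborel) \<longlonglongrightarrow> (\<integral>x. \<phi> x * (q (norm x) / norm x * x $ i) \<partial>lborel)"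
  proof (rule integral_dominated_convergence)
    show "integrable lborel (\<lambda>x. L * \<bar>\<phi> x\<bar>)" using C1_compact_integrable(1)[OF \<phi>] by auto
    show "AE x in lborel. (\<lambda>j. \<phi> x * (c j (norm x) / norm x * x $ i)) \<longlonglongrightarrow> \<phi> x * (q (norm x) / norm x * x $ i)"
      using AE_norm[OF c(5)]
    proof eventually_elim
      fix x :: "real ^ 'n" assume "(\<lambda>j. c j (norm x)) \<longlonglongrightarrow> q (norm x)"
      then show "(\<lambda>j. \<phi> x * (c j (norm x) / norm x * x $ i)) \<longlonglongrightarrow> \<phi> x * (q (norm x) / norm x * x $ i)"
        unfolding divide_inverse by (intro tendsto_intros)
    qed
    have "norm (\<phi> x * (c j (norm x) / norm x * x $ i)) \<le> L * \<bar>\<phi> x\<bar>" for j x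
    proof -
      have "\<bar>x $ i\<bar> / norm x \<le> 1" using component_le_norm_cart[of x i] by (cases "x = 0") auto
      then have "c j (norm x) * (\<bar>x $ i\<bar> / norm x) \<le> L * 1" using c(2,3) L by (intro mult_mono) auto
      then have "\<bar>\<phi> x\<bar> * (c j (norm x) * (\<bar>x $ i\<bar> / norm x)) \<le> \<bar>\<phi> x\<bar> * L" by (intro mult_left_mono) auto
      then show ?thesis using c(2)[of j "norm x"] by (simp add: abs_mult mult.commute)
    qed
    then show "AE x in lborel. norm (\<phi> x * (c j (norm x) / norm x * x $ i)) \<le> L * \<bar>\<phi> x\<bar>" for j by simp
  qed measurable
  ultimately show ?thesis unfolding eq using LIMSEQ_unique by blast
qed

text \<open>\<open>q\<close> is cut off in height and to radii in [1 / (N + 1), N]. The tail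
  integrals converge to \<open>w\<close> from below, so \<open>w\<close> and \<open>q\<close>
  themselves, locally integrable in space, dominate the two sides.\<close>

lemma radial_ibp:
  fixes \<phi> :: "real ^ 'n \<Rightarrow> real"
  assumes \<phi>: "C1_compact UNIV \<phi>" and [measurable]: "q \<in> borel_measurable borel" "w \<in> borel_measurable borel"
    and q: "\<And>s. 0 \<le> q s" and w: "\<And>s. 0 \<le> w s"
    and qw: "\<And>r. r > 0 \<Longrightarrow> (\<integral>\<^sup>+s. indicator {r<..} s * ennreal (q s) \<partial>lborel) = ennreal (w r)"
    and lq: "\<And>R. (\<integral>\<^sup>+x. indicator (cball (0 :: real ^ 'n) R) x * ennreal (q (norm x)) \<partial>lborel) < \<infinity>"
    and lw: "\<And>R. (\<integral>\<^sup>+x. indicator (cball (0 :: real ^ 'n) R) x * ennreal (w (norm x)) \<partial>lborel) < \<infinity>"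
  shows "(\<integral>x. w (norm x) * grad \<phi> x $ i \<partial>lborel) = (\<integral>x. \<phi> x * (q (norm x) / norm x * x $ i) \<partial>lborel)"
proof -
  have [measurable]: "grad \<phi> \<in> borel_measurable borel" "\<phi> \<in> borel_measurable borel" using \<phi> by measurable
  define p where "p N s = min (q s) (real N) * indicator {1 / real (Suc N)..real N} s" for N s
  have [measurable]: "p N \<in> borel_measurable borel" for N unfolding p_def by measurable
  have p: "0 \<le> p N s" "p N s \<le> real N" "p N s \<le> q s" for N s
    using q[of s] by (auto simp: p_def indicator_def)
  have plim: "(\<lambda>N. p N s) \<longlonglongrightarrow> q s" if "s > 0" for s
  proof (rule tendsto_eventually)
    obtain N0 where N0: "real N0 > max (1 / s) (max (q s) s)" using reals_Archimedean2 by blast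
    show "\<forall>\<^sub>F N in sequentially. p N s = q s"
    proof (rule eventually_sequentiallyI[of N0])
      fix N assume "N0 \<le> N"
      then have N: "real N > 1 / s" "real N > q s" "real N > s" using N0 by linarith+
      have "1 / real (Suc N) \<le> s" using N(1) that by (simp add: field_simps)
      then show "p N s = q s" using N by (simp add: p_def)
    qed
  qed
  have eq: "(\<integral>x. tail_integral (p N) (norm x) * grad \<phi> x $ i \<partial>lborel) = (\<integral>x. \<phi> x * (p N (norm x) / norm x * x $ i) \<partial>lborel)" for N
    by (rule radial_ibp_bounded[OF \<phi> _ p(1,2), where a = "1 / real (Suc N)" and b = "real N"]) (auto simp: p_def)
  have tb: "0 \<le> tail_integral (p N) r" "tail_integral (p N) r \<le> w r" if r: "r > 0" for N r
  proof -
    show "0 \<le> tail_integral (p N) r" unfolding tail_integral_def using p by (intro Bochner_Integration.integral_nonneg) auto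
    have "tail_integral (p N) r = enn2real (\<integral>\<^sup>+s. ennreal (indicator {r<..} s * p N s) \<partial>lborel)"
      unfolding tail_integral_def using p by (intro integral_eq_nn_integral) auto
    also have "\<dots> \<le> enn2real (ennreal (w r))"
      unfolding qw[OF r, symmetric] using p qw[OF r]
      by (intro enn2real_mono nn_integral_mono) (auto simp: indicator_def intro!: ennreal_leI)
    finally show "tail_integral (p N) r \<le> w r" using w by simp
  qed
  have tl: "(\<lambda>N. tail_integral (p N) r) \<longlonglongrightarrow> w r" if r: "r > 0" for r
  proof -
    have qi: "integrable lborel (\<lambda>s. indicator {r<..} s * q s)"
    proof (rule integrableI_nonneg)
      have "(\<integral>\<^sup>+s. ennreal (indicator {r<..} s * q s) \<partial>lborel) = ennreal (w r)"
        unfolding qw[OF r, symmetric] by (intro nn_integral_cong) (auto simp: indicator_def)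
      then show "(\<integral>\<^sup>+s. ennreal (indicator {r<..} s * q s) \<partial>lborel) < \<infinity>" by simp
    qed (use q in auto)
    have "(\<lambda>N. tail_integral (p N) r) \<longlonglongrightarrow> (\<integral>s. indicator {r<..} s * q s \<partial>lborel)"
      unfolding tail_integral_def
    proof (rule integral_dominated_convergence[OF _ _ qi])
      have "(\<lambda>N. indicator {r<..} s * p N s) \<longlonglongrightarrow> indicator {r<..} s * q s" for s
        using plim[of s] r by (cases "s > r") (auto intro!: tendsto_intros)
      then show "AE s in lborel. (\<lambda>N. indicator {r<..} s * p N s) \<longlonglongrightarrow> indicator {r<..} s * q s" by simp
      show "AE s in lborel. norm (indicator {r<..} s * p N s) \<le> indicator {r<..} s * q s" for N
        using p by (intro AE_I2) (auto simp: indicator_def)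
    qed measurable
    also have "(\<integral>s. indicator {r<..} s * q s \<partial>lborel) = enn2real (\<integral>\<^sup>+s. ennreal (indicator {r<..} s * q s) \<partial>lborel)"
      using q by (intro integral_eq_nn_integral) auto
    also have "(\<integral>\<^sup>+s. ennreal (indicator {r<..} s * q s) \<partial>lborel) = ennreal (w r)"
      unfolding qw[OF r, symmetric] by (intro nn_integral_cong) (auto simp: indicator_def)
    finally show ?thesis using w by simp
  qed
  obtain M where M: "M > 0" "\<And>x. norm (grad \<phi> x) \<le> M" using C1_compact_bounded_grad[OF \<phi>] by blast
  define S where "S = closure {x. \<phi> x \<noteq> 0}"
  have S: "compact S" "\<And>x. x \<notin> S \<Longrightarrow> \<phi> x = 0" "\<And>x. x \<notin> S \<Longrightarrow> grad \<phi> x = 0"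
    unfolding S_def using C1_compactD(4)[OF \<phi>] C1_compact_zero[OF \<phi>] by blast+
  obtain R where R: "S \<subseteq> cball 0 R"
    using bounded_subset_ballD[OF compact_imp_bounded[OF S(1)], of 0] ball_subset_cball by blast
  have gi: "\<bar>grad \<phi> x $ i\<bar> \<le> M" "x \<notin> cball 0 R \<Longrightarrow> grad \<phi> x $ i = 0" "x \<notin> cball 0 R \<Longrightarrow> \<phi> x = 0" for x
  proof -
    show "\<bar>grad \<phi> x $ i\<bar> \<le> M" by (rule order_trans[OF component_le_norm_cart M(2)])
    show "x \<notin> cball 0 R \<Longrightarrow> grad \<phi> x $ i = 0" "x \<notin> cball 0 R \<Longrightarrow> \<phi> x = 0"
      using R S(2,3)[of x] by (cases "x \<in> S"; auto simp: subset_iff)+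
  qed
  have "compact (\<phi> ` S)"
    using C1_compactD(3)[OF \<phi>] S(1) by (intro compact_continuous_image) auto
  then have "bounded (\<phi> ` S)" by (rule compact_imp_bounded)
  then obtain F where F: "\<And>x. x \<in> S \<Longrightarrow> \<bar>\<phi> x\<bar> \<le> F"
    unfolding bounded_iff by auto
  have Fb: "\<bar>\<phi> x\<bar> \<le> \<bar>F\<bar>" for x
    using F[of x] S(2)[of x] by (cases "x \<in> S") auto
  have n0: "AE x in lborel. (x :: real ^ 'n) \<noteq> 0" by (rule AE_lborel_singleton)
  have "(\<lambda>N. \<integral>x. tail_integral (p N) (norm x) * grad \<phi> x $ i \<partial>lborel) \<longlonglongrightarrow> (\<integral>x. w (norm x) * grad \<phi> x $ i \<partial>lborel)"
  proof (rule integral_dominated_convergence)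
    show "integrable lborel (\<lambda>x. w (norm x) * \<bar>grad \<phi> x $ i\<bar>)"
      by (rule integrable_mult_indicator_compact(2)[OF _ _ _ lw[of R], of _ M]) (use w gi in auto)
    show "AE x in lborel. (\<lambda>N. tail_integral (p N) (norm x) * grad \<phi> x $ i) \<longlonglongrightarrow> w (norm x) * grad \<phi> x $ i"
      using n0 by eventually_elim (intro tendsto_intros tl, simp)
    show "AE x in lborel. norm (tail_integral (p N) (norm x) * grad \<phi> x $ i) \<le> w (norm x) * \<bar>grad \<phi> x $ i\<bar>" for N
      using n0
    proof eventually_elim
      fix x :: "real ^ 'n" assume "x \<noteq> 0"
      then show "norm (tail_integral (p N) (norm x) * grad \<phi> x $ i) \<le> w (norm x) * \<bar>grad \<phi> x $ i\<bar>"
        using tb[of "norm x" N] by (simp add: abs_mult mult_right_mono)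
    qed
  qed measurable
  moreover have "(\<lambda>N. \<integral>x. \<phi> x * (p N (norm x) / norm x * x $ i) \<partial>lborel) \<longlonglongrightarrow> (\<integral>x. \<phi> x * (q (norm x) / norm x * x $ i) \<partial>lborel)"
  proof (rule integral_dominated_convergence)
    show "integrable lborel (\<lambda>x. q (norm x) * \<bar>\<phi> x\<bar>)"
      by (rule integrable_mult_indicator_compact(2)[OF _ _ _ lq[of R], of _ "\<bar>F\<bar>"]) (use q gi Fb in auto)
    show "AE x in lborel. (\<lambda>N. \<phi> x * (p N (norm x) / norm x * x $ i)) \<longlonglongrightarrow> \<phi> x * (q (norm x) / norm x * x $ i)"
      using n0
    proof eventually_elim
      fix x :: "real ^ 'n" assume "x \<noteq> 0"
      then have "(\<lambda>N. p N (norm x)) \<longlonglongrightarrow> q (norm x)" by (intro plim) simp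
      then show "(\<lambda>N. \<phi> x * (p N (norm x) / norm x * x $ i)) \<longlonglongrightarrow> \<phi> x * (q (norm x) / norm x * x $ i)"
        unfolding divide_inverse by (intro tendsto_intros)
    qed
    have "norm (\<phi> x * (p N (norm x) / norm x * x $ i)) \<le> q (norm x) * \<bar>\<phi> x\<bar>" for N x
    proof -
      have "\<bar>x $ i\<bar> / norm x \<le> 1" using component_le_norm_cart[of x i] by (cases "x = 0") auto
      then have "p N (norm x) * (\<bar>x $ i\<bar> / norm x) \<le> q (norm x) * 1" using p q by (intro mult_mono) auto
      then have "\<bar>\<phi> x\<bar> * (p N (norm x) * (\<bar>x $ i\<bar> / norm x)) \<le> \<bar>\<phi> x\<bar> * q (norm x)" by (intro mult_left_mono) auto
      then show ?thesis using p(1)[of N "norm x"] by (simp add: abs_mult mult.commute)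
    qed
    then show "AE x in lborel. norm (\<phi> x * (p N (norm x) / norm x * x $ i)) \<le> q (norm x) * \<bar>\<phi> x\<bar>" for N by simp
  qed measurable
  ultimately show ?thesis unfolding eq using LIMSEQ_unique by blast
qed


section \<open>Uniqueness of weak gradients\<close>

text \<open>A family containing the standard flat function \<open>exp (- 1 / t)\<close> and closed under differentiation.\<close>

definition flat :: "real poly \<Rightarrow> real \<Rightarrow> real" where
  "flat p t = (if t > 0 then poly p (1 / t) * exp (- (1 / t)) else 0)"

lemma power_poly_exp_tendsto_0:
  fixes p :: "real poly"
  shows "((\<lambda>y. y ^ k * poly p y * exp (- y)) \<longlongrightarrow> 0) at_top"
proof (induction p arbitrary: k)
  case 0
  then show ?case by simp
next
  case (pCons a p)
  have "((\<lambda>y. a * (y ^ k / exp y) + y ^ Suc k * poly p y * exp (- y)) \<longlongrightarrow> a * 0 + 0) at_top"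
    by (intro tendsto_intros tendsto_power_div_exp_0 pCons.IH)
  then show ?case by (simp add: algebra_simps exp_minus divide_inverse)
qed

text \<open>In y = 1 / t the derivative of t is -1 / y^2, so the polynomial p becomes y^2 (p - p');
  the two \<open>pCons 0\<close> are the multiplication by y^2. At t = 0 the exponential beats every
  power of y.\<close>

lemma DERIV_flat: "(flat p has_real_derivative flat (pCons 0 (pCons 0 (p - pderiv p))) t) (at t)"
proof -
  consider "t > 0" | "t < 0" | "t = 0" by linarith
  then show ?thesis
  proof cases
    case 1
    have "((\<lambda>t. poly p (1 / t)) has_real_derivative poly (pderiv p) (1 / t) * (- (1 / t\<^sup>2))) (at t)"
      by (rule DERIV_chain2[OF poly_DERIV]) (use 1 in \<open>auto intro!: derivative_eq_intros simp: power2_eq_square\<close>)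
    moreover have "((\<lambda>t. exp (- (1 / t))) has_real_derivative exp (- (1 / t)) * (1 / t\<^sup>2)) (at t)"
      by (rule DERIV_chain2[OF DERIV_exp]) (use 1 in \<open>auto intro!: derivative_eq_intros simp: power2_eq_square\<close>)
    ultimately have "((\<lambda>t. poly p (1 / t) * exp (- (1 / t))) has_real_derivative
        poly (pderiv p) (1 / t) * (- (1 / t\<^sup>2)) * exp (- (1 / t)) + exp (- (1 / t)) * (1 / t\<^sup>2) * poly p (1 / t)) (at t)"
      by (rule DERIV_mult)
    also have "poly (pderiv p) (1 / t) * (- (1 / t\<^sup>2)) * exp (- (1 / t)) + exp (- (1 / t)) * (1 / t\<^sup>2) * poly p (1 / t)
      = flat (pCons 0 (pCons 0 (p - pderiv p))) t"
      using 1 by (simp add: flat_def power2_eq_square algebra_simps)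
    finally show ?thesis
      by (rule has_field_derivative_transform_within_open[where S = "{0<..}"]) (use 1 in \<open>auto simp: flat_def\<close>)
  next
    case 2
    have "((\<lambda>t. 0::real) has_real_derivative flat (pCons 0 (pCons 0 (p - pderiv p))) t) (at t)"
      using 2 by (simp add: flat_def)
    then show ?thesis
      by (rule has_field_derivative_transform_within_open[where S = "{..<0}"]) (use 2 in \<open>auto simp: flat_def\<close>)
  next
    case 3
    have "((\<lambda>h. flat p h / h) \<longlongrightarrow> 0) (at 0)"
    proof (rule filterlim_split_at)
      have "\<forall>\<^sub>F h in at_left 0. flat p h / h = 0"
        by (auto simp: eventually_at_filter flat_def)
      then show "((\<lambda>h. flat p h / h) \<longlongrightarrow> 0) (at_left 0)" by (rule tendsto_eventually)
      have "((\<lambda>h. inverse h ^ 1 * poly p (inverse h) * exp (- inverse h)) \<longlongrightarrow> 0) (at_right (0::real))"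
        by (rule filterlim_compose[OF power_poly_exp_tendsto_0 filterlim_inverse_at_top_right])
      moreover have "\<forall>\<^sub>F h in at_right 0. inverse h ^ 1 * poly p (inverse h) * exp (- inverse h) = flat p h / h"
        by (auto simp: eventually_at_filter flat_def inverse_eq_divide)
      ultimately show "((\<lambda>h. flat p h / h) \<longlongrightarrow> 0) (at_right 0)"
        by (rule Lim_transform_eventually)
    qed
    then show ?thesis using 3 by (simp add: DERIV_def flat_def)
  qed
qed

section \<open>Smooth bump functions of boxes\<close>

lemma Ck_SucI:
  fixes f :: "real ^ 'n \<Rightarrow> real"
  assumes d: "\<And>x. (f has_derivative (\<lambda>h. G x \<bullet> h)) (at x)" and G: "\<And>i. Ck k (\<lambda>x. G x $ i)"
  shows "Ck (Suc k) f"
proof -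
  have "grad f = G" using grad_eqI[OF d] by auto
  then show ?thesis using d G by (auto simp: differentiable_def)
qed

lemma Ck_SucD:
  fixes f :: "real ^ 'n \<Rightarrow> real"
  assumes "Ck (Suc k) f"
  shows "(f has_derivative (\<lambda>h. grad f x \<bullet> h)) (at x)" "Ck k (\<lambda>x. grad f x $ i)"
  using assms has_derivative_grad[of f x] by auto

lemma Ck_continuous: "Ck k f \<Longrightarrow> continuous_on UNIV f"
  by (cases k) (auto intro!: differentiable_imp_continuous_on simp: differentiable_on_def differentiable_at_withinI)

lemma Ck_Suc: "Ck (Suc k) f \<Longrightarrow> Ck k f"
proof (induction k arbitrary: f)
  case 0
  then show ?case using Ck_continuous[of "Suc 0" f] by simp
next
  case (Suc k)
  show ?case by (rule Ck_SucI[OF Ck_SucD(1)[OF Suc.prems]]) (rule Suc.IH[OF Ck_SucD(2)[OF Suc.prems]])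
qed

lemma Ck_const: "Ck k (\<lambda>x :: real ^ 'n. c)"
proof (induction k arbitrary: c)
  case (Suc k)
  show ?case by (rule Ck_SucI[where G = "\<lambda>_. 0"]) (simp_all add: Suc.IH)
qed simp

lemma Ck_add: "Ck k f \<Longrightarrow> Ck k g \<Longrightarrow> Ck k (\<lambda>x :: real ^ 'n. f x + g x)"
proof (induction k arbitrary: f g)
  case (Suc k)
  show ?case
  proof (rule Ck_SucI[where G = "\<lambda>x. grad f x + grad g x"])
    show "((\<lambda>x. f x + g x) has_derivative (\<lambda>h. (grad f x + grad g x) \<bullet> h)) (at x)" for x
      unfolding inner_add_left by (intro has_derivative_add Ck_SucD(1)[OF Suc.prems(1)] Ck_SucD(1)[OF Suc.prems(2)])
    show "Ck k (\<lambda>x. (grad f x + grad g x) $ i)" for i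
      unfolding vector_add_component by (intro Suc.IH Ck_SucD(2)[OF Suc.prems(1)] Ck_SucD(2)[OF Suc.prems(2)])
  qed
qed (auto intro: continuous_intros)

lemma Ck_mult: "Ck k f \<Longrightarrow> Ck k g \<Longrightarrow> Ck k (\<lambda>x :: real ^ 'n. f x * g x)"
proof (induction k arbitrary: f g)
  case (Suc k)
  show ?case
  proof (rule Ck_SucI[where G = "\<lambda>x. f x *\<^sub>R grad g x + g x *\<^sub>R grad f x"])
    show "((\<lambda>x. f x * g x) has_derivative (\<lambda>h. (f x *\<^sub>R grad g x + g x *\<^sub>R grad f x) \<bullet> h)) (at x)" for x
      by (rule has_derivative_eq_rhs, rule has_derivative_mult[OF Ck_SucD(1)[OF Suc.prems(1)] Ck_SucD(1)[OF Suc.prems(2)]])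
         (auto simp: inner_simps algebra_simps)
    have "Ck k (\<lambda>x. f x * grad g x $ i + g x * grad f x $ i)" for i
      by (intro Ck_add Suc.IH Ck_SucD(2)[OF Suc.prems(1)] Ck_SucD(2)[OF Suc.prems(2)] Ck_Suc[OF Suc.prems(1)] Ck_Suc[OF Suc.prems(2)])
    then show "Ck k (\<lambda>x. (f x *\<^sub>R grad g x + g x *\<^sub>R grad f x) $ i)" for i by simp
  qed
qed (auto intro: continuous_intros)

lemma Ck_prod:
  "finite I \<Longrightarrow> (\<And>i. i \<in> I \<Longrightarrow> Ck k (f i)) \<Longrightarrow> Ck k (\<lambda>x :: real ^ 'n. \<Prod>i\<in>I. f i x)"
  by (induction I rule: finite_induct) (auto intro: Ck_mult simp: Ck_const)

lemma Ck_flat: "Ck k (\<lambda>x :: real ^ 'n. flat p (\<alpha> * x $ j + \<beta>))"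
proof (induction k arbitrary: p)
  case 0
  have "continuous_on UNIV (flat p)"
    using DERIV_flat[of p] by (auto intro!: continuous_at_imp_continuous_on DERIV_isCont)
  then have "continuous_on UNIV (\<lambda>x :: real ^ 'n. flat p (\<alpha> * x $ j + \<beta>))"
    by (rule continuous_on_compose2) (auto intro!: continuous_intros)
  then show ?case by simp
next
  case (Suc k)
  let ?p = "pCons 0 (pCons 0 (p - pderiv p))"
  show ?case
  proof (rule Ck_SucI[where G = "\<lambda>x. (flat ?p (\<alpha> * x $ j + \<beta>) * \<alpha>) *\<^sub>R axis j 1"])
    fix x :: "real ^ 'n"
    have 1: "((\<lambda>x. \<alpha> * x $ j + \<beta>) has_derivative (\<lambda>h. \<alpha> * h $ j)) (at x)"
      by (intro has_derivative_add_const has_derivative_mult_right bounded_linear_imp_has_derivative bounded_linear_vec_nth)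
    show "((\<lambda>x. flat p (\<alpha> * x $ j + \<beta>)) has_derivative (\<lambda>h. ((flat ?p (\<alpha> * x $ j + \<beta>) * \<alpha>) *\<^sub>R axis j 1) \<bullet> h)) (at x)"
      by (rule has_derivative_eq_rhs, rule has_derivative_compose[OF 1 DERIV_flat[THEN has_field_derivative_imp_has_derivative]])
         (auto simp: inner_axis' mult.assoc)
  next
    fix i
    have "Ck k (\<lambda>x :: real ^ 'n. flat ?p (\<alpha> * x $ j + \<beta>) * (\<alpha> * axis j 1 $ i))"
      by (intro Ck_mult Suc.IH Ck_const)
    then show "Ck k (\<lambda>x :: real ^ 'n. ((flat ?p (\<alpha> * x $ j + \<beta>) * \<alpha>) *\<^sub>R axis j 1) $ i)"
      by (simp add: mult.assoc)
  qed
qed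

text \<open>A product of functions exp (-1 / t), with t running over m times the distances to the
  faces of the box. As m grows it tends to 1 inside the box while remaining 0 outside: a smooth
  approximation of the indicator that never exceeds it.\<close>

definition box_bump :: "real ^ 'n \<Rightarrow> real ^ 'n \<Rightarrow> real \<Rightarrow> real ^ 'n \<Rightarrow> real" where
  "box_bump a b m x = (\<Prod>i\<in>UNIV. flat 1 (m * x $ i + - m * a $ i) * flat 1 (- m * x $ i + m * b $ i))"

lemma flat_1: "0 \<le> flat 1 t" "flat 1 t \<le> 1" "flat 1 t \<noteq> 0 \<longleftrightarrow> t > 0"
  by (auto simp: flat_def)

lemma box_bump:
  fixes a b :: "real ^ 'n"
  assumes m: "m > 0"
  shows "0 \<le> box_bump a b m x" "box_bump a b m x \<le> 1" "box_bump a b m x \<noteq> 0 \<longleftrightarrow> x \<in> box a b"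
proof -
  show "0 \<le> box_bump a b m x" unfolding box_bump_def by (intro prod_nonneg) (simp add: flat_1)
  show "box_bump a b m x \<le> 1" unfolding box_bump_def
    by (intro prod_le_1) (auto simp: flat_1 intro!: mult_le_one)
  have "m * x $ i + - m * a $ i = m * (x $ i - a $ i)" "- m * x $ i + m * b $ i = m * (b $ i - x $ i)" for i
    by (simp_all add: algebra_simps)
  then have "flat 1 (m * x $ i + - m * a $ i) * flat 1 (- m * x $ i + m * b $ i) \<noteq> 0 \<longleftrightarrow> a $ i < x $ i \<and> x $ i < b $ i" for i
    using m by (simp add: flat_1 zero_less_mult_iff)
  then show "box_bump a b m x \<noteq> 0 \<longleftrightarrow> x \<in> box a b"
    unfolding box_bump_def by (simp add: mem_box_cart)
qed

lemma box_bump_test_function: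
  assumes "m > 0" "cbox a b \<subseteq> U"
  shows "box_bump a b m \<in> test_functions U"
proof -
  have "Ck k (box_bump a b m)" for k
    unfolding box_bump_def by (intro Ck_prod Ck_mult Ck_flat) auto
  moreover have sub: "closure {x. box_bump a b m x \<noteq> 0} \<subseteq> cbox a b"
    unfolding box_bump(3)[OF assms(1)] by (intro closure_minimal) (auto simp: box_subset_cbox)
  moreover have "compact (closure {x. box_bump a b m x \<noteq> 0})"
    using compact_Int_closed[OF compact_cbox closed_closure[of "{x. box_bump a b m x \<noteq> 0}"], of a b] sub
    by (simp add: Int_absorb1)
  ultimately show ?thesis using assms(2) unfolding test_functions_def by auto
qed

lemma box_bump_tendsto:
  fixes a b :: "real ^ 'n"
  shows "(\<lambda>m. box_bump a b (real (Suc m)) x) \<longlonglongrightarrow> indicator (box a b) x"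
proof (cases "x \<in> box a b")
  case True
  have 1: "(\<lambda>m. flat 1 (real (Suc m) * t)) \<longlonglongrightarrow> 1" if "t > 0" for t
  proof -
    have "(\<lambda>m. exp (- ((1 / t) * inverse (real (Suc m))))) \<longlonglongrightarrow> exp (- ((1 / t) * 0))"
      by (intro tendsto_intros LIMSEQ_inverse_real_of_nat)
    then show ?thesis using that by (simp add: flat_def inverse_eq_divide ac_simps)
  qed
  have "(\<lambda>m. box_bump a b (real (Suc m)) x) \<longlonglongrightarrow> (\<Prod>i\<in>(UNIV :: 'n set). 1 * 1)"
    unfolding box_bump_def
  proof (intro tendsto_intros)
    fix i
    have "x $ i - a $ i > 0" "b $ i - x $ i > 0" using True by (auto simp: mem_box_cart)
    from 1[OF this(1)] 1[OF this(2)]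
    show "(\<lambda>m. flat 1 (real (Suc m) * x $ i + - real (Suc m) * a $ i)) \<longlonglongrightarrow> 1"
      "(\<lambda>m. flat 1 (- real (Suc m) * x $ i + real (Suc m) * b $ i)) \<longlonglongrightarrow> 1"
      by (simp_all add: algebra_simps)
  qed
  then show ?thesis using True by simp
next
  case False
  then have "box_bump a b (real (Suc m)) x = 0" for m using box_bump(3)[of "real (Suc m)" a b x] by auto
  then show ?thesis using False by simp
qed

lemma norm_scaleR_le: "0 \<le> c \<Longrightarrow> c \<le> 1 \<Longrightarrow> norm (c *\<^sub>R v) \<le> norm v"
  by (simp add: mult_left_le_one_le)

text \<open>Both fields have the same integral against each \<open>box_bump\<close>. These functions
  tend to the indicator of the open box, and the difference of the fields is integrable on the
  closed box, which gives the dominating function.\<close>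

lemma weak_gradient_box:
  fixes u :: "real ^ 'n \<Rightarrow> real"
  assumes G1: "has_weak_gradient U u G1" and G2: "has_weak_gradient U u G2" and ab: "cbox a b \<subseteq> U" and U: "open U"
  shows "integrable lebesgue (\<lambda>x. indicator (cbox a b) x *\<^sub>R (G1 x - G2 x))"
    and "(\<integral>x. indicator (box a b) x *\<^sub>R (G1 x - G2 x) \<partial>lebesgue) = 0"
proof -
  have i: "integrable lebesgue (\<lambda>x. indicator (cbox a b) x *\<^sub>R G1 x)" "integrable lebesgue (\<lambda>x. indicator (cbox a b) x *\<^sub>R G2 x)"
    using G1 G2 ab compact_cbox[of a b] by (auto simp: has_weak_gradient_def set_integrable_def)
  then show ii: "integrable lebesgue (\<lambda>x. indicator (cbox a b) x *\<^sub>R (G1 x - G2 x))"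
    unfolding scaleR_diff_right by (rule Bochner_Integration.integrable_diff)
  have UL: "U \<in> sets lebesgue" using U by auto
  have zero: "(\<integral>x. box_bump a b (real (Suc m)) x *\<^sub>R (indicator (cbox a b) x *\<^sub>R (G1 x - G2 x)) \<partial>lebesgue) = 0" for m
  proof -
    let ?\<phi> = "box_bump a b (real (Suc m))"
    have t: "?\<phi> \<in> test_functions U" by (rule box_bump_test_function[OF _ ab]) simp
    have [measurable]: "?\<phi> \<in> borel_measurable borel"
      using test_functions_C1_compact[OF t] by measurable
    have pm: "?\<phi> \<in> borel_measurable lebesgue" by (simp add: measurable_completion del: of_nat_Suc)
    have ip: "integrable lebesgue (\<lambda>x. ?\<phi> x *\<^sub>R (indicator (cbox a b) x *\<^sub>R G x))"
      if "integrable lebesgue (\<lambda>x. indicator (cbox a b) x *\<^sub>R G x)" for G :: "real ^ 'n \<Rightarrow> real ^ 'n"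
    proof (rule Bochner_Integration.integrable_bound[OF that])
      show "(\<lambda>x. ?\<phi> x *\<^sub>R (indicator (cbox a b) x *\<^sub>R G x)) \<in> borel_measurable lebesgue"
        by (intro borel_measurable_scaleR pm borel_measurable_integrable[OF that])
      show "AE x in lebesgue. norm (?\<phi> x *\<^sub>R (indicator (cbox a b) x *\<^sub>R G x)) \<le> norm (indicator (cbox a b) x *\<^sub>R G x)"
        by (intro AE_I2 norm_scaleR_le box_bump) simp_all
    qed
    have eq: "(\<integral>x. ?\<phi> x *\<^sub>R G x \<partial>lebesgue_on U) = (\<integral>x. ?\<phi> x *\<^sub>R (indicator (cbox a b) x *\<^sub>R G x) \<partial>lebesgue)" for G :: "real ^ 'n \<Rightarrow> real ^ 'n"
    proof -
      have "(\<integral>x. ?\<phi> x *\<^sub>R G x \<partial>lebesgue_on U) = (\<integral>x. indicator U x *\<^sub>R (?\<phi> x *\<^sub>R G x) \<partial>lebesgue)"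
        using UL by (intro integral_restrict_space) auto
      also have "\<dots> = (\<integral>x. ?\<phi> x *\<^sub>R (indicator (cbox a b) x *\<^sub>R G x) \<partial>lebesgue)"
      proof (rule Bochner_Integration.integral_cong)
        fix x
        have "x \<in> cbox a b" if "?\<phi> x \<noteq> 0"
          using that box_bump(3)[of "real (Suc m)" a b x] box_subset_cbox by auto
        then show "indicator U x *\<^sub>R (?\<phi> x *\<^sub>R G x) = ?\<phi> x *\<^sub>R (indicator (cbox a b) x *\<^sub>R G x)"
          using ab by (cases "?\<phi> x = 0") auto
      qed simp
      finally show ?thesis .
    qed
    have "(\<integral>x. ?\<phi> x *\<^sub>R G1 x \<partial>lebesgue_on U) = (\<integral>x. ?\<phi> x *\<^sub>R G2 x \<partial>lebesgue_on U)"
    proof -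
      have "(\<integral>x. u x *\<^sub>R grad ?\<phi> x \<partial>lebesgue_on U) = - (\<integral>x. ?\<phi> x *\<^sub>R G1 x \<partial>lebesgue_on U)"
        "(\<integral>x. u x *\<^sub>R grad ?\<phi> x \<partial>lebesgue_on U) = - (\<integral>x. ?\<phi> x *\<^sub>R G2 x \<partial>lebesgue_on U)"
        using G1 G2 t unfolding has_weak_gradient_def by blast+
      then show ?thesis by simp
    qed
    then have "(\<integral>x. ?\<phi> x *\<^sub>R (indicator (cbox a b) x *\<^sub>R G1 x) \<partial>lebesgue) - (\<integral>x. ?\<phi> x *\<^sub>R (indicator (cbox a b) x *\<^sub>R G2 x) \<partial>lebesgue) = 0"
      unfolding eq by simp
    then show ?thesis
      unfolding scaleR_diff_right by (subst Bochner_Integration.integral_diff[OF ip[OF i(1)] ip[OF i(2)]])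
  qed
  have "(\<lambda>m. \<integral>x. box_bump a b (real (Suc m)) x *\<^sub>R (indicator (cbox a b) x *\<^sub>R (G1 x - G2 x)) \<partial>lebesgue)
    \<longlonglongrightarrow> (\<integral>x. indicator (box a b) x *\<^sub>R (indicator (cbox a b) x *\<^sub>R (G1 x - G2 x)) \<partial>lebesgue)"
  proof (rule integral_dominated_convergence[where w = "\<lambda>x. norm (indicator (cbox a b) x *\<^sub>R (G1 x - G2 x))"])
    have gm: "(\<lambda>x. indicator (cbox a b) x *\<^sub>R (G1 x - G2 x)) \<in> borel_measurable lebesgue" using ii by auto
    have pm: "box_bump a b (real (Suc m)) \<in> borel_measurable lebesgue" for m
    proof -
      have "box_bump a b (real (Suc m)) \<in> test_functions U" by (rule box_bump_test_function[OF _ ab]) simp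
      then have "box_bump a b (real (Suc m)) \<in> borel_measurable borel"
        using test_functions_C1_compact C1_compact_measurable by blast
      then show ?thesis by (simp add: measurable_completion del: of_nat_Suc)
    qed
    show "(\<lambda>x. box_bump a b (real (Suc m)) x *\<^sub>R (indicator (cbox a b) x *\<^sub>R (G1 x - G2 x))) \<in> borel_measurable lebesgue" for m
      by (intro borel_measurable_scaleR gm pm)
    show "(\<lambda>x. indicator (box a b) x *\<^sub>R (indicator (cbox a b) x *\<^sub>R (G1 x - G2 x))) \<in> borel_measurable lebesgue"
      by (intro borel_measurable_scaleR gm borel_measurable_indicator) auto
    show "AE x in lebesgue. (\<lambda>m. box_bump a b (real (Suc m)) x *\<^sub>R (indicator (cbox a b) x *\<^sub>R (G1 x - G2 x)))
        \<longlonglongrightarrow> indicator (box a b) x *\<^sub>R (indicator (cbox a b) x *\<^sub>R (G1 x - G2 x))"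
      by (intro AE_I2 tendsto_scaleR box_bump_tendsto tendsto_const)
    show "AE x in lebesgue. norm (box_bump a b (real (Suc m)) x *\<^sub>R (indicator (cbox a b) x *\<^sub>R (G1 x - G2 x)))
        \<le> norm (indicator (cbox a b) x *\<^sub>R (G1 x - G2 x))" for m
      by (intro AE_I2 norm_scaleR_le box_bump) simp_all
    show "integrable lebesgue (\<lambda>x. norm (indicator (cbox a b) x *\<^sub>R (G1 x - G2 x)))"
      by (rule integrable_norm[OF ii])
  qed
  then have "(\<integral>x. indicator (box a b) x *\<^sub>R (indicator (cbox a b) x *\<^sub>R (G1 x - G2 x)) \<partial>lebesgue) = 0"
    unfolding zero by (simp add: LIMSEQ_const_iff)
  moreover have "indicator (box a b) x *\<^sub>R (indicator (cbox a b) x *\<^sub>R (G1 x - G2 x)) = indicator (box a b) x *\<^sub>R (G1 x - G2 x)" for x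
    using box_subset_cbox[of a b] by (auto simp: indicator_def)
  ultimately show "(\<integral>x. indicator (box a b) x *\<^sub>R (G1 x - G2 x) \<partial>lebesgue) = 0" by (simp only:)
qed

lemma box_Int_box_cart:
  fixes a b c d :: "real ^ 'n"
  shows "box a b \<inter> box c d = box (\<chi> i. max (a $ i) (c $ i)) (\<chi> i. min (b $ i) (d $ i))"
  by (auto simp: mem_box_cart set_eq_iff)

text \<open>The sets over which H integrates to 0 form a Dynkin system, where the integral over the
  whole space takes care of complements. It contains the boxes, which are stable under intersection
  and generate the Borel sets.\<close>

lemma AE_zero_of_box_integrals:
  fixes H :: "real ^ 'n \<Rightarrow> real"
  assumes H: "integrable lebesgue H" and box: "\<And>a b. (\<integral>x. indicator (box a b) x * H x \<partial>lebesgue) = 0"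
    and UNIV: "(\<integral>x. H x \<partial>lebesgue) = 0"
  shows "AE x in lebesgue. H x = 0"
proof -
  have i: "integrable lebesgue (\<lambda>x. indicator A x * H x)" if "A \<in> sets lebesgue" for A
    using integrable_real_mult_indicator[OF that H] by (simp add: mult.commute)
  have zero: "(\<integral>x. indicator A x * H x \<partial>lebesgue) = 0" if A: "A \<in> sets borel" for A
  proof -
    let ?G = "range (\<lambda>(a, b). box a b :: (real ^ 'n) set)"
    have eq: "sigma_sets UNIV ?G = sets borel" unfolding borel_eq_box by simp
    have 1: "Int_stable ?G"
    proof (rule Int_stableI)
      fix S T assume "S \<in> ?G" "T \<in> ?G"
      then obtain a b c d where "S = box a b" "T = box c d" by auto
      then have "S \<inter> T = (\<lambda>(a, b). box a b) (\<chi> i. max (a $ i) (c $ i), \<chi> i. min (b $ i) (d $ i))"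
        by (simp add: box_Int_box_cart)
      then show "S \<inter> T \<in> ?G" by (simp only: rangeI)
    qed
    have 2: "?G \<subseteq> Pow UNIV" by simp
    have 3: "A \<in> sigma_sets UNIV ?G" using A unfolding eq .
    from 1 2 3 show ?thesis
    proof (induction rule: sigma_sets_induct_disjoint)
      case (basic S)
      then show ?case using box by auto
    next
      case empty
      then show ?case by simp
    next
      case (compl S)
      have S: "S \<in> sets lebesgue" using compl(1) unfolding eq by simp
      have "(\<integral>x. indicator (UNIV - S) x * H x \<partial>lebesgue) = (\<integral>x. H x - indicator S x * H x \<partial>lebesgue)"
        by (intro Bochner_Integration.integral_cong) (auto simp: indicator_def)
      also have "\<dots> = 0" using compl by (subst Bochner_Integration.integral_diff[OF H i[OF S]]) (simp add: UNIV)
      finally show ?case .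
    next
      case (union S)
      have S: "S j \<in> sets lebesgue" for j using union(2) unfolding eq by auto
      have "(LINT x:(\<Union>j. S j)|lebesgue. H x) = (\<Sum>j. (LINT x:(S j)|lebesgue. H x))"
      proof (rule lebesgue_integral_countable_add)
        show "S i \<inter> S j = {}" if "i \<noteq> j" for i j using union(1) that by (auto simp: disjoint_family_on_def)
        show "set_integrable lebesgue (\<Union>j. S j) H" unfolding set_integrable_def using i[of "\<Union>j. S j"] S by auto
      qed (rule S)
      then show ?case using union(3) by (simp add: set_lebesgue_integral_def)
    qed
  qed
  have "H \<in> borel_measurable lebesgue" using H by auto
  then obtain H' where H' [measurable]: "H' \<in> borel_measurable lborel" and AE: "AE x in lborel. H x = H' x"
    using completion_ex_borel_measurable_real by blast
  have AE': "AE x in lebesgue. H x = H' x" using AE by (rule AE_completion)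
  have H'm: "H' \<in> borel_measurable lebesgue" using H' by (rule measurable_completion)
  have "integrable lebesgue H'" using H AE' H'm by (subst integrable_cong_AE[of _ _ H]) auto
  then have H'i: "integrable lborel H'" by (simp add: integrable_completion)
  have "AE x in lborel. H' x = 0"
  proof (rule sigma_finite_measure.density_zero[OF lborel.sigma_finite_measure_axioms H'i])
    fix A :: "(real ^ 'n) set" assume "A \<in> sets lborel"
    then have A [measurable]: "A \<in> sets borel" by simp
    have "set_lebesgue_integral lborel A H' = (\<integral>x. indicator A x * H' x \<partial>lebesgue)"
      unfolding set_lebesgue_integral_def by (subst integral_completion) auto
    also have "\<dots> = (\<integral>x. indicator A x * H x \<partial>lebesgue)"
    proof (rule integral_cong_AE)
      show "(\<lambda>x. indicator A x * H' x) \<in> borel_measurable lebesgue" by (rule measurable_completion) measurable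
      show "(\<lambda>x. indicator A x * H x) \<in> borel_measurable lebesgue" using i[of A] by auto
      show "AE x in lebesgue. indicator A x * H' x = indicator A x * H x" using AE' by eventually_elim simp
    qed
    also have "\<dots> = 0" by (rule zero[OF A])
    finally show "set_lebesgue_integral lborel A H' = 0" .
  qed
  then have "AE x in lebesgue. H' x = 0" by (rule AE_completion)
  with AE' show ?thesis by eventually_elim simp
qed

text \<open>Needed because \<open>weak_grad\<close> is an arbitrary choice. On each of countably
  many closed boxes that cover \<open>U\<close>, every component of the difference has zero integral
  over all smaller boxes.\<close>

lemma weak_gradient_unique:
  fixes u :: "real ^ 'n \<Rightarrow> real"
  assumes G1: "has_weak_gradient U u G1" and G2: "has_weak_gradient U u G2" and U: "open U"
  shows "AE x in lebesgue. x \<in> U \<longrightarrow> G1 x = G2 x"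
proof -
  obtain D where D: "countable D" "D \<subseteq> Pow U" "\<And>X. X \<in> D \<Longrightarrow> \<exists>a b. X = cbox a b" "\<Union>D = U"
    using open_countable_Union_open_cbox[OF U] by blast
  have "AE x in lebesgue. x \<in> X \<longrightarrow> G1 x = G2 x" if X: "X \<in> D" for X
  proof -
    obtain a b where ab: "X = cbox a b" "cbox a b \<subseteq> U" using D X by blast
    have comp: "integrable lebesgue (\<lambda>x. indicator (box e f) x * (G1 x - G2 x) $ i)"
      "(\<integral>x. indicator (box e f) x * (G1 x - G2 x) $ i \<partial>lebesgue) = 0" if ef: "cbox e f \<subseteq> U" for e f i
    proof -
      let ?V = "\<lambda>x. indicator (box e f) x *\<^sub>R (G1 x - G2 x)"
      have "integrable lebesgue (\<lambda>x. indicator (box e f) x *\<^sub>R (indicator (cbox e f) x *\<^sub>R (G1 x - G2 x)))"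
        by (rule integrable_mult_indicator[OF _ weak_gradient_box(1)[OF G1 G2 ef U]]) auto
      moreover have "indicator (box e f) x *\<^sub>R (indicator (cbox e f) x *\<^sub>R (G1 x - G2 x)) = ?V x" for x
        using box_subset_cbox[of e f] by (auto simp: indicator_def)
      ultimately have V: "integrable lebesgue ?V" by (simp only:)
      have "integrable lebesgue (\<lambda>x. ?V x $ i)" by (rule integrable_bounded_linear[OF bounded_linear_vec_nth V])
      then show "integrable lebesgue (\<lambda>x. indicator (box e f) x * (G1 x - G2 x) $ i)" by simp
      have "(\<integral>x. ?V x $ i \<partial>lebesgue) = (\<integral>x. ?V x \<partial>lebesgue) $ i"
        by (rule integral_bounded_linear[OF bounded_linear_vec_nth V])
      then show "(\<integral>x. indicator (box e f) x * (G1 x - G2 x) $ i \<partial>lebesgue) = 0"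
        by (simp add: weak_gradient_box(2)[OF G1 G2 ef U])
    qed
    have "AE x in lebesgue. indicator (box a b) x * (G1 x - G2 x) $ i = 0" for i
    proof (rule AE_zero_of_box_integrals)
      show "integrable lebesgue (\<lambda>x. indicator (box a b) x * (G1 x - G2 x) $ i)"
        "(\<integral>x. indicator (box a b) x * (G1 x - G2 x) $ i \<partial>lebesgue) = 0" by (rule comp[OF ab(2)])+
      fix c d :: "real ^ 'n"
      define e f where "e = (\<chi> i. max (c $ i) (a $ i))" and "f = (\<chi> i. min (d $ i) (b $ i))"
      have ef: "box c d \<inter> box a b = box e f" unfolding e_def f_def by (rule box_Int_box_cart)
      have eq: "indicator (box c d) x * (indicator (box a b) x * (G1 x - G2 x) $ i) = indicator (box e f) x * (G1 x - G2 x) $ i" for x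
        unfolding ef[symmetric] by (simp add: indicator_inter_arith)
      show "(\<integral>x. indicator (box c d) x * (indicator (box a b) x * (G1 x - G2 x) $ i) \<partial>lebesgue) = 0"
      proof (cases "box e f = {}")
        case False
        then have "cbox e f = closure (box e f)" by (rule closure_box[symmetric])
        also have "\<dots> \<subseteq> cbox a b" using ef box_subset_cbox[of a b] by (intro closure_minimal) auto
        finally have "cbox e f \<subseteq> U" using ab(2) by blast
        then show ?thesis unfolding eq by (rule comp(2))
      next
        case True
        then show ?thesis unfolding eq by simp
      qed
    qed
    then have "AE x in lebesgue. \<forall>i. indicator (box a b) x * (G1 x - G2 x) $ i = 0"
      by (rule eventually_all_finite)
    \<comment> \<open>The box integrals decide the matter on the open box only; its boundary is a
      null set.\<close>
    moreover have "AE x in lebesgue. x \<notin> cbox a b - box a b"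
      using negligible_frontier_interval[of a b] by (intro AE_not_in) (simp add: negligible_iff_null_sets)
    ultimately show ?thesis
    proof eventually_elim
      fix x assume *: "\<forall>i. indicator (box a b) x * (G1 x - G2 x) $ i = 0" "x \<notin> cbox a b - box a b"
      show "x \<in> X \<longrightarrow> G1 x = G2 x"
      proof
        assume "x \<in> X"
        then have "x \<in> box a b" using * ab by auto
        then show "G1 x = G2 x" using *(1) by (simp add: vec_eq_iff)
      qed
    qed
  qed
  then have "AE x in lebesgue. \<forall>X\<in>D. x \<in> X \<longrightarrow> G1 x = G2 x"
    unfolding AE_ball_countable[OF D(1)] by blast
  then show ?thesis by eventually_elim (use D(4) in blast)
qed


section \<open>Radial rearrangements\<close>

text \<open>Componentwise this is \<open>radial_ibp\<close>. The representation of \<open>u\<close>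
  leaves out the origin because the rearrangements are evaluated there at volume 0, where the set of
  levels may be unbounded and its supremum carries no information.\<close>

lemma radial_has_weak_gradient:
  fixes u :: "real ^ 'n \<Rightarrow> real"
  assumes U: "open U" and u: "\<And>x. x \<in> U \<Longrightarrow> x \<noteq> 0 \<Longrightarrow> u x = w (norm x)"
    and [measurable]: "q \<in> borel_measurable borel" "w \<in> borel_measurable borel"
    and q: "\<And>s. 0 \<le> q s" and w: "\<And>s. 0 \<le> w s"
    and qw: "\<And>r. r > 0 \<Longrightarrow> (\<integral>\<^sup>+s. indicator {r<..} s * ennreal (q s) \<partial>lborel) = ennreal (w r)"
    and lq: "\<And>R. (\<integral>\<^sup>+x. indicator (cball (0 :: real ^ 'n) R) x * ennreal (q (norm x)) \<partial>lborel) < \<infinity>"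
    and lw: "\<And>R. (\<integral>\<^sup>+x. indicator (cball (0 :: real ^ 'n) R) x * ennreal (w (norm x)) \<partial>lborel) < \<infinity>"
  shows "has_weak_gradient U u (\<lambda>x. - (q (norm x) / norm x) *\<^sub>R x)"
proof -
  define G where "G x = - (q (norm x) / norm x) *\<^sub>R x" for x :: "real ^ 'n"
  have Gm [measurable]: "G \<in> borel_measurable borel" unfolding G_def by measurable
  \<comment> \<open>A Borel function on the whole space that agrees with \<open>u\<close> on
    \<open>U\<close>, the origin included.\<close>
  define u' where "u' x = (if x = 0 then u 0 else w (norm x))" for x :: "real ^ 'n"
  have u'm [measurable]: "u' \<in> borel_measurable borel" unfolding u'_def by measurable
  have uu': "u x = u' x" if "x \<in> U" for x using u[OF that] by (simp add: u'_def)
  have n0: "AE x in lborel. (x :: real ^ 'n) \<noteq> 0" by (rule AE_lborel_singleton)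
  have nG: "norm (G x) \<le> q (norm x)" for x
    using q[of "norm x"] by (cases "x = 0") (auto simp: G_def)
  have loc: "integrable lborel (\<lambda>x. indicator (cball 0 R) x * u' x)" "integrable lborel (\<lambda>x. indicator (cball 0 R) x *\<^sub>R G x)" for R
  proof -
    have "integrable lborel (\<lambda>x :: real ^ 'n. indicator (cball 0 R) x * w (norm x))"
      by (rule integrable_mult_indicator_compact(1)[OF _ _ _ lw, of "\<lambda>_. 0" 0]) (use w in auto)
    moreover have "AE x in lborel. indicator (cball 0 R) x * w (norm x) = indicator (cball 0 R) x * u' x"
      using n0 by eventually_elim (simp add: u'_def)
    moreover have "(\<lambda>x. indicator (cball 0 R) x * w (norm x)) \<in> borel_measurable (lborel :: (real ^ 'n) measure)"
      "(\<lambda>x. indicator (cball 0 R) x * u' x) \<in> borel_measurable lborel"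
      by (auto intro!: borel_measurable_times borel_measurable_indicator)
    ultimately show "integrable lborel (\<lambda>x. indicator (cball 0 R) x * u' x)"
      using integrable_cong_AE by blast
    have qi: "integrable lborel (\<lambda>x :: real ^ 'n. indicator (cball 0 R) x * q (norm x))"
      by (rule integrable_mult_indicator_compact(1)[OF _ _ _ lq, of "\<lambda>_. 0" 0]) (use q in auto)
    show "integrable lborel (\<lambda>x. indicator (cball 0 R) x *\<^sub>R G x)"
    proof (rule Bochner_Integration.integrable_bound[OF qi])
      show "(\<lambda>x. indicator (cball 0 R) x *\<^sub>R G x) \<in> borel_measurable lborel"
        by (auto intro!: borel_measurable_scaleR borel_measurable_indicator)
      show "AE x in lborel. norm (indicator (cball 0 R) x *\<^sub>R G x) \<le> norm (indicator (cball 0 R) x * q (norm x))"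
        using nG q by (intro AE_I2) (auto simp: indicator_def)
    qed
  qed
  have comp: "u absolutely_integrable_on K \<and> G absolutely_integrable_on K" if K: "compact K" "K \<subseteq> U" for K
  proof -
    obtain R where R: "K \<subseteq> cball 0 R"
      using bounded_subset_ballD[OF compact_imp_bounded[OF K(1)], of 0] ball_subset_cball by blast
    have Kb: "K \<in> sets borel" using K(1) by (simp add: borel_compact)
    have "integrable lborel (\<lambda>x. indicator K x *\<^sub>R (indicator (cball 0 R) x * u' x))"
      "integrable lborel (\<lambda>x. indicator K x *\<^sub>R (indicator (cball 0 R) x *\<^sub>R G x))"
      by (rule integrable_mult_indicator[OF _ loc(1)] integrable_mult_indicator[OF _ loc(2)], use Kb in simp)+
    moreover have "indicator K x *\<^sub>R (indicator (cball 0 R) x * u' x) = indicator K x *\<^sub>R u x"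
      "indicator K x *\<^sub>R (indicator (cball 0 R) x *\<^sub>R G x) = indicator K x *\<^sub>R G x" for x
      using R K(2) uu'[of x] by (auto simp: indicator_def)
    ultimately have i: "integrable lborel (\<lambda>x. indicator K x *\<^sub>R u x)" "integrable lborel (\<lambda>x. indicator K x *\<^sub>R G x)"
      by (simp_all only:)
    show ?thesis
      unfolding set_integrable_def using i
      by (subst (1 2) integrable_completion) (auto dest: borel_measurable_integrable)
  qed
  have ibp: "(\<integral>x. u x *\<^sub>R grad \<phi> x \<partial>lebesgue_on U) = - (\<integral>x. \<phi> x *\<^sub>R G x \<partial>lebesgue_on U)"
    if t: "\<phi> \<in> test_functions U" for \<phi>
  proof -
    have \<phi>U: "C1_compact U \<phi>" using t by (rule test_functions_C1_compact)
    then have \<phi>: "C1_compact UNIV \<phi>" by (rule C1_compact_subset) simp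
    have [measurable]: "\<phi> \<in> borel_measurable borel" "grad \<phi> \<in> borel_measurable borel" using \<phi> by measurable
    have UL: "U \<inter> space lebesgue \<in> sets lebesgue" using U by auto
    define S where "S = closure {x. \<phi> x \<noteq> 0}"
    have S: "compact S" "\<And>x. x \<notin> S \<Longrightarrow> \<phi> x = 0" "\<And>x. x \<notin> S \<Longrightarrow> grad \<phi> x = 0"
      unfolding S_def using C1_compactD(4)[OF \<phi>] C1_compact_zero[OF \<phi>] by blast+
    obtain R where R: "S \<subseteq> cball 0 R"
      using bounded_subset_ballD[OF compact_imp_bounded[OF S(1)], of 0] ball_subset_cball by blast
    obtain M where M: "M > 0" "\<And>x. norm (grad \<phi> x) \<le> M" using C1_compact_bounded_grad[OF \<phi>] by blast
    have "compact (\<phi> ` S)"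
      using C1_compactD(3)[OF \<phi>] S(1) by (intro compact_continuous_image) auto
    then obtain F where F: "\<And>x. x \<in> S \<Longrightarrow> \<bar>\<phi> x\<bar> \<le> F"
      using compact_imp_bounded[of "\<phi> ` S"] unfolding bounded_iff by auto
    have l1: "(\<integral>x. u x *\<^sub>R grad \<phi> x \<partial>lebesgue_on U) = (\<integral>x. u' x *\<^sub>R grad \<phi> x \<partial>lborel)"
    proof -
      have "(\<integral>x. u x *\<^sub>R grad \<phi> x \<partial>lebesgue_on U) = (\<integral>x. indicator U x *\<^sub>R (u x *\<^sub>R grad \<phi> x) \<partial>lebesgue)"
        by (rule integral_restrict_space[OF UL])
      also have "\<dots> = (\<integral>x. u' x *\<^sub>R grad \<phi> x \<partial>lebesgue)"
      proof (rule Bochner_Integration.integral_cong)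
        fix x
        show "indicator U x *\<^sub>R (u x *\<^sub>R grad \<phi> x) = u' x *\<^sub>R grad \<phi> x"
          using uu'[of x] C1_compact_zero'(2)[OF \<phi>U, of x] by (cases "x \<in> U") auto
      qed simp
      also have "\<dots> = (\<integral>x. u' x *\<^sub>R grad \<phi> x \<partial>lborel)" by (rule integral_completion) measurable
      finally show ?thesis .
    qed
    have l2: "(\<integral>x. \<phi> x *\<^sub>R G x \<partial>lebesgue_on U) = (\<integral>x. \<phi> x *\<^sub>R G x \<partial>lborel)"
    proof -
      have "(\<integral>x. \<phi> x *\<^sub>R G x \<partial>lebesgue_on U) = (\<integral>x. indicator U x *\<^sub>R (\<phi> x *\<^sub>R G x) \<partial>lebesgue)"
        by (rule integral_restrict_space[OF UL])
      also have "\<dots> = (\<integral>x. \<phi> x *\<^sub>R G x \<partial>lebesgue)"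
      proof (rule Bochner_Integration.integral_cong)
        fix x
        show "indicator U x *\<^sub>R (\<phi> x *\<^sub>R G x) = \<phi> x *\<^sub>R G x"
          using C1_compact_zero'(1)[OF \<phi>U, of x] by (cases "x \<in> U") auto
      qed simp
      also have "\<dots> = (\<integral>x. \<phi> x *\<^sub>R G x \<partial>lborel)" by (rule integral_completion) measurable
      finally show ?thesis .
    qed
    have i1: "integrable lborel (\<lambda>x. u' x *\<^sub>R grad \<phi> x)"
    proof (rule Bochner_Integration.integrable_bound)
      show "integrable lborel (\<lambda>x. M * (indicator (cball 0 R) x * u' x))" by (intro integrable_mult_right loc)
      have "norm (u' x *\<^sub>R grad \<phi> x) \<le> norm (M * (indicator (cball 0 R) x * u' x))" for x
      proof (cases "x \<in> S")
        case True
        then show ?thesis using R M(1) mult_right_mono[OF M(2)[of x], of "\<bar>u' x\<bar>"] by (auto simp: abs_mult mult.commute)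
      qed (use S in simp)
      then show "AE x in lborel. norm (u' x *\<^sub>R grad \<phi> x) \<le> norm (M * (indicator (cball 0 R) x * u' x))" by simp
    qed measurable
    have i2: "integrable lborel (\<lambda>x. \<phi> x *\<^sub>R G x)"
    proof (rule Bochner_Integration.integrable_bound)
      show "integrable lborel (\<lambda>x. F *\<^sub>R (indicator (cball 0 R) x *\<^sub>R G x))" by (intro integrable_scaleR_right loc)
      have "norm (\<phi> x *\<^sub>R G x) \<le> norm (F *\<^sub>R (indicator (cball 0 R) x *\<^sub>R G x))" for x
      proof (cases "x \<in> S")
        case True
        then show ?thesis using R F[OF True] by (auto intro!: mult_right_mono)
      qed (use S in simp)
      then show "AE x in lborel. norm (\<phi> x *\<^sub>R G x) \<le> norm (F *\<^sub>R (indicator (cball 0 R) x *\<^sub>R G x))" by simp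
    qed measurable
    have "(\<integral>x. u' x *\<^sub>R grad \<phi> x \<partial>lborel) $ i = (- (\<integral>x. \<phi> x *\<^sub>R G x \<partial>lborel)) $ i" for i
    proof -
      have "(\<integral>x. u' x *\<^sub>R grad \<phi> x \<partial>lborel) $ i = (\<integral>x. (u' x *\<^sub>R grad \<phi> x) $ i \<partial>lborel)"
        by (rule integral_bounded_linear[OF bounded_linear_vec_nth i1, symmetric])
      also have "\<dots> = (\<integral>x. w (norm x) * grad \<phi> x $ i \<partial>lborel)"
      proof (rule integral_cong_AE)
        show "AE x in lborel. (u' x *\<^sub>R grad \<phi> x) $ i = w (norm x) * grad \<phi> x $ i"
          using n0 by eventually_elim (simp add: u'_def)
      qed measurable
      also have "\<dots> = (\<integral>x. \<phi> x * (q (norm x) / norm x * x $ i) \<partial>lborel)"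
        by (rule radial_ibp[OF \<phi> _ _ q w qw lq lw]) auto
      also have "\<dots> = - (\<integral>x. (\<phi> x *\<^sub>R G x) $ i \<partial>lborel)"
        by (simp add: G_def mult.assoc)
      also have "(\<integral>x. (\<phi> x *\<^sub>R G x) $ i \<partial>lborel) = (\<integral>x. \<phi> x *\<^sub>R G x \<partial>lborel) $ i"
        by (rule integral_bounded_linear[OF bounded_linear_vec_nth i2])
      finally show ?thesis by simp
    qed
    then show ?thesis unfolding l1 l2 by (simp add: vec_eq_iff)
  qed
  have "has_weak_gradient U u G"
    unfolding has_weak_gradient_def using comp ibp by blast
  then show ?thesis by (simp add: G_def[abs_def])
qed

lemma weak_grad_works:
  assumes "has_weak_gradient U u G" "open U"
  shows "has_weak_gradient U u (weak_grad U u)" "AE x in lebesgue. x \<in> U \<longrightarrow> weak_grad U u x = G x"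
proof -
  show h: "has_weak_gradient U u (weak_grad U u)"
    unfolding weak_grad_def using assms(1) by (rule someI[of "has_weak_gradient U u"])
  show "AE x in lebesgue. x \<in> U \<longrightarrow> weak_grad U u x = G x"
    by (rule weak_gradient_unique[OF h assms])
qed

text \<open>Substitution on the compact intervals, then monotone convergence in each direction. The
  two limits say that the new variable runs over the whole line although \<open>S\<close> may be
  bounded.\<close>

lemma nn_integral_substitution_exhaustion:
  fixes \<Lambda> \<Lambda>' :: "real \<Rightarrow> real" and a b :: "nat \<Rightarrow> real" and h :: "real \<Rightarrow> ennreal"
  assumes h [measurable]: "h \<in> borel_measurable borel"
    and d: "\<And>s. s \<in> S \<Longrightarrow> (\<Lambda> has_real_derivative \<Lambda>' s) (at s)" and c: "continuous_on S \<Lambda>'"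
    and p: "\<And>s. s \<in> S \<Longrightarrow> 0 \<le> \<Lambda>' s" and S: "open S"
    and ab: "\<And>k. a k < b k" "\<And>k. {a k..b k} \<subseteq> S" "decseq a" "incseq b" "S \<subseteq> (\<Union>k. {a k..b k})"
    and lim: "filterlim (\<lambda>k. \<Lambda> (a k)) at_bot sequentially" "filterlim (\<lambda>k. \<Lambda> (b k)) at_top sequentially"
  shows "(\<integral>\<^sup>+y. h y \<partial>lborel) = (\<integral>\<^sup>+s. indicator S s * (h (\<Lambda> s) * ennreal (\<Lambda>' s)) \<partial>lborel)"
proof (rule antisym)
  have [measurable]: "S \<in> sets borel" using S by simp
  have \<Lambda>c: "continuous_on S \<Lambda>" by (rule DERIV_continuous_on) (use d has_field_derivative_at_within in blast)
  have m1: "(\<lambda>s. indicator S s * \<Lambda> s) \<in> borel_measurable borel" "(\<lambda>s. indicator S s * \<Lambda>' s) \<in> borel_measurable borel"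
    using borel_measurable_continuous_on_indicator[OF _ \<Lambda>c] borel_measurable_continuous_on_indicator[OF _ c] by auto
  have [measurable]: "(\<lambda>s. indicator S s * (h (\<Lambda> s) * ennreal (\<Lambda>' s))) \<in> borel_measurable borel"
  proof -
    note [measurable] = m1
    have "(\<lambda>s. indicator S s * (h (indicator S s * \<Lambda> s) * ennreal (indicator S s * \<Lambda>' s))) \<in> borel_measurable borel"
      by measurable
    also have "(\<lambda>s. indicator S s * (h (indicator S s * \<Lambda> s) * ennreal (indicator S s * \<Lambda>' s))) = (\<lambda>s. indicator S s * (h (\<Lambda> s) * ennreal (\<Lambda>' s)))"
      by (auto simp: indicator_def)
    finally show ?thesis .
  qed
  have sub: "(\<integral>\<^sup>+y. h y * indicator {\<Lambda> (a k)..\<Lambda> (b k)} y \<partial>lborel) = (\<integral>\<^sup>+s. h (\<Lambda> s) * \<Lambda>' s * indicator {a k..b k} s \<partial>lborel)" for k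
  proof (rule nn_integral_substitution_aux[OF h])
    have "x \<in> S" if "x \<in> {a k..b k}" for x using that ab(2)[of k] by blast
    then show "\<And>x. x \<in> {a k..b k} \<Longrightarrow> (\<Lambda> has_real_derivative \<Lambda>' x) (at x)" "\<And>x. x \<in> {a k..b k} \<Longrightarrow> 0 \<le> \<Lambda>' x"
      using d p by blast+
    show "continuous_on {a k..b k} \<Lambda>'" by (rule continuous_on_subset[OF c ab(2)])
  qed (use ab(1) in auto)
  have mono: "\<Lambda> x \<le> \<Lambda> y" if "x \<in> {a k..b k}" "y \<in> {a k..b k}" "x \<le> y" for x y k
    using that(3)
  proof (rule DERIV_nonneg_imp_nondecreasing)
    fix z assume "x \<le> z" "z \<le> y"
    then have "z \<in> S" using that ab(2)[of k] by auto
    then show "\<exists>y. (\<Lambda> has_real_derivative y) (at z) \<and> 0 \<le> y" using d p by blast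
  qed
  show "(\<integral>\<^sup>+y. h y \<partial>lborel) \<le> (\<integral>\<^sup>+s. indicator S s * (h (\<Lambda> s) * ennreal (\<Lambda>' s)) \<partial>lborel)"
  proof (rule nn_integral_le_exhaustion[where A = "\<lambda>k. {\<Lambda> (a k)..\<Lambda> (b k)}"])
    show "incseq (\<lambda>k. {\<Lambda> (a k)..\<Lambda> (b k)})"
    proof (rule incseq_SucI)
      fix k
      have "a (Suc k) \<le> a k" "b k \<le> b (Suc k)" using ab(3,4) by (auto simp: decseq_Suc_iff incseq_Suc_iff)
      then have "\<Lambda> (a (Suc k)) \<le> \<Lambda> (a k)" "\<Lambda> (b k) \<le> \<Lambda> (b (Suc k))"
        using ab(1)[of k] by (auto intro!: mono[of _ "Suc k"])
      then show "{\<Lambda> (a k)..\<Lambda> (b k)} \<le> {\<Lambda> (a (Suc k))..\<Lambda> (b (Suc k))}" by auto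
    qed
    show "(\<Union>k. {\<Lambda> (a k)..\<Lambda> (b k)}) = space lborel"
    proof -
      have "\<exists>k. y \<in> {\<Lambda> (a k)..\<Lambda> (b k)}" for y
      proof -
        have "\<forall>\<^sub>F k in sequentially. \<Lambda> (a k) \<le> y" "\<forall>\<^sub>F k in sequentially. y \<le> \<Lambda> (b k)"
          using lim by (auto simp: filterlim_at_bot filterlim_at_top)
        then have "\<forall>\<^sub>F k in sequentially. y \<in> {\<Lambda> (a k)..\<Lambda> (b k)}" by eventually_elim simp
        then show ?thesis by (auto simp: eventually_sequentially)
      qed
      then show ?thesis by auto
    qed
    fix k
    have "(\<integral>\<^sup>+y. indicator {\<Lambda> (a k)..\<Lambda> (b k)} y * h y \<partial>lborel) = (\<integral>\<^sup>+s. h (\<Lambda> s) * \<Lambda>' s * indicator {a k..b k} s \<partial>lborel)"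
      using sub[of k] by (simp add: mult.commute)
    also have "\<dots> \<le> (\<integral>\<^sup>+s. indicator S s * (h (\<Lambda> s) * ennreal (\<Lambda>' s)) \<partial>lborel)"
      using ab(2)[of k] by (intro nn_integral_mono) (auto simp: indicator_def)
    finally show "(\<integral>\<^sup>+y. indicator {\<Lambda> (a k)..\<Lambda> (b k)} y * h y \<partial>lborel) \<le> (\<integral>\<^sup>+s. indicator S s * (h (\<Lambda> s) * ennreal (\<Lambda>' s)) \<partial>lborel)" .
  qed auto
  show "(\<integral>\<^sup>+s. indicator S s * (h (\<Lambda> s) * ennreal (\<Lambda>' s)) \<partial>lborel) \<le> (\<integral>\<^sup>+y. h y \<partial>lborel)"
  \<comment> \<open>The complement of \<open>S\<close>, on which the integrand vanishes, is added so
    that the sets exhaust the line.\<close>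
  proof (rule nn_integral_le_exhaustion[where A = "\<lambda>k. {a k..b k} \<union> - S"])
    show "incseq (\<lambda>k. {a k..b k} \<union> - S)"
    proof (rule incseq_SucI)
      fix k
      have "a (Suc k) \<le> a k" "b k \<le> b (Suc k)" using ab(3,4) by (auto simp: decseq_Suc_iff incseq_Suc_iff)
      then show "{a k..b k} \<union> - S \<le> {a (Suc k)..b (Suc k)} \<union> - S" by auto
    qed
    show "(\<Union>k. {a k..b k} \<union> - S) = space lborel" using ab(5) by auto
    fix k
    have "(\<integral>\<^sup>+s. indicator ({a k..b k} \<union> - S) s * (indicator S s * (h (\<Lambda> s) * ennreal (\<Lambda>' s))) \<partial>lborel)
      = (\<integral>\<^sup>+s. h (\<Lambda> s) * \<Lambda>' s * indicator {a k..b k} s \<partial>lborel)"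
      using ab(2)[of k] by (intro nn_integral_cong) (auto simp: indicator_def)
    also have "\<dots> = (\<integral>\<^sup>+y. h y * indicator {\<Lambda> (a k)..\<Lambda> (b k)} y \<partial>lborel)" by (rule sub[symmetric])
    also have "\<dots> \<le> (\<integral>\<^sup>+y. h y \<partial>lborel)" by (intro nn_integral_mono) (auto simp: indicator_def)
    finally show "(\<integral>\<^sup>+s. indicator ({a k..b k} \<union> - S) s * (indicator S s * (h (\<Lambda> s) * ennreal (\<Lambda>' s))) \<partial>lborel) \<le> (\<integral>\<^sup>+y. h y \<partial>lborel)" .
  qed auto
qed

lemma nn_integral_exp_lessThan: "(\<integral>\<^sup>+y. indicator {..<c} y * ennreal (exp y) \<partial>lborel) = ennreal (exp c)"
proof -
  have "(\<integral>\<^sup>+y. indicator {..<c} y * ennreal (exp y) \<partial>lborel)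
    = (\<integral>\<^sup>+y. indicator {..<c} y * ennreal (exp y) \<partial>distr lborel borel uminus)"
    by (simp add: lborel_distr_uminus)
  also have "\<dots> = (\<integral>\<^sup>+y. indicator {..<c} (- y) * ennreal (exp (- y)) \<partial>lborel)"
    by (subst nn_integral_distr) auto
  also have "\<dots> = (\<integral>\<^sup>+y. ennreal (exp (- y)) * indicator {- c..} y \<partial>lborel)"
  proof (rule nn_integral_cong_AE)
    have "AE y in lborel. y \<noteq> - c" by (rule AE_lborel_singleton)
    then show "AE y in lborel. indicator {..<c} (- y) * ennreal (exp (- y)) = ennreal (exp (- y)) * indicator {- c..} y"
      by eventually_elim (auto simp: indicator_def)
  qed
  also have "\<dots> = ennreal (0 - (- exp (- (- c))))"
  proof (rule nn_integral_FTC_atLeast)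
    show "((\<lambda>y. - exp (- y)) has_real_derivative exp (- x)) (at x)" for x :: real
      by (auto intro!: derivative_eq_intros)
    have "((\<lambda>y::real. exp (- y)) \<longlongrightarrow> 0) at_top"
      by (rule filterlim_compose[OF exp_at_bot filterlim_uminus_at_bot_at_top])
    then show "((\<lambda>y::real. - exp (- y)) \<longlongrightarrow> 0) at_top" using tendsto_minus by fastforce
  qed auto
  finally show ?thesis by simp
qed


text \<open>From g \<le> 1 + g^n: a finite n-th power integral gives the local integrability that
  \<open>radial_has_weak_gradient\<close> asks for.\<close>

lemma nn_integral_cball_of_power:
  fixes g :: "real ^ 'n \<Rightarrow> real"
  assumes [measurable]: "g \<in> borel_measurable borel" and g: "\<And>x. g x \<ge> 0"
    and fin: "(\<integral>\<^sup>+x. ennreal (g x ^ n) \<partial>lborel) < \<infinity>" and n: "n \<ge> 1"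
  shows "(\<integral>\<^sup>+x. indicator (cball 0 R) x * ennreal (g x) \<partial>lborel) < \<infinity>"
proof -
  have [measurable]: "cball (0 :: real ^ 'n) R \<in> sets borel" by simp
  have "(\<integral>\<^sup>+x. indicator (cball 0 R) x * ennreal (g x) \<partial>lborel)
    \<le> (\<integral>\<^sup>+x. indicator (cball (0 :: real ^ 'n) R) x + ennreal (g x ^ n) \<partial>lborel)"
  proof (rule nn_integral_mono)
    fix x
    have "g x \<le> 1 + g x ^ n"
    proof (cases "g x \<le> 1")
      case False
      then have "g x \<le> g x ^ n" using n by (intro self_le_power) auto
      then show ?thesis by simp
    qed (use g[of x] in \<open>auto intro: add_increasing2\<close>)
    then have "ennreal (g x) \<le> ennreal (1 + g x ^ n)" by (rule ennreal_leI)
    also have "\<dots> = 1 + ennreal (g x ^ n)" using g[of x] by (subst ennreal_plus) auto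
    finally show "indicator (cball 0 R) x * ennreal (g x) \<le> indicator (cball 0 R) x + ennreal (g x ^ n)"
      by (auto simp: indicator_def)
  qed
  also have "\<dots> = emeasure lborel (cball (0 :: real ^ 'n) R) + (\<integral>\<^sup>+x. ennreal (g x ^ n) \<partial>lborel)"
    by (subst nn_integral_add) auto
  also have "\<dots> < \<infinity>" using fin emeasure_compact_finite[of "cball (0 :: real ^ 'n) R"] by simp
  finally show ?thesis .
qed

text \<open>\<open>\<Lambda> s\<close> is the logarithm of the volume of the ball whose boundary has Euclidean radius \<open>s\<close>. The
  rearrangement is then \<open>w s = h (\<Lambda> s)\<close> as a function of the radius, and \<open>q = - w'\<close>.\<close>

locale radial_change =
  fixes S :: "real set" and \<Lambda> \<Lambda>' \<gamma> h :: "real \<Rightarrow> real" and a b :: "nat \<Rightarrow> real"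
  assumes \<gamma>m [measurable]: "\<gamma> \<in> borel_measurable borel" and \<gamma>0: "\<And>y. \<gamma> y \<ge> 0"
    and h: "\<And>y. (\<integral>\<^sup>+z. indicator {y<..} z * ennreal (\<gamma> z) \<partial>lborel) = ennreal (h y)" and h0: "\<And>y. h y \<ge> 0"
    and S: "open S" "S \<subseteq> {0<..}" and down: "\<And>s t. 0 < s \<Longrightarrow> s \<le> t \<Longrightarrow> t \<in> S \<Longrightarrow> s \<in> S"
    and d: "\<And>s. s \<in> S \<Longrightarrow> (\<Lambda> has_real_derivative \<Lambda>' s) (at s)" and c: "continuous_on S \<Lambda>'"
    and p: "\<And>s. s \<in> S \<Longrightarrow> 0 < \<Lambda>' s"
    and ab: "\<And>k. a k < b k" "\<And>k. {a k..b k} \<subseteq> S" "decseq a" "incseq b" "S \<subseteq> (\<Union>k. {a k..b k})"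
    and lim: "filterlim (\<lambda>k. \<Lambda> (a k)) at_bot sequentially" "filterlim (\<lambda>k. \<Lambda> (b k)) at_top sequentially"
begin

lemma substitution:
  "g \<in> borel_measurable borel \<Longrightarrow> (\<integral>\<^sup>+y. g y \<partial>lborel) = (\<integral>\<^sup>+s. indicator S s * (g (\<Lambda> s) * ennreal (\<Lambda>' s)) \<partial>lborel)"
  by (rule nn_integral_substitution_exhaustion[OF _ d c less_imp_le[OF p] S(1) ab lim])

lemma S_measurable [measurable]: "S \<in> sets borel" using S by simp

lemma \<Lambda>_less_iff:
  assumes "r \<in> S" "s \<in> S"
  shows "\<Lambda> r < \<Lambda> s \<longleftrightarrow> r < s"
proof -
  have *: "\<Lambda> x < \<Lambda> y" if "x \<in> S" "y \<in> S" "x < y" for x y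
    using that(3)
  proof (rule DERIV_pos_imp_increasing)
    fix z assume "x \<le> z" "z \<le> y"
    then have "z \<in> S" using that S(2) down[of z y] by auto
    then show "\<exists>y. (\<Lambda> has_real_derivative y) (at z) \<and> 0 < y" using d p by blast
  qed
  show ?thesis using *[OF assms] *[OF assms(2,1)] by (cases r s rule: linorder_cases) auto
qed

text \<open>The inner indicators change nothing on \<open>S\<close>; they make the composition
  Borel, since \<Lambda> and \<Lambda>' are continuous only there.\<close>

definition q :: "real \<Rightarrow> real" where "q s = indicator S s * (\<gamma> (indicator S s * \<Lambda> s) * (indicator S s * \<Lambda>' s))"

text \<open>Defined through \<open>q\<close>, so that measurability is immediate;
  \<open>w_eq\<close> identifies it with h composed with \<Lambda> on \<open>S\<close>, extended by
  0.\<close>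

definition w :: "real \<Rightarrow> real" where "w r = enn2real (\<integral>\<^sup>+s. (if r < s then ennreal (q s) else 0) \<partial>lborel)"

lemma \<Lambda>_measurable [measurable]: "(\<lambda>s. indicator S s * \<Lambda> s) \<in> borel_measurable borel" "(\<lambda>s. indicator S s * \<Lambda>' s) \<in> borel_measurable borel"
proof -
  have "continuous_on S \<Lambda>" by (rule DERIV_continuous_on) (use d has_field_derivative_at_within in blast)
  then show "(\<lambda>s. indicator S s * \<Lambda> s) \<in> borel_measurable borel" "(\<lambda>s. indicator S s * \<Lambda>' s) \<in> borel_measurable borel"
    using borel_measurable_continuous_on_indicator[OF S_measurable, of \<Lambda>]
      borel_measurable_continuous_on_indicator[OF S_measurable c] by auto
qed

lemma q_measurable [measurable]: "q \<in> borel_measurable borel"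
  unfolding q_def by measurable

lemma q_eq: "s \<in> S \<Longrightarrow> q s = \<gamma> (\<Lambda> s) * \<Lambda>' s" and q_eq_0: "s \<notin> S \<Longrightarrow> q s = 0"
  by (simp_all add: q_def)

lemma q_nonneg: "q s \<ge> 0"
  using p[of s] \<gamma>0 by (cases "s \<in> S") (auto simp: q_eq q_eq_0 less_imp_le)

lemma w_nonneg: "w r \<ge> 0" by (simp add: w_def)

lemma w_measurable [measurable]: "w \<in> borel_measurable borel"
  unfolding w_def by measurable

lemma tail_q:
  assumes "r > 0"
  shows "(\<integral>\<^sup>+s. indicator {r<..} s * ennreal (q s) \<partial>lborel) = (if r \<in> S then ennreal (h (\<Lambda> r)) else 0)"
proof (cases "r \<in> S")
  case True
  have "ennreal (h (\<Lambda> r)) = (\<integral>\<^sup>+y. indicator {\<Lambda> r<..} y * ennreal (\<gamma> y) \<partial>lborel)" by (rule h[symmetric])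
  also have "\<dots> = (\<integral>\<^sup>+s. indicator S s * ((indicator {\<Lambda> r<..} (\<Lambda> s) * ennreal (\<gamma> (\<Lambda> s))) * ennreal (\<Lambda>' s)) \<partial>lborel)"
    by (rule substitution[where g = "\<lambda>y. indicator {\<Lambda> r<..} y * ennreal (\<gamma> y)"]) measurable
  also have "\<dots> = (\<integral>\<^sup>+s. indicator {r<..} s * ennreal (q s) \<partial>lborel)"
  proof (rule nn_integral_cong)
    fix s
    show "indicator S s * ((indicator {\<Lambda> r<..} (\<Lambda> s) * ennreal (\<gamma> (\<Lambda> s))) * ennreal (\<Lambda>' s)) = indicator {r<..} s * ennreal (q s)"
      using \<Lambda>_less_iff[OF True, of s] \<gamma>0 by (cases "s \<in> S") (auto simp: q_eq q_eq_0 indicator_def ennreal_mult')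
  qed
  finally show ?thesis using True by simp
next
  case False
  have eq: "indicator {r<..} s * ennreal (q s) = 0" for s
    using down[of r s] assms False by (cases "s \<in> S") (auto simp: q_eq_0 indicator_def)
  show ?thesis using False unfolding eq by simp
qed

lemma w_eq: "r > 0 \<Longrightarrow> w r = (if r \<in> S then h (\<Lambda> r) else 0)"
proof -
  assume r: "r > 0"
  have "(\<integral>\<^sup>+s. (if r < s then ennreal (q s) else 0) \<partial>lborel) = (\<integral>\<^sup>+s. indicator {r<..} s * ennreal (q s) \<partial>lborel)"
    by (intro nn_integral_cong) (auto simp: indicator_def)
  then show ?thesis using tail_q[OF r] h0 by (simp add: w_def)
qed

lemma tail_q_w: "r > 0 \<Longrightarrow> (\<integral>\<^sup>+s. indicator {r<..} s * ennreal (q s) \<partial>lborel) = ennreal (w r)"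
  by (simp add: tail_q w_eq)

end

section \<open>Volumes of geodesic balls as functions of the Euclidean radius\<close>

definition hyp_volume_density :: "nat \<Rightarrow> real \<Rightarrow> real" where
  "hyp_volume_density n s = real n * unit_ball_vol (real n) * s ^ (n - 1) * (2 / (1 - s\<^sup>2)) ^ n"

text \<open>The argument 2 s / (1 - s^2) is sinh of the hyperbolic radius ln ((1 + s) / (1 -
  s)).\<close>

definition hyp_volume :: "nat \<Rightarrow> real \<Rightarrow> real" where
  "hyp_volume n s = unit_ball_vol (real n) * radial_volume n (2 * s / (1 - s\<^sup>2))"

lemma one_minus_square_pos: "s \<in> {0<..<1} \<Longrightarrow> 1 - (s :: real)\<^sup>2 > 0"
  by (simp add: power_less_one_iff abs_square_less_1)

lemma sinh_pos: "s \<in> {0<..<1} \<Longrightarrow> 2 * s / (1 - s\<^sup>2) > (0 :: real)"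
  using one_minus_square_pos[of s] by simp

lemma hyp_volume_pos: "s \<in> {0<..<1} \<Longrightarrow> n \<ge> 1 \<Longrightarrow> hyp_volume n s > 0"
  unfolding hyp_volume_def by (intro mult_pos_pos radial_volume_pos sinh_pos) auto

lemma DERIV_hyp_volume:
  assumes s: "s \<in> {0<..<1}" and n: "n \<ge> 1"
  shows "(hyp_volume n has_real_derivative hyp_volume_density n s) (at s)"
proof -
  let ?d = "1 - s\<^sup>2" and ?X = "2 * s / (1 - s\<^sup>2)"
  have dp: "?d > 0" using one_minus_square_pos[OF s] .
  have X': "((\<lambda>s. 2 * s / (1 - s\<^sup>2)) has_real_derivative 2 * (1 + s\<^sup>2) / ?d\<^sup>2) (at s)"
    using dp by (auto intro!: derivative_eq_intros simp: power2_eq_square field_simps)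
  \<comment> \<open>This is cosh of the hyperbolic radius; its numerator cancels against the
    derivative of the sinh.\<close>
  have sq: "sqrt (1 + ?X\<^sup>2) = (1 + s\<^sup>2) / ?d"
  proof (rule real_sqrt_unique)
    have "(1 + s\<^sup>2)\<^sup>2 = ?d\<^sup>2 + (2 * s)\<^sup>2" by (simp add: power2_eq_square algebra_simps)
    then have "((1 + s\<^sup>2) / ?d)\<^sup>2 = (?d\<^sup>2 + (2 * s)\<^sup>2) / ?d\<^sup>2" by (simp only: power_divide)
    also have "\<dots> = 1 + (2 * s)\<^sup>2 / ?d\<^sup>2" using dp by (subst add_divide_distrib) simp
    finally show "((1 + s\<^sup>2) / ?d)\<^sup>2 = 1 + ?X\<^sup>2" by (simp only: power_divide)
  qed (use dp in simp)
  have sp: "1 + s\<^sup>2 > 0" by (simp add: add_pos_nonneg)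
  have "(hyp_volume n has_real_derivative unit_ball_vol (real n) * (real n * ?X ^ (n - 1) / sqrt (1 + ?X\<^sup>2) * (2 * (1 + s\<^sup>2) / ?d\<^sup>2))) (at s)"
    unfolding hyp_volume_def[abs_def]
    by (intro DERIV_cmult DERIV_chain2[OF DERIV_radial_volume[OF sinh_pos[OF s]] X'])
  also have "unit_ball_vol (real n) * (real n * ?X ^ (n - 1) / sqrt (1 + ?X\<^sup>2) * (2 * (1 + s\<^sup>2) / ?d\<^sup>2)) = hyp_volume_density n s"
  proof -
    have e1: "real n * ?X ^ (n - 1) / sqrt (1 + ?X\<^sup>2) * (2 * (1 + s\<^sup>2) / ?d\<^sup>2) = real n * ?X ^ (n - 1) * (2 / ?d)"
    proof -
      have "N * P / (e / d) * (2 * e / d\<^sup>2) = N * P * (2 / d)" if "e > 0" "d > 0" for N P e d :: real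
        using that by (simp add: power2_eq_square)
      then show ?thesis unfolding sq using sp dp by blast
    qed
    have e2: "?X ^ (n - 1) = s ^ (n - 1) * (2 / ?d) ^ (n - 1)"
      by (simp add: power_mult_distrib power_divide)
    have e3: "real n * (s ^ (n - 1) * (2 / ?d) ^ (n - 1)) * (2 / ?d) = real n * s ^ (n - 1) * (2 / ?d) ^ n"
    proof -
      have pm: "(2 / ?d) ^ (n - 1) * (2 / ?d) = (2 / ?d) ^ n" by (rule power_minus_mult) (use n in simp)
      show ?thesis by (simp only: mult.assoc pm)
    qed
    show ?thesis unfolding hyp_volume_density_def e1 unfolding e2 e3 by (simp only: ac_simps)
  qed
  finally show ?thesis .
qed

lemma radial_change_euclidean:
  assumes \<gamma>: "\<gamma> \<in> borel_measurable borel" "\<And>y. \<gamma> y \<ge> 0"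
    and h: "\<And>y. (\<integral>\<^sup>+z. indicator {y<..} z * ennreal (\<gamma> z) \<partial>lborel) = ennreal (h y)" "\<And>y. h y \<ge> 0"
    and n: "n \<ge> 1" and \<sigma>: "\<sigma> > 0"
  shows "radial_change {0<..} (\<lambda>s. ln (\<sigma> * s ^ n)) (\<lambda>s. real n / s) \<gamma> h (\<lambda>k. 1 / real (k + 2)) (\<lambda>k. real (k + 2))"
proof (unfold_locales)
  show "((\<lambda>s. ln (\<sigma> * s ^ n)) has_real_derivative real n / s) (at s)" if "s \<in> {0<..}" for s
  proof -
    have "s ^ n = s * s ^ (n - 1)" using power_minus_mult[of n s] n by (simp add: mult.commute)
    then show ?thesis using that \<sigma> by (auto intro!: derivative_eq_intros simp: field_simps)
  qed
  show "continuous_on {0<..} (\<lambda>s. real n / s)" by (intro continuous_intros) auto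
  show "1 / real (k + 2) < real (k + 2)" for k
  proof -
    have "1 / real (k + 2) < 1" "1 < real (k + 2)" by simp_all
    then show ?thesis by linarith
  qed
  show "{1 / real (k + 2)..real (k + 2)} \<subseteq> {0<..}" for k
  proof -
    have "1 / real (k + 2) > 0" by simp
    from less_le_trans[OF this] show ?thesis by (simp only: subset_iff atLeastAtMost_iff greaterThan_iff) blast
  qed
  show "decseq (\<lambda>k. 1 / real (k + 2))" by (intro decseq_SucI) (simp add: field_simps)
  show "incseq (\<lambda>k. real (k + 2))" by (intro incseq_SucI) simp
  show "{0<..} \<subseteq> (\<Union>k. {1 / real (k + 2)..real (k + 2)})"
  proof
    fix s :: real assume "s \<in> {0<..}"
    then have s: "s > 0" by simp
    obtain k where k: "real k > max s (1 / s)" using reals_Archimedean2 by blast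
    then have "1 / s < real (k + 2)" "s < real (k + 2)" by auto
    then have "1 / real (k + 2) \<le> s" "s \<le> real (k + 2)" using s by (auto simp: field_simps)
    then show "s \<in> (\<Union>k. {1 / real (k + 2)..real (k + 2)})" by auto
  qed
  have l1: "filterlim (\<lambda>k. real (k + 2)) at_top sequentially"
    by (rule filterlim_compose[OF filterlim_real_sequentially filterlim_add_const_nat_at_top])
  then have l2: "filterlim (\<lambda>k. ln (real (k + 2))) at_top sequentially"
    by (rule filterlim_compose[OF ln_at_top])
  have l3: "filterlim (\<lambda>k. real n * ln (real (k + 2))) at_top sequentially"
    by (rule filterlim_tendsto_pos_mult_at_top[OF tendsto_const _ l2]) (use n in simp)
  have "filterlim (\<lambda>k. ln \<sigma> + real n * ln (real (k + 2))) at_top sequentially"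
    by (rule filterlim_tendsto_add_at_top[OF tendsto_const l3])
  moreover have "ln (\<sigma> * real (k + 2) ^ n) = ln \<sigma> + real n * ln (real (k + 2))" for k
    using \<sigma> by (subst ln_mult) (auto simp: ln_realpow)
  ultimately show "filterlim (\<lambda>k. ln (\<sigma> * real (k + 2) ^ n)) at_top sequentially" by (simp only:)
  have "filterlim (\<lambda>k. - ln \<sigma> + real n * ln (real (k + 2))) at_top sequentially"
    by (rule filterlim_tendsto_add_at_top[OF tendsto_const l3])
  then have "filterlim (\<lambda>k. - (- ln \<sigma> + real n * ln (real (k + 2)))) at_bot sequentially"
    by (rule filterlim_compose[OF filterlim_uminus_at_bot_at_top])
  moreover have "ln (\<sigma> * (1 / real (k + 2)) ^ n) = - (- ln \<sigma> + real n * ln (real (k + 2)))" for k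
    using \<sigma> by (subst ln_mult) (auto simp: ln_realpow ln_div)
  ultimately show "filterlim (\<lambda>k. ln (\<sigma> * (1 / real (k + 2)) ^ n)) at_bot sequentially" by (simp only:)
qed (use \<gamma> h n in auto)

text \<open>Used for the divergence of the volume at the sphere, so that the logarithmic volume
  reaches arbitrarily large values.\<close>

lemma radial_volume_ge_half:
  assumes "X \<ge> 1" "n \<ge> 2"
  shows "radial_volume n X \<ge> X / 2"
proof -
  have "X * X = X ^ 2" by (simp add: power2_eq_square)
  also have "\<dots> \<le> X ^ n" using assms by (intro power_increasing) auto
  also have "\<dots> \<le> radial_volume n X * (1 + X)" using assms by (intro power_le_radial_volume) auto
  also have "\<dots> \<le> radial_volume n X * (2 * X)"
    using assms radial_volume_pos[of X n] by (intro mult_left_mono) auto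
  finally have "X * X \<le> X * (2 * radial_volume n X)" by (simp add: ac_simps)
  then show ?thesis using assms by (simp only: mult_le_cancel_left_pos) 
qed

lemma radial_change_hyperbolic:
  assumes \<gamma>: "\<gamma> \<in> borel_measurable borel" "\<And>y. \<gamma> y \<ge> 0"
    and h: "\<And>y. (\<integral>\<^sup>+z. indicator {y<..} z * ennreal (\<gamma> z) \<partial>lborel) = ennreal (h y)" "\<And>y. h y \<ge> 0"
    and n: "n \<ge> 2"
  shows "radial_change {0<..<1} (\<lambda>s. ln (hyp_volume n s)) (\<lambda>s. hyp_volume_density n s / hyp_volume n s) \<gamma> h
    (\<lambda>k. 1 / real (k + 3)) (\<lambda>k. 1 - 1 / real (k + 3))"
proof (unfold_locales)
  have n1: "n \<ge> 1" using n by simp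
  show "((\<lambda>s. ln (hyp_volume n s)) has_real_derivative hyp_volume_density n s / hyp_volume n s) (at s)" if "s \<in> {0<..<1}" for s
    using DERIV_ln_divide[OF hyp_volume_pos[OF that n1]] DERIV_hyp_volume[OF that n1]
    by (rule DERIV_chain2[where f = ln, THEN DERIV_cong]) simp
  have c1: "continuous_on {0<..<1} (hyp_volume n)"
    by (rule DERIV_continuous_on) (use DERIV_hyp_volume[OF _ n1] has_field_derivative_at_within in blast)
  have c2: "continuous_on {0<..<1} (hyp_volume_density n)"
    unfolding hyp_volume_density_def using one_minus_square_pos by (intro continuous_intros) force
  show "continuous_on {0<..<1} (\<lambda>s. hyp_volume_density n s / hyp_volume n s)"
  proof (rule continuous_on_divide[OF c2 c1])
    show "\<forall>s\<in>{0<..<1}. hyp_volume n s \<noteq> 0" using hyp_volume_pos[OF _ n1] by (metis less_irrefl)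
  qed
  show "0 < hyp_volume_density n s / hyp_volume n s" if "s \<in> {0<..<1}" for s
    using hyp_volume_pos[OF that n1] one_minus_square_pos[OF that] that n1
    by (intro divide_pos_pos) (auto simp: hyp_volume_density_def)
  \<comment> \<open>The offset 3 keeps 1 / (k + 3) below 1/2, so that the exhausting intervals are
    nondegenerate for every k.\<close>
  have k3: "1 / real (k + 3) > 0" "1 / real (k + 3) \<le> 1 / 3" for k by (simp_all add: field_simps)
  show "1 / real (k + 3) < 1 - 1 / real (k + 3)" for k using k3[of k] by linarith
  show "{1 / real (k + 3)..1 - 1 / real (k + 3)} \<subseteq> {0<..<1}" for k
  proof -
    have "{e..1 - e} \<subseteq> {0<..<1}" if "e > 0" for e :: real using that by auto
    then show ?thesis using k3(1)[of k] by blast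
  qed
  have dec: "1 / real (Suc k + 3) \<le> 1 / real (k + 3)" for k by (simp add: field_simps)
  show "decseq (\<lambda>k. 1 / real (k + 3))" by (intro decseq_SucI dec)
  show "incseq (\<lambda>k. 1 - 1 / real (k + 3))" by (intro incseq_SucI diff_left_mono dec)
  show "{0<..<1} \<subseteq> (\<Union>k. {1 / real (k + 3)..1 - 1 / real (k + 3)})"
  proof
    fix s :: real assume s: "s \<in> {0<..<1}"
    obtain k where k: "real k > max (1 / s) (1 / (1 - s))" using reals_Archimedean2 by blast
    then have "1 / s < real (k + 3)" "1 / (1 - s) < real (k + 3)" by auto
    then have "1 / real (k + 3) < s" "1 / real (k + 3) < 1 - s" using s
      by (auto simp: field_simps simp del: of_nat_add)
    then have "s \<in> {1 / real (k + 3)..1 - 1 / real (k + 3)}" by auto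
    then show "s \<in> (\<Union>k. {1 / real (k + 3)..1 - 1 / real (k + 3)})" by blast
  qed
  let ?X = "\<lambda>s::real. 2 * s / (1 - s\<^sup>2)"
  have in01: "1 / real (k + 3) \<in> {0<..<1}" "1 - 1 / real (k + 3) \<in> {0<..<1}" for k
    using k3[of k] by (auto simp del: of_nat_add)
  have z: "(\<lambda>k. 1 / real (k + 3)) \<longlonglongrightarrow> 0"
    by (rule LIMSEQ_ignore_initial_segment[OF lim_1_over_n])
  have X0: "(\<lambda>k. ?X (1 / real (k + 3))) \<longlonglongrightarrow> 2 * 0 / (1 - 0\<^sup>2)"
    by (intro tendsto_intros z) simp
  have "(\<lambda>k. radial_volume n (?X (1 / real (k + 3)))) \<longlonglongrightarrow> radial_volume n 0"
    by (rule continuous_on_tendsto_compose[OF continuous_on_radial_volume])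
       (use X0 sinh_pos[OF in01(1)] in \<open>auto intro!: always_eventually simp: less_imp_le simp del: of_nat_add\<close>)
  then have "(\<lambda>k. unit_ball_vol (real n) * radial_volume n (?X (1 / real (k + 3)))) \<longlonglongrightarrow> unit_ball_vol (real n) * 0"
    by (intro tendsto_mult tendsto_const) simp
  then have "(\<lambda>k. hyp_volume n (1 / real (k + 3))) \<longlonglongrightarrow> 0"
    unfolding hyp_volume_def by simp
  then have "filterlim (\<lambda>k. hyp_volume n (1 / real (k + 3))) (at_right 0) sequentially"
    using hyp_volume_pos[OF in01(1) n1] by (intro tendsto_imp_filterlim_at_right always_eventually allI)
  then show "filterlim (\<lambda>k. ln (hyp_volume n (1 / real (k + 3)))) at_bot sequentially"
    by (rule filterlim_compose[OF ln_at_0])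
  have Xinf: "filterlim (\<lambda>k. ?X (1 - 1 / real (k + 3))) at_top sequentially"
    by real_asymp
  then have "\<forall>\<^sub>F k in sequentially. 1 \<le> ?X (1 - 1 / real (k + 3))" by (auto simp: filterlim_at_top)
  then have ev: "\<forall>\<^sub>F k in sequentially. unit_ball_vol (real n) * (1/2) * ?X (1 - 1 / real (k + 3)) \<le> hyp_volume n (1 - 1 / real (k + 3))"
  proof eventually_elim
    fix k assume *: "1 \<le> ?X (1 - 1 / real (k + 3))"
    have "unit_ball_vol (real n) * (1/2) * x \<le> unit_ball_vol (real n) * radial_volume n x" if "1 \<le> x" for x
    proof -
      have "1/2 * x \<le> radial_volume n x" using radial_volume_ge_half[OF that n] by simp
      then show ?thesis unfolding mult.assoc by (intro mult_left_mono) auto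
    qed
    from this[OF *] show "unit_ball_vol (real n) * (1/2) * ?X (1 - 1 / real (k + 3)) \<le> hyp_volume n (1 - 1 / real (k + 3))"
      unfolding hyp_volume_def .
  qed
  have "filterlim (\<lambda>k. unit_ball_vol (real n) * (1/2) * ?X (1 - 1 / real (k + 3))) at_top sequentially"
    by (rule filterlim_tendsto_pos_mult_at_top[OF tendsto_const _ Xinf]) simp
  then have "filterlim (\<lambda>k. hyp_volume n (1 - 1 / real (k + 3))) at_top sequentially"
    by (rule filterlim_at_top_mono[OF _ ev])
  then show "filterlim (\<lambda>k. ln (hyp_volume n (1 - 1 / real (k + 3)))) at_top sequentially"
    by (rule filterlim_compose[OF ln_at_top])
qed (use \<gamma> h in auto)

text \<open>The isoperimetric profile \<open>n \<sigma> X ^ (n - 1)\<close>, \<open>X = 2 s / (1 - s\<^sup>2)\<close>, of geodesic balls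
  compared with powers of their volume.\<close>

lemma hyp_profile_bounds:
  assumes s: "s \<in> {0<..<1}" and n: "n \<ge> 2"
  defines "\<sigma> \<equiv> unit_ball_vol (real n)" and "V \<equiv> hyp_volume n s" and "V' \<equiv> hyp_volume_density n s"
  shows "real n * \<sigma> * s ^ (n - 1) * (V' / V) ^ (n - 1) \<ge> real n ^ n * \<sigma> + (real n - 1) ^ n * V"
    and "real n * \<sigma> * s ^ (n - 1) * (V' / V) ^ (n - 1) \<le> real n ^ n * 2 ^ n * (\<sigma> + V)"
proof -
  let ?d = "1 - s\<^sup>2"
  define X where "X = 2 * s / ?d"
  define Y where "Y = radial_volume n X"
  have dp: "?d > 0" using one_minus_square_pos[OF s] .
  have X: "X > 0" unfolding X_def by (rule sinh_pos[OF s])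
  have Y: "Y > 0" unfolding Y_def using radial_volume_pos[OF X] n by simp
  have \<sigma>: "\<sigma> > 0" by (simp add: \<sigma>_def)
  have V: "V = \<sigma> * Y" by (simp add: V_def hyp_volume_def Y_def X_def \<sigma>_def)
  have nn: "real n ^ n = real n * real n ^ (n - 1)" using power_minus_mult[of n "real n"] n by (simp add: mult.commute)
  \<comment> \<open>With the perimeter k = n \<sigma> X^(n-1) this is k^n / V^(n-1). The lower bound
    is now \<open>radial_volume_isoperimetric\<close>, and the upper bound comes from
    \<open>power_le_radial_volume\<close>.\<close>
  have eq: "real n * \<sigma> * s ^ (n - 1) * (V' / V) ^ (n - 1) = real n ^ n * \<sigma> * (X ^ (n * (n - 1)) / Y ^ (n - 1))"
  proof -
    have "V' / V = real n * (s ^ (n - 1) * (2 / ?d) ^ n) / Y"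
      unfolding V'_def V hyp_volume_density_def \<sigma>_def[symmetric] using \<sigma> by simp
    then have "real n * \<sigma> * s ^ (n - 1) * (V' / V) ^ (n - 1)
      = real n ^ n * \<sigma> * ((s ^ (n - 1) * (s ^ (n - 1) * (2 / ?d) ^ n) ^ (n - 1)) / Y ^ (n - 1))"
      by (simp add: power_divide power_mult_distrib nn)
    also have "s ^ (n - 1) * (s ^ (n - 1) * (2 / ?d) ^ n) ^ (n - 1) = (s * s ^ (n - 1) * (2 / ?d) ^ n) ^ (n - 1)"
      by (simp add: power_mult_distrib)
    also have "s * s ^ (n - 1) = s ^ n" using power_minus_mult[of n s] n by (simp add: mult.commute)
    also have "s ^ n * (2 / ?d) ^ n = X ^ n" by (simp add: X_def power_mult_distrib[symmetric] mult.commute)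
    also have "(X ^ n) ^ (n - 1) = X ^ (n * (n - 1))" by (simp add: power_mult)
    finally show ?thesis .
  qed
  have iso: "Y ^ (n - 1) * (1 + ((real n - 1) / real n) ^ n * Y) \<le> X ^ (n * (n - 1))"
    unfolding Y_def by (rule radial_volume_isoperimetric[OF X n])
  have "real n ^ n * \<sigma> + (real n - 1) ^ n * V = real n ^ n * \<sigma> * (1 + ((real n - 1) / real n) ^ n * Y)"
    using n by (simp add: V power_divide field_simps)
  also have "\<dots> \<le> real n ^ n * \<sigma> * (X ^ (n * (n - 1)) / Y ^ (n - 1))"
    using iso Y \<sigma> by (intro mult_left_mono) (auto simp: field_simps)
  finally show "real n * \<sigma> * s ^ (n - 1) * (V' / V) ^ (n - 1) \<ge> real n ^ n * \<sigma> + (real n - 1) ^ n * V"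
    unfolding eq .
  have XY: "X ^ n \<le> Y * (1 + X)" unfolding Y_def by (rule power_le_radial_volume[OF X n])
  have "X ^ (n * (n - 1)) / Y ^ (n - 1) \<le> (1 + X) ^ (n - 1)"
  proof -
    have "X ^ (n * (n - 1)) \<le> (Y * (1 + X)) ^ (n - 1)"
      unfolding power_mult using XY X by (intro power_mono) auto
    then have "X ^ (n * (n - 1)) \<le> (1 + X) ^ (n - 1) * Y ^ (n - 1)" by (simp only: power_mult_distrib mult.commute)
    then show ?thesis by (simp only: pos_divide_le_eq[OF zero_less_power[OF Y]])
  qed
  also have "(1 + X) ^ (n - 1) \<le> 2 ^ n * (1 + Y)"
  proof (cases "X \<le> 1")
    case True
    have "(1 + X) ^ (n - 1) \<le> 2 ^ (n - 1)" using True X by (intro power_mono) auto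
    also have "\<dots> \<le> 2 ^ n * 1" by (simp add: power_increasing)
    also have "\<dots> \<le> 2 ^ n * (1 + Y)" using Y by (intro mult_left_mono) auto
    finally show ?thesis .
  next
    case False
    have "(1 + X) ^ (n - 1) \<le> (2 * X) ^ (n - 1)" using False X by (intro power_mono) auto
    also have "\<dots> = 2 ^ (n - 1) * X ^ (n - 1)" by (rule power_mult_distrib)
    also have "X ^ (n - 1) \<le> 2 * Y"
    proof -
      have "X ^ (n - 1) * X = X ^ n" by (rule power_minus_mult) (use n in simp)
      also note XY
      also have "Y * (1 + X) \<le> Y * (2 * X)" using False Y by (intro mult_left_mono) auto
      finally have "X ^ (n - 1) * X \<le> (2 * Y) * X" by (simp add: ac_simps)
      then show ?thesis using X by (simp only: mult_le_cancel_right_pos)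
    qed
    also have "2 ^ (n - 1) * (2 * Y) = 2 ^ n * Y" using power_minus_mult[of n "2::real"] n by simp
    also have "\<dots> \<le> 2 ^ n * (1 + Y)" by (intro mult_left_mono) auto
    finally show ?thesis by simp
  qed
  finally have "real n ^ n * \<sigma> * (X ^ (n * (n - 1)) / Y ^ (n - 1)) \<le> real n ^ n * \<sigma> * (2 ^ n * (1 + Y))"
    using \<sigma> by (intro mult_left_mono) auto
  also have "\<dots> = real n ^ n * 2 ^ n * (\<sigma> + V)" by (simp add: V algebra_simps)
  finally show "real n * \<sigma> * s ^ (n - 1) * (V' / V) ^ (n - 1) \<le> real n ^ n * 2 ^ n * (\<sigma> + V)" unfolding eq .
qed


lemma hyp_ball0_hyp_dist0:
  fixes x :: "real ^ 'n"
  assumes x: "x \<in> ball 0 1"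
  shows "hyp_ball0 (hyp_dist0 x) = ball (0 :: real ^ 'n) (norm x)"
proof -
  have "hyp_dist0 y < hyp_dist0 x \<longleftrightarrow> norm y < norm x" if "norm y < 1" for y :: "real ^ 'n"
  proof -
    have "0 < (1 + norm z) / (1 - norm z)" if "norm z < 1" for z :: "real ^ 'n"
      using that by (intro divide_pos_pos) (auto intro: add_pos_nonneg)
    then have "hyp_dist0 y < hyp_dist0 x \<longleftrightarrow> (1 + norm y) / (1 - norm y) < (1 + norm x) / (1 - norm x)"
      unfolding hyp_dist0_def using that x by (intro ln_less_cancel_iff) auto
    also have "\<dots> \<longleftrightarrow> (1 + norm y) * (1 - norm x) < (1 + norm x) * (1 - norm y)"
      using that x by (simp add: pos_divide_less_eq pos_less_divide_eq)
    also have "\<dots> \<longleftrightarrow> norm y < norm x" by (auto simp: algebra_simps)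
    finally show ?thesis .
  qed
  then show ?thesis using x by (auto simp: hyp_ball0_def)
qed

lemma inverse_power_hdelta: "1 / hdelta x ^ n = (2 / (1 - (norm x)\<^sup>2)) ^ n"
  by (simp add: hdelta_def power_divide)

lemma hyp_volume_density_eq:
  "s \<in> {0<..<1} \<Longrightarrow> n \<ge> 1 \<Longrightarrow> exp (ln (hyp_volume n s)) * (hyp_volume_density n s / hyp_volume n s)
    = real n * unit_ball_vol (real n) * s ^ (n - 1) * (2 / (1 - s\<^sup>2)) ^ n"
  using hyp_volume_pos[of s n] by (simp add: hyp_volume_density_def)

lemma measure_hyp_vol_ball:
  assumes n2: "CARD('n) \<ge> 2" and r: "r \<in> {0<..<1}"
  shows "measure hyp_vol (ball (0 :: real ^ 'n) r) = hyp_volume CARD('n) r"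
proof -
  define n where "n = CARD('n)"
  have n: "n \<ge> 2" "n \<ge> 1" using n2 by (auto simp: n_def)
  \<comment> \<open>The locale is entered with \<gamma> = h = 0 to obtain its substitution rule and
    the monotonicity of the logarithmic volume, independently of any rearrangement.\<close>
  interpret R: radial_change "{0<..<1}" "\<lambda>s. ln (hyp_volume n s)" "\<lambda>s. hyp_volume_density n s / hyp_volume n s"
    "\<lambda>_. 0" "\<lambda>_. 0" "\<lambda>k. 1 / real (k + 3)" "\<lambda>k. 1 - 1 / real (k + 3)"
    by (rule radial_change_hyperbolic) (use n in auto)
  define F where "F s = indicator {..<r} s * ennreal ((2 / (1 - s\<^sup>2)) ^ n)" for s :: real
  have [measurable]: "F \<in> borel_measurable borel" unfolding F_def by measurable
  let ?V = "hyp_volume n" and ?V' = "hyp_volume_density n"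
  have V: "?V r > 0" by (rule hyp_volume_pos[OF r n(2)])
  have "emeasure hyp_vol (ball (0 :: real ^ 'n) r) = (\<integral>\<^sup>+x. indicator (ball (0 :: real ^ 'n) r) x * ennreal (1 / hdelta x ^ n) \<partial>lborel)"
    unfolding n_def using r by (intro emeasure_hyp_vol sets_lebesgue_on_ballI) auto
  also have "\<dots> = (\<integral>\<^sup>+x. F (norm (x :: real ^ 'n)) \<partial>lborel)"
    unfolding inverse_power_hdelta by (intro nn_integral_cong) (auto simp: F_def indicator_def)
  also have "\<dots> = (\<integral>\<^sup>+s. indicator {0<..} s * (ennreal (real n * unit_ball_vol (real n) * s ^ (n - 1)) * F s) \<partial>lborel)"
    unfolding n_def by (rule nn_integral_radial) measurable
  also have "\<dots> = (\<integral>\<^sup>+s. indicator {0<..<1} s * ((indicator {..<ln (?V r)} (ln (?V s)) * ennreal (exp (ln (?V s)))) * ennreal (?V' s / ?V s)) \<partial>lborel)"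
  proof (rule nn_integral_cong)
    fix s
    show "indicator {0<..} s * (ennreal (real n * unit_ball_vol (real n) * s ^ (n - 1)) * F s)
      = indicator {0<..<1} s * ((indicator {..<ln (?V r)} (ln (?V s)) * ennreal (exp (ln (?V s)))) * ennreal (?V' s / ?V s))"
    proof (cases "s \<in> {0<..<1}")
      case True
      have "ennreal (real n * unit_ball_vol (real n) * s ^ (n - 1)) * ennreal ((2 / (1 - s\<^sup>2)) ^ n) = ennreal (exp (ln (?V s))) * ennreal (?V' s / ?V s)"
        unfolding ennreal_mult'[symmetric, OF exp_ge_zero] hyp_volume_density_eq[OF True n(2)]
        using True by (intro ennreal_mult'[symmetric]) auto
      moreover have "indicator {..<r} s = (indicator {..<ln (?V r)} (ln (?V s)) :: ennreal)"
        using R.\<Lambda>_less_iff[OF True r] by (simp add: indicator_def)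
      ultimately show ?thesis using True unfolding F_def by (simp add: mult.left_commute mult.assoc)
    qed (use r in \<open>auto simp: F_def indicator_def\<close>)
  qed
  also have "\<dots> = (\<integral>\<^sup>+y. indicator {..<ln (?V r)} y * ennreal (exp y) \<partial>lborel)"
    by (rule R.substitution[symmetric, where g = "\<lambda>y. indicator {..<ln (?V r)} y * ennreal (exp y)"]) measurable
  also have "\<dots> = ennreal (?V r)" using V by (simp add: nn_integral_exp_lessThan)
  finally show ?thesis using V by (simp add: measure_def n_def)
qed

text \<open>Measurability and energy pass from the explicit radial field to the chosen
  \<open>weak_grad\<close> by uniqueness almost everywhere on \<open>U\<close>. The indicators are
  there because the chosen field is arbitrary outside \<open>U\<close>.\<close>

lemma weak_grad_radial_energy:
  fixes u :: "real ^ 'n \<Rightarrow> real"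
  assumes hw: "has_weak_gradient U u (\<lambda>x. - (q (norm x) / norm x) *\<^sub>R x)" and U: "open U"
    and [measurable]: "q \<in> borel_measurable borel" and q: "\<And>s. q s \<ge> 0" "\<And>x. x \<notin> U \<Longrightarrow> q (norm x) = 0" and n: "n \<ge> 1"
  shows "(\<lambda>x. indicator U x *\<^sub>R weak_grad U u x) \<in> borel_measurable lebesgue"
    and "(\<integral>\<^sup>+x. indicator U x * ennreal (norm (weak_grad U u x) ^ n) \<partial>lborel) = (\<integral>\<^sup>+x. ennreal (q (norm (x :: real ^ 'n)) ^ n) \<partial>lborel)"
proof -
  let ?G = "\<lambda>x :: real ^ 'n. - (q (norm x) / norm x) *\<^sub>R x"
  have [measurable]: "U \<in> sets borel" using U by simp
  have AE: "AE x in lebesgue. x \<in> U \<longrightarrow> weak_grad U u x = ?G x" by (rule weak_grad_works(2)[OF hw U])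
  have "(\<lambda>x. indicator U x *\<^sub>R ?G x) \<in> borel_measurable lebesgue"
    by (rule measurable_completion) measurable
  then show "(\<lambda>x. indicator U x *\<^sub>R weak_grad U u x) \<in> borel_measurable lebesgue"
  proof (rule borel_measurable_AE)
    show "AE x in lebesgue. indicator U x *\<^sub>R ?G x = indicator U x *\<^sub>R weak_grad U u x"
      using AE by eventually_elim (auto simp: indicator_def)
  qed
  have n0: "AE x in lebesgue. (x :: real ^ 'n) \<noteq> 0" using AE_lborel_singleton[of "0 :: real ^ 'n"] by (rule AE_completion)
  have "(\<integral>\<^sup>+x. indicator U x * ennreal (norm (weak_grad U u x) ^ n) \<partial>lebesgue) = (\<integral>\<^sup>+x. ennreal (q (norm (x :: real ^ 'n)) ^ n) \<partial>lebesgue)"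
  proof (rule nn_integral_cong_AE)
    show "AE x in lebesgue. indicator U x * ennreal (norm (weak_grad U u x) ^ n) = ennreal (q (norm (x :: real ^ 'n)) ^ n)"
      using AE n0
    proof eventually_elim
      fix x :: "real ^ 'n" assume *: "x \<in> U \<longrightarrow> weak_grad U u x = ?G x" "x \<noteq> 0"
      show "indicator U x * ennreal (norm (weak_grad U u x) ^ n) = ennreal (q (norm x) ^ n)"
        using * q(1)[of "norm x"] q(2)[of x] n by (cases "x \<in> U") (auto simp: zero_power)
    qed
  qed
  then show "(\<integral>\<^sup>+x. indicator U x * ennreal (norm (weak_grad U u x) ^ n) \<partial>lborel) = (\<integral>\<^sup>+x. ennreal (q (norm (x :: real ^ 'n)) ^ n) \<partial>lborel)"
    by (simp only: nn_integral_completion)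
qed

theorem theorem1p3:
  fixes u :: "real ^ 'n \<Rightarrow> real"
  assumes "CARD('n) \<ge> 2"
    and "u \<in> W1n_hyp"
  shows "sharp_g u weakly_differentiable_on ball 0 1
    \<and> integrable hyp_vol
         (\<lambda>x. hyp_norm x (hyp_grad (weak_grad (ball 0 1) (sharp_g u)) x) ^ CARD('n))
    \<and> integrable hyp_vol (\<lambda>x. \<bar>sharp_g u x\<bar> ^ CARD('n))
    \<and> sharp_e u weakly_differentiable_on UNIV
    \<and> integrable lebesgue (\<lambda>x. norm (weak_grad UNIV (sharp_e u) x) ^ CARD('n))
    \<and> (\<integral>x. hyp_norm x (hyp_grad (weak_grad (ball 0 1) (sharp_g u)) x) ^ CARD('n) \<partial>hyp_vol)
        - ((real CARD('n) - 1) / real CARD('n)) ^ CARD('n)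
            * (\<integral>x. \<bar>sharp_g u x\<bar> ^ CARD('n) \<partial>hyp_vol)
      \<ge> (\<integral>x. norm (weak_grad UNIV (sharp_e u) x) ^ CARD('n) \<partial>lebesgue)"
proof -
  define n where "n = CARD('n)"
  have n12: "n \<ge> 2" "n \<ge> 1" using assms(1) by (auto simp: n_def)
  define \<sigma> where "\<sigma> = unit_ball_vol (real n)"
  have \<sigma>: "\<sigma> > 0" by (simp add: \<sigma>_def)
  obtain I where "rearrangement u I" using W1n_hyp_rearrangement[OF assms] by blast
  then interpret rearrangement u I .
  define h where "h y = decreasing_rearrangement u (exp y)" for y
  define \<beta> where "\<beta> x = (1 + exp (x / real n)) ^ n" for x
  obtain B where B: "B > 0"
    "\<And>N x w. \<lbrakk>\<And>i. i < N \<Longrightarrow> x i < x (Suc i); \<And>i. i < N \<Longrightarrow> x (Suc i) - x i \<le> ln 2; \<And>i. w i \<ge> 0\<rbrakk> \<Longrightarrow>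
      (\<Sum>i<N. w i ^ (n - 1) * \<beta> (x i) * (h (x i) - h (x (Suc i))))
        \<le> B * ((\<Sum>i<N. w i ^ n * \<beta> (x i) * (x (Suc i) - x i)) + 1)"
    using rearrangement_step_inequality[OF assms] unfolding h_def \<beta>_def n_def by blast
  have h0: "h y \<ge> 0" for y unfolding h_def by (rule f_nonneg) simp
  have \<beta>_ge: "\<beta> x \<ge> 1" "\<beta> x \<ge> exp x" for x
  proof -
    show "\<beta> x \<ge> 1" unfolding \<beta>_def by (rule one_le_power) simp
    have "exp x = exp (x / real n) ^ n" using n12 by (simp flip: exp_of_nat_mult)
    also have "\<dots> \<le> \<beta> x" unfolding \<beta>_def by (rule power_mono) auto
    finally show "\<beta> x \<ge> exp x" .
  qed
  interpret step_controlled h \<beta> n B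
  proof
    show "continuous_on UNIV \<beta>" unfolding \<beta>_def by (intro continuous_intros) (use n12 in auto)
    show "h y \<le> h x" if "x \<le> y" for x y unfolding h_def using that by (intro f_antimono) auto
    show "continuous (at_right x) h" for x
    proof -
      have "filterlim exp (at_right (exp x)) (at_right x)"
        unfolding filterlim_at
        by (auto intro!: tendsto_intros simp: eventually_at_filter)
      moreover have "(decreasing_rearrangement u \<longlongrightarrow> decreasing_rearrangement u (exp x)) (at_right (exp x))"
        using f_right_continuous[of "exp x"] by (simp add: continuous_within)
      ultimately show ?thesis unfolding h_def continuous_within by (rule filterlim_compose[rotated])
    qed
    show "(h \<longlongrightarrow> 0) at_top" unfolding h_def by (rule filterlim_compose[OF f_tendsto_0 exp_at_top])
  qed (use n12 B \<beta>_ge in auto)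
  obtain \<gamma> where \<gamma>m [measurable]: "\<gamma> \<in> borel_measurable borel" and \<gamma>0: "\<And>x. \<gamma> x \<ge> 0"
    and \<gamma>h: "\<And>x. (\<integral>\<^sup>+y. indicator {x<..} y * ennreal (\<gamma> y) \<partial>lborel) = ennreal (h x)"
    and \<gamma>fin: "(\<integral>\<^sup>+x. ennreal (\<gamma> x ^ n * \<beta> x) \<partial>lborel) < \<infinity>"
    using density_exists by blast
  have hm [measurable]: "h \<in> borel_measurable borel"
  proof -
    have "h = (\<lambda>x. enn2real (\<integral>\<^sup>+y. (if x < y then ennreal (\<gamma> y) else 0) \<partial>lborel))"
    proof
      fix x
      have "(\<integral>\<^sup>+y. (if x < y then ennreal (\<gamma> y) else 0) \<partial>lborel) = ennreal (h x)"
        unfolding \<gamma>h[symmetric] by (intro nn_integral_cong) (auto simp: indicator_def)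
      then show "h x = enn2real (\<integral>\<^sup>+y. (if x < y then ennreal (\<gamma> y) else 0) \<partial>lborel)" using h0 by simp
    qed
    then show ?thesis by simp
  qed
  have fin_le: "(\<integral>\<^sup>+x. ennreal (\<gamma> x ^ n * k x) \<partial>lborel) < \<infinity>" if "\<And>x. k x \<le> \<beta> x" for k
    by (rule le_less_trans[OF nn_integral_mono \<gamma>fin]) (use that \<gamma>0 in \<open>auto intro!: ennreal_leI mult_left_mono\<close>)
  obtain A where A: "(\<integral>\<^sup>+y. ennreal (\<gamma> y ^ n) \<partial>lborel) = ennreal A" "A \<ge> 0"
    using fin_le[of "\<lambda>_. 1"] \<beta>_ge(1) by (cases "\<integral>\<^sup>+y. ennreal (\<gamma> y ^ n) \<partial>lborel") auto
  obtain D where D: "(\<integral>\<^sup>+y. ennreal (\<gamma> y ^ n * exp y) \<partial>lborel) = ennreal D" "D \<ge> 0"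
    using fin_le[of exp] \<beta>_ge(2) by (cases "\<integral>\<^sup>+y. ennreal (\<gamma> y ^ n * exp y) \<partial>lborel") auto
  have "(\<integral>\<^sup>+y. ennreal (h y ^ n * exp y) \<partial>lborel) \<le> ennreal (real n ^ n) * ennreal D"
    using hardy_exponential[OF \<gamma>m \<gamma>0 n12(1)] unfolding \<gamma>h D(1)
    using h0 by (simp add: ennreal_power ennreal_mult')
  also have "\<dots> = ennreal (real n ^ n * D)" using D(2) by (simp add: ennreal_mult)
  finally have P_le: "(\<integral>\<^sup>+y. ennreal (h y ^ n * exp y) \<partial>lborel) \<le> ennreal (real n ^ n * D)" .
  then obtain P where P: "(\<integral>\<^sup>+y. ennreal (h y ^ n * exp y) \<partial>lborel) = ennreal P" "P \<ge> 0"
    by (cases "\<integral>\<^sup>+y. ennreal (h y ^ n * exp y) \<partial>lborel") (auto simp: top_unique)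
  have PD: "P \<le> real n ^ n * D" using P_le D(2) unfolding P(1) by (subst (asm) ennreal_le_iff) auto

  interpret E: radial_change "{0<..}" "\<lambda>s. ln (\<sigma> * s ^ n)" "\<lambda>s. real n / s" \<gamma> h "\<lambda>k. 1 / real (k + 2)" "\<lambda>k. real (k + 2)"
    by (rule radial_change_euclidean[OF \<gamma>m \<gamma>0 \<gamma>h h0 n12(2) \<sigma>])
  interpret H: radial_change "{0<..<1}" "\<lambda>s. ln (hyp_volume n s)" "\<lambda>s. hyp_volume_density n s / hyp_volume n s"
    \<gamma> h "\<lambda>k. 1 / real (k + 3)" "\<lambda>k. 1 - 1 / real (k + 3)"
    by (rule radial_change_hyperbolic[OF \<gamma>m \<gamma>0 \<gamma>h h0 n12(1)])
  let ?V = "hyp_volume n" and ?V' = "hyp_volume_density n"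

  have radial: "(\<integral>\<^sup>+x. F (norm (x :: real ^ 'n)) \<partial>lborel) = (\<integral>\<^sup>+s. indicator {0<..} s * (ennreal (real n * \<sigma> * s ^ (n - 1)) * F s) \<partial>lborel)"
    if "F \<in> borel_measurable borel" for F
    unfolding n_def \<sigma>_def by (rule nn_integral_radial[OF that])

  have energy_E: "(\<integral>\<^sup>+x. ennreal (E.q (norm (x :: real ^ 'n)) ^ n) \<partial>lborel) = ennreal (real n ^ n * \<sigma> * A)"
  proof -
    have "(\<integral>\<^sup>+x. ennreal (E.q (norm (x :: real ^ 'n)) ^ n) \<partial>lborel)
      = (\<integral>\<^sup>+s. indicator {0<..} s * (ennreal (real n * \<sigma> * s ^ (n - 1)) * ennreal (E.q s ^ n)) \<partial>lborel)"
      by (rule radial) measurable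
    also have "\<dots> = (\<integral>\<^sup>+s. indicator {0<..} s * (ennreal (real n ^ n * \<sigma> * \<gamma> (ln (\<sigma> * s ^ n)) ^ n) * ennreal (real n / s)) \<partial>lborel)"
    proof (rule nn_integral_cong)
      fix s
      show "indicator {0<..} s * (ennreal (real n * \<sigma> * s ^ (n - 1)) * ennreal (E.q s ^ n))
        = indicator {0<..} s * (ennreal (real n ^ n * \<sigma> * \<gamma> (ln (\<sigma> * s ^ n)) ^ n) * ennreal (real n / s))"
      proof (cases "s \<in> {0<..}")
        case True
        then have s: "s > 0" by simp
        have sn: "s ^ n = s ^ (n - 1) * s" by (rule power_minus_mult[symmetric]) (use n12 in simp)
        let ?g = "\<gamma> (ln (\<sigma> * s ^ n))"
        have "real n * \<sigma> * s ^ (n - 1) * (?g * (real n / s)) ^ n = real n ^ n * \<sigma> * ?g ^ n * (real n / s)"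
        proof -
          have "real n * \<sigma> * s ^ (n - 1) * (?g * (real n / s)) ^ n = real n * \<sigma> * ?g ^ n * real n ^ n * (s ^ (n - 1) / s ^ n)"
            by (simp add: power_mult_distrib power_divide)
          also have "s ^ (n - 1) / s ^ n = 1 / s" unfolding sn using s by simp
          finally show ?thesis by simp
        qed
        then show ?thesis
          using True s \<sigma> \<gamma>0 by (simp add: E.q_eq ennreal_mult'[symmetric])
      qed simp
    qed
    also have "\<dots> = (\<integral>\<^sup>+y. ennreal (real n ^ n * \<sigma> * \<gamma> y ^ n) \<partial>lborel)"
      by (rule E.substitution[symmetric, where g = "\<lambda>y. ennreal (real n ^ n * \<sigma> * \<gamma> y ^ n)"]) measurable
    also have "\<dots> = ennreal (real n ^ n * \<sigma>) * ennreal A"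
      unfolding A(1)[symmetric] using \<sigma> by (subst nn_integral_cmult[symmetric]) (auto simp: ennreal_mult' intro!: nn_integral_cong)
    also have "\<dots> = ennreal (real n ^ n * \<sigma> * A)" using \<sigma> by (intro ennreal_mult'[symmetric]) auto
    finally show ?thesis .
  qed

  \<comment> \<open>Equimeasurability: in the logarithmic volume both rearrangements have the same
    mass P. Here it supplies the local integrability of \<open>sharp_e u\<close>.\<close>
  have mass_E: "(\<integral>\<^sup>+x. ennreal (E.w (norm (x :: real ^ 'n)) ^ n) \<partial>lborel) = ennreal P"
  proof -
    have "(\<integral>\<^sup>+x. ennreal (E.w (norm (x :: real ^ 'n)) ^ n) \<partial>lborel)
      = (\<integral>\<^sup>+s. indicator {0<..} s * (ennreal (real n * \<sigma> * s ^ (n - 1)) * ennreal (E.w s ^ n)) \<partial>lborel)"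
      by (rule radial) measurable
    also have "\<dots> = (\<integral>\<^sup>+s. indicator {0<..} s * (ennreal (h (ln (\<sigma> * s ^ n)) ^ n * exp (ln (\<sigma> * s ^ n))) * ennreal (real n / s)) \<partial>lborel)"
    proof (rule nn_integral_cong)
      fix s
      show "indicator {0<..} s * (ennreal (real n * \<sigma> * s ^ (n - 1)) * ennreal (E.w s ^ n))
        = indicator {0<..} s * (ennreal (h (ln (\<sigma> * s ^ n)) ^ n * exp (ln (\<sigma> * s ^ n))) * ennreal (real n / s))"
      proof (cases "s \<in> {0<..}")
        case True
        then have s: "s > 0" by simp
        have sn: "s ^ n = s ^ (n - 1) * s" by (rule power_minus_mult[symmetric]) (use n12 in simp)
        have e: "exp (ln (\<sigma> * s ^ n)) = \<sigma> * (s ^ (n - 1) * s)" using s \<sigma> unfolding sn[symmetric] by simp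
        let ?k = "h (ln (\<sigma> * s ^ n))"
        have "real n * \<sigma> * s ^ (n - 1) * ?k ^ n = ?k ^ n * exp (ln (\<sigma> * s ^ n)) * (real n / s)"
          unfolding e using s by simp
        then have "ennreal (real n * \<sigma> * s ^ (n - 1) * ?k ^ n) = ennreal (?k ^ n * exp (ln (\<sigma> * s ^ n)) * (real n / s))" by simp
        moreover have "ennreal (real n * \<sigma> * s ^ (n - 1) * ?k ^ n) = ennreal (real n * \<sigma> * s ^ (n - 1)) * ennreal (?k ^ n)"
          using s \<sigma> by (intro ennreal_mult') auto
        moreover have "ennreal (?k ^ n * exp (ln (\<sigma> * s ^ n)) * (real n / s)) = ennreal (?k ^ n * exp (ln (\<sigma> * s ^ n))) * ennreal (real n / s)"
          using s h0 by (intro ennreal_mult') auto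
        ultimately show ?thesis using True E.w_eq[OF s] by simp
      qed simp
    qed
    also have "\<dots> = ennreal P"
      unfolding P(1)[symmetric] by (rule E.substitution[symmetric, where g = "\<lambda>y. ennreal (h y ^ n * exp y)"]) measurable
    finally show ?thesis .
  qed

  define e where "e = (\<integral>\<^sup>+x. ennreal (H.q (norm (x :: real ^ 'n)) ^ n) \<partial>lborel)"
  have e_eq: "e = (\<integral>\<^sup>+s. indicator {0<..<1} s * (ennreal (\<gamma> (ln (?V s)) ^ n * (real n * \<sigma> * s ^ (n - 1) * (?V' s / ?V s) ^ (n - 1))) * ennreal (?V' s / ?V s)) \<partial>lborel)"
  proof -
    have "e = (\<integral>\<^sup>+s. indicator {0<..} s * (ennreal (real n * \<sigma> * s ^ (n - 1)) * ennreal (H.q s ^ n)) \<partial>lborel)"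
      unfolding e_def by (rule radial) measurable
    also have "\<dots> = (\<integral>\<^sup>+s. indicator {0<..<1} s * (ennreal (\<gamma> (ln (?V s)) ^ n * (real n * \<sigma> * s ^ (n - 1) * (?V' s / ?V s) ^ (n - 1))) * ennreal (?V' s / ?V s)) \<partial>lborel)"
    proof (rule nn_integral_cong)
      fix s
      show "indicator {0<..} s * (ennreal (real n * \<sigma> * s ^ (n - 1)) * ennreal (H.q s ^ n))
        = indicator {0<..<1} s * (ennreal (\<gamma> (ln (?V s)) ^ n * (real n * \<sigma> * s ^ (n - 1) * (?V' s / ?V s) ^ (n - 1))) * ennreal (?V' s / ?V s))"
      proof (cases "s \<in> {0<..<1}")
        case True
        let ?L = "?V' s / ?V s" and ?g = "\<gamma> (ln (?V s))"
        have L: "?L > 0" by (rule H.p[OF True])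
        have Ln: "?L ^ n = ?L ^ (n - 1) * ?L" by (rule power_minus_mult[symmetric]) (use n12 in simp)
        have "real n * \<sigma> * s ^ (n - 1) * (?g * ?L) ^ n = ?g ^ n * (real n * \<sigma> * s ^ (n - 1) * ?L ^ (n - 1)) * ?L"
          unfolding power_mult_distrib Ln by (simp only: ac_simps)
        moreover have "ennreal (real n * \<sigma> * s ^ (n - 1) * (?g * ?L) ^ n) = ennreal (real n * \<sigma> * s ^ (n - 1)) * ennreal ((?g * ?L) ^ n)"
          using True \<sigma> by (intro ennreal_mult') auto
        moreover have "ennreal (?g ^ n * (real n * \<sigma> * s ^ (n - 1) * ?L ^ (n - 1)) * ?L) = ennreal (?g ^ n * (real n * \<sigma> * s ^ (n - 1) * ?L ^ (n - 1))) * ennreal ?L"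
          by (rule ennreal_mult''[OF less_imp_le[OF L]])
        ultimately show ?thesis using True by (simp only: H.q_eq[OF True]) (simp add: indicator_def)
      next
        case False
        then have "H.q s = 0" by (rule H.q_eq_0)
        then show ?thesis using False n12 by (simp add: zero_power)
      qed
    qed
    finally show ?thesis .
  qed
  have exp_ln_V: "exp (ln (?V s)) = ?V s" if "s \<in> {0<..<1}" for s
    using hyp_volume_pos[OF that n12(2)] by simp
  \<comment> \<open>The profile inequality integrated against \<gamma>^n: the constant term
    reproduces the Euclidean energy, and the term with V leaves the surplus (n - 1)^n D.\<close>
  have e_lower: "ennreal (real n ^ n * \<sigma> * A + (real n - 1) ^ n * D) \<le> e"
  proof -
    have "ennreal (real n ^ n * \<sigma> * A + (real n - 1) ^ n * D) = ennreal (real n ^ n * \<sigma>) * ennreal A + ennreal ((real n - 1) ^ n) * ennreal D"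
      using A(2) D(2) \<sigma> n12 by (simp add: ennreal_plus ennreal_mult)
    also have "\<dots> = (\<integral>\<^sup>+y. ennreal (real n ^ n * \<sigma>) * ennreal (\<gamma> y ^ n) + ennreal ((real n - 1) ^ n) * ennreal (\<gamma> y ^ n * exp y) \<partial>lborel)"
      unfolding A(1)[symmetric] D(1)[symmetric] by (subst nn_integral_add) (auto simp: nn_integral_cmult)
    also have "\<dots> = (\<integral>\<^sup>+y. ennreal (\<gamma> y ^ n * (real n ^ n * \<sigma> + (real n - 1) ^ n * exp y)) \<partial>lborel)"
    proof (rule nn_integral_cong)
      fix y
      have "ennreal (real n ^ n * \<sigma>) * ennreal (\<gamma> y ^ n) + ennreal ((real n - 1) ^ n) * ennreal (\<gamma> y ^ n * exp y)
        = ennreal (real n ^ n * \<sigma> * \<gamma> y ^ n + (real n - 1) ^ n * (\<gamma> y ^ n * exp y))"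
        using \<gamma>0[of y] \<sigma> n12 by (simp add: ennreal_plus ennreal_mult'')
      then show "ennreal (real n ^ n * \<sigma>) * ennreal (\<gamma> y ^ n) + ennreal ((real n - 1) ^ n) * ennreal (\<gamma> y ^ n * exp y)
        = ennreal (\<gamma> y ^ n * (real n ^ n * \<sigma> + (real n - 1) ^ n * exp y))"
        by (simp add: algebra_simps)
    qed
    also have "\<dots> = (\<integral>\<^sup>+s. indicator {0<..<1} s * (ennreal (\<gamma> (ln (?V s)) ^ n * (real n ^ n * \<sigma> + (real n - 1) ^ n * exp (ln (?V s)))) * ennreal (?V' s / ?V s)) \<partial>lborel)"
      by (rule H.substitution[where g = "\<lambda>y. ennreal (\<gamma> y ^ n * (real n ^ n * \<sigma> + (real n - 1) ^ n * exp y))"]) measurable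
    also have "\<dots> \<le> e"
      unfolding e_eq
    proof (rule nn_integral_mono)
      fix s
      show "indicator {0<..<1} s * (ennreal (\<gamma> (ln (?V s)) ^ n * (real n ^ n * \<sigma> + (real n - 1) ^ n * exp (ln (?V s)))) * ennreal (?V' s / ?V s))
        \<le> indicator {0<..<1} s * (ennreal (\<gamma> (ln (?V s)) ^ n * (real n * \<sigma> * s ^ (n - 1) * (?V' s / ?V s) ^ (n - 1))) * ennreal (?V' s / ?V s))"
      proof (cases "s \<in> {0<..<1}")
        case True
        then show ?thesis
          using hyp_profile_bounds(1)[OF True n12(1)] \<gamma>0
          by (intro mult_left_mono mult_right_mono ennreal_leI) (auto simp: exp_ln_V[OF True] \<sigma>_def)
      qed simp
    qed
    finally show ?thesis .
  qed
  \<comment> \<open>Finiteness guards against the default value of the Bochner integral, which would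
    be 0. The profile is at most a multiple of \<sigma> + V, and \<beta> dominates both 1 and
    V.\<close>
  have e_upper: "e < \<infinity>"
  proof -
    define K where "K = real n ^ n * 2 ^ n"
    have K: "K \<ge> 0" by (simp add: K_def)
    have "e \<le> (\<integral>\<^sup>+s. indicator {0<..<1} s * (ennreal (\<gamma> (ln (?V s)) ^ n * (K * (\<sigma> + exp (ln (?V s))))) * ennreal (?V' s / ?V s)) \<partial>lborel)"
      unfolding e_eq
    proof (rule nn_integral_mono)
      fix s
      show "indicator {0<..<1} s * (ennreal (\<gamma> (ln (?V s)) ^ n * (real n * \<sigma> * s ^ (n - 1) * (?V' s / ?V s) ^ (n - 1))) * ennreal (?V' s / ?V s))
        \<le> indicator {0<..<1} s * (ennreal (\<gamma> (ln (?V s)) ^ n * (K * (\<sigma> + exp (ln (?V s))))) * ennreal (?V' s / ?V s))"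
      proof (cases "s \<in> {0<..<1}")
        case True
        then show ?thesis
          using hyp_profile_bounds(2)[OF True n12(1)] \<gamma>0
          by (intro mult_left_mono mult_right_mono ennreal_leI) (auto simp: exp_ln_V[OF True] \<sigma>_def K_def)
      qed simp
    qed
    also have "\<dots> = (\<integral>\<^sup>+y. ennreal (\<gamma> y ^ n * (K * (\<sigma> + exp y))) \<partial>lborel)"
      by (rule H.substitution[symmetric, where g = "\<lambda>y. ennreal (\<gamma> y ^ n * (K * (\<sigma> + exp y)))"]) measurable
    also have "\<dots> \<le> (\<integral>\<^sup>+y. ennreal (K * (\<sigma> + 1)) * ennreal (\<gamma> y ^ n * \<beta> y) \<partial>lborel)"
    proof (rule nn_integral_mono)
      fix y
      have "\<sigma> + exp y \<le> (\<sigma> + 1) * \<beta> y"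
        using \<beta>_ge(2)[of y] mult_left_mono[OF \<beta>_ge(1)[of y] less_imp_le[OF \<sigma>]] by (simp add: distrib_right)
      then have "\<gamma> y ^ n * (K * (\<sigma> + exp y)) \<le> \<gamma> y ^ n * (K * ((\<sigma> + 1) * \<beta> y))"
        using K \<gamma>0 by (intro mult_left_mono) auto
      then have "ennreal (\<gamma> y ^ n * (K * (\<sigma> + exp y))) \<le> ennreal (K * (\<sigma> + 1) * (\<gamma> y ^ n * \<beta> y))"
        by (intro ennreal_leI) (simp add: ac_simps)
      also have "\<dots> = ennreal (K * (\<sigma> + 1)) * ennreal (\<gamma> y ^ n * \<beta> y)"
        using K \<sigma> by (intro ennreal_mult') auto
      finally show "ennreal (\<gamma> y ^ n * (K * (\<sigma> + exp y))) \<le> ennreal (K * (\<sigma> + 1)) * ennreal (\<gamma> y ^ n * \<beta> y)" .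
    qed
    also have "\<dots> = ennreal (K * (\<sigma> + 1)) * (\<integral>\<^sup>+y. ennreal (\<gamma> y ^ n * \<beta> y) \<partial>lborel)"
      by (rule nn_integral_cmult) measurable
    also have "\<dots> < \<infinity>" using \<gamma>fin by (simp add: ennreal_mult_less_top)
    finally show ?thesis .
  qed
  obtain T where T: "e = ennreal T" "T \<ge> 0" using e_upper by (cases e) auto
  have T_ge: "real n ^ n * \<sigma> * A + (real n - 1) ^ n * D \<le> T"
    using e_lower T(2) unfolding T(1) by (subst (asm) ennreal_le_iff) auto

  have mass_H: "(\<integral>\<^sup>+x. indicator (ball 0 1) x * (ennreal (1 / hdelta (x :: real ^ 'n) ^ n) * ennreal (H.w (norm x) ^ n)) \<partial>lborel) = ennreal P"
  proof -
    define F where "F s = indicator {..<1} s * (ennreal ((2 / (1 - s\<^sup>2)) ^ n) * ennreal (H.w s ^ n))" for s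
    have [measurable]: "F \<in> borel_measurable borel" unfolding F_def by measurable
    have "(\<integral>\<^sup>+x. indicator (ball 0 1) x * (ennreal (1 / hdelta (x :: real ^ 'n) ^ n) * ennreal (H.w (norm x) ^ n)) \<partial>lborel)
      = (\<integral>\<^sup>+x. F (norm (x :: real ^ 'n)) \<partial>lborel)"
      unfolding inverse_power_hdelta by (intro nn_integral_cong) (auto simp: F_def indicator_def)
    also have "\<dots> = (\<integral>\<^sup>+s. indicator {0<..} s * (ennreal (real n * \<sigma> * s ^ (n - 1)) * F s) \<partial>lborel)"
      by (rule radial) measurable
    also have "\<dots> = (\<integral>\<^sup>+s. indicator {0<..<1} s * (ennreal (h (ln (?V s)) ^ n * exp (ln (?V s))) * ennreal (?V' s / ?V s)) \<partial>lborel)"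
    proof (rule nn_integral_cong)
      fix s
      show "indicator {0<..} s * (ennreal (real n * \<sigma> * s ^ (n - 1)) * F s)
        = indicator {0<..<1} s * (ennreal (h (ln (?V s)) ^ n * exp (ln (?V s))) * ennreal (?V' s / ?V s))"
      proof (cases "s \<in> {0<..<1}")
        case True
        let ?k = "h (ln (?V s))"
        have w: "H.w s = ?k" using H.w_eq[of s] True by simp
        have "ennreal (?k ^ n * exp (ln (?V s))) * ennreal (?V' s / ?V s) = ennreal (?k ^ n * (exp (ln (?V s)) * (?V' s / ?V s)))"
          unfolding mult.assoc[symmetric] using H.p[OF True] by (intro ennreal_mult''[symmetric]) auto
        also have "\<dots> = ennreal (?k ^ n * (real n * \<sigma> * s ^ (n - 1) * (2 / (1 - s\<^sup>2)) ^ n))"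
          unfolding hyp_volume_density_eq[OF True n12(2)] \<sigma>_def ..
        also have "\<dots> = ennreal (real n * \<sigma> * s ^ (n - 1) * ((2 / (1 - s\<^sup>2)) ^ n * ?k ^ n))"
          by (simp only: ac_simps)
        also have "\<dots> = ennreal (real n * \<sigma> * s ^ (n - 1)) * (ennreal ((2 / (1 - s\<^sup>2)) ^ n) * ennreal (?k ^ n))"
        proof -
          have "0 \<le> real n * \<sigma> * s ^ (n - 1)" "0 \<le> (2 / (1 - s\<^sup>2)) ^ n"
            using True \<sigma> one_minus_square_pos[OF True] by auto
          then show ?thesis by (simp only: ennreal_mult')
        qed
        finally show ?thesis using True by (simp add: F_def w)
      next
        case False
        then show ?thesis by (auto simp: F_def indicator_def)
      qed
    qed
    also have "\<dots> = ennreal P"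
      unfolding P(1)[symmetric] by (rule H.substitution[symmetric, where g = "\<lambda>y. ennreal (h y ^ n * exp y)"]) measurable
    finally show ?thesis .
  qed
  \<comment> \<open>On the ball \<open>hdelta\<close> is at most 1, so hyperbolic volume dominates
    Lebesgue measure. The bound is over the whole space, \<open>H.w\<close> being 0 beyond the unit
    sphere, because local integrability is required there as well.\<close>
  have mass_H': "(\<integral>\<^sup>+x. ennreal (H.w (norm (x :: real ^ 'n)) ^ n) \<partial>lborel) < \<infinity>"
  proof -
    have "(\<integral>\<^sup>+x. ennreal (H.w (norm (x :: real ^ 'n)) ^ n) \<partial>lborel) \<le> ennreal P"
      unfolding mass_H[symmetric]
    proof (rule nn_integral_mono)
      fix x :: "real ^ 'n"
      show "ennreal (H.w (norm x) ^ n) \<le> indicator (ball 0 1) x * (ennreal (1 / hdelta x ^ n) * ennreal (H.w (norm x) ^ n))"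
      proof (cases "x \<in> ball 0 1")
        case True
        have "hdelta x ^ n \<le> 1" using hdelta_pos[OF True] by (intro power_le_one) (auto simp: hdelta_def intro: order_trans[OF _ zero_le_power2])
        then have "1 \<le> ennreal (1 / hdelta x ^ n)" using hdelta_pos[OF True] by (simp add: ennreal_ge_1)
        then have "1 * ennreal (H.w (norm x) ^ n) \<le> ennreal (1 / hdelta x ^ n) * ennreal (H.w (norm x) ^ n)"
          by (rule mult_right_mono) simp
        then show ?thesis using True by simp
      next
        case False
        then have "x \<noteq> 0" by auto
        then have "H.w (norm x) = 0" using False H.w_eq[of "norm x"] by auto
        then show ?thesis using n12 by (simp add: zero_power)
      qed
    qed
    then show ?thesis by (simp add: le_less_trans)
  qed

  have vol: "measure lebesgue (ball (0 :: real ^ 'n) 1) = \<sigma>"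
    by (simp add: content_ball \<sigma>_def n_def)
  have sharp_e_eq: "sharp_e u x = E.w (norm x)" if "x \<noteq> 0" for x
    using that E.w_eq[of "norm x"] \<sigma> vol by (simp add: sharp_e_def h_def n_def)
  have sharp_g_eq: "sharp_g u x = H.w (norm x)" if "x \<in> ball 0 1" "x \<noteq> 0" for x
  proof -
    have x: "norm x \<in> {0<..<1}" using that by simp
    have "measure (hyp_vol :: (real ^ 'n) measure) (hyp_ball0 (hyp_dist0 x)) = ?V (norm x)"
      unfolding hyp_ball0_hyp_dist0[OF that(1)] n_def by (rule measure_hyp_vol_ball[OF assms(1) x])
    then have "sharp_g u x = h (ln (?V (norm x)))" by (simp add: sharp_g_def h_def exp_ln_V[OF x])
    then show ?thesis using H.w_eq[of "norm x"] x by simp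
  qed

  have weak_e: "has_weak_gradient UNIV (sharp_e u) (\<lambda>x. - (E.q (norm x) / norm x) *\<^sub>R x)"
  proof (rule radial_has_weak_gradient[where w = E.w])
    show "(\<integral>\<^sup>+x. indicator (cball (0 :: real ^ 'n) R) x * ennreal (E.q (norm x)) \<partial>lborel) < \<infinity>" for R
      by (rule nn_integral_cball_of_power[where n = n]) (use n12 energy_E E.q_nonneg in auto)
    show "(\<integral>\<^sup>+x. indicator (cball (0 :: real ^ 'n) R) x * ennreal (E.w (norm x)) \<partial>lborel) < \<infinity>" for R
      by (rule nn_integral_cball_of_power[where n = n]) (use n12 mass_E E.w_nonneg in auto)
  qed (auto simp: sharp_e_eq E.q_nonneg E.w_nonneg E.tail_q_w)
  have weak_g: "has_weak_gradient (ball 0 1) (sharp_g u) (\<lambda>x. - (H.q (norm x) / norm x) *\<^sub>R x)"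
  proof (rule radial_has_weak_gradient[where w = H.w])
    show "(\<integral>\<^sup>+x. indicator (cball (0 :: real ^ 'n) R) x * ennreal (H.q (norm x)) \<partial>lborel) < \<infinity>" for R
      by (rule nn_integral_cball_of_power[where n = n]) (use n12 e_upper H.q_nonneg in \<open>auto simp: e_def\<close>)
    show "(\<integral>\<^sup>+x. indicator (cball (0 :: real ^ 'n) R) x * ennreal (H.w (norm x)) \<partial>lborel) < \<infinity>" for R
      by (rule nn_integral_cball_of_power[where n = n]) (use n12 mass_H' H.w_nonneg in auto)
  qed (auto simp: sharp_g_eq H.q_nonneg H.w_nonneg H.tail_q_w)

  have en_e: "(\<lambda>x. weak_grad UNIV (sharp_e u) x) \<in> borel_measurable lebesgue"
    "(\<integral>\<^sup>+x. ennreal (norm (weak_grad UNIV (sharp_e u) x) ^ n) \<partial>lebesgue) = ennreal (real n ^ n * \<sigma> * A)"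
    using weak_grad_radial_energy[OF weak_e open_UNIV E.q_measurable E.q_nonneg _ n12(2)] energy_E
    by (simp_all add: nn_integral_completion)
  have int_e: "integrable lebesgue (\<lambda>x. norm (weak_grad UNIV (sharp_e u) x) ^ n)"
    by (rule integrableI_nonneg) (use en_e in auto)
  have val_e: "(\<integral>x. norm (weak_grad UNIV (sharp_e u) x) ^ n \<partial>lebesgue) = real n ^ n * \<sigma> * A"
    using en_e A(2) \<sigma> by (subst integral_eq_nn_integral) auto

  let ?W = "weak_grad (ball 0 1) (sharp_g u)"
  have H0: "H.q (norm x) = 0" if "x \<notin> ball 0 1" for x :: "real ^ 'n" using that by (intro H.q_eq_0) auto
  have W_m: "?W \<in> borel_measurable (lebesgue_on (ball 0 1))"
    using weak_grad_radial_energy(1)[OF weak_g open_ball H.q_measurable H.q_nonneg H0 n12(2)]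
    by (subst borel_measurable_restrict_space_iff) auto
  have en_g: "(\<integral>\<^sup>+x. ennreal (hyp_norm x (hyp_grad ?W x) ^ n) \<partial>hyp_vol) = ennreal T"
  proof -
    have "(\<integral>\<^sup>+x. ennreal (hyp_norm x (hyp_grad ?W x) ^ n) \<partial>hyp_vol)
      = (\<integral>\<^sup>+x. indicator (ball 0 1) x * ennreal (norm (?W x) ^ n) \<partial>lborel)"
      unfolding n_def by (rule nn_integral_hyp_grad(2)[OF W_m])
    also have "\<dots> = e"
      unfolding e_def by (rule weak_grad_radial_energy(2)[OF weak_g open_ball H.q_measurable H.q_nonneg H0 n12(2)])
    finally show ?thesis using T(1) by simp
  qed
  have pos_g: "hyp_norm x (hyp_grad ?W x) ^ n \<ge> 0" for x
    by (simp add: hyp_norm_def hyp_metric_def)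
  have m_g: "(\<lambda>x. hyp_norm x (hyp_grad ?W x) ^ n) \<in> borel_measurable hyp_vol"
    unfolding n_def by (rule nn_integral_hyp_grad(1)[OF W_m])
  have int_g: "integrable hyp_vol (\<lambda>x. hyp_norm x (hyp_grad ?W x) ^ n)"
    by (rule integrableI_nonneg) (use m_g pos_g en_g in auto)
  have val_g: "(\<integral>x. hyp_norm x (hyp_grad ?W x) ^ n \<partial>hyp_vol) = T"
    using m_g pos_g en_g T(2) by (subst integral_eq_nn_integral) auto

  \<comment> \<open>A Borel function that agrees on the ball with the integrand; the uncontrolled
    value at the origin is kept, as it does not affect measurability.\<close>
  define s where "s x = (if x = 0 then \<bar>sharp_g u 0\<bar> else H.w (norm x)) ^ n" for x :: "real ^ 'n"
  have s_eq: "\<bar>sharp_g u x\<bar> ^ n = s x" if "x \<in> ball 0 1" for x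
    using sharp_g_eq[OF that] H.w_nonneg by (simp add: s_def)
  have s_m: "s \<in> borel_measurable (lebesgue_on (ball 0 1))"
    unfolding s_def by (intro borel_measurable_lebesgue_onI) measurable
  have m_s: "(\<lambda>x. \<bar>sharp_g u x\<bar> ^ n) \<in> borel_measurable hyp_vol"
    by (rule borel_measurable_hyp_volI, rule measurable_cong[THEN iffD1, OF _ s_m]) (simp add: s_eq space_restrict_space)
  have en_s: "(\<integral>\<^sup>+x. ennreal (\<bar>sharp_g u x\<bar> ^ n) \<partial>hyp_vol) = ennreal P"
  proof -
    have "(\<integral>\<^sup>+x. ennreal (\<bar>sharp_g u x\<bar> ^ n) \<partial>hyp_vol) = (\<integral>\<^sup>+x. ennreal (s x) \<partial>hyp_vol)"
      by (intro nn_integral_cong) (simp add: s_eq)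
    also have "\<dots> = (\<integral>\<^sup>+x. indicator (ball 0 1) x * (ennreal (1 / hdelta x ^ n) * ennreal (s x)) \<partial>lborel)"
      unfolding n_def by (rule nn_integral_hyp_vol) (use s_m in measurable)
    also have "\<dots> = ennreal P"
      unfolding mass_H[symmetric]
    proof (rule nn_integral_cong_AE)
      show "AE x in lborel. indicator (ball 0 1) x * (ennreal (1 / hdelta x ^ n) * ennreal (s x))
        = indicator (ball 0 1) x * (ennreal (1 / hdelta (x :: real ^ 'n) ^ n) * ennreal (H.w (norm x) ^ n))"
        using AE_lborel_singleton[of "0 :: real ^ 'n"] by eventually_elim (simp add: s_def)
    qed
    finally show ?thesis .
  qed
  have int_s: "integrable hyp_vol (\<lambda>x. \<bar>sharp_g u x\<bar> ^ n)"
    by (rule integrableI_nonneg) (use m_s en_s in auto)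
  have val_s: "(\<integral>x. \<bar>sharp_g u x\<bar> ^ n \<partial>hyp_vol) = P"
    using m_s en_s P(2) by (subst integral_eq_nn_integral) auto

  \<comment> \<open>Hardy's inequality in the form \<open>PD\<close>: its factor n^n cancels the
    denominator, and the subtracted term is at most the surplus (n - 1)^n D in
    \<open>T_ge\<close>.\<close>
  have "((real n - 1) / real n) ^ n * P \<le> ((real n - 1) / real n) ^ n * (real n ^ n * D)"
    using PD n12 by (intro mult_left_mono) auto
  also have "\<dots> = (real n - 1) ^ n * D" using n12 by (simp add: power_divide)
  finally have "real n ^ n * \<sigma> * A \<le> T - ((real n - 1) / real n) ^ n * P" using T_ge by linarith
  then show ?thesis
    using weak_e weak_g int_e int_g int_s
    unfolding n_def[symmetric] val_e val_g val_s weakly_differentiable_on_def by blast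
qed


end
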